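(* Let $A:\mathbb{R}^N\to\mathbb{R}^N$ be Lipschitz and let $\{\rho_n\}_{n\in\mathbb{N}}$ be a sequence of nonnegative radial mollifiers. Then $u\in H^1_A(\mathbb{R}^N)$ if and only if $u\in L^2(\mathbb{R}^N)$ and $$\sup_{n\in\mathbb{N}}\iint_{\mathbb{R}^{2N}}\frac{|\Psi_u(x,y)-\Psi_u(x,x)|^2}{|x-y|^2}\rho_n(|x-y|)\,dx\,dy<+\infty.$$ Moreover, for $u\in H^1_A(\mathbb{R}^N)$, we have $$\lim_{n\to+\infty}\iint_{\mathbb{R}^{2N}}\frac{|\Psi_u(x,y)-\Psi_u(x,x)|^2}{|x-y|^2}\rho_n(|x-y|)\,dx\,dy=2Q_N\int_{\mathbb{R}^N}|\nabla u-\mathrm{i}A(x)u|^2\,dx,$$ and, for every $n\in\mathbb{N}$, $$\iint_{\mathbb{R}^{2N}}\frac{|\Psi_u(x,y)-\Psi_u(x,x)|^2}{|x-y|^2}\rho_n(|x-y|)\,dx\,dy\le 2|\mathbb{S}^{N-1}|\int_{\mathbb{R}^N}|\nabla u-\mathrm{i}A(x)u|^2\,dx+2|\mathbb{S}^{N-1}|\big(2+\|\nabla A\|_{L^\infty(\mathbb{R}^N)}^2\big)\int_{\mathbb{R}^N}|u|^2\,dx.$$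
   Context: $N\ge1$ is an integer, $\mathrm{i}$ is the imaginary unit, $|\cdot|$ is the Euclidean norm, and functions $u$ are complex-valued. $H^1_A(\mathbb{R}^N)$ is the space of complex-valued $u\in L^2(\mathbb{R}^N)$ such that $\int_{\mathbb{R}^N}|\nabla u-\mathrm{i}A(x)u|^2dx<\infty$ (weak gradient), with norm $\|u\|_{H^1_A(\mathbb{R}^N)}=\big(\|u\|_{L^2(\mathbb{R}^N)}^2+\int_{\mathbb{R}^N}|\nabla u-\mathrm{i}A(x)u|^2dx\big)^{1/2}$. For measurable $u:\mathbb{R}^N\to\mathbb{C}$, $\Psi_u(x,y):=e^{\mathrm{i}(x-y)\cdot A\left(\frac{x+y}{2}\right)}u(y)$ for $x,y\in\mathbb{R}^N$ (so $\Psi_u(x,x)=u(x)$). A sequence of nonnegative radial functions $\{\rho_n\}_{n\in\mathbb{N}}$ (regarded as functions of $r=|z|$) is called a sequence of mollifiers if $\int_0^\infty\rho_n(r)r^{N-1}dr=1$ for all $n$ and $\lim_{n\to+\infty}\int_\delta^\infty\rho_n(r)r^{N-1}dr=0$ for all $\delta>0$. $Q_N:=\frac12\int_{\mathbb{S}^{N-1}}|\boldsymbol{\omega}\cdot\sigma|^2d\sigma$, where $\mathbb{S}^{N-1}$ is the unit sphere of $\mathbb{R}^N$ and $\boldsymbol{\omega}$ is an arbitrary unit vector of $\mathbb{R}^N$ (the value does not depend on $\boldsymbol{\omega}$). $|\mathbb{S}^{N-1}|$ is the $(N-1)$-dimensional Hausdorff measure of $\mathbb{S}^{N-1}$. $\nabla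 A$ is the a.e. defined Jacobian of $A$, and $\|\nabla A\|_{L^\infty(\mathbb{R}^N)}$ is the essential supremum of its Euclidean norm $|\nabla A(x)|$. *)

theory Defs
  imports "HOL-Analysis.Analysis" "HOL-Probability.Essential_Supremum"
begin

section \<open>Hausdorff measure\<close>

text \<open>
  The normalising constant \<open>unit_ball_vol k / 2 ^ k\<close> is the usual one for which the
  \<open>k\<close>-dimensional Hausdorff measure agrees with Lebesgue measure in dimension \<open>k\<close>. A nonempty
  set costs \<open>1\<close> when \<open>k = 0\<close> (since \<open>0 ^ 0 = 1\<close>), so that for \<open>k = 0\<close> one gets the
  counting measure. Boundedness is required explicitly because the library's \<open>diameter\<close> is
  unspecified on unbounded sets.
\<close>

definition hausdorff_cost :: "nat \<Rightarrow> 'a::metric_space set \<Rightarrow> ennreal" where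
  "hausdorff_cost k C =
     (if C = {} then 0 else ennreal (unit_ball_vol (real k) * (diameter C / 2) ^ k))"

definition hausdorff_covers :: "real \<Rightarrow> 'a::metric_space set \<Rightarrow> (nat \<Rightarrow> 'a set) set" where
  "hausdorff_covers \<delta> S = {C. S \<subseteq> (\<Union>i. C i) \<and> (\<forall>i. bounded (C i) \<and> diameter (C i) \<le> \<delta>)}"

definition hausdorff_pre :: "nat \<Rightarrow> real \<Rightarrow> 'a::metric_space set \<Rightarrow> ennreal" where
  "hausdorff_pre k \<delta> S = (INF C \<in> hausdorff_covers \<delta> S. \<Sum>i. hausdorff_cost k (C i))"

definition hausdorff_outer :: "nat \<Rightarrow> 'a::metric_space set \<Rightarrow> ennreal" where
  "hausdorff_outer k S = (SUP \<delta>\<in>{0<..}. hausdorff_pre k \<delta> S)"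

definition hausdorff_measure :: "nat \<Rightarrow> 'a::metric_space measure" where
  "hausdorff_measure k = measure_of UNIV (sets borel) (hausdorff_outer k)"

text \<open>
  \<open>measure_of\<close> only keeps a set function that is countably additive on the given sets; the rest
  of this section checks that this is the case here.
\<close>

lemma hausdorff_pre_le:
  "C \<in> hausdorff_covers \<delta> S \<Longrightarrow> hausdorff_pre k \<delta> S \<le> (\<Sum>i. hausdorff_cost k (C i))"
  unfolding hausdorff_pre_def by (rule INF_lower)

lemma hausdorff_pre_mono: "S \<subseteq> T \<Longrightarrow> hausdorff_pre k \<delta> S \<le> hausdorff_pre k \<delta> T"
  unfolding hausdorff_pre_def hausdorff_covers_def by (rule INF_superset_mono) auto

lemma hausdorff_pre_antimono: "\<delta> \<le> \<epsilon> \<Longrightarrow> hausdorff_pre k \<epsilon> S \<le> hausdorff_pre k \<delta> S"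
  unfolding hausdorff_pre_def hausdorff_covers_def
  by (rule INF_superset_mono) (auto intro: order_trans)

lemma hausdorff_pre_le_outer: "0 < \<delta> \<Longrightarrow> hausdorff_pre k \<delta> S \<le> hausdorff_outer k S"
  unfolding hausdorff_outer_def by (rule SUP_upper) auto

lemma hausdorff_outer_mono: "S \<subseteq> T \<Longrightarrow> hausdorff_outer k S \<le> hausdorff_outer k T"
  unfolding hausdorff_outer_def by (rule SUP_mono) (auto intro: hausdorff_pre_mono)

lemma hausdorff_outer_empty: "hausdorff_outer k {} = 0"
proof -
  have "hausdorff_pre k \<delta> ({}::'a set) = 0" if "\<delta> > 0" for \<delta>
    using hausdorff_pre_le[of "\<lambda>_. {}" \<delta> "{}::'a set" k] that
    by (simp add: hausdorff_covers_def hausdorff_cost_def)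
  then show ?thesis by (auto simp: hausdorff_outer_def bot_ennreal intro!: antisym SUP_least)
qed

lemma hausdorff_pre_subadditive:
  "hausdorff_pre k \<delta> (\<Union>n. A n) \<le> (\<Sum>n::nat. hausdorff_pre k \<delta> (A n))"
proof (rule ennreal_le_epsilon)
  fix e :: real assume fin: "(\<Sum>n. hausdorff_pre k \<delta> (A n)) < top" and e: "0 < e"
  have "\<exists>C. C \<in> hausdorff_covers \<delta> (A n) \<and>
      (\<Sum>i. hausdorff_cost k (C i)) \<le> hausdorff_pre k \<delta> (A n) + ennreal (e * (1/2) ^ Suc n)" for n
  proof -
    have "hausdorff_pre k \<delta> (A n) \<noteq> top"
      using fin by (rule contrapos_pn) (metis ennreal_suminf_lessD less_irrefl)
    then have "hausdorff_pre k \<delta> (A n) < hausdorff_pre k \<delta> (A n) + ennreal (e * (1/2) ^ Suc n)"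
      using e by (simp add: ennreal_zero_less_divide zero_less_power less_top)
    then show ?thesis
      unfolding hausdorff_pre_def[of k \<delta> "A n"] INF_less_iff by (auto intro: less_imp_le)
  qed
  then obtain C where C: "\<And>n. C n \<in> hausdorff_covers \<delta> (A n)"
    and le: "\<And>n. (\<Sum>i. hausdorff_cost k (C n i))
               \<le> hausdorff_pre k \<delta> (A n) + ennreal (e * (1/2) ^ Suc n)"
    by metis
  define D where "D i = case_prod C (prod_decode i)" for i
  have "D \<in> hausdorff_covers \<delta> (\<Union>n. A n)"
    unfolding hausdorff_covers_def
  proof (intro CollectI conjI allI subsetI)
    fix x assume "x \<in> (\<Union>n. A n)"
    then obtain n i where "x \<in> C n i" using C unfolding hausdorff_covers_def by blast
    then show "x \<in> (\<Union>i. D i)" by (auto simp: D_def intro!: exI[of _ "prod_encode (n, i)"])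
  qed (use C in \<open>auto simp: D_def hausdorff_covers_def split: prod.split\<close>)
  then have "hausdorff_pre k \<delta> (\<Union>n. A n) \<le> (\<Sum>i. hausdorff_cost k (D i))"
    by (rule hausdorff_pre_le)
  also have "\<dots> = (\<Sum>i. (case prod_decode i of (n, m) \<Rightarrow> hausdorff_cost k (C n m)))"
    by (simp add: D_def case_prod_beta)
  also have "\<dots> = (\<Sum>n. \<Sum>i. hausdorff_cost k (C n i))"
    by (rule suminf_ennreal_2dimen) simp
  also have "\<dots> \<le> (\<Sum>n. hausdorff_pre k \<delta> (A n) + ennreal (e * (1/2) ^ Suc n))"
    by (intro suminf_le le) auto
  also have "\<dots> = (\<Sum>n. hausdorff_pre k \<delta> (A n)) + (\<Sum>n. ennreal (e * (1/2) ^ Suc n))"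
    by (rule suminf_add[symmetric]) auto
  also have "(\<Sum>n. ennreal (e * (1/2) ^ Suc n)) = ennreal e"
    using sums_mult[OF power_half_series, of e] e by (intro suminf_ennreal_eq) auto
  finally show "hausdorff_pre k \<delta> (\<Union>n. A n) \<le> (\<Sum>n. hausdorff_pre k \<delta> (A n)) + ennreal e" .
qed

lemma hausdorff_outer_subadditive:
  "hausdorff_outer k (\<Union>n. A n) \<le> (\<Sum>n::nat. hausdorff_outer k (A n))"
  unfolding hausdorff_outer_def[of k "\<Union>n. A n"]
proof (rule SUP_least)
  fix \<delta> :: real assume "\<delta> \<in> {0<..}"
  then show "hausdorff_pre k \<delta> (\<Union>n. A n) \<le> (\<Sum>n. hausdorff_outer k (A n))"
    by (intro order_trans[OF hausdorff_pre_subadditive] suminf_le hausdorff_pre_le_outer) auto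
qed

lemma hausdorff_outer_Un: "hausdorff_outer k (S \<union> T) \<le> hausdorff_outer k S + hausdorff_outer k T"
proof -
  have "hausdorff_outer k (\<Union>n. binaryset S T n) \<le> (\<Sum>n. hausdorff_outer k (binaryset S T n))"
    by (rule hausdorff_outer_subadditive)
  then show ?thesis
    by (simp add: UN_binaryset_eq suminf_binaryset_eq hausdorff_outer_empty)
qed

lemma hausdorff_outer_separated:
  assumes d: "d > 0" and sep: "\<And>s t. s \<in> S \<Longrightarrow> t \<in> T \<Longrightarrow> dist s t \<ge> d"
  shows "hausdorff_outer k S + hausdorff_outer k T \<le> hausdorff_outer k (S \<union> T)"
proof -
  have pre: "hausdorff_pre k \<delta> S + hausdorff_pre k \<delta> T \<le> hausdorff_pre k \<delta> (S \<union> T)"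
    if \<delta>: "0 < \<delta>" "\<delta> < d" for \<delta>
    unfolding hausdorff_pre_def[of k \<delta> "S \<union> T"]
  proof (rule INF_greatest)
    fix C assume C: "C \<in> hausdorff_covers \<delta> (S \<union> T)"
    define C1 where "C1 i = (if C i \<inter> S = {} then {} else C i)" for i
    define C2 where "C2 i = (if C i \<inter> T = {} then {} else C i)" for i
    have disj: "C i \<inter> S = {} \<or> C i \<inter> T = {}" for i
    proof (rule ccontr)
      assume "\<not> ?thesis"
      then obtain s t where st: "s \<in> C i" "s \<in> S" "t \<in> C i" "t \<in> T" by auto
      have "dist s t \<le> diameter (C i)"
        using C st by (intro diameter_bounded_bound) (auto simp: hausdorff_covers_def)
      also have "\<dots> \<le> \<delta>" using C by (auto simp: hausdorff_covers_def)
      finally show False using sep[of s t] st \<delta> by simp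
    qed
    have "C1 \<in> hausdorff_covers \<delta> S" "C2 \<in> hausdorff_covers \<delta> T"
      using C \<delta> unfolding hausdorff_covers_def C1_def C2_def by fastforce+
    then have "hausdorff_pre k \<delta> S + hausdorff_pre k \<delta> T
        \<le> (\<Sum>i. hausdorff_cost k (C1 i)) + (\<Sum>i. hausdorff_cost k (C2 i))"
      by (intro add_mono hausdorff_pre_le)
    also have "\<dots> = (\<Sum>i. hausdorff_cost k (C1 i) + hausdorff_cost k (C2 i))"
      by (rule suminf_add) auto
    also have "\<dots> \<le> (\<Sum>i. hausdorff_cost k (C i))"
    proof (rule suminf_le)
      show "hausdorff_cost k (C1 i) + hausdorff_cost k (C2 i) \<le> hausdorff_cost k (C i)" for i
        using disj[of i] by (auto simp: C1_def C2_def hausdorff_cost_def)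
    qed auto
    finally show "hausdorff_pre k \<delta> S + hausdorff_pre k \<delta> T \<le> (\<Sum>i. hausdorff_cost k (C i))" .
  qed
  have "hausdorff_pre k \<delta> S + hausdorff_pre k \<epsilon> T \<le> hausdorff_outer k (S \<union> T)"
    if "\<delta> > 0" "\<epsilon> > 0" for \<delta> \<epsilon>
  proof -
    define \<eta> where "\<eta> = min (min \<delta> \<epsilon>) (d / 2)"
    have \<eta>: "0 < \<eta>" "\<eta> < d" "\<eta> \<le> \<delta>" "\<eta> \<le> \<epsilon>" using that d by (auto simp: \<eta>_def)
    have "hausdorff_pre k \<delta> S + hausdorff_pre k \<epsilon> T \<le> hausdorff_pre k \<eta> S + hausdorff_pre k \<eta> T"
      using \<eta> by (intro add_mono hausdorff_pre_antimono)
    also have "\<dots> \<le> hausdorff_pre k \<eta> (S \<union> T)" using \<eta> by (intro pre)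
    also have "\<dots> \<le> hausdorff_outer k (S \<union> T)" using \<eta> by (intro hausdorff_pre_le_outer)
    finally show ?thesis .
  qed
  then show ?thesis
    unfolding hausdorff_outer_def[of k S] hausdorff_outer_def[of k T]
    by (auto simp: ennreal_SUP_add_left[symmetric] ennreal_SUP_add_right intro!: SUP_least)
qed

lemma hausdorff_outer_closed_split:
  fixes F :: "'a::metric_space set"
  assumes F: "closed F"
  shows "hausdorff_outer k (X \<inter> F) + hausdorff_outer k (X - F) \<le> hausdorff_outer k X"
proof (cases "F = {} \<or> hausdorff_outer k X = top")
  case True
  then show ?thesis by (auto simp: hausdorff_outer_empty)
next
  case False
  then have ne: "F \<noteq> {}" and fin: "hausdorff_outer k X < top" by (auto simp: less_top)
  let ?\<mu> = "hausdorff_outer k"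
  define a where "a n = 1 / (real n + 1)" for n :: nat
  define Y where "Y n = {x \<in> X. infdist x F \<ge> a n}" for n
  define R where "R n = {x \<in> X. a (Suc n) \<le> infdist x F \<and> infdist x F < a n}" for n
  have a_pos: "a n > 0" for n by (simp add: a_def)
  have a_Suc: "a (Suc n) < a n" for n by (simp add: a_def field_simps)
  have a_anti: "a n \<le> a m" if "m \<le> n" for m n using that by (simp add: a_def field_simps)
  have a_strict: "a n < a m" if "m < n" for m n using that by (simp add: a_def field_simps)
  have lip: "infdist x F \<le> dist x y + infdist y F" for x y
    using infdist_triangle[of x F y] by simp
  have sumR: "(\<Sum>i<n. ?\<mu> (R (2 * i + c))) \<le> ?\<mu> (\<Union>i<n. R (2 * i + c))" for n c
  proof (induction n)
    case (Suc n)
    have "?\<mu> (\<Union>i<n. R (2*i+c)) + ?\<mu> (R (2*n+c)) \<le> ?\<mu> ((\<Union>i<n. R (2*i+c)) \<union> R (2*n+c))"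
    proof (cases "n = 0")
      case True then show ?thesis by (simp add: hausdorff_outer_empty)
    next
      case False
      show ?thesis
      proof (rule hausdorff_outer_separated)
        show "a (2*n+c-1) - a (2*n+c) > 0"
          using False by (simp add: a_strict)
        fix s t assume "s \<in> (\<Union>i<n. R (2*i+c))" and t: "t \<in> R (2*n+c)"
        then obtain i where i: "i < n" "s \<in> R (2*i+c)" by auto
        have "a (2*n+c-1) \<le> a (Suc (2*i+c))" using i by (intro a_anti) auto
        then show "a (2*n+c-1) - a (2*n+c) \<le> dist s t"
          using i t lip[of s t] by (auto simp: R_def)
      qed
    qed
    then show ?case
      using Suc.IH by (simp add: lessThan_Suc Un_commute add.commute)
        (meson add_left_mono order_trans)
  qed (simp add: hausdorff_outer_empty)
  have sumR': "(\<Sum>i. ?\<mu> (R (2 * i + c))) \<le> ?\<mu> X" for c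
  proof (rule suminf_le_const)
    show "(\<Sum>i<n. ?\<mu> (R (2 * i + c))) \<le> ?\<mu> X" for n
      by (rule order_trans[OF sumR hausdorff_outer_mono]) (auto simp: R_def)
  qed auto
  have le: "(\<Sum>i<n. ?\<mu> (R i)) \<le> ?\<mu> X + ?\<mu> X" for n
  proof -
    have "(\<Sum>i<n. ?\<mu> (R i)) \<le> (\<Sum>i<2*n. ?\<mu> (R i))"
      by (intro sum_mono2) auto
    also have "\<dots> = (\<Sum>i<n. ?\<mu> (R (2*i+0))) + (\<Sum>i<n. ?\<mu> (R (2*i+1)))"
      by (induction n) (auto simp: algebra_simps)
    also have "\<dots> \<le> (\<Sum>i. ?\<mu> (R (2*i+0))) + (\<Sum>i. ?\<mu> (R (2*i+1)))"
      by (intro add_mono sum_le_suminf) auto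
    also have "\<dots> \<le> ?\<mu> X + ?\<mu> X" by (intro add_mono sumR')
    finally show ?thesis .
  qed
  have "(\<Sum>i. ?\<mu> (R i)) \<le> ?\<mu> X + ?\<mu> X"
    by (rule suminf_le_const) (auto intro: le)
  also have XX: "\<dots> < top" using fin by (simp add: less_top)
  finally have sfin: "(\<Sum>i. ?\<mu> (R i)) \<noteq> top" by simp
  have part: "(\<Sum>i<n. ?\<mu> (R i)) \<noteq> top" for n
    using le_less_trans[OF le[of n] XX] by (simp only: less_top)
  have tail_eq: "(\<Sum>i. ?\<mu> (R (i + n))) = (\<Sum>i. ?\<mu> (R i)) - (\<Sum>i<n. ?\<mu> (R i))" for n
    using part[of n] suminf_offset[of "\<lambda>i. ?\<mu> (R i)" n] by (simp add: less_top)
  have "(\<lambda>n. (\<Sum>i. ?\<mu> (R i)) - (\<Sum>i<n. ?\<mu> (R i))) \<longlonglongrightarrow> (\<Sum>i. ?\<mu> (R i)) - (\<Sum>i. ?\<mu> (R i))"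
    using sfin by (intro tendsto_diff_ennreal tendsto_const summable_LIMSEQ) auto
  then have tail: "(\<lambda>n. \<Sum>i. ?\<mu> (R (i + n))) \<longlonglongrightarrow> 0"
    using sfin by (simp add: tail_eq less_top)
  have bound: "?\<mu> (X \<inter> F) + ?\<mu> (X - F) \<le> ?\<mu> X + (\<Sum>i. ?\<mu> (R (i + n)))" for n
  proof -
    have "X - F \<subseteq> Y n \<union> (\<Union>i. R (i + n))"
    proof
      fix x assume x: "x \<in> X - F"
      then have "infdist x F > 0"
        using F ne by (simp add: infdist_pos_not_in_closed)
      then obtain m where m: "a m < infdist x F"
        using reals_Archimedean[of "infdist x F"] by (auto simp: a_def inverse_eq_divide add.commute)
      show "x \<in> Y n \<union> (\<Union>i. R (i + n))"
      proof (cases "a n \<le> infdist x F")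
        case True then show ?thesis using x by (auto simp: Y_def)
      next
        case False
        define j where "j = (LEAST j. a j \<le> infdist x F)"
        have j: "a j \<le> infdist x F" unfolding j_def by (rule LeastI[of _ m]) (use m in simp)
        have "j > n" using False j a_anti[of j n] by (meson not_le order_trans)
        then obtain i where i: "j = Suc (i + n)"
          by (metis add.commute less_iff_Suc_add)
        have "\<not> a (i + n) \<le> infdist x F"
          using not_less_Least[of "i + n" "\<lambda>j. a j \<le> infdist x F"] i unfolding j_def by auto
        then show ?thesis using x j i by (auto simp: R_def)
      qed
    qed
    then have "?\<mu> (X - F) \<le> ?\<mu> (Y n \<union> (\<Union>i. R (i + n)))" by (rule hausdorff_outer_mono)
    also have "\<dots> \<le> ?\<mu> (Y n) + ?\<mu> (\<Union>i. R (i + n))" by (rule hausdorff_outer_Un)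
    also have "\<dots> \<le> ?\<mu> (Y n) + (\<Sum>i. ?\<mu> (R (i + n)))"
      by (intro add_left_mono hausdorff_outer_subadditive)
    finally have 1: "?\<mu> (X - F) \<le> ?\<mu> (Y n) + (\<Sum>i. ?\<mu> (R (i + n)))" .
    have "?\<mu> (X \<inter> F) + ?\<mu> (Y n) \<le> ?\<mu> ((X \<inter> F) \<union> Y n)"
    proof (rule hausdorff_outer_separated)
      show "a n > 0" by (rule a_pos)
      fix s t assume "s \<in> X \<inter> F" "t \<in> Y n"
      then show "dist s t \<ge> a n"
        using lip[of t s] by (auto simp: Y_def dist_commute)
    qed
    also have "\<dots> \<le> ?\<mu> X" by (rule hausdorff_outer_mono) (auto simp: Y_def)
    finally have "?\<mu> (X \<inter> F) + ?\<mu> (Y n) \<le> ?\<mu> X" .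
    then have "(?\<mu> (X \<inter> F) + ?\<mu> (Y n)) + (\<Sum>i. ?\<mu> (R (i + n))) \<le> ?\<mu> X + (\<Sum>i. ?\<mu> (R (i + n)))"
      by (rule add_right_mono)
    moreover have "?\<mu> (X \<inter> F) + ?\<mu> (X - F) \<le> ?\<mu> (X \<inter> F) + (?\<mu> (Y n) + (\<Sum>i. ?\<mu> (R (i + n))))"
      using 1 by (rule add_left_mono)
    ultimately show ?thesis by (simp only: add.assoc order_trans)
  qed
  have "(\<lambda>n. ?\<mu> X + (\<Sum>i. ?\<mu> (R (i + n)))) \<longlonglongrightarrow> ?\<mu> X + 0"
    by (intro tendsto_add tail tendsto_const)
  then show ?thesis
    by (intro LIMSEQ_le_const[where X="\<lambda>n. ?\<mu> X + (\<Sum>i. ?\<mu> (R (i + n)))"]) (auto intro: bound)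
qed

lemma measure_space_hausdorff:
  "measure_space (UNIV::'a::metric_space set) (sets borel) (hausdorff_outer k)"
proof -
  let ?L = "lambda_system (UNIV::'a set) UNIV (hausdorff_outer k)"
  have oms: "outer_measure_space UNIV (hausdorff_outer k :: 'a set \<Rightarrow> ennreal)"
    by (auto simp: outer_measure_space_def positive_def increasing_def countably_subadditive_def
        hausdorff_outer_empty intro: hausdorff_outer_mono hausdorff_outer_subadditive)
  interpret P: sigma_algebra "UNIV::'a set" UNIV
    using sigma_algebra_Pow[of "UNIV::'a set"] by simp
  have ms: "measure_space UNIV ?L (hausdorff_outer k)"
    by (rule P.caratheodory_lemma[OF oms])
  then have sa: "sigma_algebra UNIV ?L" by (simp add: measure_space_def)
  have "F \<in> ?L" if "closed F" for F :: "'a set"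
    unfolding P.lambda_system_eq
  proof (intro CollectI conjI ballI antisym UNIV_I)
    fix X :: "'a set"
    show "hausdorff_outer k (X \<inter> F) + hausdorff_outer k (X - F) \<le> hausdorff_outer k X"
      by (rule hausdorff_outer_closed_split[OF that])
    show "hausdorff_outer k X \<le> hausdorff_outer k (X \<inter> F) + hausdorff_outer k (X - F)"
      using hausdorff_outer_Un[of k "X \<inter> F" "X - F"] by (simp add: Int_Diff_Un)
  qed
  then have "sigma_sets UNIV {F::'a set. closed F} \<subseteq> ?L"
    by (intro sigma_algebra.sigma_sets_subset[OF sa]) auto
  then have "sets (borel::'a measure) \<subseteq> ?L"
    by (simp add: borel_eq_closed)
  then show ?thesis
    using measure_down[OF ms] sets.sigma_algebra_axioms[of "borel::'a measure"] by simp
qed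

lemma sets_hausdorff_measure [simp, measurable_cong]: "sets (hausdorff_measure k) = sets borel"
  unfolding hausdorff_measure_def
  using sets.sigma_sets_eq[of "borel::'a measure"] by (subst sets_measure_of) auto

lemma space_hausdorff_measure [simp]: "space (hausdorff_measure k) = UNIV"
  by (simp add: hausdorff_measure_def space_measure_of_conv)

lemma emeasure_hausdorff_measure:
  "B \<in> sets borel \<Longrightarrow> emeasure (hausdorff_measure k) B = hausdorff_outer k B"
  using measure_space_hausdorff[where 'a='a, of k]
  unfolding hausdorff_measure_def
  by (intro emeasure_measure_of_sigma) (auto simp: measure_space_def)


section \<open>Weak gradients and the magnetic Sobolev space\<close>

primrec C_k :: "nat \<Rightarrow> (real^'n \<Rightarrow> real) \<Rightarrow> bool" where
  "C_k 0 \<phi> \<longleftrightarrow> continuous_on UNIV \<phi>"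
| "C_k (Suc k) \<phi> \<longleftrightarrow> \<phi> differentiable_on UNIV \<and>
     (\<forall>j. C_k k (\<lambda>x. frechet_derivative \<phi> (at x) (axis j 1)))"

definition test_function :: "(real^'n \<Rightarrow> real) \<Rightarrow> bool" where
  "test_function \<phi> \<longleftrightarrow> (\<forall>k. C_k k \<phi>) \<and> compact (closure {x. \<phi> x \<noteq> 0})"

definition locally_integrable :: "(real^'n \<Rightarrow> 'b::{banach, second_countable_topology}) \<Rightarrow> bool" where
  "locally_integrable f \<longleftrightarrow> (\<forall>K. compact K \<longrightarrow> set_integrable lebesgue K f)"

definition has_weak_gradient :: "(real^'n \<Rightarrow> complex) \<Rightarrow> (real^'n \<Rightarrow> complex^'n) \<Rightarrow> bool" where
  "has_weak_gradient u g \<longleftrightarrow> locally_integrable u \<and> locally_integrable g \<and>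
     (\<forall>\<phi> j. test_function \<phi> \<longrightarrow>
        (LINT x|lebesgue. u x * of_real (frechet_derivative \<phi> (at x) (axis j 1)))
          = - (LINT x|lebesgue. g x $ j * of_real (\<phi> x)))"

text \<open>The choice below is immaterial: weak gradients are unique almost everywhere.\<close>

definition weak_gradient :: "(real^'n \<Rightarrow> complex) \<Rightarrow> (real^'n \<Rightarrow> complex^'n)" where
  "weak_gradient u = (SOME g. has_weak_gradient u g)"

definition magnetic_gradient ::
    "(real^'n \<Rightarrow> real^'n) \<Rightarrow> (real^'n \<Rightarrow> complex) \<Rightarrow> real^'n \<Rightarrow> complex^'n" where
  "magnetic_gradient A u x =
     (\<chi> j. weak_gradient u x $ j - \<i> * complex_of_real (A x $ j) * u x)"

definition magnetic_energy :: "(real^'n \<Rightarrow> real^'n) \<Rightarrow> (real^'n \<Rightarrow> complex) \<Rightarrow> ennreal" where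
  "magnetic_energy A u = (\<integral>\<^sup>+ x. ennreal ((norm (magnetic_gradient A u x))\<^sup>2) \<partial>lebesgue)"

definition L2 :: "(real^'n \<Rightarrow> complex) set" where
  "L2 = {u. u \<in> borel_measurable lebesgue \<and> (\<integral>\<^sup>+ x. ennreal ((norm (u x))\<^sup>2) \<partial>lebesgue) < \<infinity>}"

definition H1_magnetic :: "(real^'n \<Rightarrow> real^'n) \<Rightarrow> (real^'n \<Rightarrow> complex) set" where
  "H1_magnetic A = {u \<in> L2. (\<exists>g. has_weak_gradient u g) \<and> magnetic_energy A u < \<infinity>}"


section \<open>Mollifiers and the nonlocal functionals\<close>

definition Psi :: "(real^'n \<Rightarrow> real^'n) \<Rightarrow> (real^'n \<Rightarrow> complex) \<Rightarrow> real^'n \<Rightarrow> real^'n \<Rightarrow> complex" where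
  "Psi A u x y = exp (\<i> * complex_of_real ((x - y) \<bullet> A ((1/2) *\<^sub>R (x + y)))) * u y"

text \<open>
  The radial functions are given by their profiles \<open>\<rho> n r\<close>, \<open>r \<ge> 0\<close>; values at negative
  arguments are irrelevant. Here \<open>N\<close> is the dimension of the space.
\<close>

definition radial_mollifiers :: "nat \<Rightarrow> (nat \<Rightarrow> real \<Rightarrow> real) \<Rightarrow> bool" where
  "radial_mollifiers N \<rho> \<longleftrightarrow>
     (\<forall>n. \<rho> n \<in> borel_measurable (lebesgue_on {0..}) \<and> (\<forall>r\<ge>0. 0 \<le> \<rho> n r)) \<and>
     (\<forall>n. (\<integral>\<^sup>+ r\<in>{0<..}. ennreal (\<rho> n r * r ^ (N - 1)) \<partial>lebesgue) = 1) \<and>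
     (\<forall>\<delta>>0. (\<lambda>n. \<integral>\<^sup>+ r\<in>{\<delta><..}. ennreal (\<rho> n r * r ^ (N - 1)) \<partial>lebesgue) \<longlonglongrightarrow> 0)"

text \<open>
  The diagonal, where the quotient is \<open>0 / 0 = 0\<close>, is a null set. The integral is taken over the
  completed measure on the product, because \<open>\<rho>\<close> is only assumed Lebesgue measurable.
\<close>

definition nonlocal_energy ::
    "(real^'n \<Rightarrow> real^'n) \<Rightarrow> (real \<Rightarrow> real) \<Rightarrow> (real^'n \<Rightarrow> complex) \<Rightarrow> ennreal" where
  "nonlocal_energy A \<rho> u =
     (\<integral>\<^sup>+ (x, y). ennreal ((norm (Psi A u x y - Psi A u x x))\<^sup>2 / (norm (x - y))\<^sup>2 * \<rho> (norm (x - y)))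
        \<partial>(lebesgue :: ((real^'n) \<times> (real^'n)) measure))"

definition sphere_area :: "'n::finite itself \<Rightarrow> ennreal" where
  "sphere_area _ = emeasure (hausdorff_measure (CARD('n) - 1)) (sphere (0::real^'n) 1)"

definition Q_const :: "real^'n \<Rightarrow> ennreal" where
  "Q_const \<omega> =
     (\<integral>\<^sup>+ \<sigma>\<in>sphere 0 1. ennreal (\<bar>\<omega> \<bullet> \<sigma>\<bar>\<^sup>2) \<partial>(hausdorff_measure (CARD('n) - 1))) / 2"

text \<open>
  A Lipschitz map is differentiable almost everywhere (Rademacher), so the values of \<open>jacobian\<close>
  at points of non-differentiability do not matter. The norm on \<open>real^'n^'n\<close> is the Euclidean
  (Frobenius) norm.
\<close>

definition grad_Linfty :: "(real^'n \<Rightarrow> real^'n) \<Rightarrow> ennreal" where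
  "grad_Linfty A = esssup lebesgue (\<lambda>x. ennreal (norm (jacobian A (at x))))"

end

theory Submission
  imports Defs "HOL-Probability.Characteristic_Functions"
begin

text \<open>
  Write \<open>\<Delta>(h, x)\<close> for \<open>exp (-i h \<bullet> A (x + h/2)) u (x + h) - u x\<close> and \<open>D\<close> for the magnetic gradient
  \<open>\<nabla>u - i A u\<close>. In polar coordinates the nonlocal functional is the average of
  \<open>k r = \<integral>\<^sub>S \<integral> |\<Delta>(r s, x) / r|\<^sup>2 dx ds\<close> against the density \<open>\<rho>\<^sub>n r * r\<^bsup>N-1\<^esup>\<close> (\<open>nonlocal_energy_eq\<close>). These
  densities have mass one and concentrate at \<open>0\<close>, so everything is a question about \<open>k\<close> near \<open>0\<close>.

  \<^item> Upper bound. Along almost every segment \<open>u\<close> is the integral of its weak gradient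
    (\<open>weakgrad_line\<close>). Differentiating the phase times \<open>u\<close> along the segment shows that \<open>\<Delta>(h, x)\<close> is an
    average of \<open>h \<bullet> D\<close>, up to an error \<open>|h|\<^sup>2 L |u| / 2\<close>, because the phase uses the value of \<open>A\<close> at the
    midpoint (\<open>mag_diff_bound\<close>). This gives \<open>limsup k \<le> k0\<close> with \<open>k0 = \<integral>\<^sub>S \<integral> |s \<bullet> D|\<^sup>2 dx ds\<close>, and
    together with the trivial bound for \<open>r \<ge> 1\<close> the inequality for every \<open>n\<close>.
  \<^item> Lower bound. Tested against a smooth function, \<open>\<Delta>(r s, x) / r\<close> converges to a distribution,
    \<open>weak_mag\<close>, which is \<open>s \<bullet> D\<close> when \<open>D\<close> exists (\<open>mag_diff_test_tendsto\<close>); weak lower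
    semicontinuity and Fatou's lemma on the sphere give \<open>k0 \<le> liminf k\<close>.
  \<^item> Converse. If the functionals are bounded, the same argument bounds the distribution \<open>weak_mag\<close> by the
    \<open>L\<^sup>2\<close> norm of the test function, and the Riesz representation theorem turns it into a square
    integrable magnetic gradient (\<open>weakgrad_of_bounded_energy\<close>).

  Two constants need work of their own. Spherical integrals are taken against the cone measure;
  by invariance under rotations \<open>\<integral>\<^sub>S |s \<bullet> z|\<^sup>2 ds = |z|\<^sup>2 |S| / N\<close>, and the same holds for the Hausdorff measure, so it
  remains to compare the two total masses (\<open>hausdorff_sphere_eq_cone_measure\<close>). One inequality rests
  on the isodiametric inequality in tangent hyperplanes, the other on packing the sphere by caps.
  And the bound with \<open>\<nabla>A\<close> in \<open>L\<^sup>\<infinity>\<close> requires that the essential supremum of the Jacobian be a Lipschitz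
  constant (\<open>lipschitz_grad_Linfty\<close>), which needs Rademacher's theorem: a Lipschitz function has a
  bounded weak gradient, and at density points of the level sets of that gradient the line formula
  makes it a derivative.
\<close>

section \<open>Notation\<close>

abbreviation nn_integral_lborel :: "('a::euclidean_space \<Rightarrow> ennreal) \<Rightarrow> ennreal" (binder "NN " 10) where
  "NN x. f x \<equiv> \<integral>\<^sup>+x. f x \<partial>lborel"

abbreviation energy :: "('a::euclidean_space \<Rightarrow> 'b::real_normed_vector) \<Rightarrow> ennreal" where
  "energy f \<equiv> NN x. ennreal ((norm (f x))\<^sup>2)"

abbreviation borel_fun :: "('a::topological_space \<Rightarrow> 'b::topological_space) \<Rightarrow> bool" where
  "borel_fun f \<equiv> f \<in> borel_measurable borel"

abbreviation cor :: "real \<Rightarrow> complex" where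
  "cor \<equiv> complex_of_real"

abbreviation PiL :: "'i set \<Rightarrow> ('i \<Rightarrow> real) measure" where
  "PiL I \<equiv> Pi\<^sub>M I (\<lambda>_. lborel)"


section \<open>Polar coordinates\<close>

definition cone_set :: "real => 'a::euclidean_space set => 'a set" where
 "cone_set a B = {x. x ~= 0 & norm x <= a & x /\<^sub>R norm x \<in> B}"

text \<open>The surface measure of the unit sphere: a set of directions gets \<open>N\<close> times the volume
 of the part of its cone in the unit ball. The factor makes polar coordinates hold without a constant.\<close>

definition cone_measure :: "'a::euclidean_space measure" where
 "cone_measure = distr (density lborel (%x. of_nat DIM('a) * indicator (cone_set 1 UNIV) x))
   borel (%x. x /\<^sub>R norm x)"

abbreviation nn_integral_sphere :: "('a::euclidean_space => ennreal) => ennreal" (binder "NS " 10) where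
 "NS s. f s \<equiv> \<integral>\<^sup>+s. f s \<partial>cone_measure"

lemma measurable_direction [measurable]:
 "borel_fun (%x::'a::euclidean_space. x /\<^sub>R norm x)"
 by (intro borel_measurable_scaleR borel_measurable_inverse borel_measurable_norm) auto

lemma sets_vimage_direction [measurable]:
 "B \<in> sets borel ==> (%x::'a::euclidean_space. x /\<^sub>R norm x) -` B \<in> sets borel"
 using measurable_sets[OF measurable_direction, of B] by simp

lemma sets_cone_set [measurable]:
 assumes [measurable]: "B \<in> sets borel"
 shows "cone_set a (B::'a::euclidean_space set) \<in> sets borel"
proof -
 have "cone_set a B = {x. norm x <= a} \<inter> - {0} \<inter> (%x. x /\<^sub>R norm x) -` B"
  by (auto simp: cone_set_def)
 then show ?thesis by simp
qed

lemma sets_cone_measure [simp, measurable_cong]: "sets cone_measure = sets borel"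
 by (simp add: cone_measure_def)

lemma space_cone_measure [simp]: "space cone_measure = UNIV"
 by (simp add: cone_measure_def)

lemma emeasure_cone_measure:
 fixes B :: "'a::euclidean_space set"
 assumes [measurable]: "B \<in> sets borel"
 shows "emeasure cone_measure B = of_nat DIM('a) * emeasure lborel (cone_set 1 B)"
proof -
 have "emeasure cone_measure B
   = emeasure (density lborel (%x. of_nat DIM('a) * indicator (cone_set 1 UNIV) x)) ((%x. x /\<^sub>R norm x) -` B)"
  unfolding cone_measure_def by (subst emeasure_distr) auto
 also have "... = (NN x. of_nat DIM('a) * indicator (cone_set 1 UNIV) x * indicator ((%x. x /\<^sub>R norm x) -` B) x)"
  by (intro emeasure_density) auto
 also have "... = (NN x. of_nat DIM('a) * indicator (cone_set 1 B) x)"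
  by (intro nn_integral_cong) (auto simp: indicator_def cone_set_def)
 also have "... = of_nat DIM('a) * emeasure lborel (cone_set 1 B)"
  by (subst nn_integral_cmult) auto
 finally show ?thesis .
qed

lemma emeasure_cone_measure_UNIV_finite: "emeasure cone_measure (UNIV::'a::euclidean_space set) < \<infinity>"
proof -
 have "emeasure lborel (cone_set 1 (UNIV::'a set)) <= emeasure lborel (cball (0::'a) 1)"
  by (rule emeasure_mono) (auto simp: cone_set_def)
 then have "emeasure lborel (cone_set 1 (UNIV::'a set)) < \<infinity>"
  using emeasure_lborel_cball_finite[of "0::'a" 1] by simp
 then show ?thesis by (simp add: emeasure_cone_measure ennreal_mult_less_top of_nat_less_top)
qed

lemma finite_measure_cone: "finite_measure (cone_measure :: 'a::euclidean_space measure)"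
 using emeasure_cone_measure_UNIV_finite[where 'a='a] by (intro finite_measureI) auto

lemma emeasure_cone_measure_UNIV_pos: "0 < emeasure cone_measure (UNIV::'a::euclidean_space set)"
proof -
 have eq: "cball 0 1 = insert 0 (cone_set 1 (UNIV::'a set))"
  by (auto simp: cone_set_def)
 have "emeasure lborel (cball (0::'a) 1) <= emeasure lborel {0::'a} + emeasure lborel (cone_set 1 (UNIV::'a set))"
  unfolding eq by (subst insert_is_Un) (intro emeasure_subadditive; simp)
 moreover have "emeasure lborel (cball (0::'a) 1) > 0"
  by (subst emeasure_cball) (auto intro: unit_ball_vol_pos)
 ultimately have "0 < emeasure lborel (cone_set 1 (UNIV::'a set))" by simp
 then show ?thesis
  by (simp add: emeasure_cone_measure ennreal_zero_less_mult_iff)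
qed

lemma AE_cone_measure_norm: "AE s in cone_measure. norm (s::'a::euclidean_space) = 1"
 unfolding cone_measure_def
 by (subst AE_distr_iff; (subst AE_density)?) (auto simp: cone_set_def indicator_def)

lemma emeasure_cone_set_scale:
 fixes B :: "'a::euclidean_space set"
 assumes [measurable]: "B \<in> sets borel" and a: "a > 0"
 shows "emeasure lborel (cone_set a B) = ennreal (a ^ DIM('a)) * emeasure lborel (cone_set 1 B)"
proof -
 have v: "(%x. 0 + a *\<^sub>R x) -` cone_set a B = cone_set 1 B"
 proof -
  have dir: "(a *\<^sub>R x) /\<^sub>R norm (a *\<^sub>R x) = x /\<^sub>R norm x" for x :: 'a
   using a by simp
  have "a *\<^sub>R x \<in> cone_set a B \<longleftrightarrow> x \<in> cone_set 1 B" for x :: 'a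
   unfolding cone_set_def mem_Collect_eq dir using a by simp
  then show ?thesis by (simp add: vimage_def)
 qed
 have "emeasure lborel (cone_set a B)
   = emeasure (density (distr lborel borel (%x. 0 + a *\<^sub>R x)) (%_. ennreal (\<bar>a\<bar> ^ DIM('a)))) (cone_set a B)"
  using a by (subst lborel_affine[of a 0]) auto
 also have "... = (\<integral>\<^sup>+x. ennreal (a ^ DIM('a)) * indicator (cone_set a B) x \<partial>distr lborel borel (%x. 0 + a *\<^sub>R x))"
  using a by (subst emeasure_density) auto
 also have "... = ennreal (a ^ DIM('a)) * emeasure (distr lborel borel (%x. 0 + a *\<^sub>R x)) (cone_set a B)"
  by (subst nn_integral_cmult) auto
 also have "emeasure (distr lborel borel (%x. 0 + a *\<^sub>R x)) (cone_set a B) = emeasure lborel (cone_set 1 B)"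
  by (subst emeasure_distr) (auto simp: v[simplified])
 finally show ?thesis .
qed

definition radial_measure :: "nat => real measure" where
 "radial_measure n = density lborel (%r. ennreal (r ^ (n - 1)) * indicator {0<..} r)"

abbreviation radint :: "nat => (real => ennreal) => ennreal" where
 "radint n \<equiv> nn_integral (radial_measure n)"

lemma sets_radial_measure [simp, measurable_cong]: "sets (radial_measure n) = sets borel"
 by (simp add: radial_measure_def)

lemma space_radial_measure [simp]: "space (radial_measure n) = UNIV"
 by (simp add: radial_measure_def)

lemma nn_integral_radial_measure:
 "f \<in> borel_measurable borel ==>
  (radint n (%r. f r)) = (NN r. ennreal (r ^ (n - 1)) * indicator {0<..} r * f r)"
 unfolding radial_measure_def by (subst nn_integral_density) auto

lemma emeasure_radial_measure_atMost:
 assumes n: "n > 0"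
 shows "emeasure (radial_measure n) {..a} = (if a > 0 then ennreal (a ^ n / n) else 0)"
proof -
 have "emeasure (radial_measure n) {..a}
   = (NN r. ennreal (r ^ (n - 1)) * indicator {0<..} r * indicator {..a} r)"
  unfolding radial_measure_def by (subst emeasure_density) auto
 also have "... = (NN r. ennreal (r ^ (n - 1)) * indicator {0..a} r)"
  using AE_lborel_singleton[of "0::real"]
  by (intro nn_integral_cong_AE, elim AE_mp) (intro AE_I2, auto simp: indicator_def)
 also have "... = (if a > 0 then ennreal (a ^ n / n) else 0)"
 proof (cases "a > 0")
  case True
  have "(NN r. ennreal (r ^ (n - 1)) * indicator {0..a} r) = ennreal (a ^ n / n - 0 ^ n / n)"
   using True n by (intro nn_integral_FTC_Icc) (auto intro!: derivative_eq_intros)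
  also have "a ^ n / n - 0 ^ n / n = a ^ n / n" using n by (simp add: zero_power)
  finally show ?thesis using True by simp
 next
  case False
  have "(NN r. ennreal (r ^ (n - 1)) * indicator {0..a} r) = (\<integral>\<^sup>+r. 0 \<partial>(lborel :: real measure))"
  proof (rule nn_integral_cong_AE)
   show "AE r in lborel. ennreal (r ^ (n - 1)) * indicator {0..a} r = 0"
    using AE_lborel_singleton[of "0::real"]
   proof eventually_elim
    case (elim r)
    then have "r \<notin> {0..a}" using False by auto
    then show ?case by simp
   qed
  qed
  then show ?thesis using False by simp
 qed
 finally show ?thesis .
qed

lemma sigma_finite_radial_measure: "sigma_finite_measure (radial_measure n)"
 unfolding radial_measure_def
 by (subst sigma_finite_measure.sigma_finite_iff_density_finite[OF sigma_finite_lborel])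
  (auto simp: indicator_def)

text \<open>Both sides are measures in \<open>A\<close>. On a half line \<open>{..a}\<close> the right-hand
 side is the volume of a truncated cone, which scales like \<open>a ^ N\<close>; half lines determine the
 measure.\<close>

lemma emeasure_radial_direction:
 fixes B :: "'a::euclidean_space set"
 assumes A[measurable]: "A \<in> sets borel" and B[measurable]: "B \<in> sets borel"
 shows "emeasure (radial_measure DIM('a)) A * emeasure cone_measure B
  = emeasure lborel {x. x ~= 0 & norm x \<in> A & x /\<^sub>R norm x \<in> B}"
proof -
 define C where "C = {x::'a. x ~= 0 & x /\<^sub>R norm x \<in> B}"
 have C[measurable]: "C \<in> sets borel" unfolding C_def by measurable
 define M1 where "M1 = density (radial_measure DIM('a)) (%_. emeasure cone_measure B)"
 define M2 where "M2 = distr (density lborel (indicator C)) borel norm"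
 have M1: "emeasure M1 X = emeasure (radial_measure DIM('a)) X * emeasure cone_measure B"
  if [measurable]: "X \<in> sets borel" for X
 proof -
  have "emeasure M1 X = (\<integral>\<^sup>+x. emeasure cone_measure B * indicator X x \<partial>radial_measure DIM('a))"
   unfolding M1_def by (subst emeasure_density) auto
  also have "... = emeasure cone_measure B * emeasure (radial_measure DIM('a)) X"
   by (subst nn_integral_cmult) auto
  finally show ?thesis by (simp add: mult.commute)
 qed
 have M2: "emeasure M2 X = emeasure lborel {x. x ~= 0 & norm x \<in> X & x /\<^sub>R norm x \<in> B}"
  if [measurable]: "X \<in> sets borel" for X
 proof -
  have [measurable]: "norm -` X \<in> sets (borel :: 'a measure)"
   using measurable_sets[of norm "borel :: 'a measure" borel X] that by simp
  have "emeasure M2 X = emeasure (density lborel (indicator C)) (norm -` X)"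
   unfolding M2_def by (subst emeasure_distr) auto
  also have "... = (NN x. indicator C x * indicator (norm -` X) x)"
   by (intro emeasure_density) auto
  also have "... = (NN x. indicator {x. x ~= 0 & norm x \<in> X & x /\<^sub>R norm x \<in> B} x)"
   by (intro nn_integral_cong) (auto simp: indicator_def C_def)
  also have "... = emeasure lborel {x. x ~= 0 & norm x \<in> X & x /\<^sub>R norm x \<in> B}"
   by (intro nn_integral_indicator) measurable
  finally show ?thesis .
 qed
 have eq: "emeasure M1 {..a} = emeasure M2 {..a}" for a
 proof (cases "a > 0")
  case True
  have "emeasure M2 {..a} = emeasure lborel (cone_set a B)"
   by (subst M2) (auto simp: cone_set_def intro!: arg_cong[where f="emeasure lborel"])
  also have "... = ennreal (a ^ DIM('a)) * emeasure lborel (cone_set 1 B)"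
   by (rule emeasure_cone_set_scale[OF B True])
  also have "... = ennreal (a ^ DIM('a) / DIM('a)) * (of_nat DIM('a) * emeasure lborel (cone_set 1 B))"
  proof -
   have "ennreal (a ^ DIM('a) / DIM('a)) * of_nat DIM('a) = ennreal (a ^ DIM('a) / DIM('a) * real DIM('a))"
    unfolding ennreal_of_nat_eq_real_of_nat using True by (intro ennreal_mult[symmetric]) auto
   then show ?thesis by (simp add: mult.assoc[symmetric])
  qed
  finally show ?thesis
   using True by (simp add: M1 emeasure_radial_measure_atMost emeasure_cone_measure)
 next
  case False
  then have emp: "{x::'a. x ~= 0 & norm x \<in> {..a} & x /\<^sub>R norm x \<in> B} = {}"
   using norm_ge_zero order_trans by (fastforce simp: not_less)
  have "emeasure M2 {..a} = emeasure lborel {x::'a. x ~= 0 & norm x \<in> {..a} & x /\<^sub>R norm x \<in> B}"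
   by (rule M2) simp
  then show ?thesis using False unfolding emp by (simp add: M1 emeasure_radial_measure_atMost)
 qed
 have "M1 = M2"
 proof (rule measure_eqI_generator_eq[where A="%i. {..real i}" and E="range (%a::real. {..a})" and \<Omega>=UNIV])
  show "Int_stable (range (%a::real. {..a}))" 
  proof (rule Int_stableI)
   fix X Y assume "X \<in> range (%a::real. {..a})" "Y \<in> range (%a::real. {..a})"
   then obtain a b where "X = {..a}" "Y = {..b}" by auto
   then have "X \<inter> Y = {..min a b}" by auto
   then show "X \<inter> Y \<in> range (%a::real. {..a})" by auto
  qed
  show "range (%a::real. {..a}) \<subseteq> Pow UNIV" by auto
  show "sets M1 = sigma_sets UNIV (range (%a::real. {..a}))"
   by (simp add: M1_def borel_eq_atMost)
  show "sets M2 = sigma_sets UNIV (range (%a::real. {..a}))"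
   by (simp add: M2_def borel_eq_atMost)
  show "range (%i. {..real i}) \<subseteq> range (%a::real. {..a})" by auto
  show "(\<Union>i. {..real i}) = UNIV" using real_arch_simple by auto
  show "emeasure M1 {..real i} ~= \<infinity>" for i
  proof -
   have "emeasure cone_measure B <= emeasure cone_measure (UNIV::'a set)"
    by (rule emeasure_mono) auto
   then have "emeasure cone_measure B ~= \<infinity>"
    using emeasure_cone_measure_UNIV_finite[where 'a='a] by (auto simp: top_unique)
   then show ?thesis by (simp add: M1 emeasure_radial_measure_atMost ennreal_mult_eq_top_iff)
  qed
  show "emeasure M1 X = emeasure M2 X" if "X \<in> range (%a::real. {..a})" for X
   using that eq by auto
 qed
 then show ?thesis using M1[OF A] M2[OF A] by simp
qed

text \<open>By the product formula above, \<open>x \<mapsto> (norm x, x / norm x)\<close> carries Lebesgue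
 measure to the product of the radial and the cone measure.\<close>

theorem nn_integral_polar:
 fixes f :: "'a::euclidean_space => ennreal"
 assumes [measurable]: "borel_fun f"
 shows "(NN x. f x)
  = (\<integral>\<^sup>+r. (NS s. f (r *\<^sub>R s)) \<partial>radial_measure DIM('a))"
proof -
 interpret C: finite_measure "cone_measure :: 'a measure" by (rule finite_measure_cone)
 define P where "P = distr (density lborel (indicator (- {0}))) (borel \<Otimes>\<^sub>M borel) (%x::'a. (norm x, x /\<^sub>R norm x))"
 have P: "radial_measure DIM('a) \<Otimes>\<^sub>M cone_measure = P"
 proof (rule pair_measure_eqI)
  show "sigma_finite_measure (cone_measure :: 'a measure)" ..
  show "sets (radial_measure DIM('a) \<Otimes>\<^sub>M cone_measure) = sets P"
   by (simp add: P_def cong: sets_pair_measure_cong)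
  show "emeasure (radial_measure DIM('a)) A * emeasure cone_measure B = emeasure P (A \<times> B)"
   if "A \<in> sets (radial_measure DIM('a))" "B \<in> sets cone_measure" for A and B :: "'a set"
  proof -
   have [measurable]: "A \<in> sets borel" "B \<in> sets borel" using that by simp_all
   have "emeasure P (A \<times> B) = (NN x. indicator (- {0}) x * indicator ((%x. (norm x, x /\<^sub>R norm x)) -` (A \<times> B)) x)"
   proof -
    have "(%x::'a. (norm x, x /\<^sub>R norm x)) -` (A \<times> B) = norm -` A \<inter> (%x. x /\<^sub>R norm x) -` B" by auto
    moreover have "norm -` A \<in> sets (borel :: 'a measure)"
     using measurable_sets[of norm "borel :: 'a measure" borel A] by simp
    ultimately have [measurable]: "(%x::'a. (norm x, x /\<^sub>R norm x)) -` (A \<times> B) \<in> sets borel"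
     by simp
    show ?thesis
     unfolding P_def by (subst emeasure_distr; (subst emeasure_density)?) auto
   qed
   also have "... = (NN x. indicator {x. x ~= 0 & norm x \<in> A & x /\<^sub>R norm x \<in> B} x)"
    by (intro nn_integral_cong) (auto simp: indicator_def)
   also have "... = emeasure lborel {x. x ~= 0 & norm x \<in> A & x /\<^sub>R norm x \<in> B}"
    by (intro nn_integral_indicator) measurable
   finally show ?thesis by (simp add: emeasure_radial_direction)
  qed
 qed (rule sigma_finite_radial_measure)
 have "(\<integral>\<^sup>+r. (NS s. f (r *\<^sub>R s)) \<partial>radial_measure DIM('a))
   = (\<integral>\<^sup>+z. f (fst z *\<^sub>R snd z) \<partial>(radial_measure DIM('a) \<Otimes>\<^sub>M cone_measure))"
  by (subst C.nn_integral_fst[symmetric]) auto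
 also have "... = (NN x. indicator (- {0}) x * f (norm x *\<^sub>R (x /\<^sub>R norm x)))"
  unfolding P unfolding P_def by (subst nn_integral_distr; (subst nn_integral_density)?) auto
 also have "... = (NN x. f x)"
  using AE_lborel_singleton[of "0::'a"]
  by (intro nn_integral_cong_AE, elim AE_mp) (intro AE_I2, auto simp: indicator_def)
 finally show ?thesis by simp
qed

section \<open>The isodiametric inequality\<close>

text \<open>Otherwise \<open>S\<close> lies in an interval of length \<open>c\<close> below its
 supremum.\<close>

lemma exists_far_points_of_emeasure_gt:
 fixes S :: "real set"
 assumes "ennreal c < emeasure lborel S" "0 <= c"
 shows "\<exists>p\<in>S. \<exists>q\<in>S. q - p > c"
proof (rule ccontr)
 assume "\<not> ?thesis"
 then have le: "!!p q. p \<in> S ==> q \<in> S ==> q <= p + c" by force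
 show False
 proof (cases "S = {}")
  case True then show ?thesis using assms by simp
 next
  case False
  then obtain p0 where p0: "p0 \<in> S" by auto
  have bdd: "bdd_above S" by (rule bdd_aboveI[of _ "p0 + c"]) (rule le[OF p0])
  have "S \<subseteq> {Sup S - c .. Sup S}"
  proof
   fix p assume p: "p \<in> S"
   have "Sup S <= p + c" by (rule cSup_least[OF False]) (rule le[OF p])
   then show "p \<in> {Sup S - c .. Sup S}" using cSup_upper[OF p bdd] by simp
  qed
  then have "emeasure lborel S <= emeasure lborel {Sup S - c .. Sup S}"
   by (rule emeasure_mono) simp
  also have "... = ennreal c" using assms(2) by simp
  finally show False using assms(1) by simp
 qed
qed

lemma emeasure_lborel_abs_less: "emeasure lborel {t::real. ennreal (2 * \<bar>t\<bar>) < c} = c"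
proof (cases c)
 case (real r)
 have "{t::real. ennreal (2 * \<bar>t\<bar>) < c} = {- (r/2) <..< r/2}"
  using real by (auto simp: ennreal_less_iff)
 then show ?thesis using real by simp
next
 case top
 then show ?thesis by simp
qed

text \<open>Steiner symmetrization in the direction \<open>b\<close>: every section parallel to that axis
 becomes a centred open interval of the same length.\<close>

definition steiner :: "'i set => 'i => ('i => real) set => ('i => real) set" where
 "steiner I b X = {x \<in> space (PiL I).
   ennreal (2 * \<bar>x b\<bar>) < emeasure lborel {t. x(b := t) \<in> X}}"

lemma measurable_section_update:
 fixes X :: "('i => real) set"
 assumes "finite I" "X \<in> sets (PiL (insert b I))"
 shows "(%x. emeasure lborel {t. x(b := t) \<in> X}) \<in> borel_measurable (PiL I)"
  and "x \<in> space (PiL I) ==> {t. x(b := t) \<in> X} \<in> sets lborel"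
proof -
 let ?P = "PiL I"
 have 1: "(%(f, y). f(b := y)) \<in> ?P \<Otimes>\<^sub>M lborel \<rightarrow>\<^sub>M PiL (insert b I)"
  by (rule measurable_add_dim)
 define Y where "Y = (%(f, y). f(b := y)) -` X \<inter> space (?P \<Otimes>\<^sub>M (lborel::real measure))"
 have Y: "Y \<in> sets (?P \<Otimes>\<^sub>M lborel)"
  unfolding Y_def by (rule measurable_sets[OF 1 assms(2)])
 have sec: "Pair x -` Y = {t. x(b := t) \<in> X}" if "x \<in> space ?P" for x
  using that by (auto simp: Y_def space_pair_measure)
 have "(%x. emeasure lborel (Pair x -` Y)) \<in> borel_measurable ?P"
  by (rule sigma_finite_measure.measurable_emeasure_Pair[OF sigma_finite_lborel Y])
 also have "?this \<longleftrightarrow> (%x. emeasure lborel {t. x(b := t) \<in> X}) \<in> borel_measurable ?P"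
  by (rule measurable_cong) (simp add: sec)
 finally show "(%x. emeasure lborel {t. x(b := t) \<in> X}) \<in> borel_measurable ?P" .
 show "{t. x(b := t) \<in> X} \<in> sets lborel" if "x \<in> space ?P"
  using sets_Pair1[OF Y, of x] sec[OF that] by simp
qed

lemma emeasure_PiM_sections:
 fixes X :: "('i => real) set"
 assumes "finite I" "b \<notin> I" "X \<in> sets (PiL (insert b I))"
 shows "emeasure (PiL (insert b I)) X
    = (\<integral>\<^sup>+x. emeasure lborel {t. x(b := t) \<in> X} \<partial>PiL I)"
proof -
 interpret product_sigma_finite "%_::'i. lborel :: real measure"
  by standard
 have "emeasure (PiL (insert b I)) X
   = (\<integral>\<^sup>+x. indicator X x \<partial>PiL (insert b I))"
  using assms by simp
 also have "... = (\<integral>\<^sup>+x. (NN t. indicator X (x(b := t))) \<partial>PiL I)"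
  using assms by (intro product_nn_integral_insert) auto
 also have "... = (\<integral>\<^sup>+x. emeasure lborel {t. x(b := t) \<in> X} \<partial>PiL I)"
 proof (rule nn_integral_cong)
  fix x :: "'i => real" assume x: "x \<in> space (PiL I)"
  have "(NN t. indicator X (x(b := t))) = (NN t. indicator {t. x(b := t) \<in> X} t)"
   by (intro nn_integral_cong) (simp add: indicator_def)
  then show "(NN t. indicator X (x(b := t))) = emeasure lborel {t. x(b := t) \<in> X}"
   using measurable_section_update(2)[OF assms(1,3) x] by simp
 qed
 finally show ?thesis .
qed

lemma sets_steiner:
 assumes "finite I" "b \<in> I" "X \<in> sets (PiL I)"
 shows "steiner I b X \<in> sets (PiL I)"
proof -
 have [measurable]: "(%x. emeasure lborel {t. x(b := t) \<in> X}) \<in> borel_measurable (PiL I)"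
  using assms by (intro measurable_section_update) (auto simp: insert_absorb)
 have [measurable]: "(%x. x b) \<in> borel_measurable (PiL I)"
  using measurable_component_singleton[OF assms(2), of "%_. lborel :: real measure"] by simp
 show ?thesis unfolding steiner_def by measurable
qed

lemma emeasure_steiner:
 assumes I: "finite I" "b \<in> I" and X: "X \<in> sets (PiL I)"
 shows "emeasure (PiL I) (steiner I b X) = emeasure (PiL I) X"
proof -
 define J where "J = I - {b}"
 have J: "finite J" "b \<notin> J" "insert b J = I" using I by (auto simp: J_def)
 have "emeasure lborel {t. x(b := t) \<in> steiner I b X} = emeasure lborel {t. x(b := t) \<in> X}"
  if "x \<in> space (PiL J)" for x :: "'a => real"
 proof -
  have "x(b := t) \<in> space (PiL I)" for t :: real
   using that J(3) by (auto simp: space_PiM PiE_def extensional_def)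
  then have "{t. x(b := t) \<in> steiner I b X}
    = {t. ennreal (2 * \<bar>t\<bar>) < emeasure lborel {t. x(b := t) \<in> X}}"
   by (simp add: steiner_def)
  then show ?thesis by (simp add: emeasure_lborel_abs_less)
 qed
 then show ?thesis
  using emeasure_PiM_sections[OF J(1,2)] sets_steiner[OF I X] X unfolding J(3)
  by (simp cong: nn_integral_cong)
qed

definition sqdist_on :: "'i set => ('i => real) => ('i => real) => real" where
 "sqdist_on I x y = (\<Sum>i\<in>I. (x i - y i)^2)"

text \<open>The sections through \<open>x\<close> and \<open>y\<close> have lengths exceeding \<open>2 *
 \<bar>x b\<bar>\<close> and \<open>2 * \<bar>y b\<bar>\<close>. Hence each contains two points that far apart,
 and one of the crossed pairs is at least as far apart in the coordinate \<open>b\<close> as \<open>x\<close>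
 and \<open>y\<close> are.\<close>

lemma sqdist_on_steiner:
 assumes I: "finite I" "b \<in> I" and d: "!!x y. x \<in> X ==> y \<in> X ==> sqdist_on I x y <= D"
  and x: "x \<in> steiner I b X" and y: "y \<in> steiner I b X"
 shows "sqdist_on I x y <= D"
proof -
 have split: "sqdist_on I f g = (f b - g b)^2 + sqdist_on (I - {b}) f g" for f g
  unfolding sqdist_on_def by (rule sum.remove[OF I])
 have upd: "sqdist_on (I - {b}) (f(b := s)) (g(b := t)) = sqdist_on (I - {b}) f g" for f g s t
  unfolding sqdist_on_def by (rule sum.cong) auto
 obtain p q where pq: "x(b := p) \<in> X" "x(b := q) \<in> X" "q - p > 2 * \<bar>x b\<bar>"
  using exists_far_points_of_emeasure_gt[of "2 * \<bar>x b\<bar>" "{t. x(b := t) \<in> X}"] x by (auto simp: steiner_def)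
 obtain p' q' where pq': "y(b := p') \<in> X" "y(b := q') \<in> X" "q' - p' > 2 * \<bar>y b\<bar>"
  using exists_far_points_of_emeasure_gt[of "2 * \<bar>y b\<bar>" "{t. y(b := t) \<in> X}"] y by (auto simp: steiner_def)
 have "\<bar>x b - y b\<bar> <= \<bar>q - p'\<bar> \<or> \<bar>x b - y b\<bar> <= \<bar>p - q'\<bar>"
  using pq(3) pq'(3) by linarith
 then have "(x b - y b)^2 <= (q - p')^2 \<or> (x b - y b)^2 <= (p - q')^2"
  by (simp only: abs_le_square_iff)
 then show ?thesis
 proof
  assume "(x b - y b)^2 <= (q - p')^2"
  then have "sqdist_on I x y <= sqdist_on I (x(b := q)) (y(b := p'))"
   by (simp add: split upd)
  also have "... <= D" by (rule d[OF pq(2) pq'(1)])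
  finally show ?thesis .
 next
  assume "(x b - y b)^2 <= (p - q')^2"
  then have "sqdist_on I x y <= sqdist_on I (x(b := p)) (y(b := q'))"
   by (simp add: split upd)
  also have "... <= D" by (rule d[OF pq(1) pq'(2)])
  finally show ?thesis .
 qed
qed

lemma steiner_reflect_same:
 assumes "b \<in> I" "x \<in> steiner I b X"
 shows "x(b := - x b) \<in> steiner I b X"
 using assms by (auto simp: steiner_def space_PiM PiE_def extensional_def)

lemma steiner_reflect_other:
 assumes sym: "!!x. x \<in> X ==> x(i := - x i) \<in> X" and i: "i \<in> I" "i ~= b"
  and x: "x \<in> steiner I b X"
 shows "x(i := - x i) \<in> steiner I b X"
proof -
 have "x(b := t, i := - x i) \<in> X \<longleftrightarrow> x(b := t) \<in> X" for t
 proof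
  have eq: "x(b := t, i := - x i, i := - (x(b := t, i := - x i)) i) = x(b := t)"
   using i by (auto simp: fun_eq_iff)
  show "x(b := t) \<in> X" if "x(b := t, i := - x i) \<in> X"
   using sym[OF that] unfolding eq .
  show "x(b := t, i := - x i) \<in> X" if "x(b := t) \<in> X"
   using sym[OF that] i by simp
 qed
 then have "x(i := - x i, b := t) \<in> X \<longleftrightarrow> x(b := t) \<in> X" for t
  using i by (simp add: fun_upd_twist)
 then show ?thesis
  using x i by (auto simp: steiner_def space_PiM PiE_def extensional_def)
qed

text \<open>Symmetrize one coordinate after the other: a symmetry obtained earlier survives the later
 steps.\<close>

lemma exists_reflection_invariant:
 assumes I: "finite I" and X: "X \<in> sets (PiL I)"
  and d: "!!x y. x \<in> X ==> y \<in> X ==> sqdist_on I x y <= D" and J: "J \<subseteq> I"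
 shows "\<exists>Y \<in> sets (PiL I).
  emeasure (PiL I) Y = emeasure (PiL I) X &
  (\<forall>x\<in>Y. \<forall>y\<in>Y. sqdist_on I x y <= D) & (\<forall>x\<in>Y. \<forall>i\<in>J. x(i := - x i) \<in> Y)"
 using finite_subset[OF J I] J
proof (induction J)
 case empty
 then show ?case using X d by auto
next
 case (insert b J)
 obtain Y where Y: "Y \<in> sets (PiL I)"
  "emeasure (PiL I) Y = emeasure (PiL I) X"
  "\<forall>x\<in>Y. \<forall>y\<in>Y. sqdist_on I x y <= D" "\<forall>x\<in>Y. \<forall>i\<in>J. x(i := - x i) \<in> Y"
  using insert.IH insert.prems by blast
 have b: "b \<in> I" using insert by auto
 show ?case
 proof (intro bexI[of _ "steiner I b Y"] conjI ballI)
  show "steiner I b Y \<in> sets (PiL I)" by (rule sets_steiner[OF I b Y(1)])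
  show "emeasure (PiL I) (steiner I b Y) = emeasure (PiL I) X"
   using emeasure_steiner[OF I b Y(1)] Y(2) by simp
  show "sqdist_on I x y <= D" if "x \<in> steiner I b Y" "y \<in> steiner I b Y" for x y
   using sqdist_on_steiner[OF I b _ that, of D] Y(3) by auto
  show "x(i := - x i) \<in> steiner I b Y" if "x \<in> steiner I b Y" "i \<in> insert b J" for x i
  proof (cases "i = b")
   case True then show ?thesis using steiner_reflect_same[OF b] that by auto
  next
   case False
   then have "i \<in> J" "i \<in> I" using that insert by auto
   then show ?thesis using steiner_reflect_other[of Y i I b x] Y(4) False that by auto
  qed
 qed
qed

text \<open>A set that is invariant under all coordinate reflections contains \<open>- x\<close> together with
 \<open>x\<close>, so a diameter bound \<open>d\<close> puts it into the ball of radius \<open>d /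
 2\<close>.\<close>

theorem isodiametric_inequality_pos:
 assumes I: "finite I" and X: "X \<in> sets (PiL I)"
  and D: "!!x y. x \<in> X ==> y \<in> X ==> sqdist_on I x y <= d^2" and d: "d > 0"
 shows "emeasure (PiL I) X
  <= ennreal (unit_ball_vol (real (card I)) * (d / 2) ^ card I)"
proof -
 let ?P = "PiL I"
 obtain Y where Y: "Y \<in> sets ?P" "emeasure ?P Y = emeasure ?P X"
  "\<forall>x\<in>Y. \<forall>y\<in>Y. sqdist_on I x y <= d^2" "\<forall>x\<in>Y. \<forall>i\<in>I. x(i := - x i) \<in> Y"
  using exists_reflection_invariant[OF I X, of "d^2" I] D by auto
 have flip: "(%i. if i \<in> J then - x i else x i) \<in> Y" if "x \<in> Y" "J \<subseteq> I" for x J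
  using finite_subset[OF that(2) I] that(2)
 proof (induction J)
  case empty then show ?case using that by simp
 next
  case (insert b J)
  then have "(%i. if i \<in> J then - x i else x i) \<in> Y" by auto
  then have "(%i. if i \<in> J then - x i else x i)(b := - (if b \<in> J then - x b else x b)) \<in> Y"
   using Y(4)[rule_format, of "%i. if i \<in> J then - x i else x i" b] insert by auto
  moreover have "(%i. if i \<in> J then - x i else x i)(b := - (if b \<in> J then - x b else x b))
    = (%i. if i \<in> insert b J then - x i else x i)"
   using insert by auto
  ultimately show ?case by simp
 qed
 have "Y \<subseteq> {f. sqrt (\<Sum>i\<in>I. (f i)^2) <= d / 2} \<inter> space ?P"
 proof
  fix x assume x: "x \<in> Y"
  have "sqdist_on I x (%i. if i \<in> I then - x i else x i) <= d^2"
   using Y(3) x flip[OF x, of I] by auto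
  moreover have "sqdist_on I x (%i. if i \<in> I then - x i else x i) = 4 * (\<Sum>i\<in>I. (x i)^2)"
   unfolding sqdist_on_def sum_distrib_left by (rule sum.cong) (auto simp: power2_eq_square)
  ultimately have "(\<Sum>i\<in>I. (x i)^2) <= (d / 2)^2" by (simp add: power_divide)
  then have "sqrt (\<Sum>i\<in>I. (x i)^2) <= d / 2" using d by (intro real_le_lsqrt) (auto intro: sum_nonneg)
  then show "x \<in> {f. sqrt (\<Sum>i\<in>I. (f i)^2) <= d / 2} \<inter> space ?P"
   using sets.sets_into_space[OF Y(1)] x by auto
 qed
 moreover have "{f. sqrt (\<Sum>i\<in>I. (f i)^2) <= d / 2} \<inter> space ?P \<in> sets ?P"
 proof -
  have [measurable]: "!!i. i \<in> I ==> (%f. f i) \<in> borel_measurable ?P"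
   by (simp add: measurable_component_singleton)
  have "{f \<in> space ?P. sqrt (\<Sum>i\<in>I. (f i)^2) <= d / 2} \<in> sets ?P" by measurable
  then show ?thesis by (simp add: Int_def conj_commute)
 qed
 ultimately have "emeasure ?P Y <= emeasure ?P ({f. sqrt (\<Sum>i\<in>I. (f i)^2) <= d / 2} \<inter> space ?P)"
  by (rule emeasure_mono)
 also have "... = ennreal (unit_ball_vol (real (card I)) * (d / 2) ^ card I)"
  using d by (intro emeasure_cball_aux[OF I]) auto
 finally show ?thesis using Y(2) by simp
qed

theorem isodiametric_inequality:
 assumes I: "finite I" and X: "X \<in> sets (PiL I)"
  and D: "!!x y. x \<in> X ==> y \<in> X ==> sqdist_on I x y <= d^2" and d: "d \<ge> 0"
 shows "emeasure (PiL I) X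
  <= ennreal (unit_ball_vol (real (card I)) * (d / 2) ^ card I)"
proof (rule LIMSEQ_le_const)
 show "(%n. ennreal (unit_ball_vol (real (card I)) * ((d + inverse (real (Suc n))) / 2) ^ card I))
   \<longlonglongrightarrow> ennreal (unit_ball_vol (real (card I)) * (d / 2) ^ card I)"
 proof -
  have a: "(%n. d + inverse (real (Suc n))) \<longlonglongrightarrow> d + 0"
   by (intro tendsto_add tendsto_const LIMSEQ_inverse_real_of_nat)
  have "(%n. unit_ball_vol (real (card I)) * ((d + inverse (real (Suc n))) / 2) ^ card I)
   \<longlonglongrightarrow> unit_ball_vol (real (card I)) * ((d + 0) / 2) ^ card I"
   by (intro tendsto_mult tendsto_const tendsto_power tendsto_divide a) auto
  then show ?thesis by (intro tendsto_ennrealI) simp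
 qed
 have "emeasure (PiL I) X
  <= ennreal (unit_ball_vol (real (card I)) * ((d + inverse (real (Suc n))) / 2) ^ card I)" for n
 proof (rule isodiametric_inequality_pos[OF I X])
  show "sqdist_on I x y <= (d + inverse (real (Suc n)))^2" if "x \<in> X" "y \<in> X" for x y
  proof -
   have "d^2 <= (d + inverse (real (Suc n)))^2" by (rule power_mono) (use d in simp_all)
   then show ?thesis using D[OF that] by linarith
  qed
 qed (use d in \<open>auto intro: add_nonneg_pos\<close>)
 then show "\<exists>N. \<forall>n\<ge>N. emeasure (PiL I) X
  <= ennreal (unit_ball_vol (real (card I)) * ((d + inverse (real (Suc n))) / 2) ^ card I)" by blast
qed

section \<open>Rotation invariance\<close>

lemma orthogonal_transformation_continuous:
 fixes T :: "'a::euclidean_space => 'a"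
 shows "orthogonal_transformation T ==> continuous_on UNIV T"
 by (metis linear_continuous_on linear_conv_bounded_linear orthogonal_transformation_linear)

lemma orthogonal_transformation_measurable:
 fixes T :: "'a::euclidean_space => 'a"
 shows "orthogonal_transformation T ==> T \<in> borel_measurable borel"
 by (intro borel_measurable_continuous_onI orthogonal_transformation_continuous)

lemma nn_integral_lborel_translate:
 fixes f :: "'a::euclidean_space => ennreal"
 assumes [measurable]: "borel_fun f"
 shows "(NN x. f (t + x)) = (NN x. f x)"
proof -
 have "(NN x. f x) = (\<integral>\<^sup>+x. f x \<partial>distr lborel borel ((+) t))"
  by (simp add: lborel_distr_plus)
 also have "... = (NN x. f (t + x))"
  by (subst nn_integral_distr) auto
 finally show ?thesis by simp
qed

text \<open>Multiply by the volume \<open>b\<close> of the unit ball. Fubini's theorem and translations move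
 \<open>T\<close> from \<open>f\<close> to the indicator of the ball, which \<open>T\<close> preserves.\<close>

lemma nn_integral_lborel_orthogonal:
 fixes f :: "'a::euclidean_space => ennreal" and T :: "'a => 'a"
 assumes T: "orthogonal_transformation T" and f[measurable]: "borel_fun f"
 shows "(NN x. f (T x)) = (NN x. f x)"
proof -
 have [measurable]: "borel_fun T"
  by (rule orthogonal_transformation_measurable[OF T])
 define g :: "'a => ennreal" where "g = indicator (ball 0 1)"
 have [measurable]: "borel_fun g"
  unfolding g_def by (rule borel_measurable_indicator) simp
 have gT: "g (T x) = g x" "g (- x) = g x" for x
  using T by (auto simp: g_def indicator_def orthogonal_transformation_norm)
 define b where "b = (NN x. g x)"
 have surj: "\<exists>z. T z = y" for y
  using orthogonal_transformation_surj[OF T] by (metis surjD)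
 have "(NN x. f (T x)) * b = (NN x. (NN y. f (T x) * g y))"
  by (simp add: nn_integral_cmult nn_integral_multc b_def)
 also have "... = (NN x. (NN y. f (T x) * g (- T x + y)))"
  by (intro nn_integral_cong nn_integral_lborel_translate[symmetric]) measurable
 also have "... = (NN y. (NN x. f (T x) * g (- T x + y)))"
  by (rule lborel_pair.Fubini') measurable
 also have "... = (NN y. (NN x. f (y + T x) * g x))"
 proof (rule nn_integral_cong)
  fix y :: 'a
  obtain z where z: "T z = y" using surj by blast
  have add: "T (z + x) = y + T x" for x
   using orthogonal_transformation_linear[OF T] z by (simp add: linear_add)
  have "(NN x. f (T x) * g (- T x + y)) = (NN x. f (T (z + x)) * g (- T (z + x) + y))"
   by (intro nn_integral_lborel_translate[symmetric]) measurable
  also have "... = (NN x. f (y + T x) * g x)"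
   by (simp add: add gT)
  finally show "(NN x. f (T x) * g (- T x + y)) = (NN x. f (y + T x) * g x)" .
 qed
 also have "... = (NN x. (NN y. f (y + T x) * g x))"
  by (rule lborel_pair.Fubini') measurable
 also have "... = (NN x. (NN y. f y) * g x)"
 proof (rule nn_integral_cong)
  fix x :: 'a
  have "(NN y. f (y + T x)) = (NN y. f y)"
   using nn_integral_lborel_translate[OF f, of "T x"] by (simp only: add.commute)
  then show "(NN y. f (y + T x) * g x) = (NN y. f y) * g x"
   by (subst nn_integral_multc) auto
 qed
 also have "... = (NN y. f y) * b"
  by (simp add: nn_integral_cmult b_def)
 finally have eq: "(NN x. f (T x)) * b = (NN y. f y) * b" .
 have b: "b = emeasure lborel (ball (0::'a) 1)" by (simp add: b_def g_def)
 then have "b ~= \<infinity>" using emeasure_lborel_ball_finite[of "0::'a" 1] by simp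
 moreover have "b > 0"
  unfolding b by (subst emeasure_ball) (auto intro: unit_ball_vol_pos)
 ultimately show ?thesis using eq by (auto simp: ennreal_mult_cancel_left mult.commute)
qed

lemma emeasure_lborel_orthogonal_vimage:
 fixes T :: "'a::euclidean_space => 'a"
 assumes T: "orthogonal_transformation T" and X[measurable]: "X \<in> sets borel"
 shows "emeasure lborel (T -` X) = emeasure lborel X"
proof -
 have [measurable]: "borel_fun T"
  by (rule orthogonal_transformation_measurable[OF T])
 have [measurable]: "T -` X \<in> sets borel"
  using measurable_sets[of T borel borel X] by simp
 have "(NN x. indicator X (T x)) = (NN x. indicator (T -` X) x)"
  by (intro nn_integral_cong) (simp add: indicator_def)
 then have "emeasure lborel (T -` X) = (NN x. indicator X (T x))" by simp
 also have "... = emeasure lborel X"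
  by (subst nn_integral_lborel_orthogonal[OF T]) auto
 finally show ?thesis .
qed

definition sphere_invariant :: "'a::euclidean_space measure => bool" where
 "sphere_invariant \<mu> \<longleftrightarrow> sets \<mu> = sets borel & emeasure \<mu> UNIV < \<infinity> & emeasure \<mu> (- sphere 0 1) = 0 &
   (\<forall>T B. orthogonal_transformation T --> B \<in> sets borel --> emeasure \<mu> (T -` B) = emeasure \<mu> B)"

lemma sphere_invariantD:
 assumes "sphere_invariant \<mu>"
 shows "sets \<mu> = sets borel" "space \<mu> = UNIV" "emeasure \<mu> UNIV < \<infinity>" "finite_measure \<mu>" "AE s in \<mu>. norm s = 1"
  and "!!T B. orthogonal_transformation T ==> B \<in> sets borel ==> emeasure \<mu> (T -` B) = emeasure \<mu> B"
proof -
 show s: "sets \<mu> = sets borel" "emeasure \<mu> UNIV < \<infinity>" using assms by (auto simp: sphere_invariant_def)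
 then show sp: "space \<mu> = UNIV" using sets_eq_imp_space_eq[of \<mu> borel] by simp
 then show "finite_measure \<mu>" using s by (intro finite_measureI) auto
 have "- sphere 0 1 \<in> null_sets \<mu>" using assms s by (auto simp: sphere_invariant_def null_sets_def)
 from AE_not_in[OF this] show "AE s in \<mu>. norm s = 1" by simp
qed (use assms in \<open>auto simp: sphere_invariant_def\<close>)

lemma sphere_invariant_cone_measure: "sphere_invariant (cone_measure :: 'a::euclidean_space measure)"
 unfolding sphere_invariant_def
proof (intro conjI allI impI)
 show "emeasure cone_measure (- sphere 0 1 :: 'a set) = 0"
 proof -
  have "norm (x /\<^sub>R norm x) = 1" if "x ~= 0" for x :: 'a using that by simp
  then have "cone_set 1 (- sphere 0 1) = ({} :: 'a set)" by (fastforce simp: cone_set_def)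
  then show ?thesis by (subst emeasure_cone_measure) auto
 qed
 fix T :: "'a => 'a" and B :: "'a set"
 assume T: "orthogonal_transformation T" and [measurable]: "B \<in> sets borel"
 have [measurable]: "T -` B \<in> sets borel"
  using measurable_sets[OF orthogonal_transformation_measurable[OF T], of B] by simp
 have T0: "T x = 0 \<longleftrightarrow> x = 0" for x
  using orthogonal_transformation_norm[OF T, of x] by (metis norm_eq_zero)
 have "T -` cone_set 1 B = cone_set 1 (T -` B)"
  using T by (auto simp: cone_set_def orthogonal_transformation_norm orthogonal_transformation_scaleR T0)
 then show "emeasure cone_measure (T -` B) = emeasure cone_measure B"
  using emeasure_lborel_orthogonal_vimage[OF T, of "cone_set 1 B"] by (simp add: emeasure_cone_measure)
qed (use emeasure_cone_measure_UNIV_finite[where 'a='a] in auto)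

lemma nn_integral_sphere_invariant:
 assumes \<mu>: "sphere_invariant \<mu>" and T: "orthogonal_transformation T"
  and f: "borel_fun f"
 shows "(\<integral>\<^sup>+s. f (T s) \<partial>\<mu>) = (\<integral>\<^sup>+s. f s \<partial>\<mu>)"
proof -
 note D = sphere_invariantD[OF \<mu>]
 have [measurable]: "T \<in> \<mu> \<rightarrow>\<^sub>M borel"
  using orthogonal_transformation_measurable[OF T] by (simp cong: measurable_cong_sets add: D(1))
 have "distr \<mu> borel T = \<mu>"
  by (rule measure_eqI) (auto simp: D(1,2) emeasure_distr D(6)[OF T])
 then have "(\<integral>\<^sup>+s. f s \<partial>\<mu>) = (\<integral>\<^sup>+s. f s \<partial>distr \<mu> borel T)" by simp
 also have "... = (\<integral>\<^sup>+s. f (T s) \<partial>\<mu>)"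
  using f by (subst nn_integral_distr) auto
 finally show ?thesis by simp
qed

text \<open>By invariance the integral depends on \<open>norm w\<close> only, and for the vectors
 \<open>b\<close> of an orthonormal basis the functions \<open>(b \<bullet> s)\<^sup>2\<close> add up to one on
 the sphere.\<close>

lemma nn_integral_inner_square_sphere_invariant:
 fixes \<mu> :: "(real^'n) measure"
 assumes \<mu>: "sphere_invariant \<mu>"
 shows "(\<integral>\<^sup>+s. ennreal ((w \<bullet> s)^2) \<partial>\<mu>) = ennreal ((norm w)^2 / CARD('n)) * emeasure \<mu> UNIV"
proof -
 note D = sphere_invariantD[OF \<mu>]
 note [measurable_cong] = D(1)
 define q where "q = (%w. \<integral>\<^sup>+s. ennreal ((w \<bullet> s)^2) \<partial>\<mu>)"
 have meas: "borel_fun (%s. ennreal ((w \<bullet> s)^2))" for w :: "real^'n" by measurable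
 have qeq: "q w = q v" if vw: "norm w = norm v" for v w
 proof -
  obtain T where T: "orthogonal_transformation T" "T w = v"
   using orthogonal_transformation_exists[OF vw] by blast
  have "q w = (\<integral>\<^sup>+s. ennreal ((v \<bullet> T s)^2) \<partial>\<mu>)"
   unfolding q_def using T by (auto simp: orthogonal_transformation_def)
  also have "... = q v"
   unfolding q_def by (rule nn_integral_sphere_invariant[OF \<mu> T(1) meas])
  finally show ?thesis .
 qed
 define q1 where "q1 = q (SOME b. b \<in> Basis)"
 have q1: "q b = q1" if "b \<in> Basis" for b
 proof -
  have "(SOME b. b \<in> Basis) \<in> (Basis :: (real^'n) set)" by (rule someI_ex) (rule ex_in_conv[THEN iffD2], simp)
  then show ?thesis using that unfolding q1_def by (intro qeq) auto
 qed
 have "of_nat CARD('n) * q1 = (\<Sum>b\<in>(Basis :: (real^'n) set). q b)"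
  by (simp add: q1)
 also have "... = (\<integral>\<^sup>+s. (\<Sum>b\<in>Basis. ennreal ((b \<bullet> s)^2)) \<partial>\<mu>)"
  unfolding q_def by (intro nn_integral_sum[symmetric]) measurable
 also have "... = (\<integral>\<^sup>+s. 1 \<partial>\<mu>)"
  using D(5)
 proof (intro nn_integral_cong_AE, eventually_elim)
  case (elim s)
  have "(\<Sum>b\<in>Basis. (b \<bullet> s)^2) = (norm s)^2"
   unfolding power2_norm_eq_inner by (subst (2) euclidean_inner) (simp add: power2_eq_square inner_commute)
  then show ?case using elim by (simp add: sum_ennreal)
 qed
 also have "... = emeasure \<mu> UNIV" using D(2) by simp
 finally have N: "of_nat CARD('n) * q1 = emeasure \<mu> UNIV" .
 have "q1 = ennreal (1 / CARD('n)) * (of_nat CARD('n) * q1)"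
 proof -
  have "ennreal (1 / CARD('n)) * of_nat CARD('n) = ennreal (1 / CARD('n) * CARD('n))"
   unfolding ennreal_of_nat_eq_real_of_nat by (intro ennreal_mult[symmetric]) auto
  then show ?thesis by (simp add: mult.assoc[symmetric])
 qed
 then have q1': "q1 = ennreal (1 / CARD('n)) * emeasure \<mu> UNIV" by (simp add: N)
 obtain b :: "real^'n" where b: "b \<in> Basis" using nonempty_Basis by blast
 have "q w = q (norm w *\<^sub>R b)" using b by (intro qeq) simp
 also have "... = (\<integral>\<^sup>+s. ennreal ((norm w)^2) * ennreal ((b \<bullet> s)^2) \<partial>\<mu>)"
  unfolding q_def by (intro nn_integral_cong) (simp add: power_mult_distrib ennreal_mult)
 also have "... = ennreal ((norm w)^2) * q b"
  unfolding q_def by (rule nn_integral_cmult) measurable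
 also have "... = ennreal ((norm w)^2 / CARD('n)) * emeasure \<mu> UNIV"
  by (simp add: q1[OF b] q1' mult.assoc[symmetric] ennreal_mult[symmetric])
 finally show ?thesis by (simp add: q_def)
qed

lemma sphere_invariant_cap_const:
 fixes \<mu> :: "(real^'n) measure"
 assumes \<mu>: "sphere_invariant \<mu>" and xy: "norm x = norm y"
 shows "emeasure \<mu> (cball x r) = emeasure \<mu> (cball y r)"
proof -
 obtain T where T: "orthogonal_transformation T" "T x = y"
  using orthogonal_transformation_exists[OF xy] by blast
 have "dist y (T s) = dist x s" for s
  using T orthogonal_transformation_norm[OF T(1), of "x - s"] orthogonal_transformation_linear[OF T(1)]
  by (simp add: dist_norm linear_diff)
 then have "T -` cball y r = cball x r" by auto
 then show ?thesis using sphere_invariantD(6)[OF \<mu> T(1), of "cball y r"] by simp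
qed

text \<open>Integrate the indicator of the pairs of points at distance at most \<open>r\<close> in both
 orders: by the previous lemma each inner integral is constant on the sphere.\<close>

lemma sphere_invariant_cap_proportional:
 fixes \<mu> \<nu> :: "(real^'n) measure"
 assumes \<mu>: "sphere_invariant \<mu>" and \<nu>: "sphere_invariant \<nu>" and e: "norm e = 1"
 shows "emeasure \<mu> (cball e r) * emeasure \<nu> UNIV = emeasure \<nu> (cball e r) * emeasure \<mu> UNIV"
proof -
 interpret M: finite_measure \<mu> by (rule sphere_invariantD(4)[OF \<mu>])
 interpret N: finite_measure \<nu> by (rule sphere_invariantD(4)[OF \<nu>])
 interpret P: pair_sigma_finite \<mu> \<nu> ..
 note [measurable_cong] = sphere_invariantD(1)[OF \<mu>] sphere_invariantD(1)[OF \<nu>]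
 have 1: "(\<integral>\<^sup>+x. indicator {x. dist x y <= r} x \<partial>\<mu>) = emeasure \<mu> (cball e r)" if "norm y = 1" for y
 proof -
  have "{x. dist x y <= r} = cball y r" by (auto simp: dist_commute)
  then show ?thesis using sphere_invariant_cap_const[OF \<mu>, of y e r] that e
   by (simp add: sphere_invariantD(1)[OF \<mu>])
 qed
 have 2: "(\<integral>\<^sup>+y. indicator {y. dist x y <= r} y \<partial>\<nu>) = emeasure \<nu> (cball e r)" if "norm x = 1" for x
 proof -
  have "{y. dist x y <= r} = cball x r" by auto
  then show ?thesis using sphere_invariant_cap_const[OF \<nu>, of x e r] that e
   by (simp add: sphere_invariantD(1)[OF \<nu>])
 qed
 have "emeasure \<mu> (cball e r) * emeasure \<nu> UNIV = (\<integral>\<^sup>+y. emeasure \<mu> (cball e r) \<partial>\<nu>)"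
  using sphere_invariantD(2)[OF \<nu>] by simp
 also have "... = (\<integral>\<^sup>+y. (\<integral>\<^sup>+x. indicator {z. dist (fst z) (snd z) <= r} (x, y) \<partial>\<mu>) \<partial>\<nu>)"
  using sphere_invariantD(5)[OF \<nu>]
  by (intro nn_integral_cong_AE, eventually_elim) (subst 1[symmetric], auto simp: indicator_def intro!: nn_integral_cong)
 also have "... = (\<integral>\<^sup>+x. (\<integral>\<^sup>+y. indicator {z. dist (fst z) (snd z) <= r} (x, y) \<partial>\<nu>) \<partial>\<mu>)"
  by (rule P.Fubini') measurable
 also have "... = (\<integral>\<^sup>+x. emeasure \<nu> (cball e r) \<partial>\<mu>)"
  using sphere_invariantD(5)[OF \<mu>]
  by (intro nn_integral_cong_AE, eventually_elim) (subst 2[symmetric], auto simp: indicator_def intro!: nn_integral_cong)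
 also have "... = emeasure \<nu> (cball e r) * emeasure \<mu> UNIV"
  using sphere_invariantD(2)[OF \<mu>] by simp
 finally show ?thesis .
qed

section \<open>Slicing cones by hyperplanes\<close>

text \<open>The point of the coordinate hyperplane with given coordinates. It transports the isodiametric
 inequality, which lives on a product of lines, to hyperplanes of a Euclidean space.\<close>

definition hyper_emb :: "'a::euclidean_space set => ('a => real) => 'a" where
 "hyper_emb I x = (\<Sum>b\<in>I. x b *\<^sub>R b)"

lemma inner_hyper_emb:
 assumes "I \<subseteq> Basis" "b \<in> Basis"
 shows "hyper_emb I x \<bullet> b = (if b \<in> I then x b else 0)"
proof -
 have "finite I" using assms finite_subset finite_Basis by blast
 have "hyper_emb I x \<bullet> b = (\<Sum>c\<in>I. x c * (c \<bullet> b))"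
  by (simp add: hyper_emb_def inner_sum_left)
 also have "... = (\<Sum>c\<in>I. if c = b then x c else 0)"
  using assms by (intro sum.cong) (auto simp: inner_Basis)
 finally show ?thesis using \<open>finite I\<close> by simp
qed

lemma norm_hyper_emb:
 assumes I: "I \<subseteq> Basis"
 shows "(norm (hyper_emb I x))^2 = (\<Sum>b\<in>I. (x b)^2)"
proof -
 have "(norm (hyper_emb I x))^2 = (\<Sum>b\<in>Basis. (hyper_emb I x \<bullet> b)^2)"
  unfolding power2_norm_eq_inner by (subst euclidean_inner) (simp add: power2_eq_square)
 also have "... = (\<Sum>b\<in>I. (x b)^2)"
  by (rule sum.mono_neutral_cong_right) (use I in \<open>auto simp: inner_hyper_emb[OF I] subset_iff\<close>)
 finally show ?thesis .
qed

lemma hyper_emb_diff: "hyper_emb I x - hyper_emb I y = hyper_emb I (%b. x b - y b)"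
 by (simp add: hyper_emb_def scaleR_diff_left sum_subtractf)

lemma hyper_emb_divide: "hyper_emb I (\<lambda>b\<in>I. x b / c) = hyper_emb I x /\<^sub>R c"
 unfolding hyper_emb_def scaleR_sum_right by (rule sum.cong) (auto simp: divide_inverse mult.commute)

lemma measurable_hyper_emb [measurable]:
 "hyper_emb I \<in> borel_measurable (PiL I)"
proof -
 have "(%x. x b *\<^sub>R b) \<in> borel_measurable (PiL I)" if "b \<in> I" for b
 proof (rule borel_measurable_scaleR)
  show "(%x. x b) \<in> borel_measurable (PiL I)"
   using measurable_component_singleton[OF that, of "%_. lborel :: real measure"] by simp
 qed simp
 then show ?thesis unfolding hyper_emb_def[abs_def] by (rule borel_measurable_sum)
qed

lemma emeasure_lborel_slices:
 fixes W :: "'a::euclidean_space set"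
 assumes e: "e \<in> Basis" and W[measurable]: "W \<in> sets borel"
 shows "emeasure lborel W = (NN s. emeasure (PiL (Basis - {e}))
  {x \<in> space (PiL (Basis - {e})). hyper_emb (Basis - {e}) x + s *\<^sub>R e \<in> W})"
proof -
 interpret product_sigma_finite "%_::'a. lborel :: real measure"
  by standard
 define I where "I = Basis - {e}"
 have I: "finite I" "e \<notin> I" "insert e I = Basis" using e by (auto simp: I_def)
 have [measurable]: "hyper_emb Basis \<in> borel_measurable (PiL (insert e I))"
  unfolding I(3) by measurable
 have "emeasure lborel W = (NN p. indicator W p)" by simp
 also have "... = (\<integral>\<^sup>+x. indicator W (hyper_emb Basis x) \<partial>PiL (insert e I))"
 proof -
  have L: "(lborel :: 'a measure) = distr (PiL Basis) borel (hyper_emb Basis)"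
   unfolding hyper_emb_def[abs_def] by (rule lborel_eq)
  show ?thesis unfolding I(3) by (subst L, rule nn_integral_distr) auto
 qed
 also have "... = (NN s. (\<integral>\<^sup>+x. indicator W (hyper_emb Basis (x(e := s))) \<partial>PiL I))"
  using I by (intro product_nn_integral_insert_rev) auto
 also have "... = (NN s. emeasure (PiL I)
  {x \<in> space (PiL I). hyper_emb I x + s *\<^sub>R e \<in> W})"
 proof (rule nn_integral_cong)
  fix s :: real
  have eq: "hyper_emb Basis (x(e := s)) = hyper_emb I x + s *\<^sub>R e" for x
   unfolding hyper_emb_def I(3)[symmetric] using I(1,2)
   by (simp add: add.commute) (rule sum.cong, auto)
  have "(\<integral>\<^sup>+x. indicator W (hyper_emb Basis (x(e := s))) \<partial>PiL I)
   = (\<integral>\<^sup>+x. indicator {x \<in> space (PiL I). hyper_emb I x + s *\<^sub>R e \<in> W} x \<partial>PiL I)"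
   by (intro nn_integral_cong) (auto simp: eq indicator_def)
  also have "... = emeasure (PiL I) {x \<in> space (PiL I). hyper_emb I x + s *\<^sub>R e \<in> W}"
   by (intro nn_integral_indicator) measurable
  finally show "(\<integral>\<^sup>+x. indicator W (hyper_emb Basis (x(e := s))) \<partial>PiL I)
   = emeasure (PiL I) {x \<in> space (PiL I). hyper_emb I x + s *\<^sub>R e \<in> W}" .
 qed
 finally show ?thesis by (simp add: I_def)
qed

lemma emeasure_lborel_divide:
 fixes A :: "real set"
 assumes c: "c > 0" and [measurable]: "A \<in> sets borel"
 shows "emeasure lborel {t. t / c \<in> A} = ennreal c * emeasure lborel A"
proof -
 have [measurable]: "{t. t / c \<in> A} \<in> sets borel" by measurable
 have "emeasure lborel {t. t / c \<in> A} = (NN t. indicator {t. t / c \<in> A} t)" by simp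
 also have "... = ennreal \<bar>c\<bar> * (NN t. indicator {t. t / c \<in> A} (0 + c * t))"
  using c by (intro nn_integral_real_affine) auto
 also have "(NN t. indicator {t. t / c \<in> A} (0 + c * t)) = (NN t. indicator A t)"
  using c by (intro nn_integral_cong) (auto simp: indicator_def)
 finally show ?thesis using c by simp
qed

lemma measurable_divide_PiM:
 "(%x. \<lambda>i\<in>I. x i / c) \<in> PiL I \<rightarrow>\<^sub>M PiL I"
proof (rule measurable_restrict)
 fix i assume "i \<in> I"
 have [measurable]: "(%x. x i) \<in> borel_measurable (PiL I)"
  using measurable_component_singleton[OF \<open>i \<in> I\<close>, of "%_. lborel :: real measure"] by simp
 show "(%x. x i / c) \<in> PiL I \<rightarrow>\<^sub>M lborel" by simp
qed

lemma emeasure_PiM_divide: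
 fixes I :: "'i set"
 assumes I: "finite I" and c: "c > 0" and X: "X \<in> sets (PiL I)"
 shows "emeasure (PiL I) {x \<in> space (PiL I). (\<lambda>i\<in>I. x i / c) \<in> X}
  = ennreal (c ^ card I) * emeasure (PiL I) X"
proof -
 interpret product_sigma_finite "%_::'i. lborel :: real measure"
  by standard
 let ?P = "PiL I"
 define Q where "Q = distr ?P ?P (%x. \<lambda>i\<in>I. x i / c)"
 have Q: "emeasure Q Y = emeasure ?P {x \<in> space ?P. (\<lambda>i\<in>I. x i / c) \<in> Y}" if "Y \<in> sets ?P" for Y
  unfolding Q_def using that
  by (subst emeasure_distr[OF measurable_divide_PiM]) (auto intro!: arg_cong[where f="emeasure ?P"])
 have cc: "ennreal (1 / c ^ card I) * ennreal (c ^ card I) = 1"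
  using c by (simp add: ennreal_mult[symmetric])
 have "scale_measure (ennreal (1 / c ^ card I)) Q = ?P"
 proof (rule PiM_eqI[OF I])
  fix A :: "'i => real set" assume A: "!!i. i \<in> I ==> A i \<in> sets lborel"
  have "emeasure Q (Pi\<^sub>E I A) = emeasure ?P {x \<in> space ?P. (\<lambda>i\<in>I. x i / c) \<in> Pi\<^sub>E I A}"
   using A I by (intro Q sets_PiM_I_finite) auto
  also have "{x \<in> space ?P. (\<lambda>i\<in>I. x i / c) \<in> Pi\<^sub>E I A} = Pi\<^sub>E I (%i. {t. t / c \<in> A i})"
   by (auto simp: space_PiM PiE_iff extensional_def)
  also have "emeasure ?P ... = (\<Prod>i\<in>I. emeasure lborel {t. t / c \<in> A i})"
  proof (rule emeasure_PiM[OF I])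
   fix i assume "i \<in> I"
   then have [measurable]: "A i \<in> sets borel" using A by simp
   have "{t. t / c \<in> A i} \<in> sets borel" by measurable
   then show "{t. t / c \<in> A i} \<in> sets lborel" by simp
  qed
  also have "... = (\<Prod>i\<in>I. ennreal c * emeasure lborel (A i))"
   using A c by (intro prod.cong) (auto intro!: emeasure_lborel_divide)
  also have "... = ennreal (c ^ card I) * (\<Prod>i\<in>I. emeasure lborel (A i))"
   using c by (simp add: prod.distrib ennreal_power)
  finally show "emeasure (scale_measure (ennreal (1 / c ^ card I)) Q) (Pi\<^sub>E I A) = (\<Prod>i\<in>I. emeasure lborel (A i))"
   by (simp add: mult.assoc[symmetric] cc)
 qed (simp add: Q_def)
 then have "emeasure ?P X = ennreal (1 / c ^ card I) * emeasure Q X"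
  by (metis emeasure_scale_measure)
 then have "ennreal (c ^ card I) * emeasure ?P X = (ennreal (1 / c ^ card I) * ennreal (c ^ card I)) * emeasure Q X"
  by (simp add: mult_ac)
 then show ?thesis using Q[OF X] cc by simp
qed

lemma nn_integral_power_upto:
 assumes "n > 0" "a > 0"
 shows "(NN s. ennreal (s ^ (n - 1)) * indicator {0<..a} s) = ennreal (a ^ n / n)"
proof -
 have "(NN s. ennreal (s ^ (n - 1)) * indicator {0<..a} s) = emeasure (radial_measure n) {..a}"
  unfolding radial_measure_def
  by (subst emeasure_density) (auto intro!: nn_integral_cong simp: indicator_def)
 then show ?thesis using assms by (simp add: emeasure_radial_measure_atMost)
qed

lemma card_Basis_minus: "e \<in> Basis ==> card ((Basis :: 'a::euclidean_space set) - {e}) = DIM('a) - 1"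
 by (simp add: card_Diff_singleton)

lemma sets_gnomonic:
 fixes C :: "'a::euclidean_space set"
 assumes [measurable]: "C \<in> sets borel"
 shows "{x \<in> space (PiL I). (hyper_emb I x + e) /\<^sub>R norm (hyper_emb I x + e) \<in> C}
  \<in> sets (PiL I)"
proof -
 have [measurable]: "(%x. (hyper_emb I x + e) /\<^sub>R norm (hyper_emb I x + e)) \<in> borel_measurable (PiL I)"
  by (rule measurable_compose[OF _ measurable_direction]) measurable
 show ?thesis by measurable
qed

text \<open>The cone over a set of directions in the half space of the pole \<open>e\<close> sits inside the cone
 over its central projection to the tangent hyperplane at \<open>e\<close>, and the slice at height \<open>s\<close> is
 scaled by \<open>s\<close>.\<close>

lemma cone_measure_le_gnomonic:
 fixes C :: "'a::euclidean_space set"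
 assumes e: "e \<in> Basis" and C[measurable]: "C \<in> sets borel" and pos: "!!c. c \<in> C ==> c \<bullet> e > 0"
 shows "emeasure cone_measure C <= emeasure (PiL (Basis - {e}))
  {x \<in> space (PiL (Basis - {e})).
    (hyper_emb (Basis - {e}) x + e) /\<^sub>R norm (hyper_emb (Basis - {e}) x + e) \<in> C}"
proof -
 define I where "I = Basis - {e}"
 let ?P = "PiL I"
 define G where "G = {x \<in> space ?P. (hyper_emb I x + e) /\<^sub>R norm (hyper_emb I x + e) \<in> C}"
 have I: "finite I" "I \<subseteq> Basis" "card I = DIM('a) - 1"
  using e by (auto simp: I_def card_Basis_minus)
 have G: "G \<in> sets ?P" unfolding G_def by (rule sets_gnomonic[OF C])
 have slice: "{x \<in> space ?P. hyper_emb I x + s *\<^sub>R e \<in> cone_set 1 C}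
   \<subseteq> (if 0 < s & s <= 1 then {x \<in> space ?P. (\<lambda>i\<in>I. x i / s) \<in> G} else {})" (is "?L \<subseteq> ?R") for s
 proof
  fix x assume x: "x \<in> ?L"
  define p where "p = hyper_emb I x + s *\<^sub>R e"
  have p: "p ~= 0" "norm p <= 1" "p /\<^sub>R norm p \<in> C" using x by (auto simp: p_def cone_set_def)
  have "hyper_emb I x \<bullet> e = 0" using inner_hyper_emb[OF I(2) e, of x] by (simp add: I_def)
  then have pe: "p \<bullet> e = s" using e by (simp add: p_def inner_add_left)
  have "0 < (p /\<^sub>R norm p) \<bullet> e" by (rule pos[OF p(3)])
  then have s0: "0 < s" using p(1) pe by (simp add: zero_less_mult_iff)
  have "s <= norm p * norm e" using norm_cauchy_schwarz[of p e] pe by simp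
  then have s1: "s <= 1" using e p(2) by simp
  have "hyper_emb I (\<lambda>i\<in>I. x i / s) + e = p /\<^sub>R s"
   using s0 by (simp add: hyper_emb_divide p_def scaleR_add_right)
  moreover have "(p /\<^sub>R s) /\<^sub>R norm (p /\<^sub>R s) = p /\<^sub>R norm p"
   using s0 by simp
  ultimately have "(hyper_emb I (\<lambda>i\<in>I. x i / s) + e) /\<^sub>R norm (hyper_emb I (\<lambda>i\<in>I. x i / s) + e) \<in> C"
   using p(3) by (simp only:)
  then have "(\<lambda>i\<in>I. x i / s) \<in> G" by (simp add: G_def space_PiM)
  then show "x \<in> ?R" using x s0 s1 by auto
 qed
 have "emeasure lborel (cone_set 1 C) = (NN s. emeasure ?P {x \<in> space ?P. hyper_emb I x + s *\<^sub>R e \<in> cone_set 1 C})"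
  unfolding I_def by (rule emeasure_lborel_slices[OF e]) measurable
 also have "... <= (NN s. emeasure ?P G * (ennreal (s ^ (DIM('a) - 1)) * indicator {0<..1} s))"
 proof (rule nn_integral_mono)
  fix s :: real
  show "emeasure ?P {x \<in> space ?P. hyper_emb I x + s *\<^sub>R e \<in> cone_set 1 C}
   <= emeasure ?P G * (ennreal (s ^ (DIM('a) - 1)) * indicator {0<..1} s)"
  proof (cases "0 < s & s <= 1")
   case True
   have "emeasure ?P {x \<in> space ?P. hyper_emb I x + s *\<^sub>R e \<in> cone_set 1 C}
    <= emeasure ?P {x \<in> space ?P. (\<lambda>i\<in>I. x i / s) \<in> G}"
    using slice[of s] True measurable_sets[OF measurable_divide_PiM G, of s]
    by (intro emeasure_mono) (auto simp: vimage_def Int_def conj_commute)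
   then show ?thesis
    using True emeasure_PiM_divide[OF I(1) _ G, of s] by (simp add: I(3) mult.commute)
  next
   case False
   then have "{x \<in> space ?P. hyper_emb I x + s *\<^sub>R e \<in> cone_set 1 C} = {}"
    using slice[of s] by (simp only: if_False subset_empty)
   then show ?thesis by (simp only: emeasure_empty zero_le)
  qed
 qed
 also have "... = emeasure ?P G * ennreal (1 / DIM('a))"
  using nn_integral_power_upto[of "DIM('a)" 1] by (subst nn_integral_cmult) auto
 finally have "of_nat DIM('a) * emeasure lborel (cone_set 1 C) <= of_nat DIM('a) * (emeasure ?P G * ennreal (1 / DIM('a)))"
  by (rule mult_left_mono) simp
 also have "... = emeasure ?P G"
 proof -
  have "of_nat DIM('a) * ennreal (1 / DIM('a)) = ennreal (real DIM('a) * (1 / DIM('a)))"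
   unfolding ennreal_of_nat_eq_real_of_nat by (intro ennreal_mult[symmetric]) auto
  then have "of_nat DIM('a) * ennreal (1 / DIM('a)) = 1" by simp
  moreover have "of_nat DIM('a) * (emeasure ?P G * ennreal (1 / DIM('a))) = (of_nat DIM('a) * ennreal (1 / DIM('a))) * emeasure ?P G"
   by (simp only: mult_ac)
  ultimately show ?thesis by (simp only: mult_1)
 qed
 finally show ?thesis by (simp add: emeasure_cone_measure G_def I_def)
qed

lemma dist_unit_vectors:
 fixes x y :: "'a::real_inner"
 assumes "norm x = 1" "norm y = 1"
 shows "(dist x y)^2 = 2 - 2 * (x \<bullet> y)"
 using assms by (simp add: dist_norm power2_norm_eq_inner inner_diff inner_commute norm_eq_1)

text \<open>Near the pole \<open>e\<close> the projection to the tangent hyperplane is almost an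
 isometry.\<close>

lemma dist_central_projection:
 fixes e c c' :: "'a::real_inner"
 assumes e: "norm e = 1" and c: "norm c = 1" "dist c e <= \<delta>" and c': "norm c' = 1" "dist c' e <= \<delta>"
  and \<delta>: "0 <= \<delta>" "\<delta> < 1"
 shows "dist (c /\<^sub>R (c \<bullet> e)) (c' /\<^sub>R (c' \<bullet> e)) <= dist c c' / (1 - \<delta>)^2"
  and "c \<bullet> e > 0"
proof -
 have inn: "x \<bullet> e = 1 - (dist x e)^2 / 2" if "norm x = 1" for x
  using dist_unit_vectors[OF that e] by (simp add: field_simps)
 have low: "x \<bullet> e \<ge> 1 - \<delta>" if "norm x = 1" "dist x e <= \<delta>" for x
 proof -
  have "(dist x e)^2 <= \<delta>^2" using that(2) by (intro power_mono) auto
  also have "\<delta>^2 <= \<delta> * 1" unfolding power2_eq_square using \<delta> by (intro mult_left_mono) auto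
  finally show ?thesis using inn[OF that(1)] \<delta> by simp
 qed
 define a a' where "a = c \<bullet> e" and "a' = c' \<bullet> e"
 have a: "a \<ge> 1 - \<delta>" "a' \<ge> 1 - \<delta>" "a > 0" "a' > 0"
  using low[OF c] low[OF c'] \<delta> by (auto simp: a_def a'_def)
 show "c \<bullet> e > 0" using a by (simp add: a_def)
 have "\<bar>a - a'\<bar> <= dist c c' * \<delta>"
 proof -
  define X where "X = (c' - c) \<bullet> ((c - e) + (c' - e))"
  have aX: "a - a' = X / 2"
   unfolding a_def a'_def X_def using c c' by (simp add: inner_diff inner_add inner_commute norm_eq_1)
  have "2 * \<bar>a - a'\<bar> = \<bar>X\<bar>" unfolding aX by simp
  also have "\<bar>X\<bar> <= norm (c' - c) * norm ((c - e) + (c' - e))"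
   unfolding X_def by (rule Cauchy_Schwarz_ineq2)
  also have "... <= norm (c' - c) * (2 * \<delta>)"
   using norm_triangle_ineq[of "c - e" "c' - e"] c(2) c'(2)
   by (intro mult_left_mono) (auto simp: dist_norm)
  finally show ?thesis by (simp add: dist_norm norm_minus_commute)
 qed
 have "(a' - a) / (a * a') = inverse a - inverse a'"
  using a by (simp add: field_simps)
 then have "c /\<^sub>R a - c' /\<^sub>R a' = (c - c') /\<^sub>R a + ((a' - a) / (a * a')) *\<^sub>R c'"
  by (simp add: scaleR_diff_left scaleR_diff_right)
 then have "dist (c /\<^sub>R a) (c' /\<^sub>R a') <= norm ((c - c') /\<^sub>R a) + norm (((a' - a) / (a * a')) *\<^sub>R c')"
  unfolding dist_norm by (metis norm_triangle_ineq)
 also have "... = dist c c' / a + \<bar>a - a'\<bar> / (a * a')"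
  using a c' by (simp add: dist_norm divide_inverse mult.commute abs_mult abs_minus_commute)
 also have "... <= dist c c' / (1 - \<delta>) + (dist c c' * \<delta>) / ((1 - \<delta>) * (1 - \<delta>))"
  using a \<delta> \<open>\<bar>a - a'\<bar> <= dist c c' * \<delta>\<close> by (intro add_mono frac_le mult_mono) auto
 also have "... = dist c c' / (1 - \<delta>)^2"
 proof -
  define t where "t = 1 - \<delta>"
  have "t ~= 0" "\<delta> = 1 - t" using \<delta> by (auto simp: t_def)
  then show ?thesis unfolding t_def[symmetric]
   by (simp add: field_simps power2_eq_square) (simp add: distrib_right[symmetric])
 qed
 finally show "dist (c /\<^sub>R (c \<bullet> e)) (c' /\<^sub>R (c' \<bullet> e)) <= dist c c' / (1 - \<delta>)^2"
  by (simp add: a_def a'_def)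
qed

text \<open>Project centrally to the tangent hyperplane and apply the isodiametric inequality there.\<close>

lemma cone_measure_le_diam_pole:
 fixes C :: "'a::euclidean_space set"
 assumes e: "e \<in> Basis" and C: "C \<in> sets borel" "C \<subseteq> sphere 0 1"
  and near: "!!c. c \<in> C ==> dist c e <= \<delta>" and d: "!!c c'. c \<in> C ==> c' \<in> C ==> dist c c' <= d"
  and \<delta>: "0 <= \<delta>" "\<delta> < 1" and d0: "0 <= d"
 shows "emeasure cone_measure C <= ennreal (unit_ball_vol (real (DIM('a) - 1)) * (d / (1 - \<delta>)^2 / 2) ^ (DIM('a) - 1))"
proof -
 define I where "I = Basis - {e}"
 let ?P = "PiL I"
 define G where "G = {x \<in> space ?P. (hyper_emb I x + e) /\<^sub>R norm (hyper_emb I x + e) \<in> C}"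
 have I: "finite I" "I \<subseteq> Basis" "card I = DIM('a) - 1"
  using e by (auto simp: I_def card_Basis_minus)
 have e1: "norm e = 1" using e by simp
 have C1: "norm c = 1" if "c \<in> C" for c using that C(2) by auto
 have proj: "hyper_emb I x + e = c /\<^sub>R (c \<bullet> e)" if "c = (hyper_emb I x + e) /\<^sub>R norm (hyper_emb I x + e)" "c \<in> C" for x c
 proof -
  have "hyper_emb I x \<bullet> e = 0" using inner_hyper_emb[OF I(2) e, of x] by (simp add: I_def)
  then have "(hyper_emb I x + e) \<bullet> e = 1" using e by (simp add: inner_add_left)
  then have "c \<bullet> e = inverse (norm (hyper_emb I x + e))" by (simp add: that(1))
  moreover have "hyper_emb I x + e ~= 0" using \<open>(hyper_emb I x + e) \<bullet> e = 1\<close> by auto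
  ultimately show ?thesis by (simp add: that(1))
 qed
 have "emeasure cone_measure C <= emeasure ?P G"
  unfolding G_def I_def
  by (rule cone_measure_le_gnomonic[OF e C(1)]) (rule dist_central_projection(2)[OF e1 C1 near C1 near \<delta>])
 also have "... <= ennreal (unit_ball_vol (real (card I)) * (d / (1 - \<delta>)^2 / 2) ^ card I)"
 proof (rule isodiametric_inequality[OF I(1)])
  show "G \<in> sets ?P" unfolding G_def by (rule sets_gnomonic[OF C(1)])
  show "0 <= d / (1 - \<delta>)^2" using d0 by simp
  fix x y assume xy: "x \<in> G" "y \<in> G"
  define c c' where "c = (hyper_emb I x + e) /\<^sub>R norm (hyper_emb I x + e)"
   and "c' = (hyper_emb I y + e) /\<^sub>R norm (hyper_emb I y + e)"
  have cC: "c \<in> C" "c' \<in> C" using xy by (auto simp: G_def c_def c'_def)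
  have "sqdist_on I x y = (norm (hyper_emb I x - hyper_emb I y))^2"
   by (simp add: hyper_emb_diff norm_hyper_emb[OF I(2)] sqdist_on_def)
  also have "... = (dist (hyper_emb I x + e) (hyper_emb I y + e))^2" by (simp add: dist_norm)
  also have "... = (dist (c /\<^sub>R (c \<bullet> e)) (c' /\<^sub>R (c' \<bullet> e)))^2"
   using proj[OF c_def cC(1)] proj[OF c'_def cC(2)] by simp
  also have "... <= (d / (1 - \<delta>)^2)^2"
  proof (rule power_mono)
   have "dist (c /\<^sub>R (c \<bullet> e)) (c' /\<^sub>R (c' \<bullet> e)) <= dist c c' / (1 - \<delta>)^2"
    by (rule dist_central_projection(1)[OF e1 C1 near C1 near \<delta>]) (use cC in auto)
   also have "... <= d / (1 - \<delta>)^2" by (intro divide_right_mono d cC) simp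
   finally show "dist (c /\<^sub>R (c \<bullet> e)) (c' /\<^sub>R (c' \<bullet> e)) <= d / (1 - \<delta>)^2" .
  qed simp
  finally show "sqdist_on I x y <= (d / (1 - \<delta>)^2)^2" .
 qed
 finally show ?thesis by (simp add: I(3))
qed

text \<open>The cap contains all directions to the disc of radius \<open>r\<close> in the tangent hyperplane,
 and the cone over this disc up to height \<open>1 / sqrt (1 + r\<^sup>2)\<close> lies in the unit
 ball.\<close>

lemma cone_measure_cap_ge_pole:
 fixes e :: "'a::euclidean_space"
 assumes e: "e \<in> Basis" and r: "r > 0"
 shows "ennreal (unit_ball_vol (real (DIM('a) - 1)) * r ^ (DIM('a) - 1) / sqrt (1 + r^2) ^ DIM('a))
  <= emeasure cone_measure (cball e r)"
proof -
 define I where "I = Basis - {e}"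
 let ?P = "PiL I"
 define w where "w = unit_ball_vol (real (DIM('a) - 1)) * r ^ (DIM('a) - 1)"
 define q where "q = 1 / sqrt (1 + r^2)"
 have r1: "1 + r^2 > 0" by (simp add: add_pos_nonneg)
 then have q: "q > 0" by (simp add: q_def)
 have w: "w \<ge> 0" using r by (simp add: w_def)
 have I: "finite I" "I \<subseteq> Basis" "card I = DIM('a) - 1"
  using e by (auto simp: I_def card_Basis_minus)
 define G where "G = {f. sqrt (\<Sum>i\<in>I. (f i)^2) <= r} \<inter> space ?P"
 have G: "G \<in> sets ?P"
 proof -
  have [measurable]: "!!i. i \<in> I ==> (%f. f i) \<in> borel_measurable ?P"
   by (simp add: measurable_component_singleton)
  have "{f \<in> space ?P. sqrt (\<Sum>i\<in>I. (f i)^2) <= r} \<in> sets ?P" by measurable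
  then show ?thesis by (simp add: Int_def conj_commute G_def)
 qed
 have Gw: "emeasure ?P G = ennreal w"
  unfolding G_def w_def using emeasure_cball_aux[OF I(1) r] by (simp add: I(3))
 have slice: "{x \<in> space ?P. (\<lambda>i\<in>I. x i / s) \<in> G} \<subseteq> {x \<in> space ?P. hyper_emb I x + s *\<^sub>R e \<in> cone_set 1 (cball e r)}"
  if s: "0 < s" "s <= q" for s
 proof (clarsimp)
  fix x assume x: "x \<in> space ?P" "(\<lambda>i\<in>I. x i / s) \<in> G"
  define y where "y = hyper_emb I (\<lambda>i\<in>I. x i / s)"
  define m where "m = (norm y)^2"
  have "sqrt (\<Sum>i\<in>I. ((\<lambda>i\<in>I. x i / s) i)^2) <= r" using x(2) by (simp add: G_def)
  then have yr: "norm y <= r"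
   using norm_hyper_emb[OF I(2), of "\<lambda>i\<in>I. x i / s"] by (simp add: y_def real_le_rsqrt flip: real_sqrt_unique)
    (metis norm_ge_zero real_sqrt_unique)
  then have mr: "m <= r^2" unfolding m_def by (intro power_mono) auto
  have m0: "m \<ge> 0" by (simp add: m_def)
  have ye: "y \<bullet> e = 0" unfolding y_def using inner_hyper_emb[OF I(2) e] by (simp add: I_def)
  have n2: "(norm (y + e))^2 = 1 + m"
   using ye e by (simp add: power2_norm_eq_inner inner_add inner_commute m_def)
  define Q where "Q = norm (y + e)"
  have Q2: "Q^2 = 1 + m" using n2 by (simp add: Q_def)
  have "1 <= Q" by (rule power2_le_imp_le) (use Q2 m0 in \<open>auto simp: Q_def\<close>)
  note Q = Q2 this
  define p where "p = hyper_emb I x + s *\<^sub>R e"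
  have p: "p = s *\<^sub>R (y + e)" using s by (simp add: p_def y_def hyper_emb_divide scaleR_add_right)
  have "Q <= sqrt (1 + r^2)" using Q mr by (intro real_le_rsqrt) simp
  then have "s * Q <= q * sqrt (1 + r^2)" using s Q by (intro mult_mono) auto
  also have "... = 1" using r1 by (simp add: q_def)
  finally have np: "norm p <= 1" using s by (simp add: p Q_def)
  have pd: "p /\<^sub>R norm p = (y + e) /\<^sub>R Q" using s by (simp add: p Q_def)
  have "(dist e ((y + e) /\<^sub>R Q))^2 = 2 - 2 / Q"
  proof -
   have "Q ~= 0" using Q by auto
   then have "norm ((y + e) /\<^sub>R Q) = 1" by (simp add: Q_def)
   moreover have "e \<bullet> ((y + e) /\<^sub>R Q) = 1 / Q"
    using ye e by (simp add: inner_add inner_commute divide_inverse)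
   ultimately show ?thesis using e dist_unit_vectors[of e "(y + e) /\<^sub>R Q"] by simp
  qed
  also have "2 - 2 / Q <= Q^2 - 1"
  proof -
   have "2 - 2 / Q = 2 * (Q - 1) / Q" using Q by (simp add: field_simps)
   also have "... <= 2 * (Q - 1)" using Q by (simp add: divide_le_eq mult_le_cancel_left1)
   also have "... <= (Q + 1) * (Q - 1)" using Q by (intro mult_right_mono) auto
   finally show ?thesis by (simp add: algebra_simps power2_eq_square)
  qed
  also have "... <= r^2" using Q mr by simp
  finally have "dist e ((y + e) /\<^sub>R Q) <= r" by (rule power2_le_imp_le) (use r in simp)
  moreover have "p ~= 0" using s Q by (auto simp: p Q_def)
  ultimately show "hyper_emb I x + s *\<^sub>R e \<in> cone_set 1 (cball e r)"
   using np unfolding p_def[symmetric] cone_set_def by (simp add: pd)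
 qed
 have [measurable]: "cone_set 1 (cball e r) \<in> sets borel" by (intro sets_cone_set) simp
 have "ennreal (w * q ^ DIM('a)) = of_nat DIM('a) * (ennreal w * ennreal (q ^ DIM('a) / DIM('a)))"
 proof -
  have "of_nat DIM('a) * (ennreal w * ennreal (q ^ DIM('a) / DIM('a))) = ennreal (real DIM('a) * (w * (q ^ DIM('a) / DIM('a))))"
  proof -
   have "ennreal w * ennreal (q ^ DIM('a) / DIM('a)) = ennreal (w * (q ^ DIM('a) / DIM('a)))"
    using w q by (intro ennreal_mult[symmetric]) auto
   then show ?thesis
    unfolding ennreal_of_nat_eq_real_of_nat using w q by (simp only:) (intro ennreal_mult[symmetric], auto)
  qed
  then show ?thesis by simp
 qed
 also have "ennreal w * ennreal (q ^ DIM('a) / DIM('a)) = (NN s. ennreal w * (ennreal (s ^ (DIM('a) - 1)) * indicator {0<..q} s))"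
  using q nn_integral_power_upto[of "DIM('a)" q] by (subst nn_integral_cmult) auto
 also have "... <= (NN s. emeasure ?P {x \<in> space ?P. hyper_emb I x + s *\<^sub>R e \<in> cone_set 1 (cball e r)})"
 proof (rule nn_integral_mono)
  fix s :: real
  show "ennreal w * (ennreal (s ^ (DIM('a) - 1)) * indicator {0<..q} s)
   <= emeasure ?P {x \<in> space ?P. hyper_emb I x + s *\<^sub>R e \<in> cone_set 1 (cball e r)}"
  proof (cases "0 < s & s <= q")
   case True
   have "ennreal w * (ennreal (s ^ (DIM('a) - 1)) * indicator {0<..q} s) = emeasure ?P {x \<in> space ?P. (\<lambda>i\<in>I. x i / s) \<in> G}"
    using True emeasure_PiM_divide[OF I(1) _ G, of s] by (simp add: I(3) Gw mult.commute)
   also have "... <= emeasure ?P {x \<in> space ?P. hyper_emb I x + s *\<^sub>R e \<in> cone_set 1 (cball e r)}"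
    using slice True by (intro emeasure_mono) auto
   finally show ?thesis .
  qed auto
 qed
 also have "... = emeasure lborel (cone_set 1 (cball e r))"
  unfolding I_def by (rule emeasure_lborel_slices[OF e, symmetric]) measurable
 finally have "ennreal (w * q ^ DIM('a)) <= emeasure cone_measure (cball e r)"
  by (simp add: emeasure_cone_measure mult_left_mono)
 then show ?thesis by (simp add: w_def q_def power_divide)
qed

section \<open>The Hausdorff measure of the unit sphere\<close>

lemma diameter_isometry_image:
 assumes "!!x y. dist (T x) (T y) = dist x y"
 shows "diameter (T ` C) = diameter C"
proof (cases "C = {}")
 case False
 have "(%(x, y). dist x y) ` (T ` C \<times> T ` C) = (%(x, y). dist x y) ` (C \<times> C)"
 proof -
  have "T ` C \<times> T ` C = (%(x, y). (T x, T y)) ` (C \<times> C)" by auto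
  then show ?thesis by (simp add: image_image case_prod_beta assms)
 qed
 then show ?thesis using False by (simp add: diameter_def)
qed simp

lemma bounded_isometry_image:
 assumes "!!x y. dist (T x) (T y) = dist x y" "bounded C"
 shows "bounded (T ` C)"
proof (cases "C = {}")
 case False
 then obtain a where a: "a \<in> C" by auto
 obtain e where "\<forall>y\<in>C. dist a y <= e" using assms(2) bounded_any_center[of C a] by auto
 then have "\<forall>z\<in>T ` C. dist (T a) z <= e" using assms(1) by auto
 then show ?thesis unfolding bounded_def by blast
qed simp

lemma hausdorff_outer_isometry_le:
 assumes iso: "!!x y. dist (T x) (T y) = dist x y"
 shows "hausdorff_outer k (T ` B) <= hausdorff_outer k B"
proof -
 have "hausdorff_pre k \<delta> (T ` B) <= hausdorff_pre k \<delta> B" for \<delta>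
  unfolding hausdorff_pre_def[of k \<delta> B]
 proof (rule INF_greatest)
  fix C assume C: "C \<in> hausdorff_covers \<delta> B"
  have "(%i. T ` C i) \<in> hausdorff_covers \<delta> (T ` B)"
   unfolding hausdorff_covers_def
  proof (intro CollectI conjI allI)
   show "T ` B \<subseteq> (\<Union>i. T ` C i)" using C unfolding hausdorff_covers_def by blast
   fix i
   show "bounded (T ` C i)"
    by (rule bounded_isometry_image[OF iso]) (use C in \<open>simp add: hausdorff_covers_def\<close>)
   show "diameter (T ` C i) <= \<delta>"
    unfolding diameter_isometry_image[OF iso] using C by (simp add: hausdorff_covers_def)
  qed
  then have "hausdorff_pre k \<delta> (T ` B) <= (\<Sum>i. hausdorff_cost k (T ` C i))" by (rule hausdorff_pre_le)
  also have "... = (\<Sum>i. hausdorff_cost k (C i))"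
   unfolding hausdorff_cost_def diameter_isometry_image[OF iso] by simp
  finally show "hausdorff_pre k \<delta> (T ` B) <= (\<Sum>i. hausdorff_cost k (C i))" .
 qed
 then show ?thesis unfolding hausdorff_outer_def by (intro SUP_mono) blast
qed

lemma orthogonal_transformation_dist:
 "orthogonal_transformation T ==> dist (T x) (T y) = dist x y"
 using orthogonal_transformation_norm[of T "x - y"] orthogonal_transformation_linear[of T]
 by (simp add: dist_norm linear_diff)

lemma hausdorff_outer_orthogonal_vimage:
 fixes T :: "'a::euclidean_space => 'a"
 assumes T: "orthogonal_transformation T"
 shows "hausdorff_outer k (T -` B) = hausdorff_outer k B"
proof -
 have bij: "bij T" by (rule orthogonal_transformation_bij[OF T])
 have T': "orthogonal_transformation (inv T)" by (rule orthogonal_transformation_inv[OF T])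
 have v: "T -` B = inv T ` B" using bij by (simp add: bij_vimage_eq_inv_image)
 have i: "T ` (T -` B) = B" using bij by (simp add: bij_is_surj surj_image_vimage_eq)
 show ?thesis
 proof (rule antisym)
  show "hausdorff_outer k (T -` B) <= hausdorff_outer k B"
   unfolding v by (rule hausdorff_outer_isometry_le) (rule orthogonal_transformation_dist[OF T'])
  show "hausdorff_outer k B <= hausdorff_outer k (T -` B)"
   using hausdorff_outer_isometry_le[of T k "T -` B"] orthogonal_transformation_dist[OF T] by (simp only: i)
 qed
qed

lemma cone_measure_le_diam:
 fixes C :: "(real^'n) set"
 assumes x: "norm x = 1" and C: "C \<in> sets borel" "C \<subseteq> sphere 0 1"
  and near: "!!c. c \<in> C ==> dist c x <= \<delta>" and d: "!!c c'. c \<in> C ==> c' \<in> C ==> dist c c' <= d"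
  and \<delta>: "0 <= \<delta>" "\<delta> < 1" and d0: "0 <= d"
 shows "emeasure cone_measure C <= ennreal (unit_ball_vol (real (CARD('n) - 1)) * (d / (1 - \<delta>)^2 / 2) ^ (CARD('n) - 1))"
proof -
 obtain e :: "real^'n" where e: "e \<in> Basis" using nonempty_Basis by blast
 obtain T where T: "orthogonal_transformation T" "T e = x"
  using orthogonal_transformation_exists[of e x] e x by (metis norm_Basis)
 have "emeasure cone_measure (T -` C) <= ennreal (unit_ball_vol (real (DIM(real^'n) - 1)) * (d / (1 - \<delta>)^2 / 2) ^ (DIM(real^'n) - 1))"
 proof (rule cone_measure_le_diam_pole[OF e _ _ _ _ \<delta> d0])
  show "T -` C \<in> sets borel"
   using measurable_sets[OF orthogonal_transformation_measurable[OF T(1)] C(1)] by simp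
  show "T -` C \<subseteq> sphere 0 1" using C(2) orthogonal_transformation_norm[OF T(1)] by auto
  show "dist c e <= \<delta>" if "c \<in> T -` C" for c
   using near[of "T c"] that orthogonal_transformation_dist[OF T(1), of c e] T(2) by simp
  show "dist c c' <= d" if "c \<in> T -` C" "c' \<in> T -` C" for c c'
   using d[of "T c" "T c'"] that orthogonal_transformation_dist[OF T(1), of c c'] by simp
 qed
 moreover have "emeasure cone_measure (T -` C) = emeasure cone_measure C"
  by (rule sphere_invariantD(6)[OF sphere_invariant_cone_measure T(1) C(1)])
 ultimately show ?thesis by simp
qed

lemma cone_measure_cap_ge:
 fixes x :: "real^'n"
 assumes x: "norm x = 1" and r: "r > 0"
 shows "ennreal (unit_ball_vol (real (CARD('n) - 1)) * r ^ (CARD('n) - 1) / sqrt (1 + r^2) ^ CARD('n))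
  <= emeasure cone_measure (cball x r)"
proof -
 obtain e :: "real^'n" where e: "e \<in> Basis" using nonempty_Basis by blast
 have "emeasure cone_measure (cball e r) = emeasure cone_measure (cball x r)"
  by (rule sphere_invariant_cap_const[OF sphere_invariant_cone_measure]) (use e x in simp)
 then show ?thesis using cone_measure_cap_ge_pole[OF e r] by simp
qed

lemma emeasure_Int_sphere:
 assumes "sphere_invariant \<mu>" "B \<in> sets borel"
 shows "emeasure \<mu> (B \<inter> sphere 0 1) = emeasure \<mu> B"
proof (rule emeasure_eq_AE)
 note D = sphere_invariantD[OF assms(1)]
 show "AE x in \<mu>. (x \<in> B \<inter> sphere 0 1) = (x \<in> B)" using D(5) by eventually_elim auto
 show "B \<in> sets \<mu>" "B \<inter> sphere 0 1 \<in> sets \<mu>" using assms(2) by (auto simp: D(1))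
qed

text \<open>Sum the bound for small sets over a cover. Passing to closures makes the members of the cover
 Borel sets and keeps their diameters.\<close>

lemma cone_measure_le_hausdorff_pre:
 assumes \<delta>: "0 < \<delta>" "\<delta> < 1"
 shows "ennreal (((1 - \<delta>)^2) ^ (CARD('n) - 1)) * emeasure cone_measure (UNIV :: (real^'n) set)
  <= hausdorff_pre (CARD('n) - 1) \<delta> (sphere (0::real^'n) 1)"
 unfolding hausdorff_pre_def
proof (rule INF_greatest)
 define k where "k = CARD('n) - 1"
 define q where "q = ((1 - \<delta>)^2) ^ k"
 have q: "q > 0" using \<delta> by (simp add: q_def)
 fix C assume C: "C \<in> hausdorff_covers \<delta> (sphere (0::real^'n) 1)"
 define E where "E i = closure (C i) \<inter> sphere 0 1" for i
 have E[measurable]: "E i \<in> sets borel" for i by (simp add: E_def)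
 have le: "ennreal q * emeasure cone_measure (E i) <= hausdorff_cost k (C i)" for i
 proof (cases "E i = {}")
  case False
  have b: "bounded (C i)" "diameter (C i) <= \<delta>" using C by (auto simp: hausdorff_covers_def)
  have dd: "dist c c' <= diameter (C i)" if "c \<in> E i" "c' \<in> E i" for c c'
  proof -
   have "dist c c' <= diameter (closure (C i))"
    using that b by (intro diameter_bounded_bound) (auto simp: E_def bounded_closure)
   then show ?thesis using b by (simp add: diameter_closure)
  qed
  obtain x where x: "x \<in> E i" using False by auto
  have "emeasure cone_measure (E i) <= ennreal (unit_ball_vol (real k) * (diameter (C i) / (1 - \<delta>)^2 / 2) ^ k)"
   unfolding k_def
  proof (rule cone_measure_le_diam[of x])
   show "norm x = 1" using x by (simp add: E_def)
   show "E i \<in> sets borel" by (rule E)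
   show "E i \<subseteq> sphere 0 1" by (simp add: E_def)
   show "dist c x <= \<delta>" if "c \<in> E i" for c using dd[OF that x] b(2) by simp
   show "0 <= diameter (C i)" by (rule diameter_ge_0[OF b(1)])
  qed (use dd \<delta> in auto)
  then have "ennreal q * emeasure cone_measure (E i)
   <= ennreal q * ennreal (unit_ball_vol (real k) * (diameter (C i) / (1 - \<delta>)^2 / 2) ^ k)"
   by (rule mult_left_mono) simp
  also have "... = ennreal (q * (unit_ball_vol (real k) * (diameter (C i) / (1 - \<delta>)^2 / 2) ^ k))"
   using q \<delta> b by (intro ennreal_mult[symmetric]) (auto intro!: mult_nonneg_nonneg divide_nonneg_nonneg zero_le_power diameter_ge_0)
  also have "q * (unit_ball_vol (real k) * (diameter (C i) / (1 - \<delta>)^2 / 2) ^ k) = unit_ball_vol (real k) * (diameter (C i) / 2) ^ k"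
  proof -
   define t where "t = (1 - \<delta>)^2"
   have "t ~= 0" using \<delta> by (simp add: t_def)
   then have "(diameter (C i) / 2) ^ k = (t * (diameter (C i) / t / 2)) ^ k" by simp
   then show ?thesis unfolding q_def t_def[symmetric] by (simp only: power_mult_distrib mult_ac)
  qed
  also have "ennreal ... = hausdorff_cost k (C i)"
   using x by (auto simp: hausdorff_cost_def E_def)
  finally show ?thesis .
 qed simp
 have "ennreal q * emeasure cone_measure (UNIV :: (real^'n) set) = ennreal q * emeasure cone_measure (sphere (0::real^'n) 1)"
  using emeasure_Int_sphere[OF sphere_invariant_cone_measure, of "UNIV :: (real^'n) set"] by simp
 also have "... <= ennreal q * emeasure cone_measure (\<Union>i. E i)"
 proof (intro mult_left_mono emeasure_mono)
  show "sphere 0 1 \<subseteq> (\<Union>i. E i)"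
  proof
   fix x :: "real^'n" assume x: "x \<in> sphere 0 1"
   then obtain i where "x \<in> C i" using C unfolding hausdorff_covers_def by blast
   then have "x \<in> E i" using x closure_subset[of "C i"] unfolding E_def by blast
   then show "x \<in> (\<Union>i. E i)" by blast
  qed
 qed auto
 also have "... <= ennreal q * (\<Sum>i. emeasure cone_measure (E i))"
  by (intro mult_left_mono emeasure_subadditive_countably) auto
 also have "... = (\<Sum>i. ennreal q * emeasure cone_measure (E i))" by simp
 also have "... <= (\<Sum>i. hausdorff_cost k (C i))" by (intro suminf_le le) auto
 finally show "ennreal (((1 - \<delta>)^2) ^ (CARD('n) - 1)) * emeasure cone_measure (UNIV :: (real^'n) set)
  <= (\<Sum>i. hausdorff_cost (CARD('n) - 1) (C i))"
  by (simp add: q_def k_def)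
qed

lemma cone_measure_le_hausdorff:
 "emeasure cone_measure (UNIV :: (real^'n) set) <= hausdorff_outer (CARD('n) - 1) (sphere (0::real^'n) 1)"
proof (rule LIMSEQ_le_const2)
 let ?c = "emeasure cone_measure (UNIV :: (real^'n) set)"
 define \<delta> where "\<delta> n = inverse (real (Suc (Suc n)))" for n
 have \<delta>: "0 < \<delta> n" "\<delta> n < 1" for n by (auto simp: \<delta>_def inverse_less_1_iff)
 have "\<delta> \<longlonglongrightarrow> 0" unfolding \<delta>_def using LIMSEQ_Suc[OF LIMSEQ_inverse_real_of_nat] .
 then have "(%n. ((1 - \<delta> n)^2) ^ (CARD('n) - 1)) \<longlonglongrightarrow> ((1 - 0)^2) ^ (CARD('n) - 1)"
  by (intro tendsto_intros)
 then have "(%n. ?c * ennreal (((1 - \<delta> n)^2) ^ (CARD('n) - 1))) \<longlonglongrightarrow> ?c * ennreal (((1 - 0)^2) ^ (CARD('n) - 1))"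
  using emeasure_cone_measure_UNIV_finite[where 'a="real^'n"]
  by (intro ennreal_tendsto_cmult tendsto_ennrealI) auto
 then show "(%n. ennreal (((1 - \<delta> n)^2) ^ (CARD('n) - 1)) * ?c) \<longlonglongrightarrow> ?c" by (simp add: mult.commute)
 show "\<exists>N. \<forall>n\<ge>N. ennreal (((1 - \<delta> n)^2) ^ (CARD('n) - 1)) * ?c <= hausdorff_outer (CARD('n) - 1) (sphere (0::real^'n) 1)"
  using cone_measure_le_hausdorff_pre[OF \<delta>] hausdorff_pre_le_outer[OF \<delta>(1)] by (blast intro: order_trans)
qed

lemma emeasure_disjoint_caps:
 fixes F :: "(real^'n) set"
 assumes \<mu>: "sphere_invariant \<mu>" and F: "finite F" "F \<subseteq> sphere 0 1"
  and disj: "!!x y. x \<in> F ==> y \<in> F ==> x ~= y ==> cball x r \<inter> cball y r = {}" and e: "norm e = 1"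
 shows "emeasure \<mu> (\<Union>x\<in>F. cball x r) = of_nat (card F) * emeasure \<mu> (cball e r)"
proof -
 have "emeasure \<mu> (\<Union>x\<in>F. cball x r) = (\<Sum>x\<in>F. emeasure \<mu> (cball x r))"
  using F disj by (intro sum_emeasure[symmetric]) (auto simp: disjoint_family_on_def sphere_invariantD(1)[OF \<mu>])
 also have "... = (\<Sum>x\<in>F. emeasure \<mu> (cball e r))"
  using F e by (intro sum.cong sphere_invariant_cap_const[OF \<mu>]) auto
 finally show ?thesis by simp
qed

text \<open>A maximal family of disjoint caps of radius \<open>r\<close>; by maximality the doubled caps cover.\<close>

lemma exists_maximal_caps:
 assumes r: "r > 0"
 shows "\<exists>F. finite F & F \<subseteq> sphere (0::real^'n) 1 &
  (\<forall>x\<in>F. \<forall>y\<in>F. x ~= y --> cball x r \<inter> cball y r = {}) &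
  sphere 0 1 \<subseteq> (\<Union>x\<in>F. cball x (2 * r))"
proof -
 let ?m = "cone_measure :: (real^'n) measure"
 note inv = sphere_invariant_cone_measure[where 'a="real^'n"]
 define P where "P F \<longleftrightarrow> finite F & F \<subseteq> sphere (0::real^'n) 1 & (\<forall>x\<in>F. \<forall>y\<in>F. x ~= y --> cball x r \<inter> cball y r = {})" for F
 obtain b :: "real^'n" where b: "b \<in> Basis" using nonempty_Basis by blast
 define c where "c = measure ?m (cball b r)"
 define S where "S = measure ?m UNIV"
 interpret C: finite_measure ?m by (rule finite_measure_cone)
 have "0 < unit_ball_vol (real (CARD('n) - 1)) * r ^ (CARD('n) - 1) / sqrt (1 + r^2) ^ CARD('n)"
  using r by (intro divide_pos_pos mult_pos_pos zero_less_power) (auto intro: unit_ball_vol_pos simp: add_pos_nonneg)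
 then have "0 < emeasure ?m (cball b r)"
  using cone_measure_cap_ge[of b r] b r by (intro less_le_trans[OF _ cone_measure_cap_ge]) auto
 then have c: "c > 0" by (simp add: c_def C.emeasure_eq_measure)
 have bound: "real (card F) <= S / c" if "P F" for F
 proof -
  have "ennreal (real (card F) * c) = ennreal (real (card F)) * ennreal c"
   using c by (intro ennreal_mult) auto
  also have "... = of_nat (card F) * emeasure ?m (cball b r)"
   unfolding c_def by (simp only: C.emeasure_eq_measure ennreal_of_nat_eq_real_of_nat)
  also have "... = emeasure ?m (\<Union>x\<in>F. cball x r)"
   by (rule emeasure_disjoint_caps[OF inv, symmetric]) (use that b in \<open>auto simp: P_def\<close>)
  also have "... <= emeasure ?m UNIV" by (rule emeasure_mono) auto
  finally have "real (card F) * c <= S" by (simp add: S_def C.emeasure_eq_measure)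
  then show ?thesis using c by (simp add: field_simps)
 qed
 have P0: "P {}" by (simp add: P_def)
 define K where "K = card ` {F. P F}"
 have Kb: "K \<subseteq> {.. nat \<lfloor>S / c\<rfloor>}" using bound by (auto simp: K_def le_nat_floor)
 then have Kf: "finite K" by (rule finite_subset) simp
 have "K ~= {}" using P0 by (auto simp: K_def)
 then have "Max K \<in> K" using Kf by (rule Max_in[rotated])
 then obtain F where F: "P F" "card F = Max K" by (auto simp: K_def)
 have cover: "sphere 0 1 \<subseteq> (\<Union>x\<in>F. cball x (2 * r))"
 proof (rule ccontr)
  assume "\<not> ?thesis"
  then obtain y where y: "norm y = 1" "!!x. x \<in> F ==> dist x y > 2 * r" by (fastforce simp: not_le)
  have "y \<notin> F" using y(2)[of y] r by auto
  have "cball x r \<inter> cball y r = {}" if "x \<in> F" for x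
  proof (rule ccontr)
   assume "cball x r \<inter> cball y r ~= {}"
   then obtain z where "dist x z <= r" "dist y z <= r" by auto
   then show False using y(2)[OF that] dist_triangle2[of x y z] by simp
  qed
  then have "P (insert y F)" using F(1) y(1) by (auto simp: P_def)
  then have "card (insert y F) <= Max K" using Kf by (intro Max_ge) (auto simp: K_def)
  then show False using F \<open>y \<notin> F\<close> by (simp add: P_def)
 qed
 show ?thesis using F(1) cover unfolding P_def by blast
qed

lemma hausdorff_pre_finite_cover_le:
 fixes S :: "'a::euclidean_space set"
 assumes F: "finite F" and S: "S \<subseteq> (\<Union>x\<in>F. cball x r)" and r: "r > 0"
 shows "hausdorff_pre k (2 * r) S <= of_nat (card F) * ennreal (unit_ball_vol (real k) * r ^ k)"
proof -
 obtain f where f: "bij_betw f {..<card F} F" using ex_bij_betw_nat_finite[OF F] by (auto simp: atLeast0LessThan)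
 define C where "C i = (if i < card F then cball (f i) r else {})" for i
 have dia: "diameter (cball x r) <= 2 * r" for x :: 'a using r by simp
 have "C \<in> hausdorff_covers (2 * r) S"
 proof -
  have "(\<Union>x\<in>F. cball x r) = (\<Union>i. C i)"
  proof -
   have "(\<Union>x\<in>F. cball x r) = (\<Union>i\<in>{..<card F}. cball (f i) r)"
   proof -
    have "(\<Union>x\<in>f ` {..<card F}. cball x r) = (\<Union>i\<in>{..<card F}. cball (f i) r)" by simp
    then show ?thesis using bij_betw_imp_surj_on[OF f] by simp
   qed
   then show ?thesis by (auto simp: C_def split: if_splits)
  qed
  then show ?thesis using S r dia by (auto simp: hausdorff_covers_def C_def)
 qed
 then have "hausdorff_pre k (2 * r) S <= (\<Sum>i. hausdorff_cost k (C i))" by (rule hausdorff_pre_le)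
 also have "... = (\<Sum>i<card F. hausdorff_cost k (C i))"
  by (rule suminf_finite) (auto simp: C_def hausdorff_cost_def)
 also have "... <= (\<Sum>i<card F. ennreal (unit_ball_vol (real k) * r ^ k))"
 proof (rule sum_mono)
  fix i assume "i \<in> {..<card F}"
  then have "C i = cball (f i) r" by (simp add: C_def)
  moreover have "(diameter (cball (f i) r) / 2) ^ k <= r ^ k"
   using dia[of "f i"] by (intro power_mono) (auto intro: diameter_ge_0)
  ultimately show "hausdorff_cost k (C i) <= ennreal (unit_ball_vol (real k) * r ^ k)"
   by (auto simp: hausdorff_cost_def intro!: ennreal_leI mult_left_mono)
 qed
 finally show ?thesis by simp
qed

lemma hausdorff_pre_Un: "hausdorff_pre k \<delta> (S \<union> T) <= hausdorff_pre k \<delta> S + hausdorff_pre k \<delta> T"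
 if "\<delta> > 0"
proof -
 have e: "hausdorff_pre k \<delta> ({}::'a set) = 0"
  using hausdorff_pre_le[of "%_. {}" \<delta> "{}::'a set" k] that
  by (simp add: hausdorff_covers_def hausdorff_cost_def)
 have "hausdorff_pre k \<delta> (\<Union>n. binaryset S T n) <= (\<Sum>n. hausdorff_pre k \<delta> (binaryset S T n))"
  by (rule hausdorff_pre_subadditive)
 then show ?thesis by (simp add: UN_binaryset_eq suminf_binaryset_eq e)
qed

definition sphere_hausdorff :: "(real^'n) measure" where
 "sphere_hausdorff = density (hausdorff_measure (CARD('n) - 1)) (indicator (sphere 0 1))"

lemma emeasure_sphere_hausdorff:
 fixes B :: "(real^'n) set"
 assumes [measurable]: "B \<in> sets borel"
 shows "emeasure sphere_hausdorff B = hausdorff_outer (CARD('n) - 1) (B \<inter> sphere 0 1)"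
proof -
 have "emeasure sphere_hausdorff B = (\<integral>\<^sup>+x. indicator (sphere 0 1) x * indicator B x \<partial>hausdorff_measure (CARD('n) - 1))"
 proof -
  have "indicator (sphere (0::real^'n) 1) \<in> borel_measurable (hausdorff_measure (CARD('n) - 1))"
   by (rule borel_measurable_indicator) simp
  then show ?thesis unfolding sphere_hausdorff_def by (subst emeasure_density) auto
 qed
 also have "... = (\<integral>\<^sup>+x. indicator (B \<inter> sphere 0 1) x \<partial>hausdorff_measure (CARD('n) - 1))"
  by (intro nn_integral_cong) (auto simp: indicator_def)
 also have "... = emeasure (hausdorff_measure (CARD('n) - 1)) (B \<inter> sphere 0 1)"
  by (intro nn_integral_indicator) auto
 finally show ?thesis by (simp add: emeasure_hausdorff_measure)
qed

lemma cone_measure_caps_real: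
 fixes e :: "real^'n"
 assumes e: "norm e = 1" and r: "r > 0"
 shows "unit_ball_vol (real (CARD('n) - 1)) * r ^ (CARD('n) - 1)
  <= sqrt (1 + r^2) ^ CARD('n) * measure cone_measure (cball e r)"
proof -
 interpret C: finite_measure "cone_measure :: (real^'n) measure" by (rule finite_measure_cone)
 have "0 < sqrt (1 + r^2) ^ CARD('n)" by (simp add: add_pos_nonneg)
 moreover have "unit_ball_vol (real (CARD('n) - 1)) * r ^ (CARD('n) - 1) / sqrt (1 + r^2) ^ CARD('n) <= measure cone_measure (cball e r)"
  using cone_measure_cap_ge[OF e r] by (simp add: C.emeasure_eq_measure)
 ultimately show ?thesis by (simp add: divide_le_eq mult.commute)
qed

lemma caps_mass_le:
 fixes F :: "(real^'n) set" and e :: "real^'n"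
 assumes F: "finite F" "F \<subseteq> sphere 0 1"
  and disj: "!!x y. x \<in> F ==> y \<in> F ==> x ~= y ==> cball x r \<inter> cball y r = {}" and e: "norm e = 1"
 shows "real (card F) * measure cone_measure (cball e r) <= measure cone_measure (UNIV :: (real^'n) set)"
proof -
 interpret C: finite_measure "cone_measure :: (real^'n) measure" by (rule finite_measure_cone)
 have "ennreal (real (card F) * measure cone_measure (cball e r)) = of_nat (card F) * emeasure cone_measure (cball e r)"
  unfolding C.emeasure_eq_measure ennreal_of_nat_eq_real_of_nat by (intro ennreal_mult) auto
 also have "... = emeasure cone_measure (\<Union>x\<in>F. cball x r)"
  by (rule emeasure_disjoint_caps[OF sphere_invariant_cone_measure F disj e, symmetric])
 also have "... <= emeasure cone_measure (UNIV :: (real^'n) set)" by (rule emeasure_mono) auto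
 finally show ?thesis by (simp add: C.emeasure_eq_measure)
qed

text \<open>A maximal family of disjoint caps has at most the number of members that the total cone measure
 allows, and the doubled caps cover the sphere.\<close>

lemma hausdorff_outer_sphere_finite:
 "hausdorff_outer (CARD('n) - 1) (sphere (0::real^'n) 1) < \<infinity>"
proof -
 define k where "k = CARD('n) - 1"
 define w where "w = unit_ball_vol (real k)"
 define S where "S = measure cone_measure (UNIV :: (real^'n) set)"
 obtain e :: "real^'n" where e: "norm e = 1" using vector_choose_size[of 1] by auto
 have "hausdorff_pre k \<delta> (sphere (0::real^'n) 1) <= ennreal (2 ^ k * (2 ^ CARD('n) * S))" if \<delta>: "\<delta> > 0" for \<delta>
 proof -
  define r where "r = min (\<delta> / 4) 1"
  have r: "r > 0" "r <= 1" "4 * r <= \<delta>" using \<delta> by (auto simp: r_def)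
  obtain F where F: "finite F" "F \<subseteq> sphere (0::real^'n) 1"
   "!!x y. x \<in> F ==> y \<in> F ==> x ~= y ==> cball x r \<inter> cball y r = {}"
   "sphere 0 1 \<subseteq> (\<Union>x\<in>F. cball x (2 * r))"
   using exists_maximal_caps[OF r(1), where 'n='n] by blast
  have "hausdorff_pre k \<delta> (sphere (0::real^'n) 1) <= hausdorff_pre k (2 * (2 * r)) (sphere (0::real^'n) 1)"
   using r by (intro hausdorff_pre_antimono) auto
  also have "... <= of_nat (card F) * ennreal (w * (2 * r) ^ k)"
   unfolding w_def by (rule hausdorff_pre_finite_cover_le[OF F(1,4)]) (use r in simp)
  also have "... = ennreal (real (card F) * (w * (2 * r) ^ k))"
   unfolding ennreal_of_nat_eq_real_of_nat using r by (intro ennreal_mult[symmetric]) (auto simp: w_def)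
  also have "... <= ennreal (2 ^ k * (2 ^ CARD('n) * S))"
  proof (rule ennreal_leI)
   have "w * r ^ k <= sqrt (1 + r^2) ^ CARD('n) * measure cone_measure (cball e r)"
    unfolding w_def k_def by (rule cone_measure_caps_real[OF e r(1)])
   also have "... <= 2 ^ CARD('n) * measure cone_measure (cball e r)"
   proof (intro mult_right_mono power_mono)
    have "r^2 <= 1" using r by (simp add: power_le_one)
    then have "sqrt (1 + r^2) <= sqrt (2^2)" by (intro real_sqrt_le_mono) simp
    then show "sqrt (1 + r^2) <= 2" by simp
   qed auto
   finally have "real (card F) * (w * r ^ k) <= real (card F) * (2 ^ CARD('n) * measure cone_measure (cball e r))"
    by (rule mult_left_mono) simp
   also have "... = 2 ^ CARD('n) * (real (card F) * measure cone_measure (cball e r))" by simp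
   also have "... <= 2 ^ CARD('n) * S"
    unfolding S_def by (intro mult_left_mono caps_mass_le[OF F(1-3) e]) auto
   finally have "2 ^ k * (real (card F) * (w * r ^ k)) <= 2 ^ k * (2 ^ CARD('n) * S)"
    by (rule mult_left_mono) simp
   then show "real (card F) * (w * (2 * r) ^ k) <= 2 ^ k * (2 ^ CARD('n) * S)"
    by (simp add: power_mult_distrib mult_ac)
  qed
  finally show ?thesis .
 qed
 then have "hausdorff_outer k (sphere (0::real^'n) 1) <= ennreal (2 ^ k * (2 ^ CARD('n) * S))"
  unfolding hausdorff_outer_def by (intro SUP_least) auto
 also have "... < \<infinity>" by simp
 finally show ?thesis by (simp add: k_def)
qed

lemma sphere_invariant_sphere_hausdorff: "sphere_invariant (sphere_hausdorff :: (real^'n) measure)"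
 unfolding sphere_invariant_def
proof (intro conjI allI impI)
 show "sets (sphere_hausdorff :: (real^'n) measure) = sets borel" by (simp add: sphere_hausdorff_def)
 show "emeasure sphere_hausdorff (UNIV :: (real^'n) set) < \<infinity>"
  using hausdorff_outer_sphere_finite[where 'n='n] by (simp add: emeasure_sphere_hausdorff)
 show "emeasure sphere_hausdorff (- sphere 0 1 :: (real^'n) set) = 0"
  by (simp add: emeasure_sphere_hausdorff hausdorff_outer_empty)
 fix T :: "real^'n => real^'n" and B :: "(real^'n) set"
 assume T: "orthogonal_transformation T" and [measurable]: "B \<in> sets borel"
 have [measurable]: "T -` B \<in> sets borel"
  using measurable_sets[OF orthogonal_transformation_measurable[OF T], of B] by simp
 have "T -` B \<inter> sphere 0 1 = T -` (B \<inter> sphere 0 1)"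
  using orthogonal_transformation_norm[OF T] by auto
 then show "emeasure sphere_hausdorff (T -` B) = emeasure sphere_hausdorff B"
  using hausdorff_outer_orthogonal_vimage[OF T, of _ "B \<inter> sphere 0 1"]
  by (subst (1 2) emeasure_sphere_hausdorff) (simp_all only: \<open>T -` B \<in> sets borel\<close> \<open>B \<in> sets borel\<close>)
qed

text \<open>Both measures are rotation invariant, so a disjoint family of caps carries the same fraction of
 each. Cover the sphere by such a family of small caps, whose Hausdorff cost is at most about their cone
 measure, and by its complement. If the Hausdorff measure exceeded the cone measure, this cover would be
 cheaper than the Hausdorff measure by an amount independent of the size of the caps; a maximal family carries
 at least the fraction \<open>\<theta>\<close>.\<close>

lemma hausdorff_le_cone_measure:
 "hausdorff_outer (CARD('n) - 1) (sphere (0::real^'n) 1) <= emeasure cone_measure (UNIV :: (real^'n) set)"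
proof -
 define k where "k = CARD('n) - 1"
 define w where "w = unit_ball_vol (real k)"
 define S where "S = measure cone_measure (UNIV :: (real^'n) set)"
 define h where "h = measure sphere_hausdorff (UNIV :: (real^'n) set)"
 \<comment> \<open>doubling a small cap multiplies its cone measure by at most \<open>1 / \<theta>\<close>\<close>
 define \<theta> where "\<theta> = 1 / (4 ^ k * 2 ^ CARD('n) :: real)"
 note inv = sphere_invariant_cone_measure[where 'a="real^'n"]
 note invH = sphere_invariant_sphere_hausdorff[where 'n='n]
 interpret C: finite_measure "cone_measure :: (real^'n) measure" by (rule finite_measure_cone)
 interpret H: finite_measure "sphere_hausdorff :: (real^'n) measure" by (rule sphere_invariantD(4)[OF invH])
 have [simp]: "sets (sphere_hausdorff :: (real^'n) measure) = sets borel" "space (sphere_hausdorff :: (real^'n) measure) = UNIV"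
  using sphere_invariantD[OF invH] by auto
 have S0: "S > 0"
  using emeasure_cone_measure_UNIV_pos[where 'a="real^'n"] by (simp add: S_def C.emeasure_eq_measure)
 have Hh: "hausdorff_outer k (sphere (0::real^'n) 1) = ennreal h"
  using emeasure_sphere_hausdorff[of "UNIV :: (real^'n) set"] by (simp add: H.emeasure_eq_measure h_def k_def)
 obtain e :: "real^'n" where e: "norm e = 1" using vector_choose_size[of 1] by auto
 have w0: "w > 0" by (simp add: w_def)
 have \<theta>0: "\<theta> > 0" by (simp add: \<theta>_def)
 have "h <= S"
 proof (rule ccontr)
  assume "\<not> h <= S"
  then have hS: "h > S" by simp
  have "((%r. sqrt (1 + r^2) ^ CARD('n) * S) \<longlongrightarrow> sqrt (1 + 0^2) ^ CARD('n) * S) (at_right (0::real))"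
   by (intro tendsto_intros)
  then have "\<forall>\<^sub>F r in at_right (0::real). sqrt (1 + r^2) ^ CARD('n) * S < (h + S) / 2"
   by (rule order_tendstoD(2)) (use hS in simp)
  then obtain r0 where r0: "r0 > 0" "!!r. 0 < r ==> r < r0 ==> sqrt (1 + r^2) ^ CARD('n) * S < (h + S) / 2"
   unfolding eventually_at_right_field by auto
  define b where "b = h - \<theta> * ((h - S) / 2)"
  have "hausdorff_pre k \<delta> (sphere (0::real^'n) 1) <= ennreal b" if \<delta>: "\<delta> > 0" for \<delta>
  proof -
   define r where "r = min (min (\<delta> / 2) (r0 / 2)) (1 / 8)"
   have r: "r > 0" "r <= 1 / 8" "2 * r <= \<delta>" "r < r0" using \<delta> r0(1) by (auto simp: r_def)
   define \<tau> where "\<tau> = sqrt (1 + r^2) ^ CARD('n)"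
   have \<tau>S: "\<tau> * S <= (h + S) / 2" using r0(2)[OF r(1,4)] by (simp add: \<tau>_def)
   define c where "c = measure cone_measure (cball e r)"
   have c: "w * r ^ k <= \<tau> * c"
    unfolding w_def k_def \<tau>_def c_def by (rule cone_measure_caps_real[OF e r(1)])
   have c2: "measure cone_measure (cball e (2 * r)) <= w * (4 * r) ^ k"
   proof -
    define D where "D = cball e (2 * r) \<inter> sphere 0 1"
    have "emeasure cone_measure D <= ennreal (unit_ball_vol (real (CARD('n) - 1)) * ((4 * r) / (1 - 2 * r)^2 / 2) ^ (CARD('n) - 1))"
    proof (rule cone_measure_le_diam[of e, OF e])
     show "D \<in> sets borel" by (simp add: D_def)
     show "dist c c' <= 4 * r" if "c \<in> D" "c' \<in> D" for c c'
      using that dist_triangle3[of c c' e] by (auto simp: D_def)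
    qed (use r in \<open>auto simp: D_def dist_commute\<close>)
    also have "... <= ennreal (w * (4 * r) ^ k)"
     unfolding w_def k_def
    proof (intro ennreal_leI mult_left_mono power_mono)
     have "(3 / 4)^2 <= (1 - 2 * r)^2" using r by (intro power_mono) auto
     then have "1 / 2 <= (1 - 2 * r)^2" by (simp add: power2_eq_square)
     then have "4 * r * 1 <= 4 * r * (2 * (1 - 2 * r)^2)" using r by (intro mult_left_mono) auto
     moreover have "(1 - 2 * r)^2 > 0" using r by simp
     ultimately show "4 * r / (1 - 2 * r)^2 / 2 <= 4 * r"
      by (simp add: divide_le_eq)
    qed (use r in auto)
    finally have "emeasure cone_measure D <= ennreal (w * (4 * r) ^ k)" .
    moreover have "emeasure cone_measure D = emeasure cone_measure (cball e (2 * r))"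
     unfolding D_def by (rule emeasure_Int_sphere[OF inv]) simp
    ultimately show ?thesis using w0 r by (simp add: C.emeasure_eq_measure)
   qed
   obtain F where F: "finite F" "F \<subseteq> sphere (0::real^'n) 1"
    "!!x y. x \<in> F ==> y \<in> F ==> x ~= y ==> cball x r \<inter> cball y r = {}"
    "sphere 0 1 \<subseteq> (\<Union>x\<in>F. cball x (2 * r))"
    using exists_maximal_caps[OF r(1), where 'n='n] by blast
   define m where "m = real (card F)"
   have m0: "m \<ge> 0" by (simp add: m_def)
   define M where "M = m * c"
   have MS: "M <= S" unfolding M_def m_def c_def S_def by (rule caps_mass_le[OF F(1-3) e])
   \<comment> \<open>the doubled caps cover, so the caps carry a fixed fraction of the mass\<close>
   have M\<theta>: "\<theta> * S <= M"
   proof -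
    have "emeasure cone_measure (UNIV :: (real^'n) set) = emeasure cone_measure (sphere (0::real^'n) 1)"
     using emeasure_Int_sphere[OF inv, of UNIV] by simp
    also have "... <= emeasure cone_measure (\<Union>x\<in>F. cball x (2 * r))" 
    proof (rule emeasure_mono)
     show "sphere 0 1 \<subseteq> (\<Union>x\<in>F. cball x (2 * r))" using F by blast
     have "closed (\<Union>x\<in>F. cball x (2 * r))" using F(1) by (intro closed_UN) auto
     then show "(\<Union>x\<in>F. cball x (2 * r)) \<in> sets cone_measure" by (simp add: borel_closed)
    qed
    also have "... <= (\<Sum>x\<in>F. emeasure cone_measure (cball x (2 * r)))"
     by (intro emeasure_subadditive_finite F) auto
    also have "... = (\<Sum>x\<in>F. emeasure cone_measure (cball e (2 * r)))"
     by (intro sum.cong sphere_invariant_cap_const[OF inv]) (use F(2) e in auto)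
    also have "... = ennreal (m * measure cone_measure (cball e (2 * r)))"
     by (simp add: m_def C.emeasure_eq_measure ennreal_mult flip: ennreal_of_nat_eq_real_of_nat)
    finally have "S <= m * measure cone_measure (cball e (2 * r))"
     using m0 by (simp add: S_def C.emeasure_eq_measure)
    also have "... <= m * (w * (4 * r) ^ k)" by (intro mult_left_mono c2 m0)
    also have "... = 4 ^ k * (m * (w * r ^ k))" by (simp add: power_mult_distrib)
    also have "... <= 4 ^ k * (m * (2 ^ CARD('n) * c))"
    proof (intro mult_left_mono m0)
     have "\<tau> <= 2 ^ CARD('n)" unfolding \<tau>_def
     proof (rule power_mono)
      have "r^2 <= 1" using r by (simp add: power_le_one)
      then have "sqrt (1 + r^2) <= sqrt (2^2)" by (intro real_sqrt_le_mono) simp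
      then show "sqrt (1 + r^2) <= 2" by simp
     qed simp
     then have "\<tau> * c <= 2 ^ CARD('n) * c" by (rule mult_right_mono) (simp add: c_def)
     then show "w * r ^ k <= 2 ^ CARD('n) * c" using c by simp
    qed simp
    finally have "S <= (4 ^ k * 2 ^ CARD('n)) * M" by (simp add: M_def mult_ac)
    then show ?thesis by (simp add: \<theta>_def divide_le_eq mult.commute)
   qed
   define V where "V = (\<Union>x\<in>F. cball x r)"
   have V[measurable]: "V \<in> sets borel" unfolding V_def by (rule borel_closed) (use F(1) in auto)
   have cH: "measure sphere_hausdorff (cball e r) * S = c * h"
   proof -
    have "ennreal (measure sphere_hausdorff (cball e r)) * ennreal S = ennreal c * ennreal h"
     using sphere_invariant_cap_proportional[OF invH inv e, of r]
     by (simp add: C.emeasure_eq_measure H.emeasure_eq_measure S_def c_def h_def)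
    then show ?thesis
     using S0 by (simp add: ennreal_mult[symmetric] c_def h_def)
   qed
   have mV: "measure sphere_hausdorff V = M * h / S"
   proof -
    have "ennreal (measure sphere_hausdorff V) = of_nat (card F) * emeasure sphere_hausdorff (cball e r)"
     unfolding V_def H.emeasure_eq_measure[symmetric] by (rule emeasure_disjoint_caps[OF invH F(1-3) e])
    also have "... = ennreal (m * measure sphere_hausdorff (cball e r))"
     by (simp add: m_def H.emeasure_eq_measure ennreal_mult flip: ennreal_of_nat_eq_real_of_nat)
    finally have "measure sphere_hausdorff V = m * measure sphere_hausdorff (cball e r)"
     using m0 by simp
    moreover have "measure sphere_hausdorff (cball e r) = c * h / S"
     using cH S0 by (simp add: field_simps)
    ultimately show ?thesis by (simp add: M_def)
   qed
   have h0: "h \<ge> 0" by (simp add: h_def)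
   have "hausdorff_outer k (sphere 0 1 - V) = ennreal (h - M * h / S)"
   proof -
    have "hausdorff_outer k (sphere 0 1 - V) = emeasure sphere_hausdorff (- V)"
     by (simp add: emeasure_sphere_hausdorff k_def Diff_eq Int_commute)
    also have "... = ennreal (measure sphere_hausdorff (UNIV - V))"
     by (simp add: H.emeasure_eq_measure Compl_eq_Diff_UNIV)
    also have "measure sphere_hausdorff (UNIV - V) = h - M * h / S"
     using H.finite_measure_compl[of V] by (simp add: mV h_def)
    finally show ?thesis .
   qed
   then have rest: "hausdorff_pre k (2 * r) (sphere 0 1 - V) <= ennreal (h - M * h / S)"
    using hausdorff_pre_le_outer[of "2 * r" k "sphere 0 1 - V"] r by simp
   have caps: "hausdorff_pre k (2 * r) (sphere 0 1 \<inter> V) <= ennreal (\<tau> * M)"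
   proof -
    have "hausdorff_pre k (2 * r) (sphere 0 1 \<inter> V) <= of_nat (card F) * ennreal (w * r ^ k)"
     unfolding w_def by (rule hausdorff_pre_finite_cover_le[OF F(1) _ r(1)]) (auto simp: V_def)
    also have "... = ennreal (m * (w * r ^ k))"
     using w0 r m0 by (simp add: m_def ennreal_mult flip: ennreal_of_nat_eq_real_of_nat)
    also have "... <= ennreal (m * (\<tau> * c))" by (intro ennreal_leI mult_left_mono c m0)
    finally show ?thesis by (simp add: M_def mult_ac)
   qed
   have "hausdorff_pre k \<delta> (sphere (0::real^'n) 1) <= hausdorff_pre k (2 * r) (sphere (0::real^'n) 1)"
    using r by (intro hausdorff_pre_antimono) auto
   also have "hausdorff_pre k (2 * r) (sphere (0::real^'n) 1) <= ennreal (\<tau> * M) + ennreal (h - M * h / S)"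
   proof -
    have split: "sphere (0::real^'n) 1 = (sphere 0 1 \<inter> V) \<union> (sphere 0 1 - V)" by auto
    show ?thesis
     by (subst split, rule order_trans[OF hausdorff_pre_Un add_mono[OF caps rest]]) (use r in simp)
   qed
   also have "... = ennreal (\<tau> * M + (h - M * h / S))"
   proof (rule ennreal_plus[symmetric])
    show "0 <= \<tau> * M" by (simp add: \<tau>_def M_def m_def c_def)
    have "M * h <= S * h" using MS h0 by (rule mult_right_mono)
    then show "0 <= h - M * h / S" using S0 by (simp add: field_simps)
   qed
   also have "\<tau> * M + (h - M * h / S) = h - M / S * (h - \<tau> * S)"
    using S0 by (simp add: field_simps)
   also have "... <= b"
   proof -
    have "\<theta> <= M / S" using M\<theta> S0 by (simp add: field_simps)
    then have "\<theta> * ((h - S) / 2) <= M / S * (h - \<tau> * S)"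
     using \<tau>S hS \<theta>0 by (intro mult_mono) (auto simp: field_simps)
    then show ?thesis by (simp add: b_def)
   qed
   finally show ?thesis by (simp add: ennreal_leI)
  qed
  then have "hausdorff_outer k (sphere (0::real^'n) 1) <= ennreal b"
   unfolding hausdorff_outer_def by (intro SUP_least) auto
  then have "ennreal h <= ennreal b" by (simp add: Hh)
  moreover have "b < h" using hS \<theta>0 by (simp add: b_def)
  moreover have "0 < h" using hS S0 by simp
  ultimately show False by (simp add: ennreal_le_iff2)
 qed
 then show ?thesis
  using Hh by (simp add: k_def S_def C.emeasure_eq_measure ennreal_leI)
qed

theorem hausdorff_sphere_eq_cone_measure:
 "hausdorff_outer (CARD('n) - 1) (sphere (0::real^'n) 1) = emeasure cone_measure (UNIV :: (real^'n) set)"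
 by (rule antisym[OF hausdorff_le_cone_measure cone_measure_le_hausdorff])

theorem sphere_area_eq: "sphere_area TYPE('n::finite) = emeasure cone_measure (UNIV :: (real^'n) set)"
proof -
 have "sphere (0::real^'n) 1 \<in> sets borel" by simp
 from emeasure_hausdorff_measure[OF this] hausdorff_sphere_eq_cone_measure show ?thesis
  unfolding sphere_area_def by (rule trans)
qed

text \<open>The Hausdorff measure on the sphere is rotation invariant with the mass of the cone
 measure.\<close>

theorem two_Q_const_eq:
 fixes \<omega> :: "real^'n"
 assumes "norm \<omega> = 1"
 shows "2 * Q_const \<omega> = ennreal (1 / CARD('n)) * emeasure cone_measure (UNIV :: (real^'n) set)"
proof -
 have "(\<integral>\<^sup>+\<sigma>\<in>sphere 0 1. ennreal (\<bar>\<omega> \<bullet> \<sigma>\<bar>^2) \<partial>hausdorff_measure (CARD('n) - 1))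
   = (\<integral>\<^sup>+\<sigma>. ennreal ((\<omega> \<bullet> \<sigma>)^2) \<partial>sphere_hausdorff)"
 proof -
  have "indicator (sphere (0::real^'n) 1) \<in> borel_measurable (hausdorff_measure (CARD('n) - 1))"
   by (rule borel_measurable_indicator) simp
  moreover have "(%\<sigma>. ennreal ((\<omega> \<bullet> \<sigma>)^2)) \<in> borel_measurable (hausdorff_measure (CARD('n) - 1))"
   by measurable
  ultimately show ?thesis
   unfolding sphere_hausdorff_def by (subst nn_integral_density) (auto simp: mult.commute)
 qed
 also have "... = ennreal (1 / CARD('n)) * emeasure sphere_hausdorff (UNIV :: (real^'n) set)"
  using nn_integral_inner_square_sphere_invariant[OF sphere_invariant_sphere_hausdorff, of \<omega>] assms by simp
 also have "emeasure sphere_hausdorff (UNIV :: (real^'n) set) = emeasure cone_measure (UNIV :: (real^'n) set)"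
  using emeasure_sphere_hausdorff[of "UNIV :: (real^'n) set"] hausdorff_sphere_eq_cone_measure[where 'n='n] by simp
 finally show ?thesis
  by (simp add: Q_const_def ennreal_times_divide mult.commute[of 2] mult_divide_eq_ennreal)
qed

section \<open>Test functions\<close>

abbreviation pderivative :: "'n => (real^'n => real) => real^'n => real" where
 "pderivative j \<phi> \<equiv> (%x. frechet_derivative \<phi> (at x) (axis j 1))"

lemma differentiable_on_UNIV_iff: "f differentiable_on UNIV \<longleftrightarrow> (\<forall>x. f differentiable (at x))"
 by (simp add: differentiable_on_def)

lemma pderivative_eq:
 "(\<phi> has_derivative D) (at x) ==> pderivative j \<phi> x = D (axis j 1)"
 using frechet_derivative_at by metis

lemma C_k_Suc_imp: "C_k (Suc k) \<phi> ==> C_k k \<phi>"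
proof (induction k arbitrary: \<phi>)
 case 0 then show ?case by (simp add: differentiable_imp_continuous_on)
next
 case (Suc k) then show ?case by (metis C_k.simps(2))
qed

lemma C_k_const: "C_k k (%x. c)"
 by (induction k arbitrary: c) (auto simp: differentiable_on_def frechet_derivative_const)

lemma C_k_add: "C_k k f ==> C_k k g ==> C_k k (%x. f x + g x)"
proof (induction k arbitrary: f g)
 case 0 then show ?case by (auto intro: continuous_on_add)
next
 case (Suc k)
 have d: "(f has_derivative frechet_derivative f (at x)) (at x)" "(g has_derivative frechet_derivative g (at x)) (at x)" for x
  using Suc.prems by (auto simp: differentiable_on_UNIV_iff frechet_derivative_works)
 have "pderivative j (%x. f x + g x) = (%x. pderivative j f x + pderivative j g x)" for j
  by (rule ext, rule pderivative_eq[OF has_derivative_add[OF d]])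
 then show ?case using Suc by (auto intro: differentiable_on_add)
qed

lemma C_k_mult: "C_k k f ==> C_k k g ==> C_k k (%x. f x * g x)"
proof (induction k arbitrary: f g)
 case 0 then show ?case by (auto intro: continuous_on_mult)
next
 case (Suc k)
 have d: "(f has_derivative frechet_derivative f (at x)) (at x)" "(g has_derivative frechet_derivative g (at x)) (at x)" for x
  using Suc.prems by (auto simp: differentiable_on_UNIV_iff frechet_derivative_works)
 have "pderivative j (%x. f x * g x) = (%x. f x * pderivative j g x + pderivative j f x * g x)" for j
  by (rule ext, rule pderivative_eq[OF has_derivative_mult[OF d]])
 moreover have "C_k k f" "C_k k g" using Suc.prems by (auto intro: C_k_Suc_imp)
 ultimately show ?case using Suc by (auto intro!: differentiable_on_mult C_k_add)
qed

lemma C_k_sum: "finite I ==> (!!i. i \<in> I ==> C_k k (f i)) ==> C_k k (%x. \<Sum>i\<in>I. f i x)"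
 by (induction I rule: finite_induct) (auto intro: C_k_const C_k_add)

lemma C_k_component: "C_k k (%x. x $ i)"
proof (cases k)
 case (Suc m)
 have d: "((%x. x $ i) has_derivative (%x. x $ i)) (at x)" for x :: "real^'a"
  by (rule bounded_linear_imp_has_derivative) (rule bounded_linear_vec_nth)
 have "pderivative j (%x::real^'a. x $ i) = (%x. axis j 1 $ i)" for j
  by (rule ext, rule pderivative_eq[OF d])
 then show ?thesis using Suc d by (auto simp: differentiable_on_UNIV_iff differentiable_def intro: C_k_const)
qed (auto intro: continuous_intros)

text \<open>The outer functions form a sequence in which each is the derivative of its predecessor; this makes
 the induction on \<open>k\<close> possible.\<close>

lemma C_k_compose:
 assumes b: "!!l t. (b l has_real_derivative b (Suc l) t) (at t)" and q: "!!k. C_k k q"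
 shows "C_k k (%x. b l (q x))"
proof (induction k arbitrary: l)
 case 0
 have "continuous_on UNIV (b l)" using b by (meson DERIV_isCont continuous_at_imp_continuous_on)
 then show ?case using q[of 0] by (simp add: continuous_on_compose2)
next
 case (Suc k)
 have d: "(q has_derivative frechet_derivative q (at x)) (at x)" for x
  using q[of 1] by (auto simp: differentiable_on_UNIV_iff frechet_derivative_works)
 have d2: "((%x. b l (q x)) has_derivative (%h. b (Suc l) (q x) * frechet_derivative q (at x) h)) (at x)" for x
  using has_derivative_compose[OF d[of x], of "b l" "%h. b (Suc l) (q x) * h"] b[of l "q x"]
  by (simp add: has_field_derivative_def)
 have "pderivative j (%x. b l (q x)) = (%x. b (Suc l) (q x) * pderivative j q x)" for j
  by (rule ext, rule pderivative_eq[OF d2])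
 moreover have "C_k k (pderivative j q)" for j using q[of "Suc k"] by simp
 moreover have "(%x. b l (q x)) differentiable (at x)" for x by (rule differentiableI[OF d2])
 ultimately show ?case
  using Suc by (auto simp: differentiable_on_UNIV_iff intro!: C_k_mult)
qed

lemma pderivative_shift:
 assumes "\<phi> differentiable (at (x + h))"
 shows "pderivative j (%x. \<phi> (x + h)) x = pderivative j \<phi> (x + h)"
  and "(%x. \<phi> (x + h)) differentiable (at x)"
proof -
 have "((%x. x + h) has_derivative (%x. x)) (at x)" by (auto intro!: derivative_eq_intros)
 then have d: "((%x. \<phi> (x + h)) has_derivative frechet_derivative \<phi> (at (x + h))) (at x)"
  using has_derivative_compose[of "%x. x + h" "%x. x" x UNIV \<phi> "frechet_derivative \<phi> (at (x + h))"] assms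
  by (auto simp: frechet_derivative_works)
 show "pderivative j (%x. \<phi> (x + h)) x = pderivative j \<phi> (x + h)" by (rule pderivative_eq[OF d])
 show "(%x. \<phi> (x + h)) differentiable (at x)" using d by (auto simp: differentiable_def)
qed

lemma C_k_shift: "C_k k \<phi> ==> C_k k (%x. \<phi> (x + h))"
proof (induction k arbitrary: \<phi>)
 case 0 then show ?case
  by (auto intro!: continuous_on_compose2[of UNIV \<phi>] continuous_intros)
next
 case (Suc k)
 then have d: "\<phi> differentiable (at x)" for x by (auto simp: differentiable_on_UNIV_iff)
 have "pderivative j (%x. \<phi> (x + h)) = (%x. pderivative j \<phi> (x + h))" for j
  by (rule ext, rule pderivative_shift(1)[OF d])
 moreover have "C_k k (%x. pderivative j \<phi> (x + h))" for j
  using Suc.IH[of "pderivative j \<phi>"] Suc.prems by simp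
 ultimately show ?case using pderivative_shift(2)[OF d] by (auto simp: differentiable_on_UNIV_iff)
qed

lemma test_iff: "test_function \<phi> \<longleftrightarrow> (\<forall>k. C_k k \<phi>) & bounded {x. \<phi> x ~= 0}"
 by (simp add: test_function_def)

lemma test_lincomb:
 assumes "test_function \<phi>" "test_function \<psi>"
 shows "test_function (%x. a * \<phi> x + b * \<psi> x)"
proof -
 have "bounded {x. a * \<phi> x + b * \<psi> x ~= 0}"
  by (rule bounded_subset[of "{x. \<phi> x ~= 0} \<union> {x. \<psi> x ~= 0}"])
   (use assms in \<open>auto simp: test_iff\<close>)
 then show ?thesis using assms by (auto simp: test_iff intro!: C_k_add C_k_mult C_k_const)
qed

lemma test_zero: "test_function (%x. 0)"
 by (auto simp: test_iff intro: C_k_const)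

lemma test_shift:
 assumes "test_function \<phi>" shows "test_function (%x. \<phi> (x + h))"
proof -
 have "{x. \<phi> (x + h) ~= 0} = (%x. x - h) ` {x. \<phi> x ~= 0}" by (force intro: image_eqI[where x="_ + h"])
 then have "bounded {x. \<phi> (x + h) ~= 0}" using assms by (simp add: test_iff bounded_translation_minus)
 then show ?thesis using assms by (auto simp: test_iff intro: C_k_shift)
qed

lemma test_continuous: "test_function \<phi> ==> continuous_on UNIV \<phi>"
 by (metis C_k.simps(1) test_function_def)

lemma test_measurable: "test_function \<phi> ==> \<phi> \<in> borel_measurable borel"
 by (rule borel_measurable_continuous_onI[OF test_continuous])

lemma test_support:
 assumes "test_function \<phi>" obtains R where "R > 0" "!!x. norm x \<ge> R ==> \<phi> x = 0"
proof -
 obtain b where b: "b > 0" "!!x. \<phi> x ~= 0 ==> norm x <= b"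
  using assms unfolding test_iff bounded_pos by blast
 show thesis by (rule that[of "b + 1"]) (use b in \<open>force+\<close>)
qed

lemma test_differentiable: "test_function \<phi> ==> \<phi> differentiable (at x)"
 using differentiable_on_UNIV_iff[of \<phi>] C_k.simps(2)[of 0 \<phi>] unfolding test_function_def by blast

lemma test_pderivative:
 assumes \<phi>: "test_function \<phi>" shows "test_function (pderivative j \<phi>)"
proof -
 obtain R where R: "R > 0" "!!x. norm x \<ge> R ==> \<phi> x = 0" using test_support[OF \<phi>] by blast
 have "pderivative j \<phi> x = 0" if "norm x > R" for x
 proof -
  have "open {x. norm x > R}" by (intro open_Collect_less continuous_intros)
  then have "(\<phi> has_derivative (%_. 0)) (at x)"
   by (rule has_derivative_transform_within_open[of "%_. 0", rotated]) (use that R in \<open>auto intro: less_imp_le\<close>)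
  then show ?thesis by (rule pderivative_eq)
 qed
 then have "{x. pderivative j \<phi> x ~= 0} \<subseteq> cball 0 R" by (force simp: not_less[symmetric])
 then have "bounded {x. pderivative j \<phi> x ~= 0}" using bounded_cball bounded_subset by blast
 moreover have "C_k k (pderivative j \<phi>)" for k
  using \<phi> C_k.simps(2)[of k \<phi>] unfolding test_function_def by blast
 ultimately show ?thesis by (auto simp: test_iff)
qed

definition grad :: "(real^'n => real) => real^'n => real^'n" where
 "grad \<phi> x = (\<chi> j. pderivative j \<phi> x)"

lemma frechet_derivative_eq_grad:
 fixes \<phi> :: "real^'n => real"
 assumes "\<phi> differentiable (at x)"
 shows "frechet_derivative \<phi> (at x) h = h \<bullet> grad \<phi> x"
proof -
 interpret l: linear "frechet_derivative \<phi> (at x)" by (rule linear_frechet_derivative[OF assms])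
 have "frechet_derivative \<phi> (at x) h = frechet_derivative \<phi> (at x) (\<Sum>j\<in>UNIV. (h $ j) *\<^sub>R axis j 1)"
  using basis_expansion[of h] by (simp add: scalar_mult_eq_scaleR)
 also have "... = (\<Sum>j\<in>UNIV. h $ j * pderivative j \<phi> x)" by (simp add: l.sum l.scale)
 finally show ?thesis by (simp add: grad_def inner_vec_def)
qed

lemma test_has_derivative:
 "test_function \<phi> ==> (\<phi> has_derivative (%h. h \<bullet> grad \<phi> x)) (at x)"
 using test_differentiable[of \<phi> x] frechet_derivative_eq_grad[of \<phi> x]
 by (auto simp: frechet_derivative_works) (metis ext)

lemma test_bounded: assumes "test_function \<phi>" obtains B where "B > 0" "!!x. \<bar>\<phi> x\<bar> <= B"
proof -
 obtain R where R: "R > 0" "!!x. norm x \<ge> R ==> \<phi> x = 0" using test_support[OF assms] by blast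
 have "compact (\<phi> ` cball 0 R)"
  by (intro compact_continuous_image continuous_on_subset[OF test_continuous[OF assms]]) auto
 then obtain B where B: "B > 0" "!!y. y \<in> \<phi> ` cball 0 R ==> norm y <= B"
  using compact_imp_bounded bounded_pos by metis
 have "\<bar>\<phi> x\<bar> <= B" for x
  by (cases "norm x <= R") (use B R(2)[of x] in auto)
 then show thesis using that B(1) by blast
qed

lemma grad_continuous: assumes "test_function \<phi>" shows "continuous_on UNIV (grad \<phi>)"
proof -
 have "continuous_on UNIV (pderivative j \<phi>)" for j
  by (rule test_continuous[OF test_pderivative[OF assms]])
 then show ?thesis unfolding grad_def by (intro continuous_on_vec_lambda)
qed

lemma grad_bounded: assumes "test_function \<phi>" obtains B where "B > 0" "!!x. norm (grad \<phi> x) <= B"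
proof -
 have "\<forall>j. \<exists>B. B > 0 & (\<forall>x. \<bar>pderivative j \<phi> x\<bar> <= B)"
  using test_bounded[OF test_pderivative[OF assms]] by metis
 then obtain B where B: "!!j. B j > 0" "!!j x. \<bar>pderivative j \<phi> x\<bar> <= B j" by metis
 have "norm (grad \<phi> x) <= (\<Sum>j\<in>UNIV. B j)" for x
 proof -
  have "norm (grad \<phi> x) <= (\<Sum>j\<in>UNIV. \<bar>grad \<phi> x $ j\<bar>)" by (rule norm_le_l1_cart)
  also have "... <= (\<Sum>j\<in>UNIV. B j)" by (intro sum_mono) (use B in \<open>simp add: grad_def\<close>)
  finally show ?thesis .
 qed
 then show thesis using that[of "\<Sum>j\<in>UNIV. B j"] B(1) by (simp add: sum_pos)
qed

lemma test_lipschitz: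
 assumes "test_function \<phi>" "!!x. norm (grad \<phi> x) <= B"
 shows "\<bar>\<phi> y - \<phi> x\<bar> <= B * norm (y - x)"
proof -
 have "norm (\<phi> y - \<phi> x) <= B * norm (y - x)"
 proof (rule differentiable_bound[of UNIV])
  show "(\<phi> has_derivative (%h. h \<bullet> grad \<phi> x)) (at x within UNIV)" for x
   using test_has_derivative[OF assms(1)] by simp
  have "norm (h \<bullet> grad \<phi> x) <= norm h * B" for h x
   using Cauchy_Schwarz_ineq2[of h "grad \<phi> x"] assms(2)[of x]
   by (metis mult_left_mono norm_ge_zero order_trans real_norm_def)
  then show "onorm (%h. h \<bullet> grad \<phi> x) <= B" for x by (intro onorm_le) (simp add: mult.commute)
 qed auto
 then show ?thesis by simp
qed

section \<open>Smooth bumps\<close>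

lemma tendsto_poly_exp_at_top:
 "((%y::real. y ^ n * poly p y * exp (- y)) \<longlongrightarrow> 0) at_top"
proof (induction p arbitrary: n)
 case 0 then show ?case by simp
next
 case (pCons a p)
 have "((%y::real. a * (y ^ n / exp y) + y ^ Suc n * poly p y * exp (- y)) \<longlongrightarrow> a * 0 + 0) at_top"
  by (intro tendsto_add tendsto_mult tendsto_const tendsto_power_div_exp_0 pCons.IH)
 then show ?case by (simp add: algebra_simps exp_minus divide_inverse)
qed

primrec bump_poly :: "nat => real poly" where
 "bump_poly 0 = 1"
| "bump_poly (Suc l) = [:0, 0, 1:] * (bump_poly l - pderiv (bump_poly l))"

text \<open>The derivatives of the standard function \<open>exp (-1/t)\<close> extended by zero.\<close>

definition bump_deriv :: "nat => real => real" where
 "bump_deriv l t = (if t <= 0 then 0 else poly (bump_poly l) (inverse t) * exp (- inverse t))"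

lemma bump_deriv_has_derivative: "(bump_deriv l has_real_derivative bump_deriv (Suc l) t) (at t)"
proof -
 consider "t < 0" | "t > 0" | "t = 0" by linarith
 then show ?thesis
 proof cases
  case 1
  have "((%_. 0) has_real_derivative 0) (at t)" by simp
  then have "(bump_deriv l has_real_derivative 0) (at t)"
   by (rule has_field_derivative_transform_within_open[of _ _ _ "{..<0}"])
    (use 1 in \<open>auto simp: bump_deriv_def\<close>)
  then show ?thesis using 1 by (simp add: bump_deriv_def)
 next
  case 2
  have "((%t. poly (bump_poly l) (inverse t) * exp (- inverse t)) has_real_derivative bump_deriv (Suc l) t) (at t)"
   using 2 by (auto intro!: derivative_eq_intros simp: bump_deriv_def field_simps power2_eq_square)
  then show ?thesis
   by (rule has_field_derivative_transform_within_open[of _ _ _ "{0<..}"])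
    (use 2 in \<open>auto simp: bump_deriv_def\<close>)
 next
  case 3
  have "((%y. bump_deriv l y / y) \<longlongrightarrow> 0) (at 0)"
  proof (rule filterlim_split_at)
   show "((%y. bump_deriv l y / y) \<longlongrightarrow> 0) (at_left 0)"
    by (rule tendsto_eventually) (auto simp: eventually_at_left_field bump_deriv_def intro!: exI[of _ "-1"])
   have "((%y. inverse y ^ 1 * poly (bump_poly l) (inverse y) * exp (- inverse y)) \<longlongrightarrow> 0) (at_right 0)"
    by (rule filterlim_compose[OF tendsto_poly_exp_at_top filterlim_inverse_at_top_right])
   then show "((%y. bump_deriv l y / y) \<longlongrightarrow> 0) (at_right 0)"
    by (rule Lim_transform_eventually)
     (auto simp: eventually_at_right_field bump_deriv_def divide_inverse mult_ac intro!: exI[of _ 1])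
  qed
  then show ?thesis using 3 by (simp add: has_field_derivative_iff bump_deriv_def)
 qed
qed

text \<open>As \<open>m\<close> grows, these functions tend to the indicator of \<open>ball a
 r\<close>.\<close>

definition ball_bump :: "real^'n => real => nat => real^'n => real" where
 "ball_bump a r m x = bump_deriv 0 (real (Suc m) * (r^2 - (norm (x - a))^2))"

lemma ball_bump_range: "0 <= ball_bump a r m x" "ball_bump a r m x <= 1"
proof -
 have "0 <= bump_deriv 0 t" "bump_deriv 0 t <= 1" for t by (auto simp: bump_deriv_def)
 then show "0 <= ball_bump a r m x" "ball_bump a r m x <= 1" by (auto simp: ball_bump_def)
qed

lemma ball_bump_outside:
 assumes "r > 0" "x \<notin> ball a r" shows "ball_bump a r m x = 0"
proof -
 have "r^2 <= (norm (x - a))^2" using assms by (intro power_mono) (auto simp: dist_norm norm_minus_commute)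
 then have "real (Suc m) * (r^2 - (norm (x - a))^2) <= 0" by (intro mult_nonneg_nonpos) auto
 then show ?thesis by (simp add: ball_bump_def bump_deriv_def)
qed

lemma test_ball_bump:
 assumes "r > 0" shows "test_function (ball_bump a r m)"
proof -
 have "C_k k (%x. real (Suc m) * (r^2 - (norm (x - a))^2))" for k
 proof -
  have "(%x. real (Suc m) * (r^2 - (norm (x - a))^2))
    = (%x. real (Suc m) * (r^2 + (-1) * (\<Sum>i\<in>UNIV. (x $ i + (- a $ i)) * (x $ i + (- a $ i)))))"
  proof
   fix x :: "real^'a"
   have "(norm (x - a))^2 = (\<Sum>i\<in>UNIV. (x $ i - a $ i) * (x $ i - a $ i))"
    by (simp add: power2_norm_eq_inner inner_vec_def)
   then show "real (Suc m) * (r^2 - (norm (x - a))^2)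
    = real (Suc m) * (r^2 + (-1) * (\<Sum>i\<in>UNIV. (x $ i + (- a $ i)) * (x $ i + (- a $ i))))" by simp
  qed
  then show ?thesis
   by (simp only:) (intro C_k_mult C_k_const C_k_add C_k_sum C_k_component, auto)
 qed
 then have "C_k k (ball_bump a r m)" for k
  unfolding ball_bump_def[abs_def] by (rule C_k_compose[of bump_deriv, OF bump_deriv_has_derivative])
 moreover have "{x. ball_bump a r m x ~= 0} \<subseteq> ball a r" using ball_bump_outside[OF assms] by blast
 then have "bounded {x. ball_bump a r m x ~= 0}" using bounded_ball bounded_subset by blast
 ultimately show ?thesis by (simp add: test_iff)
qed

lemma ball_bump_tendsto:
 assumes "r > 0" shows "(%m. ball_bump a r m x) \<longlonglongrightarrow> indicator (ball a r) x"
proof (cases "x \<in> ball a r")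
 case True
 define s where "s = r^2 - (norm (x - a))^2"
 have "(norm (x - a))^2 < r^2" using True by (intro power_strict_mono) (auto simp: dist_norm norm_minus_commute)
 then have s: "s > 0" by (simp add: s_def)
 have "(%m. exp (- (inverse s * inverse (real (Suc m))))) \<longlonglongrightarrow> exp (- (inverse s * 0))"
  by (intro tendsto_exp tendsto_minus tendsto_mult tendsto_const LIMSEQ_inverse_real_of_nat)
 moreover have "ball_bump a r m x = exp (- (inverse s * inverse (real (Suc m))))" for m
 proof -
  have "real (Suc m) * s > 0" using s by (intro mult_pos_pos) auto
  then show ?thesis by (simp add: ball_bump_def bump_deriv_def s_def[symmetric] mult.commute)
 qed
 ultimately show ?thesis using True by simp
next
 case False
 then show ?thesis using ball_bump_outside[OF assms False] by simp
qed

lemma pderivative_lincomb: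
 assumes "test_function v" "test_function z"
 shows "pderivative j (%x. a * v x + b * z x) x = a * pderivative j v x + b * pderivative j z x"
proof -
 have "(v has_derivative frechet_derivative v (at x)) (at x)" "(z has_derivative frechet_derivative z (at x)) (at x)"
  using test_differentiable[OF assms(1)] test_differentiable[OF assms(2)] by (auto simp: frechet_derivative_works)
 then have "((%x. a * v x + b * z x) has_derivative (%h. a * frechet_derivative v (at x) h + b * frechet_derivative z (at x) h)) (at x)"
  by (intro has_derivative_add has_derivative_mult_right)
 from pderivative_eq[OF this] show ?thesis .
qed

section \<open>Consequences of the Vitali covering theorem\<close>

text \<open>The Vitali covering theorem, for centres that need not lie in \<open>S\<close> and with a side
 condition \<open>P\<close> on the balls.\<close>

lemma Vitali_open_balls:
 fixes U :: "'a::euclidean_space set"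
 assumes "S \<subseteq> U" "open U" and P: "!!x d. x \<in> S ==> d > 0 ==> \<exists>a r. 0 < r & r < d & x \<in> ball a r & P a r"
 obtains C where "countable C" "!!a r. (a, r) \<in> C ==> 0 < r & ball a r \<subseteq> U & P a r"
  "disjoint_family_on (%(a, r). ball a r) C" "negligible (S - (\<Union>(a, r)\<in>C. ball a r))"
proof -
 define K where "K = {(a, r). 0 < r & ball a r \<subseteq> U & P a r}"
 have K: "\<exists>i. i \<in> K & x \<in> ball (fst i) (snd i) & snd i < d" if x: "x \<in> S" and d: "d > 0" for x d
 proof -
  obtain e where e: "e > 0" "ball x e \<subseteq> U" using assms(1,2) x open_contains_ball by (metis subsetD)
  obtain a r where ar: "0 < r" "r < min d (e / 2)" "x \<in> ball a r" "P a r"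
   using P[OF x, of "min d (e / 2)"] d e(1) by auto
  have "ball a r \<subseteq> ball x e"
  proof
   fix y assume "y \<in> ball a r"
   then have "dist x y < e" using ar(2,3) dist_triangle2[of x y a] by (simp add: dist_commute)
   then show "y \<in> ball x e" by simp
  qed
  then have "(a, r) \<in> K" using ar e(2) by (auto simp: K_def)
  then show ?thesis using ar by (intro exI[of _ "(a, r)"]) auto
 qed
 obtain C where C: "countable C" "C \<subseteq> K"
  "pairwise (%i j. disjnt (ball (fst i) (snd i)) (ball (fst j) (snd j))) C"
  "negligible (S - (\<Union>i\<in>C. ball (fst i) (snd i)))"
  using Vitali_covering_theorem_balls[of S K fst snd, OF K] by blast
 show thesis
 proof (rule that[of C])
  show "disjoint_family_on (%(a, r). ball a r) C"
   using C(3) by (simp add: case_prod_unfold disjoint_family_on_def pairwise_def disjnt_def)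
  show "negligible (S - (\<Union>(a, r)\<in>C. ball a r))" using C(4) by (simp add: case_prod_unfold)
 qed (use C in \<open>auto simp: K_def\<close>)
qed

lemma emeasure_balls_Un:
 fixes M :: "'a::euclidean_space measure"
 assumes "countable C" "disjoint_family_on (%(a, r). ball a r) C" "sets M = sets borel"
 shows "emeasure M (\<Union>(a, r)\<in>C. ball a r) = (\<integral>\<^sup>+(a, r). emeasure M (ball a r) \<partial>count_space C)"
 unfolding case_prod_unfold
 by (rule emeasure_UN_countable) (use assms in \<open>simp_all add: case_prod_unfold\<close>)

lemma sets_balls_Un:
 "countable C ==> (\<Union>(a, r)\<in>C. ball a r) \<in> sets (borel :: 'a::euclidean_space measure)"
 by (intro borel_open open_UN) auto

text \<open>An open set is a disjoint union of balls up to a null set, so the comparison extends from balls to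
 open sets and, by outer regularity, to Borel sets. On the set where \<open>q\<close> is positive
 \<open>p\<close> vanishes.\<close>

lemma AE_le_of_balls:
 fixes p q :: "'a::euclidean_space => ennreal"
 assumes [measurable]: "borel_fun p" "borel_fun q"
  and fin: "!!R. (NN x. p x * indicator (ball 0 R) x) < \<infinity>"
  and le: "!!a r. 0 < r ==> (NN x. q x * indicator (ball a r) x) <= (NN x. p x * indicator (ball a r) x)"
  and pq: "!!x. p x = 0 \<or> q x = 0"
 shows "AE x in lborel. q x = 0"
proof -
 have openle: "emeasure (density lborel q) U <= emeasure (density lborel p) U" if U: "open U" for U
 proof -
  obtain C where C: "countable C" "!!a r. (a, r) \<in> C ==> 0 < r & ball a r \<subseteq> U & True"
   "disjoint_family_on (%(a, r). ball a r) C" "negligible (U - (\<Union>(a, r)\<in>C. ball a r))"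
  proof (rule Vitali_open_balls[of U U "%a r. True"])
   show "\<exists>a r. 0 < r & r < d & x \<in> ball a r & True" if "d > 0" for x :: 'a and d
    using that by (intro exI[of _ x] exI[of _ "d/2"]) auto
  qed (use U in blast)+
  define W where "W = (\<Union>(a, r)\<in>C. ball a r)"
  have W[measurable]: "W \<in> sets borel" unfolding W_def by (rule sets_balls_Un[OF C(1)])
  have [measurable]: "U \<in> sets borel" using U by simp
  have WU: "W \<subseteq> U" using C(2) by (auto simp: W_def)
  have "U - W \<in> null_sets lebesgue" using C(4) by (simp add: W_def negligible_iff_null_sets)
  then have "U - W \<in> null_sets lborel" by (simp add: null_sets_completion_iff)
  then have AEW: "AE x in lborel. x \<notin> U - W" by (rule AE_not_in)
  have "(NN x. q x * indicator U x) = (NN x. q x * indicator W x)"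
  proof (rule nn_integral_cong_AE)
   show "AE x in lborel. q x * indicator U x = q x * indicator W x"
    using AEW by eventually_elim (use WU in \<open>auto simp: indicator_def\<close>)
  qed
  then have "emeasure (density lborel q) U = emeasure (density lborel q) W"
   by (simp add: emeasure_density)
  also have "... = (\<integral>\<^sup>+(a, r). emeasure (density lborel q) (ball a r) \<partial>count_space C)"
   unfolding W_def by (rule emeasure_balls_Un[OF C(1,3)]) simp
  also have "... <= (\<integral>\<^sup>+(a, r). emeasure (density lborel p) (ball a r) \<partial>count_space C)"
   using C(2) le by (intro nn_integral_mono) (auto simp: emeasure_density split: prod.splits)
  also have "... = emeasure (density lborel p) W"
   unfolding W_def by (rule emeasure_balls_Un[OF C(1,3), symmetric]) simp
  also have "... <= emeasure (density lborel p) U" by (rule emeasure_mono[OF WU]) simp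
  finally show ?thesis .
 qed
 have "AE x in lborel. q x * indicator (ball 0 (real n)) x = 0" for n
 proof -
  define B where "B = ball (0::'a) (real n)"
  define M where "M = density lborel (%x. p x * indicator B x)"
  have [measurable]: "B \<in> sets borel" by (simp add: B_def)
  have "emeasure M UNIV = (NN x. p x * indicator B x)"
   unfolding M_def by (subst emeasure_density) auto
  then have M: "sets M = sets borel" "emeasure M (space M) ~= \<infinity>"
   using fin[of n] by (simp_all add: M_def B_def)
  define E where "E = {x. q x ~= 0} \<inter> B"
  have "{x \<in> space borel. q x ~= 0} \<in> sets borel" by measurable
  then have E: "E \<in> sets borel" by (simp add: E_def)
  have "emeasure M E = (\<integral>\<^sup>+x. 0 \<partial>(lborel :: 'a measure))"
  proof -
   have "p x * indicator B x * indicator E x = 0" for x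
    using pq[of x] by (cases "q x = 0") (auto simp: E_def)
   then have "(NN x. p x * indicator B x * indicator E x) = (\<integral>\<^sup>+x. 0 \<partial>(lborel :: 'a measure))"
    by (intro nn_integral_cong)
   moreover have "emeasure M E = (NN x. p x * indicator B x * indicator E x)"
    unfolding M_def by (rule emeasure_density) (use E in auto)
   ultimately show ?thesis by (simp only:)
  qed
  then have ME: "emeasure M E = 0" by simp
  have "emeasure (density lborel q) E <= emeasure M U" if U: "E \<subseteq> U" "open U" for U
  proof -
   have "emeasure (density lborel q) E <= emeasure (density lborel q) (U \<inter> B)"
    using U by (intro emeasure_mono) (auto simp: E_def B_def)
   also have "... <= emeasure (density lborel p) (U \<inter> B)"
    using U(2) by (intro openle) (auto simp: B_def)
   also have "... = emeasure M U"
    unfolding M_def using U(2) by (simp add: emeasure_density)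
     (auto intro!: nn_integral_cong simp: indicator_def)
   finally show ?thesis .
  qed
  then have "emeasure (density lborel q) E <= (INF U\<in>{U. E \<subseteq> U & open U}. emeasure M U)"
   by (intro INF_greatest) auto
  also have "... = emeasure M E" by (rule outer_regular[OF M E, symmetric])
  finally have "emeasure (density lborel q) E = 0" using ME by simp
  then have "(NN x. q x * indicator E x) = 0" using E by (simp add: emeasure_density)
  then have "AE x in lborel. q x * indicator E x = 0" using E by (simp add: nn_integral_0_iff_AE)
  then show ?thesis by eventually_elim (auto simp: E_def B_def indicator_def)
 qed
 then have "AE x in lborel. \<forall>n. q x * indicator (ball 0 (real n)) x = 0" unfolding AE_all_countable by blast
 then show ?thesis
 proof eventually_elim
  case (elim x)
  obtain n where "norm x < real n" using reals_Archimedean2 by blast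
  then show ?case using elim[rule_format, of n] by simp
 qed
qed

text \<open>Local integrability with respect to Borel sets; working with \<open>lborel\<close> makes Fubini's
 theorem and translations available, and completion is dealt with at the end.\<close>

definition locint :: "('a::euclidean_space => 'b::{banach, second_countable_topology}) => bool" where
 "locint f \<longleftrightarrow> f \<in> borel_measurable borel & (\<forall>R. integrable lborel (%x. indicator (ball 0 R) x *\<^sub>R f x))"

lemma locint_bounded_mult:
 fixes f :: "'a::euclidean_space => 'b::{real_normed_algebra, banach, second_countable_topology}"
 assumes f: "locint f" and [measurable]: "borel_fun g"
  and B: "!!x. norm (g x) <= B" and R: "!!x. norm x \<ge> R ==> g x = 0"
 shows "integrable lborel (%x. f x * g x)"
proof (rule Bochner_Integration.integrable_bound)
 have [measurable]: "borel_fun f" using f by (simp add: locint_def)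
 show "(%x. f x * g x) \<in> borel_measurable lborel" by (intro borel_measurable_times) (use assms(2) in measurable)
 show "integrable lborel (%x. B * norm (indicator (ball 0 R) x *\<^sub>R f x))"
  using f by (intro integrable_mult_right integrable_norm) (simp add: locint_def)
 show "AE x in lborel. norm (f x * g x) <= norm (B * norm (indicator (ball 0 R) x *\<^sub>R f x))"
 proof (rule AE_I2)
  fix x
  have B0: "B \<ge> 0" using B[of x] norm_ge_zero order_trans by blast
  show "norm (f x * g x) <= norm (B * norm (indicator (ball 0 R) x *\<^sub>R f x))"
  proof (cases "norm x < R")
   case True
   have "norm (f x * g x) <= norm (f x) * norm (g x)" by (rule norm_mult_ineq)
   also have "... <= norm (f x) * B" by (intro mult_left_mono B) simp
   finally show ?thesis using True B0 by (simp add: mult.commute)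
  qed (use R in auto)
 qed
qed

text \<open>Bumps that tend to the indicator of a ball show that the negative part of \<open>f\<close> is
 dominated by the positive part on all balls.\<close>

theorem nonneg_AE_of_test_functions:
 fixes f :: "real^'n => real"
 assumes f: "locint f"
  and pos: "!!\<phi>. test_function \<phi> ==> (!!x. 0 <= \<phi> x) ==> 0 <= (LBINT x. f x * \<phi> x)"
 shows "AE x in lborel. 0 <= f x"
proof -
 have [measurable]: "borel_fun f" using f by (simp add: locint_def)
 have int: "integrable lborel (%x. f x * indicator (ball a r) x)" for a r
  by (rule locint_bounded_mult[OF f, where B=1 and R="norm a + \<bar>r\<bar>"])
   (auto simp: indicator_def dist_norm, use norm_triangle_sub[of _ a] in \<open>smt (verit) norm_minus_commute\<close>)
 have ball: "0 <= (LBINT x. f x * indicator (ball a r) x)" if r: "r > 0" for a r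
 proof -
  have "(%m. \<integral>x. f x * ball_bump a r m x \<partial>lborel) \<longlonglongrightarrow> (LBINT x. f x * indicator (ball a r) x)"
  proof (rule integral_dominated_convergence[where w="%x. norm (f x * indicator (ball a r) x)"])
   show "(%x. f x * ball_bump a r m x) \<in> borel_measurable lborel" for m
    using test_measurable[OF test_ball_bump[OF r]] by measurable
   show "AE x in lborel. (%m. f x * ball_bump a r m x) \<longlonglongrightarrow> f x * indicator (ball a r) x"
    by (intro AE_I2 tendsto_mult tendsto_const ball_bump_tendsto[OF r])
   show "AE x in lborel. norm (f x * ball_bump a r m x) <= norm (f x * indicator (ball a r) x)" for m
   proof (rule AE_I2)
    fix x show "norm (f x * ball_bump a r m x) <= norm (f x * indicator (ball a r) x)"
     using ball_bump_outside[OF r, of x a m] ball_bump_range[of a r m x]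
     by (cases "x \<in> ball a r") (auto simp: abs_mult mult_left_le)
   qed
  qed (use int in auto)
  moreover have "0 <= (LBINT x. f x * ball_bump a r m x)" for m
   by (intro pos test_ball_bump[OF r] ball_bump_range)
  ultimately show ?thesis by (intro LIMSEQ_le_const) auto
 qed
 have int': "integrable lborel (%x. max 0 (f x) * indicator (ball a r) x)" "integrable lborel (%x. max 0 (- f x) * indicator (ball a r) x)" for a r
  by (rule Bochner_Integration.integrable_bound[OF int[of a r]]; auto simp: indicator_def)+
 have "AE x in lborel. ennreal (max 0 (- f x)) = 0"
 proof (rule AE_le_of_balls[of "%x. ennreal (max 0 (f x))"])
  have eq: "(NN x. ennreal (max 0 (g x)) * indicator (ball a r) x) = ennreal (LBINT x. max 0 (g x) * indicator (ball a r) x)"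
   if "integrable lborel (%x. max 0 (g x) * indicator (ball a r) x)" for g :: "real^'n => real" and a r
   using that by (subst nn_integral_eq_integral[symmetric]) (auto intro!: nn_integral_cong simp: indicator_def)
  show "(NN x. ennreal (max 0 (f x)) * indicator (ball 0 R) x) < \<infinity>" for R
   by (subst eq[OF int'(1)]) simp
  show "(NN x. ennreal (max 0 (- f x)) * indicator (ball a r) x)
   <= (NN x. ennreal (max 0 (f x)) * indicator (ball a r) x)" if "0 < r" for a r
  proof -
   have "(LBINT x. max 0 (f x) * indicator (ball a r) x) - (LBINT x. max 0 (- f x) * indicator (ball a r) x)
    = (LBINT x. max 0 (f x) * indicator (ball a r) x - max 0 (- f x) * indicator (ball a r) x)"
    by (rule Bochner_Integration.integral_diff[symmetric]) (rule int')+
   also have "... = (LBINT x. f x * indicator (ball a r) x)"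
    by (rule Bochner_Integration.integral_cong) (auto simp: indicator_def max_def)
   finally have "(LBINT x. max 0 (- f x) * indicator (ball a r) x) <= (LBINT x. max 0 (f x) * indicator (ball a r) x)"
    using ball[OF that, of a] by simp
   then show ?thesis by (simp add: eq int' ennreal_leI)
  qed
 qed (auto simp: max_def)
 then show ?thesis by eventually_elim (auto simp: max_def ennreal_eq_0_iff split: if_splits)
qed

theorem zero_AE_of_test_functions:
 fixes f :: "real^'n => real"
 assumes f: "locint f" and zero: "!!\<phi>. test_function \<phi> ==> (LBINT x. f x * \<phi> x) = 0"
 shows "AE x in lborel. f x = 0"
proof -
 have "AE x in lborel. 0 <= f x" by (rule nonneg_AE_of_test_functions[OF f]) (simp add: zero)
 moreover have "AE x in lborel. 0 <= - f x"
 proof (rule nonneg_AE_of_test_functions)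
  show "locint (%x. - f x)" using f by (simp add: locint_def)
 qed (simp add: zero)
 ultimately show ?thesis by eventually_elim auto
qed

section \<open>The Lebesgue density theorem\<close>

definition density_point :: "'a::euclidean_space set => 'a => bool" where
 "density_point E x \<longleftrightarrow> (\<forall>\<eta>>0. \<exists>\<delta>>0. \<forall>r. 0 < r & r < \<delta> -->
   measure lborel (ball x r - E) <= \<eta> * measure lborel (ball x r))"

text \<open>Cover \<open>S\<close>, inside an open set \<open>U\<close>, by disjoint balls in which
 \<open>E\<close> has density below \<open>1 - \<eta>\<close>. Then the outer measure of \<open>S\<close> is at
 most \<open>1 - \<eta>\<close> times the measure of \<open>U\<close>, for every such \<open>U\<close>.\<close>

lemma negligible_low_density:
 fixes E :: "'a::euclidean_space set"
 assumes E[measurable]: "E \<in> sets borel" and \<eta>: "0 < \<eta>" "\<eta> < 1" and S: "bounded S" "S \<subseteq> E"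
  and low: "!!x \<delta>. x \<in> S ==> \<delta> > 0 ==> \<exists>r. 0 < r & r < \<delta> & measure lborel (ball x r - E) > \<eta> * measure lborel (ball x r)"
 shows "negligible S"
proof -
 define \<U> where "\<U> = {U. open U & S \<subseteq> U}"
 define m where "m = (INF U\<in>\<U>. emeasure lborel U)"
 have step: "m <= ennreal (1 - \<eta>) * emeasure lborel U" if U: "open U" "S \<subseteq> U" for U
 proof -
  obtain C where C: "countable C"
   "!!a r. (a, r) \<in> C ==> 0 < r & ball a r \<subseteq> U & measure lborel (ball a r - E) > \<eta> * measure lborel (ball a r)"
   "disjoint_family_on (%(a, r). ball a r) C" "negligible (S - (\<Union>(a, r)\<in>C. ball a r))"
  proof (rule Vitali_open_balls[of S U "%a r. measure lborel (ball a r - E) > \<eta> * measure lborel (ball a r)"])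
   show "\<exists>a r. 0 < r & r < d & x \<in> ball a r & measure lborel (ball a r - E) > \<eta> * measure lborel (ball a r)"
    if "x \<in> S" "d > 0" for x d
    using low[OF that] by (metis centre_in_ball)
  qed (use U in blast)+
  define W where "W = (\<Union>(a, r)\<in>C. ball a r)"
  have W[measurable]: "W \<in> sets borel" unfolding W_def by (rule sets_balls_Un[OF C(1)])
  have WU: "W \<subseteq> U" using C(2) by (auto simp: W_def)
  have ball: "emeasure lborel (ball a r \<inter> E) <= ennreal (1 - \<eta>) * emeasure lborel (ball a r)" if "(a, r) \<in> C" for a r
  proof -
   have fm: "ball a r \<in> fmeasurable lborel" using emeasure_lborel_ball_finite[of a r] by (intro fmeasurableI) auto
   have "measure lborel (ball a r \<inter> E) = measure lborel (ball a r) - measure lborel (ball a r - E)"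
   proof -
    have "measure lborel (ball a r - (ball a r - E)) = measure lborel (ball a r) - measure lborel (ball a r - E)"
     by (rule measurable_measure_Diff[OF fm]) auto
    moreover have "ball a r - (ball a r - E) = ball a r \<inter> E" by auto
    ultimately show ?thesis by simp
   qed
   also have "... <= (1 - \<eta>) * measure lborel (ball a r)"
    using C(2)[OF that] by (simp add: algebra_simps)
   finally have "ennreal (measure lborel (ball a r \<inter> E)) <= ennreal (1 - \<eta>) * ennreal (measure lborel (ball a r))"
    using \<eta> by (simp add: ennreal_mult[symmetric] ennreal_leI)
   moreover have "ball a r \<inter> E \<in> fmeasurable lborel" using fm by (rule fmeasurable_Int_fmeasurable) simp
   ultimately show ?thesis using fm by (simp add: fmeasurable_def emeasure_eq_ennreal_measure)
  qed
  have "emeasure lborel (W \<inter> E) = (\<integral>\<^sup>+(a, r). emeasure lborel (ball a r \<inter> E) \<partial>count_space C)"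
  proof -
   have "W \<inter> E = (\<Union>i\<in>C. (case i of (a, r) => ball a r \<inter> E))" by (auto simp: W_def)
   moreover have "disjoint_family_on (%i. case i of (a, r) => ball a r \<inter> E) C"
    using C(3) by (fastforce simp: disjoint_family_on_def split: prod.splits)
   ultimately show ?thesis
    using emeasure_UN_countable[of C "%i. case i of (a, r) => ball a r \<inter> E" lborel] C(1)
    by (simp add: case_prod_unfold)
  qed
  also have "... <= (\<integral>\<^sup>+i. ennreal (1 - \<eta>) * (case i of (a, r) => emeasure lborel (ball a r)) \<partial>count_space C)"
   using ball by (intro nn_integral_mono) (auto split: prod.splits)
  also have "... = ennreal (1 - \<eta>) * emeasure lborel W"
   unfolding W_def by (subst emeasure_balls_Un[OF C(1,3)]) (simp_all add: nn_integral_cmult)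
  also have "... <= ennreal (1 - \<eta>) * emeasure lborel U"
   using WU U by (intro mult_left_mono emeasure_mono) auto
  finally have WE: "emeasure lborel (W \<inter> E) <= ennreal (1 - \<eta>) * emeasure lborel U" .
  have "S - W \<in> null_sets lebesgue" using C(4) by (simp add: W_def negligible_iff_null_sets)
  then obtain N where N: "N \<in> null_sets lborel" "S - W \<subseteq> N"
   unfolding null_sets_completion_iff2 by auto
  show ?thesis
  proof (rule ennreal_le_epsilon)
   fix e :: real assume e: "0 < e"
   have "(W \<inter> E) \<union> N \<in> sets borel" using N by auto
   then obtain V where V: "open V" "(W \<inter> E) \<union> N \<subseteq> V" "emeasure lborel (V - ((W \<inter> E) \<union> N)) < ennreal e"
    using outer_regular_lborel[OF _ e] by blast
   have "S \<subseteq> V" using V(2) N(2) S(2) by blast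
   then have "m <= emeasure lborel V" unfolding m_def \<U>_def using V(1) by (intro INF_lower) auto
   also have "... <= emeasure lborel (((W \<inter> E) \<union> N) \<union> (V - ((W \<inter> E) \<union> N)))"
    using V(1) N by (intro emeasure_mono) auto
   also have "... <= emeasure lborel ((W \<inter> E) \<union> N) + emeasure lborel (V - ((W \<inter> E) \<union> N))"
    using V(1) N by (intro emeasure_subadditive) auto
   also have "emeasure lborel ((W \<inter> E) \<union> N) = emeasure lborel (W \<inter> E)"
    using N by (intro emeasure_Un_null_set) auto
   finally show "m <= ennreal (1 - \<eta>) * emeasure lborel U + ennreal e"
    using WE V(3) by (meson add_mono less_imp_le order_trans)
  qed
 qed
 obtain b where b: "S \<subseteq> ball 0 b" using S(1) bounded_subset_ballD by blast
 have "m <= emeasure lborel (ball (0::'a) b)" unfolding m_def \<U>_def using b by (intro INF_lower) auto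
 then have mfin: "m < \<infinity>" using emeasure_lborel_ball_finite[of "0::'a" b] by (simp add: le_less_trans)
 have "m <= ennreal (1 - \<eta>) * m"
 proof (cases "m = 0")
  case False
  show ?thesis
  proof (rule ennreal_le_epsilon)
   fix e :: real assume e: "0 < e"
   have "m < m + ennreal e" using mfin e by (simp add: less_top)
   then obtain U where U: "open U" "S \<subseteq> U" "emeasure lborel U < m + ennreal e"
    unfolding m_def \<U>_def INF_less_iff by auto
   have "m <= ennreal (1 - \<eta>) * emeasure lborel U" by (rule step[OF U(1,2)])
   also have "... <= ennreal (1 - \<eta>) * (m + ennreal e)" using U(3) by (intro mult_left_mono) auto
   also have "... = ennreal (1 - \<eta>) * m + ennreal ((1 - \<eta>) * e)"
    using \<eta> e by (simp add: distrib_left ennreal_mult)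
   also have "... <= ennreal (1 - \<eta>) * m + ennreal e"
    using \<eta> e by (intro add_left_mono ennreal_leI) (simp add: mult_left_le_one_le)
   finally show "m <= ennreal (1 - \<eta>) * m + ennreal e" .
  qed
 qed simp
 moreover obtain x where x: "m = ennreal x" "x \<ge> 0" using mfin by (cases m) auto
 ultimately have "x <= (1 - \<eta>) * x" using \<eta> by (simp add: ennreal_mult[symmetric])
 then have "m = 0" using x \<eta> by (simp add: algebra_simps mult_le_0_iff)
 show ?thesis
  unfolding negligible_outer
 proof (intro allI impI)
  fix e :: real assume "0 < e"
  then have "m < ennreal e" using \<open>m = 0\<close> by simp
  then obtain U where U: "open U" "S \<subseteq> U" "emeasure lborel U < ennreal e"
   unfolding m_def \<U>_def INF_less_iff by auto
  have "U \<in> lmeasurable"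
   by (rule fmeasurableI) (use U less_trans[OF U(3), of top] in auto)
  moreover have "measure lebesgue U < e"
  proof -
   have "emeasure lborel U = ennreal (measure lborel U)"
    by (rule emeasure_eq_ennreal_measure) (use U(3) in \<open>auto simp: top_unique\<close>)
   then have "measure lborel U < e" using U(3) by (simp add: ennreal_less_iff)
   then show ?thesis using U(1) by (simp add: measure_completion)
  qed
  ultimately show "\<exists>T. S \<subseteq> T & T \<in> lmeasurable & measure lebesgue T < e" using U(2) by blast
 qed
qed

theorem Lebesgue_density:
 fixes E :: "'a::euclidean_space set"
 assumes E: "E \<in> sets borel"
 shows "AE x in lebesgue. x \<in> E --> density_point E x"
proof -
 define \<eta> where "\<eta> k = inverse (real (Suc (Suc k)))" for k
 have \<eta>: "0 < \<eta> k" "\<eta> k < 1" for k by (auto simp: \<eta>_def inverse_less_1_iff)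
 define S where "S k n = {x \<in> E \<inter> ball 0 (real n). \<forall>\<delta>>0. \<exists>r. 0 < r & r < \<delta> &
  measure lborel (ball x r - E) > \<eta> k * measure lborel (ball x r)}" for k n :: nat
 have neg: "negligible (S k n)" for k n
 proof (rule negligible_low_density[OF E \<eta>[of k]])
  show "bounded (S k n)" by (rule bounded_subset[OF bounded_ball[of 0 "real n"]]) (auto simp: S_def)
 qed (auto simp: S_def)
 have "S k n \<in> null_sets lebesgue" for k n using neg[of k n] by (simp add: negligible_iff_null_sets)
 then have "AE x in lebesgue. x \<notin> S k n" for k n by (rule AE_not_in)
 then have "AE x in lebesgue. \<forall>k n. x \<notin> S k n" by (simp add: AE_all_countable)
 then show ?thesis
 proof (eventually_elim, intro impI)
  fix x assume elim: "\<forall>k n. x \<notin> S k n" "x \<in> E"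
  show "density_point E x"
   unfolding density_point_def
  proof (intro allI impI)
   fix e :: real assume e: "0 < e"
   obtain k0 where k0: "inverse (real (Suc k0)) < e" using reals_Archimedean[OF e] by blast
   have ek: "\<eta> k0 <= e" using k0 
   proof -
    have "\<eta> k0 <= inverse (real (Suc k0))" unfolding \<eta>_def by (rule le_imp_inverse_le) auto
    then show ?thesis using k0 by simp
   qed
   obtain n where n: "norm x < real n" using reals_Archimedean2 by blast
   have "x \<notin> S k0 n" using elim(1) by blast
   then obtain \<delta> where \<delta>: "\<delta> > 0" "!!r. 0 < r ==> r < \<delta> ==> measure lborel (ball x r - E) <= \<eta> k0 * measure lborel (ball x r)"
   proof -
    have "x \<in> E \<inter> ball 0 (real n)" using elim(2) n by simp
    then have "\<exists>\<delta>>0. \<forall>r. \<not> (0 < r & r < \<delta> & measure lborel (ball x r - E) > \<eta> k0 * measure lborel (ball x r))"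
     using \<open>x \<notin> S k0 n\<close> unfolding S_def by blast
    then show ?thesis using that by (metis not_less)
   qed
   have "measure lborel (ball x r - E) <= e * measure lborel (ball x r)" if "0 < r" "r < \<delta>" for r
    using \<delta>(2)[OF that] mult_right_mono[OF ek, of "measure lborel (ball x r)"] by simp
   then show "\<exists>\<delta>>0. \<forall>r. 0 < r & r < \<delta> --> measure lborel (ball x r - E) <= e * measure lborel (ball x r)"
    using \<delta>(1) by blast
  qed
 qed
qed

section \<open>The Riesz representation theorem in a space of square integrable functions\<close>

definition sq_integrable :: "'a measure => ('a => real) => bool" where
 "sq_integrable M f \<longleftrightarrow> f \<in> borel_measurable M & integrable M (%x. (f x)^2)"

lemma sq_integrable_mult_integrable:
 assumes "sq_integrable M f" "sq_integrable M g"
 shows "integrable M (%x. f x * g x)"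
proof (rule Bochner_Integration.integrable_bound[of M "%x. (f x)^2 + (g x)^2"])
 show "AE x in M. norm (f x * g x) <= norm ((f x)^2 + (g x)^2)"
 proof (rule AE_I2)
  fix x
  have "0 <= (\<bar>f x\<bar> - \<bar>g x\<bar>)^2" by simp
  then have "2 * (\<bar>f x\<bar> * \<bar>g x\<bar>) <= (f x)^2 + (g x)^2" by (simp add: power2_diff)
  moreover have "0 <= \<bar>f x\<bar> * \<bar>g x\<bar>" by simp
  ultimately have "\<bar>f x\<bar> * \<bar>g x\<bar> <= (f x)^2 + (g x)^2" by linarith
  then show "norm (f x * g x) <= norm ((f x)^2 + (g x)^2)" by (simp add: abs_mult)
 qed
qed (use assms in \<open>auto simp: sq_integrable_def intro: borel_measurable_times\<close>)

lemma sq_integrable_lincomb: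
 assumes "sq_integrable M f" "sq_integrable M g"
 shows "sq_integrable M (%x. a * f x + b * g x)"
proof -
 have "integrable M (%x. a^2 * (f x)^2 + b^2 * (g x)^2 + 2 * a * b * (f x * g x))"
  using assms sq_integrable_mult_integrable[OF assms] by (auto simp: sq_integrable_def)
 moreover have "(%x. (a * f x + b * g x)^2) = (%x. a^2 * (f x)^2 + b^2 * (g x)^2 + 2 * a * b * (f x * g x))"
  by (rule ext) (simp add: power2_eq_square algebra_simps)
 moreover have "(%x. a * f x + b * g x) \<in> borel_measurable M"
  using assms by (intro borel_measurable_add borel_measurable_times borel_measurable_const) (simp_all add: sq_integrable_def)
 ultimately show ?thesis by (simp add: sq_integrable_def)
qed

lemma sq_integrable_lincomb_integral:
 assumes "sq_integrable M f" "sq_integrable M g"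
 shows "(\<integral>x. (a * f x + b * g x)^2 \<partial>M)
  = a^2 * (\<integral>x. (f x)^2 \<partial>M) + b^2 * (\<integral>x. (g x)^2 \<partial>M) + 2 * a * b * (\<integral>x. f x * g x \<partial>M)"
proof -
 have "(%x. (a * f x + b * g x)^2) = (%x. a^2 * (f x)^2 + b^2 * (g x)^2 + 2 * a * b * (f x * g x))"
  by (rule ext) (simp add: power2_eq_square algebra_simps)
 then show ?thesis using assms sq_integrable_mult_integrable[OF assms] by (simp add: sq_integrable_def)
qed

lemma sq_integrable_nn_integral:
 assumes "sq_integrable M f" shows "(\<integral>\<^sup>+x. ennreal ((f x)^2) \<partial>M) = ennreal (\<integral>x. (f x)^2 \<partial>M)"
 using assms by (intro nn_integral_eq_integral) (auto simp: sq_integrable_def)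

lemma sq_integrableI_nn:
 assumes "f \<in> borel_measurable M" "(\<integral>\<^sup>+x. ennreal ((f x)^2) \<partial>M) < \<infinity>"
 shows "sq_integrable M f"
 using assms unfolding sq_integrable_def by (auto intro!: integrableI_nonneg)

lemma sq_integrable_Cauchy_Schwarz:
 assumes "sq_integrable M f" "sq_integrable M g"
 shows "(\<integral>x. f x * g x \<partial>M)^2 <= (\<integral>x. (f x)^2 \<partial>M) * (\<integral>x. (g x)^2 \<partial>M)"
proof -
 define A B C where "A = (\<integral>x. (f x)^2 \<partial>M)" and "B = (\<integral>x. (g x)^2 \<partial>M)" and "C = (\<integral>x. f x * g x \<partial>M)"
 have *: "0 <= a^2 * A + b^2 * B + 2 * a * b * C" for a b
  using sq_integrable_lincomb_integral[OF assms, of a b] by (simp add: A_def B_def C_def flip: sq_integrable_lincomb_integral[OF assms])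
 have A: "A \<ge> 0" "B \<ge> 0" by (auto simp: A_def B_def)
 show ?thesis
 proof (cases "B = 0")
  case True
  have "C = 0"
  proof (rule ccontr)
   assume "C ~= 0"
   have "0 <= A + 2 * (- (A + 1) / (2 * C)) * C" using *[of 1 "- (A + 1) / (2 * C)"] True by simp
   then show False using \<open>C ~= 0\<close> by (simp add: field_simps)
  qed
  then show ?thesis using True by (simp add: B_def C_def)
 next
  case False
  then have B: "B > 0" using A by simp
  have "0 <= B^2 * A + C^2 * B - 2 * B * C * C" using *[of B "- C"] by simp
  then have "0 <= B * (A * B - C^2)" by (simp add: algebra_simps power2_eq_square)
  then have "0 <= A * B - C^2" using B by (simp add: zero_le_mult_iff)
  then show ?thesis by (simp add: A_def B_def C_def)
 qed
qed

lemma ennreal_term_le_suminf: "f k <= (\<Sum>i. f i)" for f :: "nat => ennreal"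
 using sum_le_suminf[of f "{k}"] by simp

text \<open>Completeness for sequences that converge at a geometric rate, which is all that a minimizing
 sequence needs.\<close>

lemma sq_integrable_complete:
 assumes v: "!!n::nat. sq_integrable M (v n)"
  and cauchy: "!!n p. n <= p ==> (\<integral>x. (v n x - v p x)^2 \<partial>M) <= C * (1 / 4) ^ n"
 shows "\<exists>g. sq_integrable M g & (\<forall>n. (\<integral>x. (v n x - g x)^2 \<partial>M) <= C * (1 / 4) ^ n)"
proof -
 have [measurable]: "v n \<in> borel_measurable M" for n using v by (simp add: sq_integrable_def)
 have dif: "sq_integrable M (%x. v n x - v p x)" for n p
  using sq_integrable_lincomb[OF v v, of 1 n "-1" p] by simp
 have C0: "C \<ge> 0" using cauchy[of 0 0] by simp
 define d where "d k x = v k x - v (Suc k) x" for k x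
 have "(\<integral>\<^sup>+x. (\<Sum>k. ennreal (2 ^ k * (d k x)^2)) \<partial>M) = (\<Sum>k. (\<integral>\<^sup>+x. ennreal (2 ^ k * (d k x)^2) \<partial>M))"
  unfolding d_def by (rule nn_integral_suminf) measurable
 also have "... <= (\<Sum>k. ennreal (C * (1 / 2) ^ k))"
 proof (intro suminf_le)
  fix k
  have "(\<integral>\<^sup>+x. ennreal (2 ^ k * (d k x)^2) \<partial>M) = ennreal (2 ^ k * (\<integral>x. (d k x)^2 \<partial>M))"
   using dif[of k "Suc k"] unfolding d_def
   by (subst nn_integral_eq_integral) (auto simp: sq_integrable_def)
  also have "... <= ennreal (2 ^ k * (C * (1 / 4) ^ k))"
   using cauchy[of k "Suc k"] unfolding d_def by (intro ennreal_leI mult_left_mono) auto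
  also have "2 ^ k * (C * (1 / 4) ^ k) = C * (1 / 2) ^ k"
   using power_mult_distrib[of 2 "1/4::real" k] by simp
  finally show "(\<integral>\<^sup>+x. ennreal (2 ^ k * (d k x)^2) \<partial>M) <= ennreal (C * (1 / 2) ^ k)" .
 qed auto
 also have "... < \<infinity>"
 proof -
  have "summable (%k. C * (1 / 2 :: real) ^ k)" by (intro summable_mult summable_geometric) simp
  then have "(\<Sum>k. ennreal (C * (1 / 2) ^ k)) = ennreal (\<Sum>k. C * (1 / 2) ^ k)"
   using C0 by (intro suminf_ennreal2) auto
  then show ?thesis by simp
 qed
 finally have fin: "(\<integral>\<^sup>+x. (\<Sum>k. ennreal (2 ^ k * (d k x)^2)) \<partial>M) ~= \<infinity>" by simp
 have "AE x in M. (\<Sum>k. ennreal (2 ^ k * (d k x)^2)) ~= \<infinity>"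
  by (rule nn_integral_PInf_AE[OF _ fin]) (simp add: d_def)
 then have conv: "AE x in M. convergent (%n. v n x)"
 proof eventually_elim
  case (elim x)
  define T where "T = (\<Sum>k. ennreal (2 ^ k * (d k x)^2))"
  define S where "S = enn2real T"
  have "T < top" using elim by (simp only: T_def less_top infinity_ennreal_def)
  then have S: "T = ennreal S" "S \<ge> 0" by (simp_all add: S_def)
  have le: "\<bar>d k x\<bar> <= sqrt S * sqrt (1 / 2) ^ k" for k
  proof -
   have "ennreal (2 ^ k * (d k x)^2) <= ennreal S"
    unfolding S(1)[symmetric] T_def by (rule ennreal_term_le_suminf)
   then have "2 ^ k * (d k x)^2 <= S" using S(2) by simp
   then have "(d k x)^2 <= S * (1 / 2) ^ k" by (simp add: field_simps)
   then have "sqrt ((d k x)^2) <= sqrt (S * (1 / 2) ^ k)" by (rule real_sqrt_le_mono)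
   moreover have "sqrt (S * (1 / 2) ^ k) = sqrt S * sqrt (1 / 2) ^ k" by (simp only: real_sqrt_mult real_sqrt_power)
   ultimately show ?thesis by (simp only: real_sqrt_abs)
  qed
  have "summable (%k. sqrt S * sqrt (1 / 2) ^ k)"
   by (intro summable_mult summable_geometric) (simp add: real_sqrt_lt_1_iff)
  then have "summable (%k. d k x)" by (rule summable_comparison_test') (use le in auto)
  then have "summable (%k. v (Suc k) x - v k x)"
   using summable_minus[of "%k. d k x"] by (simp add: d_def)
  then have "convergent (%n. v n x - v 0 x)"
   unfolding summable_iff_convergent sum_lessThan_telescope[of "%i. v i x"] .
  then obtain L where "(%n. v n x - v 0 x) \<longlonglongrightarrow> L" by (auto simp: convergent_def)
  then have "(%n. (v n x - v 0 x) + v 0 x) \<longlonglongrightarrow> L + v 0 x" by (intro tendsto_add tendsto_const)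
  then show ?case by (auto simp: convergent_def)
 qed
 define g where "g x = lim (%n. v n x)" for x
 have [measurable]: "g \<in> borel_measurable M" unfolding g_def by measurable
 have lim: "AE x in M. (%n. v n x) \<longlonglongrightarrow> g x"
  using conv by eventually_elim (simp add: g_def convergent_LIMSEQ_iff)
 have bound: "(\<integral>\<^sup>+x. ennreal ((v n x - g x)^2) \<partial>M) <= ennreal (C * (1 / 4) ^ n)" for n
 proof -
  have "(\<integral>\<^sup>+x. ennreal ((v n x - g x)^2) \<partial>M) = (\<integral>\<^sup>+x. liminf (%p. ennreal ((v n x - v p x)^2)) \<partial>M)"
   using lim
  proof (intro nn_integral_cong_AE, eventually_elim)
   case (elim x)
   then have "(%p. ennreal ((v n x - v p x)^2)) \<longlonglongrightarrow> ennreal ((v n x - g x)^2)"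
    by (intro tendsto_ennrealI tendsto_intros)
   then show ?case using lim_imp_Liminf[OF sequentially_bot] by metis
  qed
  also have "... <= liminf (%p. \<integral>\<^sup>+x. ennreal ((v n x - v p x)^2) \<partial>M)"
   by (rule nn_integral_liminf) measurable
  also have "... <= liminf (%p. ennreal (C * (1 / 4) ^ n))"
  proof (rule Liminf_mono)
   show "\<forall>\<^sub>F p in sequentially. (\<integral>\<^sup>+x. ennreal ((v n x - v p x)^2) \<partial>M) <= ennreal (C * (1 / 4) ^ n)"
    using eventually_ge_at_top[of n]
    by eventually_elim (use cauchy in \<open>simp add: sq_integrable_nn_integral[OF dif] ennreal_leI\<close>)
  qed
  also have "... = ennreal (C * (1 / 4) ^ n)" by (rule Liminf_const) simp
  finally show ?thesis .
 qed
 have vg: "sq_integrable M (%x. v n x - g x)" for n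
  using bound[of n] by (intro sq_integrableI_nn) (auto intro: le_less_trans)
 have "sq_integrable M g"
  using sq_integrable_lincomb[OF v[of 0] vg[of 0], of 1 "-1"] by simp
 moreover have "(\<integral>x. (v n x - g x)^2 \<partial>M) <= C * (1 / 4) ^ n" for n
  using bound[of n] C0 by (simp add: sq_integrable_nn_integral[OF vg])
 ultimately show ?thesis by blast
qed

text \<open>For a subspace \<open>V\<close> of square integrable functions that need not be closed. The last
 clause places the representing function in the closure of \<open>V\<close>, which yields density
 theorems.\<close>

theorem Riesz_representation:
 fixes V :: "('a => real) set" and l :: "('a => real) => real"
 assumes ne: "V ~= {}" and V: "!!v. v \<in> V ==> sq_integrable M v"
  and lin: "!!v w a b. v \<in> V ==> w \<in> V ==> (%x. a * v x + b * w x) \<in> V"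
  and l: "!!v w a b. v \<in> V ==> w \<in> V ==> l (%x. a * v x + b * w x) = a * l v + b * l w"
  and bound: "!!v. v \<in> V ==> (l v)^2 <= K * (\<integral>x. (v x)^2 \<partial>M)" and K: "K \<ge> 0"
 shows "\<exists>g. sq_integrable M g & (\<forall>v\<in>V. l v = (\<integral>x. g x * v x \<partial>M)) &
  (\<forall>e>0. \<exists>v\<in>V. (\<integral>x. (v x - g x)^2 \<partial>M) < e)"
proof -
 \<comment> \<open>the representing function minimises this functional over the closure of \<open>V\<close>\<close>
 define J where "J v = (\<integral>x. (v x)^2 \<partial>M) - 2 * l v" for v
 have low: "- K <= J v" if "v \<in> V" for v
 proof -
  define s where "s = (\<integral>x. (v x)^2 \<partial>M)"
  have s: "s \<ge> 0" by (simp add: s_def)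
  have b: "(l v)^2 <= K * s" using bound[OF that] by (simp add: s_def)
  have "4 * (K * s) <= (s + K)^2" using sum_squares_bound[of s K] by (simp add: power2_sum algebra_simps)
  then have "(2 * l v)^2 <= (s + K)^2" using b by (simp add: power_mult_distrib)
  then have "2 * l v <= s + K" by (rule power2_le_imp_le) (use s K in simp)
  then show ?thesis by (simp add: J_def s_def)
 qed
 define m where "m = Inf (J ` V)"
 have bdd: "bdd_below (J ` V)" using low by (intro bdd_belowI[of _ "- K"]) auto
 have mle: "m <= J v" if "v \<in> V" for v unfolding m_def by (rule cInf_lower[OF _ bdd]) (use that in auto)
 have "\<exists>v\<in>V. J v < m + (1 / 4) ^ n" for n :: nat
 proof -
  have "Inf (J ` V) < m + (1 / 4) ^ n" by (simp add: m_def)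
  then show ?thesis using cInf_lessD[of "J ` V"] ne by fastforce
 qed
 then obtain v where v: "!!n. v n \<in> V" "!!n. J (v n) < m + (1 / 4) ^ n" by metis
 have parallelogram: "(\<integral>x. (a x - b x)^2 \<partial>M) = 2 * J a + 2 * J b - 4 * J (%x. 1 / 2 * a x + 1 / 2 * b x)"
  if "a \<in> V" "b \<in> V" for a b
 proof -
  have "l (%x. 1 / 2 * a x + 1 / 2 * b x) = 1 / 2 * l a + 1 / 2 * l b" by (rule l[OF that])
  moreover have "(\<integral>x. (1 / 2 * a x + 1 / 2 * b x)^2 \<partial>M)
   = (1 / 2)^2 * (\<integral>x. (a x)^2 \<partial>M) + (1 / 2)^2 * (\<integral>x. (b x)^2 \<partial>M) + 2 * (1 / 2) * (1 / 2) * (\<integral>x. a x * b x \<partial>M)"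
   by (rule sq_integrable_lincomb_integral[OF V[OF that(1)] V[OF that(2)]])
  moreover have "(\<integral>x. (a x - b x)^2 \<partial>M) = (\<integral>x. (a x)^2 \<partial>M) + (\<integral>x. (b x)^2 \<partial>M) - 2 * (\<integral>x. a x * b x \<partial>M)"
   using sq_integrable_lincomb_integral[OF V[OF that(1)] V[OF that(2)], of 1 "-1"] by simp
  ultimately show ?thesis unfolding J_def by (simp add: power2_eq_square)
 qed
 have cauchy: "(\<integral>x. (v n x - v p x)^2 \<partial>M) <= 4 * (1 / 4) ^ n" if "n <= p" for n p
 proof -
  have "m <= J (%x. 1 / 2 * v n x + 1 / 2 * v p x)" by (rule mle[OF lin[OF v(1) v(1)]])
  then have "(\<integral>x. (v n x - v p x)^2 \<partial>M) <= 2 * (1 / 4) ^ n + 2 * (1 / 4) ^ p"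
   using parallelogram[OF v(1)[of n] v(1)[of p]] v(2)[of n] v(2)[of p] by simp
  also have "(1 / 4 :: real) ^ p <= (1 / 4) ^ n" by (rule power_decreasing[OF that]) auto
  finally show ?thesis by simp
 qed
 obtain g where g: "sq_integrable M g" "!!n. (\<integral>x. (v n x - g x)^2 \<partial>M) <= 4 * (1 / 4) ^ n"
  using sq_integrable_complete[of M v 4, OF V[OF v(1)] cauchy] by blast
 have pow: "(%n. (1 / 4 :: real) ^ n) \<longlonglongrightarrow> 0" by (rule LIMSEQ_power_zero) simp
 have vg: "sq_integrable M (%x. v n x - g x)" for n
  using sq_integrable_lincomb[OF V[OF v(1)[of n]] g(1), of 1 "-1"] by simp
 have "l w = (\<integral>x. g x * w x \<partial>M)" if w: "w \<in> V" for w
 proof -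
  define W where "W = (\<integral>x. (w x)^2 \<partial>M)"
  have W: "W \<ge> 0" by (simp add: W_def)
  have "(%n. (\<integral>x. v n x * w x \<partial>M) - (\<integral>x. g x * w x \<partial>M)) \<longlonglongrightarrow> 0"
  proof (rule Lim_null_comparison)
   have "\<bar>(\<integral>x. v n x * w x \<partial>M) - (\<integral>x. g x * w x \<partial>M)\<bar> <= sqrt (4 * (1 / 4) ^ n * W)" for n
   proof -
    have "(\<integral>x. v n x * w x \<partial>M) - (\<integral>x. g x * w x \<partial>M) = (\<integral>x. (v n x - g x) * w x \<partial>M)"
     using sq_integrable_mult_integrable[OF V[OF v(1)] V[OF w]] sq_integrable_mult_integrable[OF g(1) V[OF w]]
     by (simp add: left_diff_distrib)
    moreover have "(\<integral>x. (v n x - g x) * w x \<partial>M)^2 <= (\<integral>x. (v n x - g x)^2 \<partial>M) * W"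
     unfolding W_def by (rule sq_integrable_Cauchy_Schwarz[OF vg V[OF w]])
    moreover have "... <= 4 * (1 / 4) ^ n * W" by (intro mult_right_mono g(2) W)
    ultimately show ?thesis by (simp add: real_le_rsqrt abs_le_square_iff flip: real_sqrt_abs)
   qed
   then show "\<forall>\<^sub>F n in sequentially. norm ((\<integral>x. v n x * w x \<partial>M) - (\<integral>x. g x * w x \<partial>M)) <= sqrt (4 * (1 / 4) ^ n * W)"
    by simp
   have "(%n. sqrt (4 * (1 / 4) ^ n * W)) \<longlonglongrightarrow> sqrt (4 * 0 * W)"
    by (intro tendsto_real_sqrt tendsto_mult tendsto_const pow)
   then show "(%n. sqrt (4 * (1 / 4) ^ n * W)) \<longlonglongrightarrow> 0" by simp
  qed
  then have lim: "(%n. \<integral>x. v n x * w x \<partial>M) \<longlonglongrightarrow> (\<integral>x. g x * w x \<partial>M)" by (simp add: LIM_zero_iff)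
  define D where "D = (\<integral>x. g x * w x \<partial>M) - l w"
  have quad: "0 <= t^2 * W + 2 * t * D" for t
  proof -
   have "0 <= (1 / 4) ^ n + t^2 * W + 2 * t * ((\<integral>x. v n x * w x \<partial>M) - l w)" for n
   proof -
    have "m <= J (%x. 1 * v n x + t * w x)" by (rule mle[OF lin[OF v(1) w]])
    moreover have "J (%x. 1 * v n x + t * w x) = J (v n) + t^2 * W + 2 * t * ((\<integral>x. v n x * w x \<partial>M) - l w)"
     unfolding J_def l[OF v(1) w] sq_integrable_lincomb_integral[OF V[OF v(1)] V[OF w]] W_def
     by (simp add: algebra_simps)
    ultimately show ?thesis using v(2)[of n] by linarith
   qed
   moreover have "(%n. (1 / 4) ^ n + t^2 * W + 2 * t * ((\<integral>x. v n x * w x \<partial>M) - l w)) \<longlonglongrightarrow> 0 + t^2 * W + 2 * t * D"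
    unfolding D_def by (intro tendsto_intros pow lim)
   ultimately have "0 <= 0 + t^2 * W + 2 * t * D" by (intro LIMSEQ_le_const) auto
   then show ?thesis by simp
  qed
  have "D = 0"
  proof (rule ccontr)
   assume D: "D ~= 0"
   define t where "t = - D / (W + 1)"
   have "D = - t * (W + 1)" using W by (simp add: t_def)
   then have "t^2 * W + 2 * t * D = t^2 * W + 2 * t * (- t * (W + 1))" by (simp only:)
   also have "... = - (t^2 * (W + 2))" by (simp add: algebra_simps power2_eq_square)
   finally have "t^2 * W + 2 * t * D = - (t^2 * (W + 2))" .
   moreover have "t ~= 0" using D W by (simp add: t_def)
   then have "t^2 * (W + 2) > 0" using W by (intro mult_pos_pos) auto
   ultimately show False using quad[of t] by linarith
  qed
  then show ?thesis by (simp add: D_def)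
 qed
 moreover have "\<exists>v\<in>V. (\<integral>x. (v x - g x)^2 \<partial>M) < e" if "e > 0" for e
 proof -
  have "(%n. 4 * (1 / 4 :: real) ^ n) \<longlonglongrightarrow> 4 * 0" by (intro tendsto_mult tendsto_const pow)
  then have "\<forall>\<^sub>F n in sequentially. 4 * (1 / 4 :: real) ^ n < e"
   by (rule order_tendstoD(2)) (use that in simp)
  then obtain n where "4 * (1 / 4 :: real) ^ n < e" by (auto simp: eventually_sequentially)
  then show ?thesis using g(2)[of n] v(1)[of n] by (intro bexI[of _ "v n"]) auto
 qed
 ultimately show ?thesis using g(1) by blast
qed

section \<open>Weak gradients along lines\<close>

lemma sets_ball [measurable]: "ball (a::'a::euclidean_space) r \<in> sets borel"
 by simp

lemma lborel_integral_shift: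
 fixes f :: "'a::euclidean_space => 'b::{banach, second_countable_topology}"
 assumes [measurable]: "borel_fun f"
 shows "(LBINT x. f (x + h)) = (LBINT x. f x)"
  and "integrable lborel (%x. f (x + h)) \<longleftrightarrow> integrable lborel f"
proof -
 have "(LBINT x. f x) = (\<integral>x. f x \<partial>distr lborel borel ((+) h))" by (simp add: lborel_distr_plus)
 also have "... = (LBINT x. f (h + x))" by (rule integral_distr) auto
 finally show "(LBINT x. f (x + h)) = (LBINT x. f x)" by (simp add: add.commute)
 have "integrable lborel f \<longleftrightarrow> integrable (distr lborel borel ((+) h)) f" by (simp add: lborel_distr_plus)
 also have "... \<longleftrightarrow> integrable lborel (%x. f (h + x))" by (rule integrable_distr_eq) auto
 finally show "integrable lborel (%x. f (x + h)) \<longleftrightarrow> integrable lborel f" by (simp add: add.commute)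
qed

lemma nn_integral_lborel_shift:
 fixes f :: "'a::euclidean_space => ennreal"
 assumes [measurable]: "borel_fun f"
 shows "(NN x. f (x + h)) = (NN x. f x)"
 using nn_integral_lborel_translate[OF assms, of h] by (simp add: add.commute)

lemma locint_measurable: "locint f ==> f \<in> borel_measurable borel"
 by (simp add: locint_def)

lemma locintI:
 assumes "borel_fun f" "!!R. (NN x. indicator (ball 0 R) x * ennreal (norm (f x))) < \<infinity>"
 shows "locint f"
 unfolding locint_def
proof (intro conjI allI)
 note [measurable] = assms(1)
 show "integrable lborel (%x. indicator (ball 0 R) x *\<^sub>R f x)" for R
 proof (rule integrableI_bounded)
  have "(NN x. ennreal (norm (indicator (ball 0 R) x *\<^sub>R f x))) = (NN x. indicator (ball 0 R) x * ennreal (norm (f x)))"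
   by (intro nn_integral_cong) (auto simp: indicator_def)
  then show "(NN x. ennreal (norm (indicator (ball 0 R) x *\<^sub>R f x))) < \<infinity>" using assms(2)[of R] by simp
 qed measurable
qed (rule assms(1))

lemma locint_nn:
 assumes "locint f" shows "(NN x. indicator (ball 0 R) x * ennreal (norm (f x))) < \<infinity>"
proof -
 have "(NN x. ennreal (norm (indicator (ball 0 R) x *\<^sub>R f x))) < \<infinity>"
  using assms by (simp add: locint_def integrable_iff_bounded)
 moreover have "(NN x. ennreal (norm (indicator (ball 0 R) x *\<^sub>R f x))) = (NN x. indicator (ball 0 R) x * ennreal (norm (f x)))"
  by (intro nn_integral_cong) (auto simp: indicator_def)
 ultimately show ?thesis by simp
qed

lemma locint_add: "locint f ==> locint g ==> locint (%x. f x + g x)"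
 by (auto simp: locint_def scaleR_add_right)

lemma locint_diff: "locint f ==> locint g ==> locint (%x. f x - g x)"
 by (auto simp: locint_def scaleR_diff_right)

lemma locint_cmult: "locint f ==> locint (%x. c * f x)" for c :: "'b::{real_normed_field, banach, second_countable_topology}"
proof -
 assume f: "locint f"
 have eq: "(%x. indicator (ball 0 R) x *\<^sub>R (c * f x)) = (%x. c * (indicator (ball 0 R) x *\<^sub>R f x))" for R
  by (rule ext) (auto simp: indicator_def)
 show ?thesis
  unfolding locint_def
 proof (intro conjI allI)
  show "borel_fun (%x. c * f x)"
   using f by (intro borel_measurable_times borel_measurable_const) (simp add: locint_def)
  show "integrable lborel (%x. indicator (ball 0 R) x *\<^sub>R (c * f x))" for R
   unfolding eq using f by (intro integrable_mult_right) (simp add: locint_def)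
 qed
qed

lemma locint_sum: "finite I ==> (!!i. i \<in> I ==> locint (f i)) ==> locint (%x. \<Sum>i\<in>I. f i x)"
proof (induction I rule: finite_induct)
 case empty then show ?case by (simp add: locint_def)
next
 case (insert i I) then show ?case by (simp add: locint_add)
qed

lemma locint_mult_bounded_on_balls:
 fixes f :: "'a::euclidean_space => complex"
 assumes f: "locint f" and [measurable]: "borel_fun g" and g: "!!R. \<exists>B. \<forall>x\<in>ball 0 R. norm (g x) <= B"
 shows "locint (%x. g x * f x)"
proof (rule locintI)
 note [measurable] = locint_measurable[OF f]
 show "borel_fun (%x. g x * f x)" by measurable
 fix R
 obtain B where B: "\<forall>x\<in>ball 0 R. norm (g x) <= B" using g by blast
 have "(NN x. indicator (ball 0 R) x * ennreal (norm (g x * f x)))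
  <= (NN x. ennreal \<bar>B\<bar> * (indicator (ball 0 R) x * ennreal (norm (f x))))"
 proof (rule nn_integral_mono)
  fix x
  show "indicator (ball 0 R) x * ennreal (norm (g x * f x)) <= ennreal \<bar>B\<bar> * (indicator (ball 0 R) x * ennreal (norm (f x)))"
  proof (cases "x \<in> ball 0 R")
   case True
   then have "norm (g x) <= \<bar>B\<bar>" using B by force
   then show ?thesis using True by (simp add: norm_mult ennreal_mult[symmetric] ennreal_leI mult_right_mono)
  qed simp
 qed
 also have "... = ennreal \<bar>B\<bar> * (NN x. indicator (ball 0 R) x * ennreal (norm (f x)))"
  by (rule nn_integral_cmult) measurable
 also have "... < \<infinity>" using locint_nn[OF f, of R] by (simp add: ennreal_mult_less_top)
 finally show "(NN x. indicator (ball 0 R) x * ennreal (norm (g x * f x))) < \<infinity>" .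
qed

lemma locint_shift: "locint f ==> locint (%x. f (x + h))"
proof -
 assume f: "locint f"
 note [measurable] = locint_measurable[OF f]
 show ?thesis
 proof (rule locintI)
  fix R
  have "(NN x. indicator (ball 0 R) x * ennreal (norm (f (x + h))))
   <= (NN x. indicator (ball 0 (R + norm h)) (x + h) * ennreal (norm (f (x + h))))"
  proof (intro nn_integral_mono mult_right_mono)
   fix x show "(indicator (ball 0 R) x :: ennreal) <= indicator (ball 0 (R + norm h)) (x + h)"
    using norm_triangle_ineq[of x h] by (auto simp: indicator_def)
  qed simp
  also have "... = (NN x. indicator (ball 0 (R + norm h)) x * ennreal (norm (f x)))"
   by (rule nn_integral_lborel_shift) measurable
  also have "... < \<infinity>" by (rule locint_nn[OF f])
  finally show "(NN x. indicator (ball 0 R) x * ennreal (norm (f (x + h)))) < \<infinity>" .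
 qed measurable
qed

lemma locint_mult_compact:
 fixes f :: "'a::euclidean_space => complex"
 assumes f: "locint f" and [measurable]: "borel_fun p"
  and B: "!!x. \<bar>p x\<bar> <= B" and R: "!!x. norm x \<ge> R ==> p x = 0"
 shows "integrable lborel (%x. f x * cor (p x))"
 by (rule locint_bounded_mult[OF f, of _ B R]) (use B R in auto)

lemma locint_mult_test:
 fixes f :: "real^'n => complex"
 assumes f: "locint f" and \<phi>: "test_function \<phi>"
 shows "integrable lborel (%x. f x * cor (\<phi> x))"
proof -
 obtain B where "!!x. \<bar>\<phi> x\<bar> <= B" using test_bounded[OF \<phi>] by blast
 moreover obtain R where "!!x. norm x \<ge> R ==> \<phi> x = 0" using test_support[OF \<phi>] by blast
 ultimately show ?thesis by (intro locint_mult_compact[OF f test_measurable[OF \<phi>]])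
qed

theorem zero_AE_of_test_functions_complex:
 fixes f :: "real^'n => complex"
 assumes f: "locint f" and zero: "!!\<phi>. test_function \<phi> ==> (LBINT x. f x * cor (\<phi> x)) = 0"
 shows "AE x in lborel. f x = 0"
proof -
 have "locint (%x. Re (f x))" "locint (%x. Im (f x))"
  using f by (auto simp: locint_def simp flip: scaleR_complex.sel)
 moreover have "(LBINT x. Re (f x) * \<phi> x) = 0" "(LBINT x. Im (f x) * \<phi> x) = 0" if "test_function \<phi>" for \<phi>
  using integral_Re[OF locint_mult_test[OF f that]] integral_Im[OF locint_mult_test[OF f that]] zero[OF that] by simp_all
 ultimately have "AE x in lborel. Re (f x) = 0" "AE x in lborel. Im (f x) = 0"
  by (auto intro: zero_AE_of_test_functions)
 then show ?thesis by eventually_elim (simp add: complex_eq_iff)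
qed

definition cdot :: "real^'n => complex^'n => complex" where
 "cdot h z = (\<Sum>j\<in>UNIV. cor (h $ j) * z $ j)"

definition weakgrad :: "(real^'n => complex) => (real^'n => complex^'n) => bool" where
 "weakgrad u g \<longleftrightarrow> locint u & (\<forall>j. locint (%x. g x $ j)) &
   (\<forall>\<phi> j. test_function \<phi> -->
    (LBINT x. u x * cor (pderivative j \<phi> x)) = - (LBINT x. g x $ j * cor (\<phi> x)))"

lemma locint_cdot: "(!!j. locint (%x. g x $ j)) ==> locint (%x. cdot h (g x))"
 unfolding cdot_def by (intro locint_sum locint_cmult) auto

lemma weakgrad_direction:
 assumes w: "weakgrad u g" and \<phi>: "test_function \<phi>"
 shows "(LBINT x. u x * cor (h \<bullet> grad \<phi> x)) = - (LBINT x. cdot h (g x) * cor (\<phi> x))"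
proof -
 have u: "locint u" and g: "!!j. locint (%x. g x $ j)" using w by (auto simp: weakgrad_def)
 have "(LBINT x. u x * cor (h \<bullet> grad \<phi> x))
  = (LBINT x. (\<Sum>j\<in>UNIV. cor (h $ j) * (u x * cor (pderivative j \<phi> x))))"
  by (rule Bochner_Integration.integral_cong) (auto simp: grad_def inner_vec_def sum_distrib_left mult_ac)
 also have "... = (\<Sum>j\<in>UNIV. cor (h $ j) * (LBINT x. u x * cor (pderivative j \<phi> x)))"
  using locint_mult_test[OF u test_pderivative[OF \<phi>]] by (subst Bochner_Integration.integral_sum) auto
 also have "... = (\<Sum>j\<in>UNIV. cor (h $ j) * - (LBINT x. g x $ j * cor (\<phi> x)))"
  using w \<phi> by (simp add: weakgrad_def)
 also have "... = - (\<Sum>j\<in>UNIV. cor (h $ j) * (LBINT x. g x $ j * cor (\<phi> x)))"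
  by (simp add: sum_negf)
 also have "(\<Sum>j\<in>UNIV. cor (h $ j) * (LBINT x. g x $ j * cor (\<phi> x)))
  = (LBINT x. (\<Sum>j\<in>UNIV. cor (h $ j) * (g x $ j * cor (\<phi> x))))"
  using locint_mult_test[OF g \<phi>] by (subst Bochner_Integration.integral_sum) auto
 also have "... = (LBINT x. cdot h (g x) * cor (\<phi> x))"
  by (rule Bochner_Integration.integral_cong) (auto simp: cdot_def sum_distrib_right sum_distrib_left mult_ac)
 finally show ?thesis .
qed

lemma integrable_pair_line:
 fixes f :: "'a::euclidean_space => complex"
 assumes f: "locint f" and t: "t \<ge> 0"
 shows "integrable (lborel \<Otimes>\<^sub>M lborel) (%(s, x). indicator {0..t} s *\<^sub>R (indicator (ball 0 R) x *\<^sub>R f (x + s *\<^sub>R h)))"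
proof (rule integrableI_bounded)
 note [measurable] = locint_measurable[OF f]
 show "(%(s, x). indicator {0..t} s *\<^sub>R (indicator (ball 0 R) x *\<^sub>R f (x + s *\<^sub>R h))) \<in> borel_measurable (lborel \<Otimes>\<^sub>M lborel)"
  by measurable
 define C where "C = (NN x. indicator (ball 0 (R + t * norm h)) x * ennreal (norm (f x)))"
 have C: "C < \<infinity>" unfolding C_def by (rule locint_nn[OF f])
 have inner: "(NN x. indicator (ball 0 R) x * ennreal (norm (f (x + s *\<^sub>R h)))) <= C" if s: "0 <= s" "s <= t" for s
 proof -
  have "(NN x. indicator (ball 0 R) x * ennreal (norm (f (x + s *\<^sub>R h))))
   <= (NN x. indicator (ball 0 (R + t * norm h)) (x + s *\<^sub>R h) * ennreal (norm (f (x + s *\<^sub>R h))))"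
  proof (intro nn_integral_mono mult_right_mono)
   fix x
   have "norm (x + s *\<^sub>R h) <= norm x + t * norm h"
    using norm_triangle_ineq[of x "s *\<^sub>R h"] s mult_right_mono[OF s(2), of "norm h"] by simp
   then show "(indicator (ball 0 R) x :: ennreal) <= indicator (ball 0 (R + t * norm h)) (x + s *\<^sub>R h)"
    by (auto simp: indicator_def)
  qed simp
  also have "... = C" unfolding C_def by (rule nn_integral_lborel_shift) measurable
  finally show ?thesis .
 qed
 have "(\<integral>\<^sup>+z. ennreal (norm (case z of (s, x) => indicator {0..t} s *\<^sub>R (indicator (ball 0 R) x *\<^sub>R f (x + s *\<^sub>R h)))) \<partial>(lborel \<Otimes>\<^sub>M lborel))
  = (NN s. (NN x. ennreal (norm (indicator {0..t} s *\<^sub>R (indicator (ball 0 R) x *\<^sub>R f (x + s *\<^sub>R h))))))"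
  by (subst lborel.nn_integral_fst[symmetric]) (auto, measurable)
 also have "... <= (NN s. C * indicator {0..t} s)"
 proof (rule nn_integral_mono)
  fix s
  show "(NN x. ennreal (norm (indicator {0..t} s *\<^sub>R (indicator (ball 0 R) x *\<^sub>R f (x + s *\<^sub>R h))))) <= C * indicator {0..t} s"
  proof (cases "s \<in> {0..t}")
   case True
   have "(NN x. ennreal (norm (indicator {0..t} s *\<^sub>R (indicator (ball 0 R) x *\<^sub>R f (x + s *\<^sub>R h)))))
    = (NN x. indicator (ball 0 R) x * ennreal (norm (f (x + s *\<^sub>R h))))"
    using True by (intro nn_integral_cong) (auto simp: indicator_def)
   then show ?thesis using inner[of s] True by simp
  qed simp
 qed
 also have "... = C * ennreal t" using t by (simp add: nn_integral_cmult_indicator)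
 also have "... < \<infinity>" using C by (simp add: ennreal_mult_less_top)
 finally show "(\<integral>\<^sup>+z. ennreal (norm (case z of (s, x) => indicator {0..t} s *\<^sub>R (indicator (ball 0 R) x *\<^sub>R f (x + s *\<^sub>R h)))) \<partial>(lborel \<Otimes>\<^sub>M lborel)) < \<infinity>" .
qed

lemma AE_integrable_line:
 fixes f :: "'a::euclidean_space => complex"
 assumes f: "locint f" and t: "t \<ge> 0"
 shows "AE x in lborel. integrable lborel (%s. indicator {0..t} s *\<^sub>R f (x + s *\<^sub>R h))"
proof -
 have "AE x in lborel. integrable lborel (%s. indicator {0..t} s *\<^sub>R (indicator (ball 0 (real n)) x *\<^sub>R f (x + s *\<^sub>R h)))" for n
  using lborel_pair.AE_integrable_snd[OF integrable_pair_line[OF f t, of "real n" h]] by simp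
 then have "AE x in lborel. \<forall>n. integrable lborel (%s. indicator {0..t} s *\<^sub>R (indicator (ball 0 (real n)) x *\<^sub>R f (x + s *\<^sub>R h)))"
  unfolding AE_all_countable by blast
 then show ?thesis
 proof eventually_elim
  case (elim x)
  obtain n where "norm x < real n" using reals_Archimedean2 by blast
  then show ?case using elim[rule_format, of n] by simp
 qed
qed

definition line_integral :: "('a::euclidean_space => complex) => real => 'a => 'a => complex" where
 "line_integral f t h x = (LBINT s. indicator {0..t} s *\<^sub>R f (x + s *\<^sub>R h))"

lemma line_integral_measurable:
 assumes [measurable]: "borel_fun f"
 shows "(%(t, x). line_integral f t h x) \<in> borel_measurable (borel \<Otimes>\<^sub>M borel)"
proof -
 have [measurable]: "(%z::(real \<times> 'a) \<times> real. indicator {0..fst (fst z)} (snd z) :: real) \<in> borel_measurable ((borel \<Otimes>\<^sub>M borel) \<Otimes>\<^sub>M lborel)"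
 proof -
  have "(%z::(real \<times> 'a) \<times> real. indicator {0..fst (fst z)} (snd z) :: real) = (%z. if 0 <= snd z & snd z <= fst (fst z) then 1 else 0)"
   by (auto simp: indicator_def)
  then show ?thesis by simp
 qed
 have "(%z. \<integral>s. indicator {0..fst z} s *\<^sub>R f (snd z + s *\<^sub>R h) \<partial>lborel) \<in> borel_measurable (borel \<Otimes>\<^sub>M borel)"
  by (rule lborel.borel_measurable_lebesgue_integral) measurable
 then show ?thesis by (simp add: line_integral_def case_prod_unfold)
qed

lemma locint_line_integral:
 fixes f :: "'a::euclidean_space => complex"
 assumes f: "locint f" and t: "t \<ge> 0"
 shows "locint (line_integral f t h)"
 unfolding locint_def
proof (intro conjI allI)
 note [measurable] = locint_measurable[OF f]
 have "borel_fun (%x. (%(t, x). line_integral f t h x) (t, x))"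
  by (rule measurable_compose[OF _ line_integral_measurable]) measurable
 then show "borel_fun (line_integral f t h)" by simp
 fix R
 have "integrable lborel (%x. \<integral>s. indicator {0..t} s *\<^sub>R (indicator (ball 0 R) x *\<^sub>R f (x + s *\<^sub>R h)) \<partial>lborel)"
  using lborel_pair.integrable_snd[OF integrable_pair_line[OF f t, of R h]] by simp
 moreover have "(LBINT s. indicator {0..t} s *\<^sub>R (indicator (ball 0 R) x *\<^sub>R f (x + s *\<^sub>R h))) = indicator (ball 0 R) x *\<^sub>R line_integral f t h x" for x
  by (cases "x \<in> ball 0 R") (simp_all add: line_integral_def)
 ultimately show "integrable lborel (%x. indicator (ball 0 R) x *\<^sub>R line_integral f t h x)" by simp
qed

text \<open>Tested against \<open>\<phi>\<close>, both sides of the line formula become the increment of \<open>\<phi>\<close> along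
 the segment paired with \<open>u\<close>.\<close>

lemma test_increment:
 assumes \<phi>: "test_function \<phi>" and t: "t \<ge> 0"
 shows "(LBINT s. indicator {0..t} s *\<^sub>R (h \<bullet> grad \<phi> (x - s *\<^sub>R h))) = \<phi> x - \<phi> (x - t *\<^sub>R h)"
proof -
 have "(LBINT s. indicator {0..t} s *\<^sub>R (h \<bullet> grad \<phi> (x - s *\<^sub>R h)))
  = - \<phi> (x - t *\<^sub>R h) - - \<phi> (x - 0 *\<^sub>R h)"
 proof (rule integral_FTC_Icc[OF t])
  fix s
  have "((%s. \<phi> (x - s *\<^sub>R h)) has_derivative (%d. (- d *\<^sub>R h) \<bullet> grad \<phi> (x - s *\<^sub>R h))) (at s within {0..t})"
  proof (rule has_derivative_compose[of "%s. x - s *\<^sub>R h" "%d. - d *\<^sub>R h" s "{0..t}" \<phi>])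
   show "((%s. x - s *\<^sub>R h) has_derivative (%d. - d *\<^sub>R h)) (at s within {0..t})"
    by (auto intro!: derivative_eq_intros)
   show "(\<phi> has_derivative (%d. d \<bullet> grad \<phi> (x - s *\<^sub>R h))) (at (x - s *\<^sub>R h))"
    by (rule test_has_derivative[OF \<phi>])
  qed
  from has_derivative_minus[OF this]
  show "((%s. - \<phi> (x - s *\<^sub>R h)) has_vector_derivative h \<bullet> grad \<phi> (x - s *\<^sub>R h)) (at s within {0..t})"
   by (simp add: has_vector_derivative_def)
 next
  show "continuous_on {0..t} (%s. h \<bullet> grad \<phi> (x - s *\<^sub>R h))"
   by (intro continuous_intros continuous_on_compose2[OF grad_continuous[OF \<phi>]]) auto
 qed
 then show ?thesis by simp
qed

lemma pair_integrable_mult_bounded: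
 fixes F :: "'a \<times> 'b => complex"
 assumes "integrable M F" and "p \<in> borel_measurable M" "!!z. \<bar>p z\<bar> <= B"
 shows "integrable M (%z. F z * cor (p z))"
proof (rule Bochner_Integration.integrable_bound)
 show "integrable M (%z. B * norm (F z))" using assms by (intro integrable_mult_right integrable_norm)
 show "(%z. F z * cor (p z)) \<in> borel_measurable M" using assms by measurable
 have "norm (F z * cor (p z)) <= norm (B * norm (F z))" for z
 proof -
  have "B \<ge> 0" using assms(3)[of z] by simp
  then show ?thesis using mult_left_mono[OF assms(3)[of z], of "norm (F z)"] by (simp add: norm_mult mult.commute)
 qed
 then show "AE z in M. norm (F z * cor (p z)) <= norm (B * norm (F z))" by simp
qed

lemma grad_support:
 assumes \<phi>: "test_function \<phi>"
 shows "\<exists>R. \<forall>x. norm x \<ge> R --> grad \<phi> x = 0"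
proof -
 have "\<exists>R. \<forall>x. norm x \<ge> R --> pderivative j \<phi> x = 0" for j
  by (rule test_support[OF test_pderivative[OF \<phi>, of j]]) blast
 then obtain R where R: "!!j x. norm x \<ge> R j ==> pderivative j \<phi> x = 0" by metis
 have "grad \<phi> x = 0" if x: "norm x \<ge> Max (range R)" for x
 proof -
  have "R j <= norm x" for j using Max_ge[of "range R" "R j"] x by auto
  then show ?thesis using R by (simp add: vec_eq_iff grad_def)
 qed
 then show ?thesis by blast
qed

text \<open>Against a test function, both sides become the integral of \<open>u\<close> times the increment of
 the test function along the segment: the left one by translation, the right one by Fubini's theorem and the
 definition of the weak gradient.\<close>

theorem weakgrad_line:
 assumes w: "weakgrad u g" and t: "t \<ge> 0"
 shows "AE x in lborel. u (x + t *\<^sub>R h) - u x = line_integral (%x. cdot h (g x)) t h x"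
proof -
 have u: "locint u" and g: "!!j. locint (%x. g x $ j)" using w by (auto simp: weakgrad_def)
 define G where "G x = cdot h (g x)" for x
 have G: "locint G" unfolding G_def by (rule locint_cdot[OF g])
 note [measurable] = locint_measurable[OF u] locint_measurable[OF G]
 have Du: "locint (%x. u (x + t *\<^sub>R h) - u x)" by (intro locint_diff locint_shift u)
 have F: "locint (line_integral G t h)" by (rule locint_line_integral[OF G t])
 have "AE x in lborel. (u (x + t *\<^sub>R h) - u x) - line_integral G t h x = 0"
 proof (rule zero_AE_of_test_functions_complex[OF locint_diff[OF Du F]])
  fix \<phi> :: "real^'a => real" assume \<phi>: "test_function \<phi>"
  note [measurable] = test_measurable[OF \<phi>]
  obtain R where R: "R > 0" "!!x. norm x \<ge> R ==> \<phi> x = 0" using test_support[OF \<phi>] by blast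
  obtain B where B: "B > 0" "!!x. \<bar>\<phi> x\<bar> <= B" using test_bounded[OF \<phi>] by blast
  obtain B' where B': "B' > 0" "!!x. norm (grad \<phi> x) <= B'" using grad_bounded[OF \<phi>] by blast
  define p where "p x = h \<bullet> grad \<phi> x" for x
  have pc: "continuous_on UNIV p" unfolding p_def by (intro continuous_intros grad_continuous[OF \<phi>])
  then have [measurable]: "borel_fun p" by (rule borel_measurable_continuous_onI)
  have pB: "\<bar>p x\<bar> <= norm h * B'" for x
   unfolding p_def using Cauchy_Schwarz_ineq2[of h "grad \<phi> x"] mult_left_mono[OF B'(2)[of x], of "norm h"] by simp
  obtain R1 where "!!x. norm x \<ge> R1 ==> grad \<phi> x = 0" using grad_support[OF \<phi>] by blast
  then have pR: "p x = 0" if "norm x \<ge> R1" for x using that by (simp add: p_def)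
  \<comment> \<open>first exchange: integrate in \<open>x\<close> for fixed \<open>s\<close>\<close>
  have I1: "integrable (lborel \<Otimes>\<^sub>M lborel) (%(s, x). indicator {0..t} s *\<^sub>R (G (x + s *\<^sub>R h) * cor (\<phi> x)))"
  proof -
   have "integrable (lborel \<Otimes>\<^sub>M lborel) (%z. (case z of (s, x) => indicator {0..t} s *\<^sub>R (indicator (ball 0 R) x *\<^sub>R G (x + s *\<^sub>R h))) * cor (\<phi> (snd z)))"
    by (rule pair_integrable_mult_bounded[OF integrable_pair_line[OF G t]]) (use B in auto)
   moreover have "(case z of (s, x) => indicator {0..t} s *\<^sub>R (indicator (ball 0 R) x *\<^sub>R G (x + s *\<^sub>R h))) * cor (\<phi> (snd z))
    = (case z of (s, x) => indicator {0..t} s *\<^sub>R (G (x + s *\<^sub>R h) * cor (\<phi> x)))" for z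
    using R(2)[of "snd z"] by (auto simp: case_prod_unfold indicator_def)
   ultimately show ?thesis by simp
  qed
  have I2: "integrable (lborel \<Otimes>\<^sub>M lborel) (%(s, x). indicator {0..t} s *\<^sub>R (u x * cor (p (x - s *\<^sub>R h))))"
  proof -
   define r where "r = R1 + t * norm h"
   have "integrable (lborel \<Otimes>\<^sub>M lborel) (%z. (case z of (s, x) => indicator {0..t} s *\<^sub>R (indicator (ball 0 r) x *\<^sub>R u (x + s *\<^sub>R 0))) * cor (p (snd z - fst z *\<^sub>R h)))"
    by (rule pair_integrable_mult_bounded[OF integrable_pair_line[OF u t]]) (use pB in auto)
   moreover have "(case z of (s, x) => indicator {0..t} s *\<^sub>R (indicator (ball 0 r) x *\<^sub>R u (x + s *\<^sub>R 0))) * cor (p (snd z - fst z *\<^sub>R h))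
    = (case z of (s, x) => indicator {0..t} s *\<^sub>R (u x * cor (p (x - s *\<^sub>R h))))" for z
   proof (cases "fst z \<in> {0..t} & snd z \<notin> ball 0 r")
    case True
    then have "fst z * norm h <= t * norm h" by (intro mult_right_mono) auto
    then have "R1 <= norm (snd z - fst z *\<^sub>R h)"
     using True norm_triangle_ineq2[of "snd z" "fst z *\<^sub>R h"] by (simp add: r_def)
    then show ?thesis using pR by (simp add: case_prod_unfold)
   qed (auto simp: case_prod_unfold indicator_def)
   ultimately show ?thesis by simp
  qed
  have step: "(LBINT x. G (x + s *\<^sub>R h) * cor (\<phi> x)) = - (LBINT x. u x * cor (p (x - s *\<^sub>R h)))" for s
  proof -
   have gr: "grad (%x. \<phi> (x - s *\<^sub>R h)) x = grad \<phi> (x - s *\<^sub>R h)" for x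
    unfolding grad_def using pderivative_shift(1)[OF test_differentiable[OF \<phi>], where x=x and h="- s *\<^sub>R h"] by simp
   have "(LBINT x. G (x + s *\<^sub>R h) * cor (\<phi> x)) = (LBINT x. G x * cor (\<phi> (x - s *\<^sub>R h)))"
    using lborel_integral_shift(1)[of "%x. G x * cor (\<phi> (x - s *\<^sub>R h))" "s *\<^sub>R h"] by simp
   also have "... = - (LBINT x. u x * cor (h \<bullet> grad (%x. \<phi> (x - s *\<^sub>R h)) x))"
    using weakgrad_direction[OF w test_shift[OF \<phi>, of "- s *\<^sub>R h"], of h] by (simp add: G_def)
   also have "... = - (LBINT x. u x * cor (p (x - s *\<^sub>R h)))" by (simp add: gr p_def)
   finally show ?thesis .
  qed
  have "(LBINT x. line_integral G t h x * cor (\<phi> x))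
   = (LBINT x. (LBINT s. indicator {0..t} s *\<^sub>R (G (x + s *\<^sub>R h) * cor (\<phi> x))))"
   by (simp add: line_integral_def scaleR_conv_of_real flip: integral_mult_left_zero)
    (simp add: mult.assoc)
  also have "... = (LBINT s. (LBINT x. indicator {0..t} s *\<^sub>R (G (x + s *\<^sub>R h) * cor (\<phi> x))))"
   by (rule lborel_pair.Fubini_integral[OF I1])
  also have "... = - (LBINT s. (LBINT x. indicator {0..t} s *\<^sub>R (u x * cor (p (x - s *\<^sub>R h)))))"
   by (simp add: step)
  also have "(LBINT s. (LBINT x. indicator {0..t} s *\<^sub>R (u x * cor (p (x - s *\<^sub>R h)))))
   = (LBINT x. (LBINT s. indicator {0..t} s *\<^sub>R (u x * cor (p (x - s *\<^sub>R h)))))"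
   by (rule lborel_pair.Fubini_integral[OF I2, symmetric])
  also have "... = (LBINT x. u x * cor (\<phi> x - \<phi> (x - t *\<^sub>R h)))"
  proof (rule Bochner_Integration.integral_cong)
   fix x
   have "(LBINT s. indicator {0..t} s *\<^sub>R (u x * cor (p (x - s *\<^sub>R h))))
    = u x * cor (LBINT s. indicator {0..t} s *\<^sub>R p (x - s *\<^sub>R h))"
    by (simp add: scaleR_conv_of_real mult.left_commute flip: integral_complex_of_real integral_mult_right_zero)
   also have "(LBINT s. indicator {0..t} s *\<^sub>R p (x - s *\<^sub>R h)) = \<phi> x - \<phi> (x - t *\<^sub>R h)"
    unfolding p_def by (rule test_increment[OF \<phi> t])
   finally show "(LBINT s. indicator {0..t} s *\<^sub>R (u x * cor (p (x - s *\<^sub>R h))))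
    = u x * cor (\<phi> x - \<phi> (x - t *\<^sub>R h))" .
  qed simp
  finally have L: "(LBINT x. line_integral G t h x * cor (\<phi> x)) = - (LBINT x. u x * cor (\<phi> x - \<phi> (x - t *\<^sub>R h)))" .
  have iu: "integrable lborel (%x. u x * cor (\<phi> x))" by (rule locint_mult_test[OF u \<phi>])
  have iu': "integrable lborel (%x. u x * cor (\<phi> (x - t *\<^sub>R h)))"
   using locint_mult_test[OF u test_shift[OF \<phi>, of "- t *\<^sub>R h"]] by simp
  have iu'': "integrable lborel (%x. u (x + t *\<^sub>R h) * cor (\<phi> x))" by (rule locint_mult_test[OF locint_shift[OF u] \<phi>])
  have sh: "(LBINT x. u (x + t *\<^sub>R h) * cor (\<phi> x)) = (LBINT x. u x * cor (\<phi> (x - t *\<^sub>R h)))"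
   using lborel_integral_shift(1)[of "%x. u x * cor (\<phi> (x - t *\<^sub>R h))" "t *\<^sub>R h"] by simp
  have "(LBINT x. ((u (x + t *\<^sub>R h) - u x) - line_integral G t h x) * cor (\<phi> x))
   = (LBINT x. u (x + t *\<^sub>R h) * cor (\<phi> x)) - (LBINT x. u x * cor (\<phi> x)) - (LBINT x. line_integral G t h x * cor (\<phi> x))"
   using iu iu'' locint_mult_test[OF F \<phi>] by (simp add: left_diff_distrib)
  also have "... = 0"
   using iu iu' by (simp add: L sh right_diff_distrib)
  finally show "(LBINT x. ((u (x + t *\<^sub>R h) - u x) - line_integral G t h x) * cor (\<phi> x)) = 0" .
 qed
 then show ?thesis by eventually_elim (simp add: G_def[abs_def])
qed

lemma phase_integral:
 "(LBINT t. indicator {a..1} t *\<^sub>R (- \<i> * cor c * exp (- \<i> * cor (c * t))))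
  = exp (- \<i> * cor c) - exp (- \<i> * cor (c * a))" if "a <= 1"
proof -
 have "(LBINT t. indicator {a..1} t *\<^sub>R (- \<i> * cor c * exp (- \<i> * cor (c * t))))
  = exp (- \<i> * cor (c * 1)) - exp (- \<i> * cor (c * a))"
 proof (rule integral_FTC_Icc[OF that])
  fix t
  have "((%t. exp (- \<i> * cor (c * t))) has_vector_derivative (- \<i> * cor c) * exp (- \<i> * cor (c * t))) (at t within {a..1})"
  proof (rule field_vector_diff_chain_within[of "%t. - \<i> * cor (c * t)" _ t "{a..1}" exp, unfolded o_def])
   show "((%t. - \<i> * cor (c * t)) has_vector_derivative - \<i> * cor c) (at t within {a..1})"
    by (auto intro!: derivative_eq_intros simp: has_vector_derivative_def scaleR_conv_of_real)
   show "(exp has_field_derivative exp (- \<i> * cor (c * t))) (at (- \<i> * cor (c * t)) within (%t. - \<i> * cor (c * t)) ` {a..1})"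
    by (rule DERIV_subset[OF DERIV_exp]) simp
  qed
  then show "((%t. exp (- \<i> * cor (c * t))) has_vector_derivative - \<i> * cor c * exp (- \<i> * cor (c * t))) (at t within {a..1})"
   by simp
 next
  show "continuous_on {a..1} (%t. - \<i> * cor c * exp (- \<i> * cor (c * t)))"
   by (intro continuous_intros)
 qed
 then show ?thesis by simp
qed

text \<open>The derivative of \<open>t \<mapsto> E t * v t\<close>, integrated; as \<open>v\<close> is only an
 indefinite integral, this is an instance of Fubini's theorem on a triangle.\<close>

lemma phase_by_parts:
 fixes f :: "real => complex" and v0 :: complex and c :: real
 assumes f: "integrable lborel (%s. indicator {0..1} s *\<^sub>R f s)" and [measurable]: "borel_fun f"
 defines "v \<equiv> %t. v0 + (LBINT s. indicator {0..t} s *\<^sub>R f s)" and "E \<equiv> %t. exp (- \<i> * cor (c * t))"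
 shows "exp (- \<i> * cor c) * v 1 - v0
  = (LBINT t. indicator {0..1} t *\<^sub>R (E t * f t - \<i> * cor c * E t * v t))"
proof -
 define k where "k = - \<i> * cor c"
 define D where "D t = k * E t" for t
 have normE: "norm (E t) = 1" for t by (simp add: E_def)
 have Ec: "continuous_on UNIV E" unfolding E_def by (intro continuous_intros)
 have [measurable]: "borel_fun E" by (rule borel_measurable_continuous_onI[OF Ec])
 have [measurable]: "borel_fun D" unfolding D_def by measurable
 have normD: "norm (D t) = \<bar>c\<bar>" for t by (simp add: D_def k_def norm_mult normE)
 have phase: "(LBINT t. indicator {a..1} t *\<^sub>R D t) = E 1 - E a" if "a <= 1" for a
  using phase_integral[OF that, of c] by (simp add: D_def k_def E_def)
 define f1 where "f1 s = indicator {0..1} s *\<^sub>R f s" for s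
 have [measurable]: "borel_fun f1" unfolding f1_def by measurable
 have f1: "integrable lborel f1" using f by (simp add: f1_def[abs_def])
 have Ef: "integrable lborel (%t. E t * f1 t)"
  by (rule Bochner_Integration.integrable_bound[OF f1]) (auto simp: norm_mult normE)
 have iD: "integrable lborel (%t. indicator {0..1} t *\<^sub>R D t)"
 proof (rule Bochner_Integration.integrable_bound)
  show "integrable lborel (%t::real. indicator {0..1} t * \<bar>c\<bar>)" by simp
 qed (auto simp: normD indicator_def)
 define H where "H = (%(t::real, s). (if 0 <= s & s <= t & t <= 1 then D t * f1 s else 0))"
 have [measurable]: "H \<in> borel_measurable (lborel \<Otimes>\<^sub>M lborel)" unfolding H_def by measurable
 have H: "integrable (lborel \<Otimes>\<^sub>M lborel) H"
 proof (rule integrableI_bounded)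
  have "(\<integral>\<^sup>+z. ennreal (norm (H z)) \<partial>(lborel \<Otimes>\<^sub>M lborel)) = (NN t. (NN s. ennreal (norm (H (t, s)))))"
   by (subst lborel.nn_integral_fst[symmetric]) auto
  also have "... <= (NN t. (NN s. (ennreal \<bar>c\<bar> * indicator {0..1::real} t) * ennreal (norm (f1 s))))"
  proof (intro nn_integral_mono)
   fix t s :: real
   show "ennreal (norm (H (t, s))) <= (ennreal \<bar>c\<bar> * indicator {0..1::real} t) * ennreal (norm (f1 s))"
   proof (cases "0 <= s & s <= t & t <= 1")
    case True
    then have "norm (H (t, s)) = \<bar>c\<bar> * norm (f1 s)" by (simp add: H_def norm_mult normD)
    then show ?thesis using True by (simp add: ennreal_mult)
   next
    case False
    then have "H (t, s) = 0" by (auto simp: H_def)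
    then show ?thesis by simp
   qed
  qed
  also have "... = (NN t. (ennreal \<bar>c\<bar> * indicator {0..1::real} t) * (NN s. ennreal (norm (f1 s))))"
   by (simp add: nn_integral_cmult)
  also have "... = ennreal \<bar>c\<bar> * (NN s. ennreal (norm (f1 s)))"
   by (simp add: nn_integral_multc nn_integral_cmult_indicator)
  also have "... < \<infinity>" using f1 by (simp add: integrable_iff_bounded ennreal_mult_less_top)
  finally show "(\<integral>\<^sup>+z. ennreal (norm (H z)) \<partial>(lborel \<Otimes>\<^sub>M lborel)) < \<infinity>" .
 qed measurable
 have inner: "(LBINT s. H (t, s)) = indicator {0..1} t *\<^sub>R (D t * (v t - v0))" for t
 proof (cases "0 <= t & t <= 1")
  case True
  have "(LBINT s. H (t, s)) = (LBINT s. D t * (indicator {0..t} s *\<^sub>R f s))"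
   using True by (intro Bochner_Integration.integral_cong) (auto simp: H_def f1_def indicator_def)
  also have "... = D t * (LBINT s. indicator {0..t} s *\<^sub>R f s)" by (rule integral_mult_right_zero)
  finally show ?thesis using True by (simp add: v_def)
 next
  case False
  then have "H (t, s) = 0" for s by (auto simp: H_def)
  then show ?thesis using False by (auto simp: indicator_def)
 qed
 have outer: "(LBINT t. H (t, s)) = f1 s * (E 1 - E s)" for s
 proof (cases "0 <= s & s <= 1")
  case True
  have "(LBINT t. H (t, s)) = (LBINT t. (indicator {s..1} t *\<^sub>R D t) * f1 s)"
   using True by (intro Bochner_Integration.integral_cong) (auto simp: H_def indicator_def)
  also have "... = (LBINT t. indicator {s..1} t *\<^sub>R D t) * f1 s" by (rule integral_mult_left_zero)
  also have "... = (E 1 - E s) * f1 s" using phase[of s] True by simp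
  finally show ?thesis by (simp add: mult.commute)
 next
  case False
  then have "H (t, s) = 0" for t by (auto simp: H_def)
  then show ?thesis using False by (auto simp: f1_def indicator_def)
 qed
 have "(LBINT t. indicator {0..1} t *\<^sub>R (D t * (v t - v0))) = (LBINT t. (LBINT s. H (t, s)))"
  by (simp add: inner)
 also have "... = (LBINT s. (LBINT t. H (t, s)))"
  using lborel_pair.Fubini_integral[of "%t s. H (t, s)"] H by simp
 also have "... = (LBINT s. E 1 * f1 s - E s * f1 s)" by (simp add: outer algebra_simps)
 also have "... = E 1 * (LBINT s. f1 s) - (LBINT s. E s * f1 s)"
  using f1 Ef by simp
 finally have parts: "(LBINT t. indicator {0..1} t *\<^sub>R (D t * (v t - v0))) = E 1 * (LBINT s. f1 s) - (LBINT s. E s * f1 s)" .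
 have iv: "integrable lborel (%t. indicator {0..1} t *\<^sub>R (D t * (v t - v0)))"
  using lborel_pair.integrable_fst'[OF H] by (simp add: inner)
 define P where "P t = indicator {0..1} t *\<^sub>R (D t * (v t - v0))" for t
 define Q where "Q t = indicator {0..1} t *\<^sub>R D t" for t
 have iP: "integrable lborel P" and iQ: "integrable lborel Q" using iv iD by (simp_all add: P_def[abs_def] Q_def[abs_def])
 have vP: "(LBINT t. P t) = E 1 * (LBINT s. f1 s) - (LBINT s. E s * f1 s)"
  and vQ: "(LBINT t. Q t) = E 1 - E 0"
  using parts phase[of 0] by (simp_all add: P_def[abs_def] Q_def[abs_def])
 have "(LBINT t. indicator {0..1} t *\<^sub>R (E t * f t + D t * v t)) = (LBINT t. E t * f1 t + P t + Q t * v0)"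
  by (rule Bochner_Integration.integral_cong) (auto simp: f1_def P_def Q_def indicator_def algebra_simps)
 also have "... = (LBINT t. E t * f1 t) + (LBINT t. P t) + (LBINT t. Q t) * v0"
  using Ef iP iQ by simp
 also have "... = E 1 * ((LBINT s. f1 s) + v0) - E 0 * v0"
  unfolding vP vQ by (simp add: algebra_simps)
 also have "... = exp (- \<i> * cor c) * v 1 - v0"
  by (simp add: E_def v_def f1_def[abs_def] add.commute)
 finally show ?thesis by (simp add: D_def k_def)
qed

section \<open>Magnetic differences\<close>

definition mag_diff :: "(real^'n => real^'n) => (real^'n => complex) => real^'n => real^'n => complex" where
 "mag_diff A u h x = exp (- \<i> * cor (h \<bullet> A (x + (1/2) *\<^sub>R h))) * u (x + h) - u x"

definition mag_grad :: "(real^'n => real^'n) => (real^'n => complex) => (real^'n => complex^'n) => real^'n => complex^'n" where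
 "mag_grad A u g x = (\<chi> j. g x $ j - \<i> * cor (A x $ j) * u x)"

lemma cdot_mag_grad: "cdot h (mag_grad A u g x) = cdot h (g x) - \<i> * cor (h \<bullet> A x) * u x"
 by (simp add: cdot_def mag_grad_def inner_vec_def right_diff_distrib sum_subtractf sum_distrib_left sum_distrib_right mult_ac)

lemma lipschitz_measurable: "L-lipschitz_on UNIV A ==> A \<in> borel_measurable borel"
 for A :: "real^'n => 'b::{second_countable_topology, metric_space}"
 by (intro borel_measurable_continuous_onI lipschitz_on_continuous_on)

lemma mag_diff_measurable1:
 assumes [measurable]: "borel_fun A" "borel_fun u"
 shows "borel_fun (mag_diff A u h)"
 unfolding mag_diff_def by measurable

text \<open>Along the segment the phase is \<open>exp (- i c t)\<close> with the constant \<open>c = h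
 \<bullet> A (x + h/2)\<close>, so \<open>phase_by_parts\<close> applies.\<close>

theorem mag_diff_formula:
 assumes w: "weakgrad u g" and [measurable]: "borel_fun A"
 shows "AE x in lborel. mag_diff A u h x = (LBINT t. indicator {0..1} t *\<^sub>R
   (exp (- \<i> * cor ((h \<bullet> A (x + (1/2) *\<^sub>R h)) * t)) *
    (cdot h (g (x + t *\<^sub>R h)) - \<i> * cor (h \<bullet> A (x + (1/2) *\<^sub>R h)) * u (x + t *\<^sub>R h))))"
proof -
 have u: "locint u" and g: "!!j. locint (%x. g x $ j)" using w by (auto simp: weakgrad_def)
 define G where "G x = cdot h (g x)" for x
 have G: "locint G" unfolding G_def by (rule locint_cdot[OF g])
 note [measurable] = locint_measurable[OF u] locint_measurable[OF G] line_integral_measurable[OF locint_measurable[OF G]]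
 have [measurable]: "(%z. line_integral G (fst z) h (snd z)) \<in> borel_measurable (borel \<Otimes>\<^sub>M borel)"
  using line_integral_measurable[OF locint_measurable[OF G], of h] by (simp add: case_prod_unfold)
 have line: "AE x in lborel. u (x + t *\<^sub>R h) - u x = line_integral G t h x" if "t \<ge> 0" for t
  unfolding G_def by (rule weakgrad_line[OF w that])
 have "AE t in lborel. AE x in lborel. 0 <= t --> u (x + t *\<^sub>R h) - u x = line_integral G t h x"
 proof (rule AE_I2)
  fix t :: real
  show "AE x in lborel. 0 <= t --> u (x + t *\<^sub>R h) - u x = line_integral G t h x"
   using line[of t] by (cases "0 <= t") auto
 qed
 then have "AE x in lborel. AE t in lborel. 0 <= t --> u (x + t *\<^sub>R h) - u x = line_integral G t h x"
  by (subst (asm) lborel_pair.AE_commute) measurable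
 moreover have "AE x in lborel. u (x + 1 *\<^sub>R h) - u x = line_integral G 1 h x" by (rule line) simp
 moreover have "AE x in lborel. integrable lborel (%s. indicator {0..1} s *\<^sub>R G (x + s *\<^sub>R h))"
  by (rule AE_integrable_line[OF G]) simp
 ultimately show ?thesis
 proof eventually_elim
  case (elim x)
  define c where "c = h \<bullet> A (x + (1/2) *\<^sub>R h)"
  define E where "E t = exp (- \<i> * cor (c * t))" for t
  have [measurable]: "borel_fun E" unfolding E_def by measurable
  have [measurable]: "borel_fun (%t. line_integral G t h x)"
   using measurable_compose[OF _ line_integral_measurable[OF locint_measurable[OF G], of h], of "%t. (t, x)" borel] by simp
  have "mag_diff A u h x = exp (- \<i> * cor c) * (u x + line_integral G 1 h x) - u x"
   using elim(2) by (simp add: mag_diff_def c_def algebra_simps)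
  also have "... = (LBINT t. indicator {0..1} t *\<^sub>R (E t * G (x + t *\<^sub>R h) - \<i> * cor c * E t * (u x + line_integral G t h x)))"
   using phase_by_parts[OF elim(3), of c "u x"] by (simp add: E_def line_integral_def)
  also have "... = (LBINT t. indicator {0..1} t *\<^sub>R (E t * (G (x + t *\<^sub>R h) - \<i> * cor c * u (x + t *\<^sub>R h))))"
  proof (rule integral_cong_AE)
   show "AE t in lborel. indicator {0..1} t *\<^sub>R (E t * G (x + t *\<^sub>R h) - \<i> * cor c * E t * (u x + line_integral G t h x))
    = indicator {0..1} t *\<^sub>R (E t * (G (x + t *\<^sub>R h) - \<i> * cor c * u (x + t *\<^sub>R h)))"
    using elim(1)
   proof eventually_elim
    case (elim t)
    show ?case
    proof (cases "t \<in> {0..1}")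
     case True
     then have "u (x + t *\<^sub>R h) = u x + line_integral G t h x" using elim by (simp add: algebra_simps)
     then show ?thesis by (simp add: algebra_simps)
    qed simp
   qed
  qed measurable
  finally show ?case by (simp add: E_def c_def G_def)
 qed
qed

lemma ennreal_norm_integral_le:
 fixes f :: "'a => 'b::{banach, second_countable_topology}"
 shows "ennreal (norm (\<integral>x. f x \<partial>M)) <= (\<integral>\<^sup>+x. ennreal (norm (f x)) \<partial>M)"
 by (cases "integrable M f") (auto simp: integral_norm_bound_ennreal not_integrable_integral_eq)

text \<open>Replacing \<open>c\<close> by \<open>h \<bullet> A (x + t h)\<close> turns the integrand into the
 magnetic gradient; the points differ from the midpoint by at most half of \<open>h\<close>.\<close>

lemma mag_diff_bound:
 assumes w: "weakgrad u g" and L: "L-lipschitz_on UNIV A"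
 shows "AE x in lborel. ennreal (norm (mag_diff A u h x)) <= (NN t. indicator {0..1} t *
   ennreal (norm (cdot h (mag_grad A u g (x + t *\<^sub>R h))) + (norm h)^2 * L / 2 * norm (u (x + t *\<^sub>R h))))"
 using mag_diff_formula[OF w lipschitz_measurable[OF L], of h]
proof eventually_elim
 case (elim x)
 define c where "c = h \<bullet> A (x + (1/2) *\<^sub>R h)"
 define F where "F t = exp (- \<i> * cor (c * t)) * (cdot h (g (x + t *\<^sub>R h)) - \<i> * cor c * u (x + t *\<^sub>R h))" for t
 have "mag_diff A u h x = (LBINT t. indicator {0..1} t *\<^sub>R F t)" using elim by (simp add: F_def c_def)
 then have "ennreal (norm (mag_diff A u h x)) <= (NN t. ennreal (norm (indicator {0..1} t *\<^sub>R F t)))"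
  by (simp only: ennreal_norm_integral_le)
 also have "... <= (NN t. indicator {0..1} t *
   ennreal (norm (cdot h (mag_grad A u g (x + t *\<^sub>R h))) + (norm h)^2 * L / 2 * norm (u (x + t *\<^sub>R h))))"
 proof (rule nn_integral_mono)
  fix t :: real
  show "ennreal (norm (indicator {0..1} t *\<^sub>R F t)) <= indicator {0..1} t *
   ennreal (norm (cdot h (mag_grad A u g (x + t *\<^sub>R h))) + (norm h)^2 * L / 2 * norm (u (x + t *\<^sub>R h)))"
  proof (cases "t \<in> {0..1}")
   case True
   define y where "y = x + t *\<^sub>R h"
   have L0: "L \<ge> 0" using L by (rule lipschitz_on_nonneg)
   have "\<bar>h \<bullet> A y - c\<bar> <= norm h * norm (A y - A (x + (1/2) *\<^sub>R h))"
    unfolding c_def using Cauchy_Schwarz_ineq2[of h "A y - A (x + (1/2) *\<^sub>R h)"] by (simp add: inner_diff_right)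
   also have "norm (A y - A (x + (1/2) *\<^sub>R h)) <= L * norm (y - (x + (1/2) *\<^sub>R h))"
    using lipschitz_onD[OF L, of y "x + (1/2) *\<^sub>R h"] by (simp add: dist_norm)
   also have "y - (x + (1/2) *\<^sub>R h) = (t - 1/2) *\<^sub>R h" by (simp add: y_def algebra_simps)
   also have "norm ((t - 1/2) *\<^sub>R h) <= 1/2 * norm h"
   proof -
    have "0 <= t" "t <= 1" using True by auto
    then have "\<bar>t - 1/2\<bar> <= 1/2" by (intro abs_leI) linarith+
    then have "\<bar>t - 1/2\<bar> * norm h <= 1/2 * norm h" by (rule mult_right_mono) simp
    then show ?thesis by simp
   qed
   finally have "\<bar>h \<bullet> A y - c\<bar> <= norm h * (L * (1/2 * norm h))"
    using L0 by (simp add: mult_left_mono)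
   then have dA: "\<bar>h \<bullet> A y - c\<bar> <= (norm h)^2 * L / 2" by (simp add: power2_eq_square mult_ac)
   have "norm (F t) = norm (cdot h (g y) - \<i> * cor c * u y)"
    by (simp add: F_def y_def norm_mult)
   also have "cdot h (g y) - \<i> * cor c * u y = cdot h (mag_grad A u g y) + \<i> * cor (h \<bullet> A y - c) * u y"
    by (simp add: cdot_mag_grad algebra_simps)
   also have "norm ... <= norm (cdot h (mag_grad A u g y)) + \<bar>h \<bullet> A y - c\<bar> * norm (u y)"
    by (rule norm_triangle_le) (simp add: norm_mult del: of_real_diff)
   also have "... <= norm (cdot h (mag_grad A u g y)) + (norm h)^2 * L / 2 * norm (u y)"
    by (intro add_left_mono mult_right_mono dA) simp
   finally show ?thesis using True by (simp add: y_def ennreal_leI)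
  qed simp
 qed
 finally show ?case .
qed

lemma square_sum_le: "((a::real) + b)^2 <= (1 + \<eta>) * a^2 + (1 + 1 / \<eta>) * b^2" if "\<eta> > 0"
proof -
 have "0 <= (\<eta> * a - b)^2 / \<eta>" using that by simp
 also have "... = \<eta> * a^2 + b^2 / \<eta> - 2 * a * b" using that by (simp add: field_simps power2_eq_square)
 finally show ?thesis using that by (simp add: power2_sum algebra_simps)
qed

lemma nn_integral_unit_interval_square:
 assumes [measurable]: "borel_fun f"
 shows "(NN t. indicator {0..1::real} t * f t)^2 <= (NN t. indicator {0..1} t * (f t)^2)"
proof -
 have "(NN t. indicator {0..1::real} t * f t) = (NN t. indicator {0..1::real} t * (indicator {0..1} t * f t))"
  by (intro nn_integral_cong) (auto simp: indicator_def)
 also have "...^2 <= (NN t. (indicator {0..1::real} t)^2) * (NN t. (indicator {0..1} t * f t)^2)"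
  by (rule Cauchy_Schwarz_nn_integral) measurable
 also have "(NN t. (indicator {0..1::real} t)^2) = (NN t. indicator {0..1::real} t)"
  by (intro nn_integral_cong) (auto simp: indicator_def)
 also have "(NN t. (indicator {0..1} t * f t)^2) = (NN t. indicator {0..1} t * (f t)^2)"
  by (intro nn_integral_cong) (auto simp: indicator_def)
 finally show ?thesis by simp
qed

lemma mag_grad_measurable:
 assumes w: "weakgrad u g" and A: "borel_fun A"
 shows "borel_fun (%x. cdot h (mag_grad A u g x))"
proof -
 have u: "borel_fun u" and g: "!!j. (%x. g x $ j) \<in> borel_measurable borel"
  using w by (auto simp: weakgrad_def locint_def)
 note [measurable] = A u locint_measurable[OF locint_cdot[of g h]]
 have "borel_fun (%x. cdot h (g x))"
  using w by (intro locint_measurable locint_cdot) (auto simp: weakgrad_def)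
 then show ?thesis unfolding cdot_mag_grad using u A by measurable
qed

lemma ennreal_lincomb:
 "0 <= a ==> 0 <= b ==> 0 <= p ==> 0 <= q ==> ennreal (a * p + b * q) = ennreal a * ennreal p + ennreal b * ennreal q"
 by (simp add: ennreal_mult ennreal_plus)

text \<open>Jensen's inequality on the segment, then translation invariance; \<open>\<eta>\<close> splits the
 square of the sum.\<close>

theorem mag_diff_upper:
 assumes w: "weakgrad u g" and L: "L-lipschitz_on UNIV A" and \<eta>: "\<eta> > 0"
 shows "(energy (mag_diff A u h))
  <= ennreal (1 + \<eta>) * (energy (%x. cdot h (mag_grad A u g x)))
   + ennreal ((1 + 1 / \<eta>) * ((norm h)^2 * L / 2)^2) * (energy u)"
proof -
 define X where "X x = norm (cdot h (mag_grad A u g x))" for x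
 define Y where "Y x = norm (u x)" for x
 define b where "b = (norm h)^2 * L / 2"
 have b0: "b \<ge> 0" using lipschitz_on_nonneg[OF L] by (simp add: b_def)
 have A: "borel_fun A" by (rule lipschitz_measurable[OF L])
 have u: "borel_fun u" using w by (simp add: weakgrad_def locint_def)
 note [measurable] = u A mag_grad_measurable[OF w A] mag_diff_measurable1[OF A u]
 have [measurable]: "borel_fun X" "borel_fun Y" unfolding X_def Y_def by measurable
 define Z where "Z x = ennreal ((1 + \<eta>) * (X x)^2 + (1 + 1 / \<eta>) * (b * Y x)^2)" for x
 have [measurable]: "borel_fun Z" unfolding Z_def by measurable
 have "(energy (mag_diff A u h)) <= (NN x. (NN t. indicator {0..1} t * Z (x + t *\<^sub>R h)))"
 proof (rule nn_integral_mono_AE)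
  show "AE x in lborel. ennreal ((norm (mag_diff A u h x))^2) <= (NN t. indicator {0..1} t * Z (x + t *\<^sub>R h))"
   using mag_diff_bound[OF w L, of h]
  proof eventually_elim
   case (elim x)
   have "ennreal ((norm (mag_diff A u h x))^2) = (ennreal (norm (mag_diff A u h x)))^2"
    by (simp add: ennreal_power)
   also have "... <= (NN t. indicator {0..1} t * ennreal (X (x + t *\<^sub>R h) + b * Y (x + t *\<^sub>R h)))^2"
    using elim by (intro power_mono) (auto simp: X_def Y_def b_def)
   also have "... <= (NN t. indicator {0..1} t * (ennreal (X (x + t *\<^sub>R h) + b * Y (x + t *\<^sub>R h)))^2)"
    by (rule nn_integral_unit_interval_square) measurable
   also have "... <= (NN t. indicator {0..1} t * Z (x + t *\<^sub>R h))"
   proof (intro nn_integral_mono mult_left_mono)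
    fix t
    have "(ennreal (X (x + t *\<^sub>R h) + b * Y (x + t *\<^sub>R h)))^2 = ennreal ((X (x + t *\<^sub>R h) + b * Y (x + t *\<^sub>R h))^2)"
     using b0 by (intro ennreal_power) (simp add: X_def Y_def)
    also have "... <= Z (x + t *\<^sub>R h)" unfolding Z_def by (intro ennreal_leI square_sum_le \<eta>)
    finally show "(ennreal (X (x + t *\<^sub>R h) + b * Y (x + t *\<^sub>R h)))^2 <= Z (x + t *\<^sub>R h)" .
   qed simp
   finally show ?case .
  qed
 qed
 also have "... = (NN t. (NN x. indicator {0..1} t * Z (x + t *\<^sub>R h)))"
  by (rule lborel_pair.Fubini') measurable
 also have "... = (NN t. indicator {0..1::real} t * (NN x. Z x))"
  by (intro nn_integral_cong) (simp add: nn_integral_cmult nn_integral_lborel_shift)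
 also have "... = (NN x. Z x)" by (simp add: nn_integral_multc)
 also have "... = (NN x. ennreal (1 + \<eta>) * ennreal ((X x)^2) + ennreal ((1 + 1 / \<eta>) * b^2) * ennreal ((Y x)^2))"
  unfolding Z_def using \<eta> by (intro nn_integral_cong) (simp add: ennreal_lincomb power_mult_distrib mult.assoc[symmetric] del: ennreal_plus)
 also have "... = ennreal (1 + \<eta>) * (NN x. ennreal ((X x)^2)) + ennreal ((1 + 1 / \<eta>) * b^2) * (NN x. ennreal ((Y x)^2))"
  by (simp add: nn_integral_add nn_integral_cmult)
 finally show ?thesis by (simp add: X_def Y_def b_def)
qed

theorem mag_diff_trivial_upper:
 assumes [measurable]: "borel_fun u" "borel_fun A"
 shows "(energy (mag_diff A u h)) <= 4 * (energy u)"
proof -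
 have "(energy (mag_diff A u h))
  <= (NN x. 2 * ennreal ((norm (u (x + h)))^2) + 2 * ennreal ((norm (u x))^2))"
 proof (rule nn_integral_mono)
  fix x
  have "norm (mag_diff A u h x) <= norm (u (x + h)) + norm (u x)"
   unfolding mag_diff_def by (rule norm_triangle_le_diff) (simp add: norm_mult)
  then have "(norm (mag_diff A u h x))^2 <= (norm (u (x + h)) + norm (u x))^2" by (intro power_mono) auto
  also have "... <= 2 * (norm (u (x + h)))^2 + 2 * (norm (u x))^2"
   using square_sum_le[of 1 "norm (u (x + h))" "norm (u x)"] by simp
  finally have "ennreal ((norm (mag_diff A u h x))^2) <= ennreal (2 * (norm (u (x + h)))^2 + 2 * (norm (u x))^2)" by (rule ennreal_leI)
  then show "ennreal ((norm (mag_diff A u h x))^2) <= 2 * ennreal ((norm (u (x + h)))^2) + 2 * ennreal ((norm (u x))^2)"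
   by (simp add: ennreal_mult)
 qed
 also have "... = 2 * (energy (%x. u (x + h))) + 2 * (energy u)"
  by (simp add: nn_integral_add nn_integral_cmult)
 also have "(energy (%x. u (x + h))) = (energy u)"
  using nn_integral_lborel_shift[of "%x. ennreal ((norm (u x))^2)" h] by simp
 finally show ?thesis by (simp add: distrib_right[symmetric])
qed

lemma norm_iexp_minus_1: "norm (exp (\<i> * cor \<theta>) - 1) <= \<bar>\<theta>\<bar>"
 using iexp_approx1[of \<theta> 0] by simp

lemma norm_iexp_minus_linear: "norm (exp (\<i> * cor \<theta>) - 1 - \<i> * cor \<theta>) <= \<theta>^2"
proof -
 have "norm (exp (\<i> * cor \<theta>) - (1 + \<i> * cor \<theta>)) <= \<theta>^2 / 2"
  using iexp_approx1[of \<theta> 1] by (simp add: power2_eq_square)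
 then show ?thesis by (simp add: diff_diff_add) (smt (verit) zero_le_power2 field_sum_of_halves)
qed

section \<open>The limit of magnetic difference quotients against test functions\<close>

lemma lipschitz_norm_le:
 fixes A :: "'a::real_normed_vector => 'b::real_normed_vector"
 assumes "L-lipschitz_on UNIV A" shows "norm (A x) <= norm (A 0) + L * norm x"
proof -
 have "dist (A x) (A 0) <= L * dist x 0" by (rule lipschitz_onD[OF assms]) auto
 then have "norm (A x - A 0) <= L * norm x" by (simp add: dist_norm)
 then show ?thesis using norm_triangle_sub[of "A x" "A 0"] by linarith
qed

text \<open>The adjoint of the magnetic difference applied to \<open>\<phi>\<close>, so that limits can be
 taken on the smooth side.\<close>

definition shifted_test :: "(real^'n => real^'n) => (real^'n => real) => real^'n => real^'n => complex" where
 "shifted_test A \<phi> h x = exp (\<i> * cor (- (h \<bullet> A (x - (1/2) *\<^sub>R h)))) * cor (\<phi> (x - h)) - cor (\<phi> x)"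

lemma integral_mag_diff_test:
 assumes u: "locint u" and A[measurable]: "borel_fun A" and \<phi>: "test_function \<phi>"
 shows "(LBINT x. mag_diff A u h x * cor (\<phi> x)) = (LBINT x. u x * shifted_test A \<phi> h x)"
  and "integrable lborel (%x. mag_diff A u h x * cor (\<phi> x))"
proof -
 note [measurable] = locint_measurable[OF u] test_measurable[OF \<phi>]
 define F where "F y = exp (- \<i> * cor (h \<bullet> A (y - (1/2) *\<^sub>R h))) * u y * cor (\<phi> (y - h))" for y
 have [measurable]: "borel_fun F" unfolding F_def by measurable
 have iu: "integrable lborel (%x. u x * cor (\<phi> x))" by (rule locint_mult_test[OF u \<phi>])
 have iu': "integrable lborel (%x. u x * cor (\<phi> (x - h)))"
  using locint_mult_test[OF u test_shift[OF \<phi>, of "- h"]] by simp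
 have iF: "integrable lborel F"
  by (rule Bochner_Integration.integrable_bound[OF iu']) (auto simp: F_def norm_mult)
 have xh: "x + h - (1/2) *\<^sub>R h = x + (1/2) *\<^sub>R h" for x :: "real^'a"
  by (simp add: algebra_simps scaleR_left_distrib[symmetric] flip: scaleR_left.add)
 have Fh: "F (x + h) = exp (- \<i> * cor (h \<bullet> A (x + (1/2) *\<^sub>R h))) * u (x + h) * cor (\<phi> x)" for x
  unfolding F_def xh by simp
 have iFh: "integrable lborel (%x. F (x + h))" using lborel_integral_shift(2)[of F h] iF by simp
 have eq: "mag_diff A u h x * cor (\<phi> x) = F (x + h) - u x * cor (\<phi> x)" for x
  unfolding Fh mag_diff_def by (simp add: algebra_simps)
 show "integrable lborel (%x. mag_diff A u h x * cor (\<phi> x))"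
  unfolding eq by (intro Bochner_Integration.integrable_diff iFh iu)
 have "(LBINT x. mag_diff A u h x * cor (\<phi> x)) = (LBINT x. F (x + h)) - (LBINT x. u x * cor (\<phi> x))"
  unfolding eq by (rule Bochner_Integration.integral_diff[OF iFh iu])
 also have "(LBINT x. F (x + h)) = (LBINT x. F x)" by (rule lborel_integral_shift(1)) measurable
 also have "(LBINT x. F x) - (LBINT x. u x * cor (\<phi> x)) = (LBINT x. F x - u x * cor (\<phi> x))"
  by (rule Bochner_Integration.integral_diff[OF iF iu, symmetric])
 also have "... = (LBINT x. u x * shifted_test A \<phi> h x)"
  by (rule Bochner_Integration.integral_cong) (auto simp: F_def shifted_test_def algebra_simps)
 finally show "(LBINT x. mag_diff A u h x * cor (\<phi> x)) = (LBINT x. u x * shifted_test A \<phi> h x)" .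
qed

lemma shifted_test_bound:
 assumes L: "L-lipschitz_on UNIV A" and \<phi>: "test_function \<phi>"
 obtains C R where "C \<ge> 0" "!!r x. 0 < r ==> r <= 1 ==> norm (shifted_test A \<phi> (r *\<^sub>R s) x) <= r * C"
  "!!r x. 0 < r ==> r <= 1 ==> norm x \<ge> R ==> shifted_test A \<phi> (r *\<^sub>R s) x = 0"
proof -
 obtain R where R: "R > 0" "!!x. norm x \<ge> R ==> \<phi> x = 0" using test_support[OF \<phi>] by blast
 obtain B where B: "B > 0" "!!x. \<bar>\<phi> x\<bar> <= B" using test_bounded[OF \<phi>] by blast
 obtain M where M: "M > 0" "!!x. norm (grad \<phi> x) <= M" using grad_bounded[OF \<phi>] by blast
 have L0: "L \<ge> 0" by (rule lipschitz_on_nonneg[OF L])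
 define K where "K = norm (A 0) + L * (R + norm s)"
 have K0: "K \<ge> 0" using L0 R(1) by (simp add: K_def)
 define C where "C = M * norm s + norm s * K * B"
 show thesis
 proof (rule that[of C "R + norm s"])
  show "C \<ge> 0" using M B K0 by (simp add: C_def)
  fix r :: real and x assume r: "0 < r" "r <= 1"
  have rs: "norm (r *\<^sub>R s) <= norm s" using r by (simp add: mult_left_le_one_le)
  define \<theta> where "\<theta> = (r *\<^sub>R s) \<bullet> A (x - (1/2) *\<^sub>R (r *\<^sub>R s))"
  have eq: "shifted_test A \<phi> (r *\<^sub>R s) x = exp (\<i> * cor (- \<theta>)) * cor (\<phi> (x - r *\<^sub>R s) - \<phi> x)
   + (exp (\<i> * cor (- \<theta>)) - 1) * cor (\<phi> x)"
   unfolding shifted_test_def \<theta>_def[symmetric] by (simp add: algebra_simps)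
  have 1: "\<bar>\<phi> (x - r *\<^sub>R s) - \<phi> x\<bar> <= M * (r * norm s)"
   using test_lipschitz[OF \<phi> M(2), of "x - r *\<^sub>R s" x] r by simp
  have 2: "norm ((exp (\<i> * cor (- \<theta>)) - 1) * cor (\<phi> x)) <= r * (norm s * K * B)"
  proof (cases "norm x \<ge> R")
   case True then show ?thesis using R K0 B r by simp
  next
   case False
   have "norm (x - (1/2) *\<^sub>R (r *\<^sub>R s)) <= norm x + norm (r *\<^sub>R s)"
   proof -
    have "norm ((1/2) *\<^sub>R v) <= norm v" for v :: "real^'a" by simp
    then show ?thesis
     using norm_triangle_ineq4[of x "(1/2) *\<^sub>R (r *\<^sub>R s)"] by (meson add_left_mono order_trans)
   qed
   then have "norm (x - (1/2) *\<^sub>R (r *\<^sub>R s)) <= R + norm s" using rs False by simp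
   then have "norm (A (x - (1/2) *\<^sub>R (r *\<^sub>R s))) <= K"
    unfolding K_def using lipschitz_norm_le[OF L, of "x - (1/2) *\<^sub>R (r *\<^sub>R s)"] L0 by (meson add_left_mono mult_left_mono order_trans)
   then have "\<bar>\<theta>\<bar> <= norm (r *\<^sub>R s) * K"
    unfolding \<theta>_def using Cauchy_Schwarz_ineq2 by (meson mult_left_mono norm_ge_zero order_trans)
   then have "norm (exp (\<i> * cor (- \<theta>)) - 1) <= r * norm s * K"
    using norm_iexp_minus_1[of "- \<theta>"] r by simp
   then have "norm (exp (\<i> * cor (- \<theta>)) - 1) * \<bar>\<phi> x\<bar> <= (r * norm s * K) * B"
    using B K0 r by (intro mult_mono) auto
   then show ?thesis by (simp add: norm_mult mult_ac)
  qed
  have "norm (shifted_test A \<phi> (r *\<^sub>R s) x) <= \<bar>\<phi> (x - r *\<^sub>R s) - \<phi> x\<bar> + r * (norm s * K * B)"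
   unfolding eq by (rule order_trans[OF norm_triangle_ineq add_mono[OF _ 2]]) (simp add: norm_mult del: of_real_diff)
  then show "norm (shifted_test A \<phi> (r *\<^sub>R s) x) <= r * C"
   using 1 by (simp add: C_def algebra_simps)
  assume x: "norm x \<ge> R + norm s"
  have "norm (x - r *\<^sub>R s) \<ge> R" using x rs norm_triangle_ineq2[of x "r *\<^sub>R s"] by linarith
  moreover have "norm x \<ge> R" using x norm_ge_zero[of s] by linarith
  ultimately show "shifted_test A \<phi> (r *\<^sub>R s) x = 0" using R by (simp add: shifted_test_def)
 qed
qed

lemma shifted_test_tendsto:
 assumes L: "L-lipschitz_on UNIV A" and \<phi>: "test_function \<phi>" and r: "!!n. r n > 0" "r \<longlonglongrightarrow> 0"
 shows "(%n. shifted_test A \<phi> (r n *\<^sub>R s) x / cor (r n))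
  \<longlonglongrightarrow> - (cor (s \<bullet> grad \<phi> x) + \<i> * cor (s \<bullet> A x) * cor (\<phi> x))"
proof -
 define a where "a n = s \<bullet> A (x - (1/2) *\<^sub>R (r n *\<^sub>R s))" for n
 define e where "e n = exp (\<i> * cor (- (r n * a n)))" for n
 have Ac: "continuous_on UNIV A" by (rule lipschitz_on_continuous_on[OF L])
 have "(%n. x - (1/2) *\<^sub>R (r n *\<^sub>R s)) \<longlonglongrightarrow> x - (1/2) *\<^sub>R (0 *\<^sub>R s)" by (intro tendsto_intros r)
 then have "(%n. A (x - (1/2) *\<^sub>R (r n *\<^sub>R s))) \<longlonglongrightarrow> A x"
  using Ac by (intro continuous_on_tendsto_compose[OF Ac]) auto
 then have a: "a \<longlonglongrightarrow> s \<bullet> A x" unfolding a_def by (intro tendsto_intros)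
 have ra: "(%n. r n * a n) \<longlonglongrightarrow> 0 * (s \<bullet> A x)" by (intro tendsto_mult r a)
 have "e \<longlonglongrightarrow> exp (\<i> * cor (- (0 * (s \<bullet> A x))))"
  unfolding e_def by (intro tendsto_exp tendsto_mult[OF tendsto_const] tendsto_of_real tendsto_minus ra)
 then have e: "e \<longlonglongrightarrow> 1" by simp
 have q: "(%n. (\<phi> (x - r n *\<^sub>R s) - \<phi> x) / r n) \<longlonglongrightarrow> - (s \<bullet> grad \<phi> x)"
 proof -
  have "((%d. \<phi> (x - d *\<^sub>R s)) has_derivative (%d. (- d *\<^sub>R s) \<bullet> grad \<phi> (x - 0 *\<^sub>R s))) (at 0 within UNIV)"
  proof (rule has_derivative_compose[of "%d. x - d *\<^sub>R s" "%d. - d *\<^sub>R s" 0 UNIV \<phi>])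
   show "((%d. x - d *\<^sub>R s) has_derivative (%d. - d *\<^sub>R s)) (at 0 within UNIV)"
    by (auto intro!: derivative_eq_intros)
   show "(\<phi> has_derivative (%d. d \<bullet> grad \<phi> (x - 0 *\<^sub>R s))) (at (x - 0 *\<^sub>R s))"
    by (rule test_has_derivative[OF \<phi>])
  qed
  then have "((%d. \<phi> (x - d *\<^sub>R s)) has_real_derivative - (s \<bullet> grad \<phi> x)) (at 0)"
  proof -
   have "(%d. - (d * (s \<bullet> grad \<phi> x))) = (*) (- (s \<bullet> grad \<phi> x))" by (auto simp: fun_eq_iff)
   then show "((%d. \<phi> (x - d *\<^sub>R s)) has_derivative (%d. (- d *\<^sub>R s) \<bullet> grad \<phi> (x - 0 *\<^sub>R s))) (at 0 within UNIV) ==> ?thesis"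
    by (simp add: has_field_derivative_def)
  qed
  then have "((%d. (\<phi> (x - d *\<^sub>R s) - \<phi> x) / d) \<longlongrightarrow> - (s \<bullet> grad \<phi> x)) (at 0)"
   by (simp add: has_field_derivative_iff)
  moreover have "filterlim r (at 0) sequentially"
   using r by (auto simp: filterlim_at intro!: always_eventually) (metis less_irrefl)
  ultimately show ?thesis by (rule filterlim_compose)
 qed
 have p: "(%n. (e n - 1) / cor (r n)) \<longlonglongrightarrow> - (\<i> * cor (s \<bullet> A x))"
 proof -
  have "(%n. (e n - 1) / cor (r n) + \<i> * cor (a n)) \<longlonglongrightarrow> 0"
  proof (rule Lim_null_comparison)
   have "norm ((e n - 1) / cor (r n) + \<i> * cor (a n)) <= r n * (a n)^2" for n
   proof -
    have "(e n - 1) / cor (r n) + \<i> * cor (a n) = (e n - 1 - \<i> * cor (- (r n * a n))) / cor (r n)"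
     using r(1)[of n] by (simp add: field_simps)
    then have "norm ((e n - 1) / cor (r n) + \<i> * cor (a n)) = norm (e n - 1 - \<i> * cor (- (r n * a n))) / r n"
     using r(1)[of n] by (simp add: norm_divide)
    also have "... <= (- (r n * a n))^2 / r n"
     unfolding e_def using r(1)[of n] by (intro divide_right_mono norm_iexp_minus_linear) auto
    also have "... = r n * (a n)^2" using r(1)[of n] by (simp add: power2_eq_square)
    finally show ?thesis .
   qed
   then show "\<forall>\<^sub>F n in sequentially. norm ((e n - 1) / cor (r n) + \<i> * cor (a n)) <= r n * (a n)^2" by simp
   have "(%n. r n * (a n)^2) \<longlonglongrightarrow> 0 * (s \<bullet> A x)^2" by (intro tendsto_intros r a)
   then show "(%n. r n * (a n)^2) \<longlonglongrightarrow> 0" by simp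
  qed
  moreover have "(%n. \<i> * cor (a n)) \<longlonglongrightarrow> \<i> * cor (s \<bullet> A x)" by (intro tendsto_intros a)
  ultimately have "(%n. ((e n - 1) / cor (r n) + \<i> * cor (a n)) - \<i> * cor (a n)) \<longlonglongrightarrow> 0 - \<i> * cor (s \<bullet> A x)"
   by (rule tendsto_diff)
  then show ?thesis by simp
 qed
 have "shifted_test A \<phi> (r n *\<^sub>R s) x / cor (r n)
  = e n * cor ((\<phi> (x - r n *\<^sub>R s) - \<phi> x) / r n) + (e n - 1) / cor (r n) * cor (\<phi> x)" for n
  using r(1)[of n] unfolding shifted_test_def e_def a_def by (simp add: field_simps)
 moreover have "(%n. e n * cor ((\<phi> (x - r n *\<^sub>R s) - \<phi> x) / r n) + (e n - 1) / cor (r n) * cor (\<phi> x))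
  \<longlonglongrightarrow> 1 * cor (- (s \<bullet> grad \<phi> x)) + - (\<i> * cor (s \<bullet> A x)) * cor (\<phi> x)"
  by (intro tendsto_add tendsto_mult tendsto_of_real tendsto_const e q p)
 ultimately show ?thesis by (simp add: algebra_simps)
qed

text \<open>The magnetic gradient in the direction \<open>s\<close> as a distribution.\<close>

definition weak_mag :: "(real^'n => real^'n) => (real^'n => complex) => real^'n => (real^'n => real) => complex" where
 "weak_mag A u s \<phi> = - (LBINT x. u x * (cor (s \<bullet> grad \<phi> x) + \<i> * cor (s \<bullet> A x) * cor (\<phi> x)))"

theorem mag_diff_test_tendsto:
 assumes u: "locint u" and L: "L-lipschitz_on UNIV A" and \<phi>: "test_function \<phi>"
  and r: "!!n. r n > 0" "!!n. r n <= 1" "r \<longlonglongrightarrow> 0"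
 shows "(%n. (LBINT x. mag_diff A u (r n *\<^sub>R s) x * cor (\<phi> x)) / cor (r n)) \<longlonglongrightarrow> weak_mag A u s \<phi>"
proof -
 have A[measurable]: "borel_fun A" by (rule lipschitz_measurable[OF L])
 note [measurable] = locint_measurable[OF u] test_measurable[OF \<phi>]
 have [measurable]: "borel_fun (grad \<phi>)" by (rule borel_measurable_continuous_onI[OF grad_continuous[OF \<phi>]])
 obtain C R where C: "C \<ge> 0" "!!r x. 0 < r ==> r <= 1 ==> norm (shifted_test A \<phi> (r *\<^sub>R s) x) <= r * C"
  "!!r x. 0 < r ==> r <= 1 ==> norm x \<ge> R ==> shifted_test A \<phi> (r *\<^sub>R s) x = 0"
  using shifted_test_bound[OF L \<phi>, of s] by blast
 have "(%n. \<integral>x. u x * (shifted_test A \<phi> (r n *\<^sub>R s) x / cor (r n)) \<partial>lborel)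
  \<longlonglongrightarrow> (LBINT x. u x * - (cor (s \<bullet> grad \<phi> x) + \<i> * cor (s \<bullet> A x) * cor (\<phi> x)))"
 proof (rule integral_dominated_convergence[where w="%x. C * norm (indicator (ball 0 R) x *\<^sub>R u x)"])
  show "integrable lborel (%x. C * norm (indicator (ball 0 R) x *\<^sub>R u x))"
   using u by (intro integrable_mult_right integrable_norm) (simp add: locint_def)
  show "AE x in lborel. (%n. u x * (shifted_test A \<phi> (r n *\<^sub>R s) x / cor (r n)))
   \<longlonglongrightarrow> u x * - (cor (s \<bullet> grad \<phi> x) + \<i> * cor (s \<bullet> A x) * cor (\<phi> x))"
   by (intro AE_I2 tendsto_mult tendsto_const shifted_test_tendsto[OF L \<phi> r(1,3)])
  show "AE x in lborel. norm (u x * (shifted_test A \<phi> (r n *\<^sub>R s) x / cor (r n))) <= C * norm (indicator (ball 0 R) x *\<^sub>R u x)" for n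
  proof (rule AE_I2)
   fix x
   show "norm (u x * (shifted_test A \<phi> (r n *\<^sub>R s) x / cor (r n))) <= C * norm (indicator (ball 0 R) x *\<^sub>R u x)"
   proof (cases "norm x < R")
    case True
    have "norm (shifted_test A \<phi> (r n *\<^sub>R s) x) / r n <= C"
     using C(2)[OF r(1,2), of n x] r(1)[of n] by (simp add: divide_le_eq mult.commute)
    then have "norm (u x) * (norm (shifted_test A \<phi> (r n *\<^sub>R s) x) / r n) <= norm (u x) * C" by (rule mult_left_mono) simp
    then show ?thesis using True r(1)[of n] by (simp add: norm_mult norm_divide mult.commute)
   qed (use C(3)[OF r(1,2)] in auto)
  qed
  show "(%x. u x * (shifted_test A \<phi> (r n *\<^sub>R s) x / cor (r n))) \<in> borel_measurable lborel" for n
   unfolding shifted_test_def by measurable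
  show "(%x. u x * - (cor (s \<bullet> grad \<phi> x) + \<i> * cor (s \<bullet> A x) * cor (\<phi> x))) \<in> borel_measurable lborel"
   by measurable
 qed
 moreover have "(LBINT x. u x * (shifted_test A \<phi> (r n *\<^sub>R s) x / cor (r n)))
  = (LBINT x. mag_diff A u (r n *\<^sub>R s) x * cor (\<phi> x)) / cor (r n)" for n
  unfolding integral_mag_diff_test(1)[OF u A \<phi>] times_divide_eq_right by (rule integral_divide_zero)
 moreover have "(LBINT x. u x * - (cor (s \<bullet> grad \<phi> x) + \<i> * cor (s \<bullet> A x) * cor (\<phi> x))) = weak_mag A u s \<phi>"
  unfolding weak_mag_def mult_minus_right by (rule Bochner_Integration.integral_minus)
 ultimately show ?thesis by (simp only:)
qed

section \<open>Square integrable functions and weak lower semicontinuity\<close>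

definition cL2 :: "('a::euclidean_space => complex) => bool" where
 "cL2 u \<longleftrightarrow> u \<in> borel_measurable borel & (energy u) < \<infinity>"

lemma cL2_parts:
 assumes "cL2 u"
 shows "sq_integrable lborel (%x. Re (u x))" "sq_integrable lborel (%x. Im (u x))"
proof -
 have [measurable]: "borel_fun u" using assms by (simp add: cL2_def)
 have "(NN x. ennreal ((Re (u x))^2)) <= (energy u)"
  by (intro nn_integral_mono ennreal_leI) (simp add: cmod_power2)
 moreover have "(NN x. ennreal ((Im (u x))^2)) <= (energy u)"
  by (intro nn_integral_mono ennreal_leI) (simp add: cmod_power2)
 ultimately show "sq_integrable lborel (%x. Re (u x))" "sq_integrable lborel (%x. Im (u x))"
  using assms by (auto intro!: sq_integrableI_nn simp: cL2_def le_less_trans)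
qed

lemma cL2_integrable: "cL2 u ==> integrable lborel (%x. (norm (u x))^2)"
 unfolding cL2_def by (intro integrableI_nonneg) auto

lemma cL2_nn_integral: "cL2 u ==> (energy u) = ennreal (LBINT x. (norm (u x))^2)"
 by (intro nn_integral_eq_integral cL2_integrable) auto

lemma cL2_locint: assumes "cL2 u" shows "locint u"
proof (rule locintI)
 show u[measurable]: "borel_fun u" using assms by (simp add: cL2_def)
 fix R
 have "(NN x. indicator (ball 0 R) x * ennreal (norm (u x)))
  <= (NN x. indicator (ball 0 R) x + ennreal ((norm (u x))^2))"
 proof (rule nn_integral_mono)
  fix x
  have "norm (u x) <= 1 + (norm (u x))^2"
   using zero_le_power2[of "norm (u x) - 1/2"] by (simp add: power2_eq_square algebra_simps)
  then have "ennreal (norm (u x)) <= 1 + ennreal ((norm (u x))^2)"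
   by (metis ennreal_1 ennreal_leI ennreal_plus zero_le_one zero_le_power2)
  then show "indicator (ball 0 R) x * ennreal (norm (u x)) <= indicator (ball 0 R) x + ennreal ((norm (u x))^2)"
   by (auto simp: indicator_def)
 qed
 also have "... = emeasure lborel (ball (0::'a) R) + (energy u)"
  by (subst nn_integral_add) auto
 also have "... < \<infinity>" using assms emeasure_lborel_ball_finite[of "0::'a" R] by (simp add: cL2_def)
 finally show "(NN x. indicator (ball 0 R) x * ennreal (norm (u x))) < \<infinity>" .
qed

lemma cL2_of_real: "sq_integrable lborel f ==> cL2 (%x. cor (f x))"
proof -
 assume f: "sq_integrable lborel f"
 then have "borel_fun f" by (simp add: sq_integrable_def)
 then have "borel_fun (%x. cor (f x))" by measurable
 then show ?thesis using sq_integrable_nn_integral[OF f] by (simp add: cL2_def)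
qed

lemma test_sq_integrable:
 fixes \<phi> :: "real^'n => real"
 assumes \<phi>: "test_function \<phi>" shows "sq_integrable lborel \<phi>"
proof -
 have meas[measurable]: "borel_fun (\<phi>)" by (rule test_measurable[OF \<phi>])
 obtain R where R: "R > 0" "!!x. norm x \<ge> R ==> \<phi> x = 0" using test_support[OF \<phi>] by blast
 obtain B where B: "B > 0" "!!x. \<bar>\<phi> x\<bar> <= B" using test_bounded[OF \<phi>] by blast
 have "(NN x. ennreal ((\<phi> x)^2)) <= (NN x. ennreal (B^2) * indicator (ball (0::real^'n) R) x)"
 proof (rule nn_integral_mono)
  fix x
  have "(\<phi> x)^2 <= B^2" using power_mono[OF B(2)[of x], of 2] by simp
  then show "ennreal ((\<phi> x)^2) <= ennreal (B^2) * indicator (ball 0 R) x"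
   using R(2)[of x] by (auto simp: indicator_def intro: ennreal_leI)
 qed
 also have "... = ennreal (B^2) * emeasure lborel (ball (0::real^'n) R)" by (subst nn_integral_cmult) auto
 also have "... < \<infinity>" using emeasure_lborel_ball_finite[of "0::real^'n" R] by (simp add: ennreal_mult_less_top)
 finally show ?thesis by (intro sq_integrableI_nn) auto
qed

text \<open>Represent \<open>\<phi> \<mapsto> \<integral> f \<phi>\<close> by a function in the closure of the
 test functions; it equals \<open>f\<close> almost everywhere.\<close>

lemma test_dense:
 fixes f :: "real^'n => real"
 assumes f: "sq_integrable lborel f" and e: "e > 0"
 shows "\<exists>\<phi>. test_function \<phi> & (LBINT x. (\<phi> x - f x)^2) < e"
proof -
 define V where "V = {\<phi> :: real^'n => real. test_function \<phi>}"
 have V: "\<phi> \<in> V ==> sq_integrable lborel \<phi>" for \<phi> by (simp add: V_def test_sq_integrable)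
 have ex: "\<exists>g. sq_integrable lborel g & (\<forall>v\<in>V. (LBINT x. f x * v x) = (LBINT x. g x * v x)) &
  (\<forall>e>0. \<exists>v\<in>V. (LBINT x. (v x - g x)^2) < e)"
 proof (rule Riesz_representation[of V lborel "%v. \<integral>x. f x * v x \<partial>lborel" "\<integral>x. (f x)^2 \<partial>lborel"])
  show "V ~= {}" using test_zero by (auto simp: V_def)
  show "(%x. a * v x + b * w x) \<in> V" if "v \<in> V" "w \<in> V" for v w a b
   using that test_lincomb by (auto simp: V_def)
  show "(LBINT x. f x * (a * v x + b * w x)) = a * (LBINT x. f x * v x) + b * (LBINT x. f x * w x)"
   if "v \<in> V" "w \<in> V" for v w a b
  proof -
   have "(LBINT x. f x * (a * v x + b * w x)) = (LBINT x. a * (f x * v x) + b * (f x * w x))"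
    by (rule Bochner_Integration.integral_cong) (auto simp: algebra_simps)
   then show ?thesis
    using sq_integrable_mult_integrable[OF f V[OF that(1)]] sq_integrable_mult_integrable[OF f V[OF that(2)]] by simp
  qed
  show "(LBINT x. f x * v x)^2 <= (LBINT x. (f x)^2) * (LBINT x. (v x)^2)" if "v \<in> V" for v
   by (rule sq_integrable_Cauchy_Schwarz[OF f V[OF that]])
 qed (use V in auto)
 obtain g where g: "sq_integrable lborel g" "!!v. v \<in> V ==> (LBINT x. f x * v x) = (LBINT x. g x * v x)"
  "!!e. e > 0 ==> \<exists>v\<in>V. (LBINT x. (v x - g x)^2) < e"
  using ex by blast
 have "AE x in lborel. cor (f x) - cor (g x) = 0"
 proof (rule zero_AE_of_test_functions_complex)
  show "locint (%x. cor (f x) - cor (g x))"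
   by (intro locint_diff cL2_locint cL2_of_real f g)
  fix \<phi> :: "real^'n => real" assume \<phi>: "test_function \<phi>"
  then have \<phi>V: "\<phi> \<in> V" by (simp add: V_def)
  have "(LBINT x. (cor (f x) - cor (g x)) * cor (\<phi> x))
   = (LBINT x. cor (f x * \<phi> x - g x * \<phi> x))"
   by (rule Bochner_Integration.integral_cong) (auto simp: algebra_simps)
  also have "... = cor (LBINT x. f x * \<phi> x - g x * \<phi> x)" by (rule integral_complex_of_real)
  also have "(LBINT x. f x * \<phi> x - g x * \<phi> x) = 0"
   using g(2)[OF \<phi>V] sq_integrable_mult_integrable[OF f V[OF \<phi>V]] sq_integrable_mult_integrable[OF g(1) V[OF \<phi>V]] by simp
  finally show "(LBINT x. (cor (f x) - cor (g x)) * cor (\<phi> x)) = 0" by simp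
 qed
 then have fg: "AE x in lborel. f x = g x" by eventually_elim (simp flip: of_real_diff)
 obtain v where v: "v \<in> V" "(LBINT x. (v x - g x)^2) < e" using g(3)[OF e] by blast
 have [measurable]: "f \<in> borel_measurable lborel" "g \<in> borel_measurable lborel" "v \<in> borel_measurable lborel"
  using f g V[OF v(1)] by (auto simp: sq_integrable_def)
 have "(LBINT x. (v x - f x)^2) = (LBINT x. (v x - g x)^2)"
  by (rule integral_cong_AE) (measurable, use fg in \<open>eventually_elim, simp\<close>)
 then show ?thesis using v by (auto simp: V_def)
qed

lemma weak_mag_weakgrad:
 assumes w: "weakgrad u g" and L: "L-lipschitz_on UNIV A" and \<phi>: "test_function \<phi>"
 shows "weak_mag A u s \<phi> = (LBINT x. cdot s (mag_grad A u g x) * cor (\<phi> x))"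
proof -
 have u: "locint u" and g: "!!j. locint (%x. g x $ j)" using w by (auto simp: weakgrad_def)
 have A[measurable]: "borel_fun A" by (rule lipschitz_measurable[OF L])
 have Au: "locint (%x. cor (s \<bullet> A x) * u x)"
 proof (rule locint_mult_bounded_on_balls[OF u])
  fix R
  have "norm (cor (s \<bullet> A x)) <= norm s * (norm (A 0) + L * \<bar>R\<bar>)" if "x \<in> ball 0 R" for x
  proof -
   have "norm (A x) <= norm (A 0) + L * norm x" by (rule lipschitz_norm_le[OF L])
   also have "... <= norm (A 0) + L * \<bar>R\<bar>"
    using that lipschitz_on_nonneg[OF L] by (intro add_left_mono mult_left_mono) auto
   finally have "norm s * norm (A x) <= norm s * (norm (A 0) + L * \<bar>R\<bar>)" by (rule mult_left_mono) simp
   then show ?thesis using Cauchy_Schwarz_ineq2[of s "A x"] by simp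
  qed
  then show "\<exists>B. \<forall>x\<in>ball 0 R. norm (cor (s \<bullet> A x)) <= B" by blast
 qed measurable
 have i1: "integrable lborel (%x. u x * cor (s \<bullet> grad \<phi> x))"
 proof -
  obtain R where R: "!!x. norm x \<ge> R ==> grad \<phi> x = 0" using grad_support[OF \<phi>] by blast
  obtain B where B: "B > 0" "!!x. norm (grad \<phi> x) <= B" using grad_bounded[OF \<phi>] by blast
  show ?thesis
  proof (rule locint_mult_compact[OF u, where R=R])
   show "borel_fun (%x. s \<bullet> grad \<phi> x)"
    by (intro borel_measurable_continuous_onI continuous_intros grad_continuous[OF \<phi>])
   show "\<bar>s \<bullet> grad \<phi> x\<bar> <= norm s * B" for x
    using Cauchy_Schwarz_ineq2[of s "grad \<phi> x"] mult_left_mono[OF B(2)[of x], of "norm s"] by simp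
  qed (use R in auto)
 qed
 have i2: "integrable lborel (%x. \<i> * ((cor (s \<bullet> A x) * u x) * cor (\<phi> x)))"
  by (intro integrable_mult_right locint_mult_test[OF Au \<phi>])
 have i3: "integrable lborel (%x. cdot s (g x) * cor (\<phi> x))"
  by (rule locint_mult_test[OF locint_cdot[OF g] \<phi>])
 have "(LBINT x. u x * (cor (s \<bullet> grad \<phi> x) + \<i> * cor (s \<bullet> A x) * cor (\<phi> x)))
  = (LBINT x. u x * cor (s \<bullet> grad \<phi> x) + \<i> * ((cor (s \<bullet> A x) * u x) * cor (\<phi> x)))"
  by (rule Bochner_Integration.integral_cong) (auto simp: algebra_simps)
 also have "... = (LBINT x. u x * cor (s \<bullet> grad \<phi> x)) + (LBINT x. \<i> * ((cor (s \<bullet> A x) * u x) * cor (\<phi> x)))"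
  by (rule Bochner_Integration.integral_add[OF i1 i2])
 also have "... = - (LBINT x. cdot s (g x) * cor (\<phi> x)) + (LBINT x. \<i> * ((cor (s \<bullet> A x) * u x) * cor (\<phi> x)))"
  by (simp only: weakgrad_direction[OF w \<phi>])
 finally have "weak_mag A u s \<phi> = (LBINT x. cdot s (g x) * cor (\<phi> x)) - (LBINT x. \<i> * ((cor (s \<bullet> A x) * u x) * cor (\<phi> x)))"
  by (simp add: weak_mag_def)
 also have "... = (LBINT x. cdot s (g x) * cor (\<phi> x) - \<i> * ((cor (s \<bullet> A x) * u x) * cor (\<phi> x)))"
  by (rule Bochner_Integration.integral_diff[OF i3 i2, symmetric])
 also have "... = (LBINT x. cdot s (mag_grad A u g x) * cor (\<phi> x))"
  by (rule Bochner_Integration.integral_cong) (auto simp: cdot_mag_grad algebra_simps)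
 finally show ?thesis .
qed

lemma cL2_mag_diff:
 assumes u: "cL2 u" and A: "borel_fun A"
 shows "cL2 (mag_diff A u h)"
proof -
 have [measurable]: "borel_fun u" "borel_fun A" using u A by (auto simp: cL2_def)
 have "(energy (mag_diff A u h)) <= 4 * (energy u)"
  by (rule mag_diff_trivial_upper) measurable
 also have "... < \<infinity>" using u by (simp add: cL2_def ennreal_mult_less_top)
 finally show ?thesis by (simp add: cL2_def mag_diff_measurable1)
qed

lemma cL2_divide: "cL2 f ==> cL2 (%x. f x / c)"
proof -
 assume f: "cL2 f"
 then have [measurable]: "borel_fun f" by (simp add: cL2_def)
 have "(energy (%x. f x / c)) = (NN x. ennreal (1 / (norm c)^2) * ennreal ((norm (f x))^2))"
  by (intro nn_integral_cong) (simp add: norm_divide power_divide flip: ennreal_mult)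
 also have "... = ennreal (1 / (norm c)^2) * (energy f)"
  by (rule nn_integral_cmult) measurable
 also have "... < \<infinity>" using f by (simp add: cL2_def ennreal_mult_less_top)
 finally show ?thesis by (simp add: cL2_def)
qed

text \<open>Weak convergence against test functions does not increase the norm.\<close>

lemma weak_lower_semicontinuity:
 fixes F :: "real^'n => complex"
 assumes F: "cL2 F" and X: "!!n. cL2 (X n)"
  and conv: "!!\<phi>. test_function \<phi> ==> (%n. \<integral>x. X n x * cor (\<phi> x) \<partial>lborel) \<longlonglongrightarrow> (LBINT x. F x * cor (\<phi> x))"
 shows "(energy F) <= liminf (%n. \<integral>\<^sup>+x. ennreal ((norm (X n x))^2) \<partial>lborel)"
proof (rule ennreal_le_epsilon)
 fix e :: real assume e: "0 < e"
 obtain \<phi> where \<phi>: "test_function \<phi>" "(LBINT x. (\<phi> x - Re (F x))^2) < e / 4"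
  using test_dense[OF cL2_parts(1)[OF F], of "e / 4"] e by auto
 obtain \<psi> where \<psi>: "test_function \<psi>" "(LBINT x. (\<psi> x - Im (F x))^2) < e / 4"
  using test_dense[OF cL2_parts(2)[OF F], of "e / 4"] e by auto
 note s\<phi> = test_sq_integrable[OF \<phi>(1)] and s\<psi> = test_sq_integrable[OF \<psi>(1)]
 define a where "a = (LBINT x. (\<phi> x)^2) + (LBINT x. (\<psi> x)^2)"
 define p where "p Y = (LBINT x. Re (Y x) * \<phi> x) + (LBINT x. Im (Y x) * \<psi> x)" for Y :: "real^'n => complex"
 have expand: "(LBINT x. (norm (Y x))^2) - 2 * p Y + a = (LBINT x. (\<phi> x - Re (Y x))^2) + (LBINT x. (\<psi> x - Im (Y x))^2)"
  if Y: "cL2 Y" for Y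
 proof -
  have "(LBINT x. (norm (Y x))^2) = (LBINT x. (Re (Y x))^2 + (Im (Y x))^2)"
   by (rule Bochner_Integration.integral_cong) (auto simp: cmod_power2)
  also have "... = (LBINT x. (Re (Y x))^2) + (LBINT x. (Im (Y x))^2)"
   using cL2_parts[OF Y] by (simp add: sq_integrable_def)
  finally show ?thesis
   using sq_integrable_lincomb_integral[OF s\<phi> cL2_parts(1)[OF Y], of 1 "-1"] sq_integrable_lincomb_integral[OF s\<psi> cL2_parts(2)[OF Y], of 1 "-1"]
   by (simp add: a_def p_def mult.commute)
 qed
 have lower: "2 * p (X n) - a <= (LBINT x. (norm (X n x))^2)" for n
 proof -
  have "0 <= (LBINT x. (\<phi> x - Re (X n x))^2)" "0 <= (LBINT x. (\<psi> x - Im (X n x))^2)" by simp_all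
  then show ?thesis using expand[OF X[of n]] by linarith
 qed
 have p_eq: "p Y = Re (LBINT x. Y x * cor (\<phi> x)) + Im (LBINT x. Y x * cor (\<psi> x))" if Y: "cL2 Y" for Y
  unfolding p_def using locint_mult_test[OF cL2_locint[OF Y] \<phi>(1)] locint_mult_test[OF cL2_locint[OF Y] \<psi>(1)]
  by (simp flip: integral_Re integral_Im)
 have "(%n. 2 * p (X n) - a) \<longlonglongrightarrow> 2 * p F - a"
  unfolding p_eq[OF X] p_eq[OF F] by (intro tendsto_intros conv \<phi>(1) \<psi>(1))
 then have "(%n. ennreal (2 * p (X n) - a)) \<longlonglongrightarrow> ennreal (2 * p F - a)" by (rule tendsto_ennrealI)
 then have "ennreal (2 * p F - a) = liminf (%n. ennreal (2 * p (X n) - a))"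
  using lim_imp_Liminf[OF sequentially_bot] by metis
 also have "... <= liminf (%n. \<integral>\<^sup>+x. ennreal ((norm (X n x))^2) \<partial>lborel)"
  by (intro Liminf_mono always_eventually allI) (simp add: cL2_nn_integral[OF X] ennreal_leI lower)
 finally have 1: "ennreal (2 * p F - a) <= liminf (%n. \<integral>\<^sup>+x. ennreal ((norm (X n x))^2) \<partial>lborel)" .
 have "(LBINT x. (norm (F x))^2) <= (2 * p F - a) + e"
  using expand[OF F] \<phi>(2) \<psi>(2) e by linarith
 then have "(energy F) <= ennreal ((2 * p F - a) + e)"
  by (simp add: cL2_nn_integral[OF F] ennreal_leI)
 also have "... <= ennreal (2 * p F - a) + ennreal e"
  using e by (cases "0 <= 2 * p F - a") (auto simp: ennreal_plus ennreal_neg intro: ennreal_leI)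
 finally show "(energy F) <= liminf (%n. \<integral>\<^sup>+x. ennreal ((norm (X n x))^2) \<partial>lborel) + ennreal e"
  using 1 by (meson add_right_mono order_trans)
qed

text \<open>The quotients converge to \<open>s \<bullet> D\<close> in the sense of distributions, and the
 energy is weakly lower semicontinuous.\<close>

theorem mag_diff_lower:
 assumes u: "cL2 u" and w: "weakgrad u g" and L: "L-lipschitz_on UNIV A"
  and F: "cL2 (%x. cdot s (mag_grad A u g x))" and r: "!!n. r n > 0" "!!n. r n <= 1" "r \<longlonglongrightarrow> 0"
 shows "(energy (%x. cdot s (mag_grad A u g x)))
  <= liminf (%n. \<integral>\<^sup>+x. ennreal ((norm (mag_diff A u (r n *\<^sub>R s) x / cor (r n)))^2) \<partial>lborel)"
proof (rule weak_lower_semicontinuity[OF F])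
 show "cL2 (%x. mag_diff A u (r n *\<^sub>R s) x / cor (r n))" for n
  by (intro cL2_divide cL2_mag_diff u lipschitz_measurable[OF L])
 fix \<phi> :: "real^'a => real" assume \<phi>: "test_function \<phi>"
 have "(%n. (LBINT x. mag_diff A u (r n *\<^sub>R s) x * cor (\<phi> x)) / cor (r n))
  \<longlonglongrightarrow> (LBINT x. cdot s (mag_grad A u g x) * cor (\<phi> x))"
  using mag_diff_test_tendsto[OF cL2_locint[OF u] L \<phi> r, where s=s] weak_mag_weakgrad[OF w L \<phi>, of s] by simp
 moreover have "(LBINT x. mag_diff A u (r n *\<^sub>R s) x * cor (\<phi> x)) / cor (r n)
  = (LBINT x. mag_diff A u (r n *\<^sub>R s) x / cor (r n) * cor (\<phi> x))" for n
  by (simp add: integral_divide_zero[symmetric] del: integral_divide_zero)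
 ultimately show "(%n. \<integral>x. mag_diff A u (r n *\<^sub>R s) x / cor (r n) * cor (\<phi> x) \<partial>lborel)
  \<longlonglongrightarrow> (LBINT x. cdot s (mag_grad A u g x) * cor (\<phi> x))" by (simp only:)
qed

section \<open>Rademacher's theorem\<close>

text \<open>Provides a locally bounded weight with integrable inverse for the next theorem.\<close>

lemma nn_integral_inverse_power_finite:
 "(NN (x::'a::euclidean_space). ennreal (1 / (1 + norm x) ^ (DIM('a) + 1))) < \<infinity>"
proof -
 let ?N = "DIM('a)"
 have "(NN (x::'a). ennreal (1 / (1 + norm x) ^ (?N + 1)))
  = (\<integral>\<^sup>+r. (NS s. ennreal (1 / (1 + norm (r *\<^sub>R s :: 'a)) ^ (?N + 1))) \<partial>radial_measure ?N)"
  by (rule nn_integral_polar) measurable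
 also have "... = (radint ?N (%r. ennreal (1 / (1 + \<bar>r\<bar>) ^ (?N + 1)) * emeasure cone_measure (UNIV :: 'a set)))"
 proof (rule nn_integral_cong)
  fix r :: real
  have "(NS s. ennreal (1 / (1 + norm (r *\<^sub>R s :: 'a)) ^ (?N + 1)))
   = (NS (s::'a). ennreal (1 / (1 + \<bar>r\<bar>) ^ (?N + 1)))"
   by (rule nn_integral_cong_AE) (use AE_cone_measure_norm[where 'a='a] in \<open>eventually_elim, simp\<close>)
  then show "(NS s. ennreal (1 / (1 + norm (r *\<^sub>R s :: 'a)) ^ (?N + 1)))
   = ennreal (1 / (1 + \<bar>r\<bar>) ^ (?N + 1)) * emeasure cone_measure (UNIV :: 'a set)" by simp
 qed
 also have "... = (radint ?N (%r. ennreal (1 / (1 + \<bar>r\<bar>) ^ (?N + 1)))) * emeasure cone_measure (UNIV :: 'a set)"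
  by (rule nn_integral_multc) measurable
 also have "(radint ?N (%r. ennreal (1 / (1 + \<bar>r\<bar>) ^ (?N + 1)))) <= (NN r. ennreal (1 / (1 + r)^2) * indicator {0..} r)"
 proof -
  have "(radint ?N (%r. ennreal (1 / (1 + \<bar>r\<bar>) ^ (?N + 1))))
   = (NN r. ennreal (r ^ (?N - 1)) * indicator {0<..} r * ennreal (1 / (1 + \<bar>r\<bar>) ^ (?N + 1)))"
   by (rule nn_integral_radial_measure) measurable
  also have "... <= (NN r. ennreal (1 / (1 + r)^2) * indicator {0..} r)"
  proof (rule nn_integral_mono)
   fix r :: real
   show "ennreal (r ^ (?N - 1)) * indicator {0<..} r * ennreal (1 / (1 + \<bar>r\<bar>) ^ (?N + 1)) <= ennreal (1 / (1 + r)^2) * indicator {0..} r"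
   proof (cases "r > 0")
    case True
    have N: "?N + 1 = (?N - 1) + 2" using DIM_positive[where 'a='a] by linarith
    have "r ^ (?N - 1) <= (1 + r) ^ (?N - 1)" using True by (intro power_mono) auto
    then have "r ^ (?N - 1) * (1 / (1 + r) ^ (?N + 1)) <= (1 + r) ^ (?N - 1) * (1 / (1 + r) ^ (?N + 1))"
     using True by (intro mult_right_mono) auto
    also have "... = 1 / (1 + r)^2" unfolding N power_add using True by simp
    finally show ?thesis using True by (simp add: ennreal_mult[symmetric] ennreal_leI)
   qed simp
  qed
  finally show ?thesis .
 qed
 also have "(NN r. ennreal (1 / (1 + r)^2) * indicator {0..} r) = ennreal (0 - (- 1 / (1 + 0)))"
 proof (rule nn_integral_FTC_atLeast)
  show "((%r. - 1 / (1 + r)) has_real_derivative 1 / (1 + r)^2) (at r)" if "0 <= r" for r :: real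
   using that by (auto intro!: derivative_eq_intros simp: power2_eq_square)
  have "((%r::real. - (inverse (1 + r))) \<longlongrightarrow> - 0) at_top"
   by (intro tendsto_minus tendsto_inverse_0_at_top filterlim_tendsto_add_at_top[OF tendsto_const] filterlim_ident)
  then show "((%r::real. - 1 / (1 + r)) \<longlongrightarrow> 0) at_top" by (simp add: divide_inverse)
 qed auto
 finally have "(NN (x::'a). ennreal (1 / (1 + norm x) ^ (?N + 1))) <= 1 * emeasure cone_measure (UNIV :: 'a set)"
  by (simp add: mult_right_mono)
 then show ?thesis using emeasure_cone_measure_UNIV_finite[where 'a='a] by (simp add: le_less_trans)
qed

lemma lipschitz_locint:
 fixes f :: "'a::euclidean_space => 'b::{banach, second_countable_topology}"
 assumes L: "L-lipschitz_on UNIV f" shows "locint f"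
proof (rule locintI)
 show [measurable]: "borel_fun f"
  by (intro borel_measurable_continuous_onI lipschitz_on_continuous_on[OF L])
 fix R
 have "(NN x. indicator (ball 0 R) x * ennreal (norm (f x))) <= (NN x. ennreal (norm (f 0) + L * \<bar>R\<bar>) * indicator (ball (0::'a) R) x)"
 proof (rule nn_integral_mono)
  fix x :: 'a
  show "indicator (ball 0 R) x * ennreal (norm (f x)) <= ennreal (norm (f 0) + L * \<bar>R\<bar>) * indicator (ball 0 R) x"
  proof (cases "x \<in> ball 0 R")
   case True
   have "norm (f x) <= norm (f 0) + L * norm x" by (rule lipschitz_norm_le[OF L])
   also have "... <= norm (f 0) + L * \<bar>R\<bar>" using True lipschitz_on_nonneg[OF L] by (intro add_left_mono mult_left_mono) auto
   finally show ?thesis using True by (simp add: ennreal_leI)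
  qed simp
 qed
 also have "... = ennreal (norm (f 0) + L * \<bar>R\<bar>) * emeasure lborel (ball (0::'a) R)" by (subst nn_integral_cmult) auto
 also have "... < \<infinity>" using emeasure_lborel_ball_finite[of "0::'a" R] by (simp add: ennreal_mult_less_top)
 finally show "(NN x. indicator (ball 0 R) x * ennreal (norm (f x))) < \<infinity>" .
qed

text \<open>The weak derivative of a Lipschitz function is bounded on \<open>L\<^sup>1\<close>: pass to the limit in the
 difference quotients.\<close>

lemma lipschitz_weak_derivative_bound:
 fixes f :: "real^'n => real"
 assumes L: "L-lipschitz_on UNIV f" and \<phi>: "test_function \<phi>"
 shows "\<bar>\<integral>x. f x * pderivative j \<phi> x \<partial>lborel\<bar> <= L * (LBINT x. \<bar>\<phi> x\<bar>)"
proof -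
 define u where "u x = cor (f x)" for x
 have f: "locint f" by (rule lipschitz_locint[OF L])
 have u_eq: "u = (%x. cor (f x))" by (rule ext) (rule u_def)
 have u: "locint u" unfolding u_eq using f
  by (auto simp: locint_def scaleR_conv_of_real simp flip: of_real_mult)
 have Z: "0-lipschitz_on UNIV (%_::real^'n. 0::real^'n)" by (rule lipschitz_onI) auto
 define r where "r n = inverse (real (Suc n))" for n
 have r: "!!n. r n > 0" "!!n. r n <= 1" "r \<longlonglongrightarrow> 0"
  unfolding r_def using LIMSEQ_inverse_real_of_nat by (auto simp: inverse_le_1_iff)
 define s :: "real^'n" where "s = axis j 1"
 have lim: "(%n. (LBINT x. mag_diff (%_. 0) u (r n *\<^sub>R s) x * cor (\<phi> x)) / cor (r n)) \<longlonglongrightarrow> weak_mag (%_. 0) u s \<phi>"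
  by (rule mag_diff_test_tendsto[OF u Z \<phi> r])
 have \<phi>i: "integrable lborel (%x. \<bar>\<phi> x\<bar>)"
 proof -
  have "locint (%_::real^'n. 1::complex)" by (rule lipschitz_locint[of 0]) (rule lipschitz_onI, auto)
  from integrable_norm[OF locint_mult_test[OF this \<phi>]] show ?thesis by simp
 qed
 have "norm ((LBINT x. mag_diff (%_. 0) u (r n *\<^sub>R s) x * cor (\<phi> x)) / cor (r n)) <= L * (LBINT x. \<bar>\<phi> x\<bar>)" for n
 proof -
  have "norm (LBINT x. mag_diff (%_. 0) u (r n *\<^sub>R s) x * cor (\<phi> x)) <= (LBINT x. L * r n * \<bar>\<phi> x\<bar>)"
  proof (rule Bochner_Integration.integral_norm_bound_integral)
   show "integrable lborel (%x. mag_diff (%_. 0) u (r n *\<^sub>R s) x * cor (\<phi> x))"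
    by (rule integral_mag_diff_test(2)[OF u _ \<phi>]) simp
   show "integrable lborel (%x. L * r n * \<bar>\<phi> x\<bar>)" by (intro integrable_mult_right \<phi>i)
   fix x
   have "mag_diff (%_. 0) u (r n *\<^sub>R s) x = cor (f (x + r n *\<^sub>R s) - f x)"
    by (simp add: mag_diff_def u_def)
   moreover have "\<bar>f (x + r n *\<^sub>R s) - f x\<bar> <= L * r n"
    using lipschitz_onD[OF L, of "x + r n *\<^sub>R s" x] r(1)[of n] by (simp add: dist_norm s_def)
   ultimately show "norm (mag_diff (%_. 0) u (r n *\<^sub>R s) x * cor (\<phi> x)) <= L * r n * \<bar>\<phi> x\<bar>"
    by (simp add: norm_mult mult_right_mono del: of_real_diff)
  qed
  also have "... = (L * (LBINT x. \<bar>\<phi> x\<bar>)) * r n" by simp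
  finally show ?thesis using r(1)[of n] by (simp add: norm_divide divide_le_eq)
 qed
 then have "norm (weak_mag (%_. 0) u s \<phi>) <= L * (LBINT x. \<bar>\<phi> x\<bar>)"
  by (intro LIMSEQ_le_const2[OF tendsto_norm[OF lim]]) auto
 moreover have "weak_mag (%_. 0) u s \<phi> = - cor (LBINT x. f x * pderivative j \<phi> x)"
  unfolding weak_mag_def by (simp add: u_def s_def inner_axis' grad_def flip: of_real_mult)
 ultimately show ?thesis by simp
qed

text \<open>The functional \<open>\<phi> \<mapsto> - \<integral> f \<partial>\<^sub>j\<phi>\<close> is bounded
 in \<open>L\<^sup>1\<close>. By the Cauchy-Schwarz inequality it is bounded in \<open>L\<^sup>2\<close> with
 the weight \<open>w\<close>, as \<open>1 / w\<close> is integrable, and the Riesz theorem represents it.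
 Nonnegative test functions then show that the representing function is bounded by \<open>L\<close>.\<close>

theorem lipschitz_weak_derivative:
 fixes f :: "real^'n => real"
 assumes L: "L-lipschitz_on UNIV f"
 shows "\<exists>g. g \<in> borel_measurable borel & (\<forall>x. \<bar>g x\<bar> <= L) &
  (\<forall>\<phi>. test_function \<phi> --> (LBINT x. f x * pderivative j \<phi> x) = - (LBINT x. g x * \<phi> x))"
proof -
 define w :: "real^'n => real" where "w x = (1 + norm x) ^ (CARD('n) + 1)" for x
 have w1: "w x \<ge> 1" for x unfolding w_def by (rule one_le_power) simp
 then have w0: "w x > 0" for x by (smt (verit))
 have wR: "w x <= (1 + R) ^ (CARD('n) + 1)" if "norm x <= R" for x R unfolding w_def using that by (intro power_mono) auto
 have wm[measurable]: "borel_fun w" unfolding w_def by measurable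
 define M where "M = density lborel (%x. ennreal (w x))"
 have M[simp]: "sets M = sets borel" "space M = UNIV" by (simp_all add: M_def)
 have nnM: "(\<integral>\<^sup>+x. h x \<partial>M) = (NN x. ennreal (w x) * h x)" if "borel_fun h" for h
  unfolding M_def using that by (subst nn_integral_density) auto
 have intM: "(\<integral>x. h x \<partial>M) = (LBINT x. w x * h x)" if "borel_fun h" for h :: "real^'n => real"
  unfolding M_def using that w0 by (subst integral_density) (auto simp: less_imp_le)
 define I where "I = (LBINT x. 1 / w x)"
 have Ifin: "(NN x. ennreal (1 / w x)) < \<infinity>"
  using nn_integral_inverse_power_finite[where 'a="real^'n"] by (simp add: w_def)
 have Iint: "integrable lborel (%x. 1 / w x)" using Ifin by (intro integrableI_nonneg) (simp_all add: less_imp_le[OF w0])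
 have I0: "I \<ge> 0" unfolding I_def by (intro Bochner_Integration.integral_nonneg) (simp add: less_imp_le[OF w0])
 define V where "V = {\<phi> :: real^'n => real. test_function \<phi>}"
 have Vs: "sq_integrable M \<phi>" if "\<phi> \<in> V" for \<phi>
 proof -
  have \<phi>: "test_function \<phi>" using that by (simp add: V_def)
  note [measurable] = test_measurable[OF \<phi>]
  obtain R where R: "R > 0" "!!x. norm x \<ge> R ==> \<phi> x = 0" using test_support[OF \<phi>] by blast
  have "(\<integral>\<^sup>+x. ennreal ((\<phi> x)^2) \<partial>M) = (NN x. ennreal (w x) * ennreal ((\<phi> x)^2))" by (rule nnM) measurable
  also have "... <= (NN x. ennreal ((1 + R) ^ (CARD('n) + 1)) * ennreal ((\<phi> x)^2))"
  proof (rule nn_integral_mono)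
   fix x show "ennreal (w x) * ennreal ((\<phi> x)^2) <= ennreal ((1 + R) ^ (CARD('n) + 1)) * ennreal ((\<phi> x)^2)"
    using R(2)[of x] wR[of x R] by (cases "norm x <= R") (auto intro!: mult_right_mono ennreal_leI)
  qed
  also have "... = ennreal ((1 + R) ^ (CARD('n) + 1)) * (NN x. ennreal ((\<phi> x)^2))" by (rule nn_integral_cmult) measurable
  also have "... < \<infinity>" by (simp add: sq_integrable_nn_integral[OF test_sq_integrable[OF \<phi>]] ennreal_mult_less_top)
  finally show ?thesis by (intro sq_integrableI_nn) (simp_all add: measurable_cong_sets[OF M(1) refl])
 qed
 have fl: "locint f" by (rule lipschitz_locint[OF L])
 have fi: "integrable lborel (%x. f x * \<phi> x)" if \<phi>: "test_function \<phi>" for \<phi> :: "real^'n => real"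
 proof -
  obtain R where R: "R > 0" "!!x. norm x \<ge> R ==> \<phi> x = 0" using test_support[OF \<phi>] by blast
  obtain B where B: "B > 0" "!!x. \<bar>\<phi> x\<bar> <= B" using test_bounded[OF \<phi>] by blast
  show ?thesis by (rule locint_bounded_mult[OF fl test_measurable[OF \<phi>], where B=B and R=R]) (use B R in auto)
 qed
 define l where "l \<phi> = - (LBINT x. f x * pderivative j \<phi> x)" for \<phi>
 have lbound: "\<bar>l \<phi>\<bar> <= L * (LBINT x. \<bar>\<phi> x\<bar>)" if "test_function \<phi>" for \<phi>
  unfolding l_def using lipschitz_weak_derivative_bound[OF L that, of j] by simp
 have L0: "L \<ge> 0" by (rule lipschitz_on_nonneg[OF L])
 have "\<exists>g. sq_integrable M g & (\<forall>v\<in>V. l v = (\<integral>x. g x * v x \<partial>M)) & (\<forall>e>0. \<exists>v\<in>V. (\<integral>x. (v x - g x)^2 \<partial>M) < e)"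
 proof (rule Riesz_representation[of V M l "L^2 * I"])
  show "V ~= {}" using test_zero by (auto simp: V_def)
  show "(%x. a * v x + b * w x) \<in> V" if "v \<in> V" "w \<in> V" for v w a b
   using that test_lincomb by (auto simp: V_def)
  show "l (%x. a * v x + b * z x) = a * l v + b * l z" if "v \<in> V" "z \<in> V" for v z a b
  proof -
   have vt: "test_function v" "test_function z" using that by (auto simp: V_def)
   have "(LBINT x. f x * pderivative j (%x. a * v x + b * z x) x) = (LBINT x. a * (f x * pderivative j v x) + b * (f x * pderivative j z x))"
    by (rule Bochner_Integration.integral_cong) (auto simp: pderivative_lincomb[OF vt] algebra_simps)
   also have "... = a * (LBINT x. f x * pderivative j v x) + b * (LBINT x. f x * pderivative j z x)"
    using fi[OF test_pderivative[OF vt(1), of j]] fi[OF test_pderivative[OF vt(2), of j]] by simp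
   finally show ?thesis by (simp add: l_def)
  qed
  show "(l \<phi>)^2 <= L^2 * I * (\<integral>x. (\<phi> x)^2 \<partial>M)" if "\<phi> \<in> V" for \<phi>
  proof -
   have \<phi>: "test_function \<phi>" using that by (simp add: V_def)
   have \<phi>m[measurable]: "borel_fun (\<phi>)" by (rule test_measurable[OF \<phi>])
   have s1: "sq_integrable lborel (%x. sqrt (w x) * \<bar>\<phi> x\<bar>)"
   proof (rule sq_integrableI_nn)
    have "(NN x. ennreal ((sqrt (w x) * \<bar>\<phi> x\<bar>)^2)) = (\<integral>\<^sup>+x. ennreal ((\<phi> x)^2) \<partial>M)"
     by (subst nnM) (auto intro!: nn_integral_cong simp: power_mult_distrib w0 less_imp_le ennreal_mult)
    then show "(NN x. ennreal ((sqrt (w x) * \<bar>\<phi> x\<bar>)^2)) < \<infinity>"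
     using sq_integrable_nn_integral[OF Vs[OF that]] by simp
   qed measurable
   have s2: "sq_integrable lborel (%x. sqrt (1 / w x))"
    by (rule sq_integrableI_nn) (use Ifin w0 in \<open>auto simp: less_imp_le\<close>)
   have ab: "sqrt (1 / w x) * (sqrt (w x) * \<bar>\<phi> x\<bar>) = \<bar>\<phi> x\<bar>" for x
    using w0[of x] by (simp add: real_sqrt_divide)
   have "(LBINT x. \<bar>\<phi> x\<bar>)^2 <= (LBINT x. (sqrt (1 / w x))^2) * (LBINT x. (sqrt (w x) * \<bar>\<phi> x\<bar>)^2)"
    using sq_integrable_Cauchy_Schwarz[OF s2 s1] by (simp only: ab)
   also have "(LBINT x. (sqrt (1 / w x))^2) = I" unfolding I_def using w0 by (simp add: less_imp_le)
   also have "(LBINT x. (sqrt (w x) * \<bar>\<phi> x\<bar>)^2) = (\<integral>x. (\<phi> x)^2 \<partial>M)"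
    using w0 by (subst intM) (simp_all add: power_mult_distrib less_imp_le)
   finally have CS: "(LBINT x. \<bar>\<phi> x\<bar>)^2 <= I * (\<integral>x. (\<phi> x)^2 \<partial>M)" .
   have "(l \<phi>)^2 <= (L * (LBINT x. \<bar>\<phi> x\<bar>))^2"
    using power_mono[OF lbound[OF \<phi>], of 2] by simp
   also have "... = L^2 * (LBINT x. \<bar>\<phi> x\<bar>)^2" by (simp add: power_mult_distrib)
   also have "... <= L^2 * (I * (\<integral>x. (\<phi> x)^2 \<partial>M))" by (intro mult_left_mono CS) simp
   finally show ?thesis by (simp add: mult.assoc)
  qed
 qed (use Vs I0 in auto)
 then obtain g0 where g0: "sq_integrable M g0" "!!v. v \<in> V ==> l v = (\<integral>x. g0 x * v x \<partial>M)" by blast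
 have g0m[measurable]: "borel_fun g0" using g0(1) by (simp add: sq_integrable_def measurable_cong_sets[OF M(1) refl])
 define g1 where "g1 x = w x * g0 x" for x
 have g1m[measurable]: "borel_fun g1" unfolding g1_def by measurable
 have g1l: "locint g1"
 proof (rule locintI)
  fix R
  have "(NN x. indicator (ball 0 R) x * ennreal (norm (g1 x)))
   <= (NN x. ennreal ((1 + \<bar>R\<bar>) ^ (CARD('n) + 1)) * indicator (ball 0 R) x + ennreal (w x) * ennreal ((g0 x)^2))"
  proof (rule nn_integral_mono)
   fix x :: "real^'n"
   show "indicator (ball 0 R) x * ennreal (norm (g1 x)) <= ennreal ((1 + \<bar>R\<bar>) ^ (CARD('n) + 1)) * indicator (ball 0 R) x + ennreal (w x) * ennreal ((g0 x)^2)"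
   proof (cases "x \<in> ball 0 R")
    case True
    have xR: "norm x <= \<bar>R\<bar>" using True by simp
    have "\<bar>g0 x\<bar> <= 1 + (g0 x)^2"
     using zero_le_power2[of "\<bar>g0 x\<bar> - 1/2"] by (simp add: power2_eq_square algebra_simps)
    then have "w x * \<bar>g0 x\<bar> <= w x * (1 + (g0 x)^2)" using w0[of x] by (intro mult_left_mono) auto
    then have "norm (g1 x) <= (1 + \<bar>R\<bar>) ^ (CARD('n) + 1) + w x * (g0 x)^2"
     using wR[of x "\<bar>R\<bar>", OF xR] w0[of x] by (simp add: g1_def abs_mult distrib_left)
    then have "ennreal (norm (g1 x)) <= ennreal ((1 + \<bar>R\<bar>) ^ (CARD('n) + 1) + w x * (g0 x)^2)" by (rule ennreal_leI)
    also have "... = ennreal ((1 + \<bar>R\<bar>) ^ (CARD('n) + 1)) + ennreal (w x) * ennreal ((g0 x)^2)"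
     using w0[of x] by (subst ennreal_plus) (simp_all add: ennreal_mult)
    finally show ?thesis using True by simp
   qed simp
  qed
  also have "... = ennreal ((1 + \<bar>R\<bar>) ^ (CARD('n) + 1)) * emeasure lborel (ball (0::real^'n) R) + (\<integral>\<^sup>+x. ennreal ((g0 x)^2) \<partial>M)"
   by (subst nn_integral_add) (auto simp: nn_integral_cmult nnM)
  also have "... < \<infinity>"
   using emeasure_lborel_ball_finite[of "0::real^'n" R] sq_integrable_nn_integral[OF g0(1)] by (simp add: ennreal_mult_less_top)
  finally show "(NN x. indicator (ball 0 R) x * ennreal (norm (g1 x))) < \<infinity>" .
 qed (rule g1m)
 have rep: "l \<phi> = (LBINT x. g1 x * \<phi> x)" if \<phi>: "test_function \<phi>" for \<phi>
  using g0(2)[of \<phi>] \<phi> test_measurable[OF \<phi>] by (simp add: V_def intM g1_def mult.assoc)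
 have g1i: "integrable lborel (%x. g1 x * \<phi> x)" and \<phi>i: "integrable lborel \<phi>" if \<phi>: "test_function \<phi>" for \<phi> :: "real^'n => real"
 proof -
  obtain R where R: "R > 0" "!!x. norm x \<ge> R ==> \<phi> x = 0" using test_support[OF \<phi>] by blast
  obtain B where B: "B > 0" "!!x. \<bar>\<phi> x\<bar> <= B" using test_bounded[OF \<phi>] by blast
  show "integrable lborel (%x. g1 x * \<phi> x)"
   by (rule locint_bounded_mult[OF g1l test_measurable[OF \<phi>], where B=B and R=R]) (use B R in auto)
  have "locint (%_::real^'n. 1::real)" by (rule lipschitz_locint[of 0]) (rule lipschitz_onI, auto)
  then have "integrable lborel (%x. 1 * \<phi> x)"
   by (rule locint_bounded_mult[OF _ test_measurable[OF \<phi>], where B=B and R=R]) (use B R in auto)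
  then show "integrable lborel \<phi>" by simp
 qed
 have cl: "locint (%_::real^'n. L)" by (rule lipschitz_locint[of 0]) (rule lipschitz_onI, auto)
 have "AE x in lborel. 0 <= L - g1 x"
 proof (rule nonneg_AE_of_test_functions[OF locint_diff[OF cl g1l]])
  fix \<phi> :: "real^'n => real" assume \<phi>: "test_function \<phi>" and pos: "!!x. 0 <= \<phi> x"
  have "(LBINT x. (L - g1 x) * \<phi> x) = L * (LBINT x. \<phi> x) - l \<phi>"
   using g1i[OF \<phi>] \<phi>i[OF \<phi>] by (simp add: left_diff_distrib rep[OF \<phi>])
  then show "0 <= (LBINT x. (L - g1 x) * \<phi> x)" using lbound[OF \<phi>] pos by simp
 qed
 moreover have "AE x in lborel. 0 <= L + g1 x"
 proof (rule nonneg_AE_of_test_functions[OF locint_add[OF cl g1l]])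
  fix \<phi> :: "real^'n => real" assume \<phi>: "test_function \<phi>" and pos: "!!x. 0 <= \<phi> x"
  have "(LBINT x. (L + g1 x) * \<phi> x) = L * (LBINT x. \<phi> x) + l \<phi>"
   using g1i[OF \<phi>] \<phi>i[OF \<phi>] by (simp add: distrib_right rep[OF \<phi>])
  then show "0 <= (LBINT x. (L + g1 x) * \<phi> x)" using lbound[OF \<phi>] pos by simp
 qed
 ultimately have gL: "AE x in lborel. g1 x = max (- L) (min L (g1 x))" by eventually_elim auto
 define g where "g x = max (- L) (min L (g1 x))" for x
 have [measurable]: "borel_fun g" unfolding g_def by measurable
 have "(LBINT x. f x * pderivative j \<phi> x) = - (LBINT x. g x * \<phi> x)" if \<phi>: "test_function \<phi>" for \<phi>
 proof -
  note [measurable] = test_measurable[OF \<phi>]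
  have "(LBINT x. g1 x * \<phi> x) = (LBINT x. g x * \<phi> x)"
   by (rule integral_cong_AE) (measurable, use gL in \<open>eventually_elim, simp add: g_def\<close>)
  then show ?thesis using rep[OF \<phi>] by (simp add: l_def)
 qed
 moreover have "\<bar>g x\<bar> <= L" for x using L0 by (auto simp: g_def)
 ultimately show ?thesis by (intro exI[of _ g]) auto
qed

lemma AE_lborel_shift:
 fixes h :: "'a::euclidean_space"
 assumes "AE x in lborel. P x" shows "AE x in lborel. P (x + h)"
proof -
 have "AE x in distr lborel borel ((+) h). P x" unfolding lborel_distr_plus by (rule assms)
 then have "AE x in lborel. P (h + x)" by (rule AE_distrD[rotated]) simp
 then show ?thesis by (simp add: add.commute)
qed

lemma AE_translate_segment:
 fixes h :: "'a::euclidean_space"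
 assumes P: "AE x in lborel. P x"
 shows "AE x in lborel. AE s in lborel. P (x + s *\<^sub>R h)"
proof -
 obtain N where sub: "{x \<in> space lborel. \<not> P x} \<subseteq> N" and N0: "emeasure lborel N = 0" and N[measurable]: "N \<in> sets lborel"
  by (rule AE_E[OF P])
 have "AE s in lborel. AE x in lborel. x + s *\<^sub>R h \<notin> N"
  by (intro AE_I2 AE_lborel_shift AE_not_in) (use N0 N in \<open>simp add: null_sets_def\<close>)
 moreover have "(AE x in lborel. AE s in lborel. x + s *\<^sub>R h \<notin> N) \<longleftrightarrow> (AE s in lborel. AE x in lborel. x + s *\<^sub>R h \<notin> N)"
  by (rule lborel_pair.AE_commute) measurable
 ultimately have "AE x in lborel. AE s in lborel. x + s *\<^sub>R h \<notin> N" by simp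
 then show ?thesis
 proof eventually_elim
  case (elim x)
  then show ?case by eventually_elim (use sub in auto)
 qed
qed

text \<open>Average over the starting point: since \<open>E\<close> nearly fills the ball of radius \<open>2 *
 norm h\<close>, most segments that start in a small ball around \<open>a\<close> spend little time outside
 \<open>E\<close>. The point \<open>a\<close> itself may be exceptional, hence the small ball.\<close>

lemma typical_segment:
 fixes E :: "'a::euclidean_space set"
 assumes E[measurable]: "E \<in> sets borel" and \<kappa>: "0 < \<kappa>" "\<kappa> <= 1" and \<eta>: "\<eta> > 0" and h: "h ~= 0"
  and dens: "measure lborel (ball a (2 * norm h) - E) <= \<eta> * measure lborel (ball a (2 * norm h))"
  and P: "AE x in lborel. P x"
 shows "\<exists>x\<in>ball a (\<kappa> * norm h). P x &
  (NN s. indicator {0..1::real} s * indicator (- E) (x + s *\<^sub>R h)) < ennreal (2 * (\<eta> * (2 / \<kappa>) ^ DIM('a)))"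
proof (rule ccontr)
 define c where "c = \<eta> * (2 / \<kappa>) ^ DIM('a)"
 define B where "B = ball a (\<kappa> * norm h)"
 define \<Phi> where "\<Phi> x = (NN s. indicator {0..1::real} s * indicator (- E) (x + s *\<^sub>R h))" for x
 have c: "c > 0" unfolding c_def using \<eta> \<kappa> by simp
 have [measurable]: "B \<in> sets borel" by (simp add: B_def)
 assume "\<not> ?thesis"
 then have *: "!!x. x \<in> B ==> P x ==> ennreal (2 * c) <= \<Phi> x" by (auto simp: B_def c_def \<Phi>_def not_less)
 have mB: "measure lborel B > 0" unfolding B_def using \<kappa> h by (intro content_ball_pos) simp
 have fB: "emeasure lborel B = ennreal (measure lborel B)"
  by (rule emeasure_eq_ennreal_measure) (use emeasure_lborel_ball_finite[of a "\<kappa> * norm h"] in \<open>simp add: B_def\<close>)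
 have b2: "measure lborel (ball a (2 * norm h)) = (2 / \<kappa>) ^ DIM('a) * measure lborel B"
  using \<kappa> h by (simp add: B_def content_ball power_mult_distrib power_divide field_simps)
 have "ennreal (2 * c * measure lborel B) = (NN x. ennreal (2 * c) * indicator B x)"
  using c by (subst nn_integral_cmult_indicator) (auto simp: fB ennreal_mult'')
 also have "... <= (NN x. indicator B x * \<Phi> x)"
 proof (rule nn_integral_mono_AE)
  show "AE x in lborel. ennreal (2 * c) * indicator B x <= indicator B x * \<Phi> x"
   using P by eventually_elim (use * in \<open>auto simp: indicator_def\<close>)
 qed
 also have "... = (NN x. (NN s. indicator B x * (indicator {0..1::real} s * indicator (- E) (x + s *\<^sub>R h))))"
  unfolding \<Phi>_def by (intro nn_integral_cong nn_integral_cmult[symmetric]) measurable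
 also have "... = (NN s. (NN x. indicator B x * (indicator {0..1::real} s * indicator (- E) (x + s *\<^sub>R h))))"
  by (rule lborel_pair.Fubini') measurable
 also have "... <= (NN s. indicator {0..1::real} s * emeasure lborel (ball a (2 * norm h) - E))"
 proof (rule nn_integral_mono)
  fix s :: real
  show "(NN x. indicator B x * (indicator {0..1::real} s * indicator (- E) (x + s *\<^sub>R h)))
   <= indicator {0..1::real} s * emeasure lborel (ball a (2 * norm h) - E)"
  proof (cases "s \<in> {0..1}")
   case True
   have "(NN x. indicator B x * (indicator {0..1::real} s * indicator (- E) (x + s *\<^sub>R h)))
    <= (NN x. indicator (ball a (2 * norm h) - E) (x + s *\<^sub>R h))"
   proof (rule nn_integral_mono)
    fix x
    have "x + s *\<^sub>R h \<in> ball a (2 * norm h)" if "x \<in> B"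
    proof -
     have "dist a (x + s *\<^sub>R h) <= dist a x + norm (s *\<^sub>R h)" by (metis dist_add_cancel dist_triangle dist_0_norm add.right_neutral dist_commute)
     moreover have "dist a x < \<kappa> * norm h" using that by (simp add: B_def)
     moreover have "\<kappa> * norm h <= 1 * norm h" using \<kappa> by (intro mult_right_mono) auto
     moreover have "norm (s *\<^sub>R h) <= 1 * norm h" unfolding norm_scaleR using True by (intro mult_right_mono) auto
     ultimately show ?thesis by simp
    qed
    then show "indicator B x * (indicator {0..1::real} s * indicator (- E) (x + s *\<^sub>R h)) <= (indicator (ball a (2 * norm h) - E) (x + s *\<^sub>R h) :: ennreal)"
     by (auto simp: indicator_def)
   qed
   also have "... = (NN x. indicator (ball a (2 * norm h) - E) x)" by (rule nn_integral_lborel_shift) measurable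
   also have "... = emeasure lborel (ball a (2 * norm h) - E)" by simp
   finally show ?thesis using True by simp
  qed simp
 qed
 also have "... = emeasure lborel (ball a (2 * norm h) - E)" by (subst nn_integral_multc) auto
 also have "... = ennreal (measure lborel (ball a (2 * norm h) - E))"
 proof (rule emeasure_eq_ennreal_measure)
  have "emeasure lborel (ball a (2 * norm h) - E) <= emeasure lborel (ball a (2 * norm h))" by (rule emeasure_mono) auto
  then show "emeasure lborel (ball a (2 * norm h) - E) ~= top" using emeasure_lborel_ball_finite[of a "2 * norm h"] by (auto simp: top_unique)
 qed
 also have "... <= ennreal (c * measure lborel B)" using dens by (intro ennreal_leI) (simp add: c_def b2 mult.assoc)
 finally have "2 * c * measure lborel B <= c * measure lborel B" using c mB by (subst (asm) ennreal_le_iff) auto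
 then show False using c mB by (simp add: mult_le_cancel_right)
qed

text \<open>Take \<open>a\<close> to be a density point of all sets from a countable family on which
 \<open>g\<close> is nearly constant. A typical segment near \<open>a\<close> stays mostly where
 \<open>g\<close> is close to \<open>g a\<close>, so the increment of \<open>f\<close> along it is close to
 \<open>h \<bullet> g a\<close>; the Lipschitz bound moves the start of the segment to
 \<open>a\<close>.\<close>

theorem Rademacher:
 fixes f :: "'a::euclidean_space => real"
 assumes L: "L-lipschitz_on UNIV f" and g[measurable]: "borel_fun g" and M: "!!x. norm (g x) <= M"
  and line: "!!h. AE x in lborel. f (x + h) - f x = (LBINT s. indicator {0..1} s *\<^sub>R (h \<bullet> g (x + s *\<^sub>R h)))"
 shows "AE x in lebesgue. (f has_derivative (%h. h \<bullet> g x)) (at x)"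
proof -
 obtain D :: "'a set" where D: "countable D" "!!X. open X ==> X ~= {} ==> \<exists>d\<in>D. d \<in> X"
  using countable_dense_exists by metis
 define E where "E q k = {y. dist (g y) q < inverse (real (Suc k))}" for q and k :: nat
 have Em[measurable]: "E q k \<in> sets borel" for q k unfolding E_def by measurable
 have "AE x in lebesgue. \<forall>q\<in>D. \<forall>k. x \<in> E q k --> density_point (E q k) x"
  using Lebesgue_density[OF Em] D(1) by (subst AE_ball_countable) (auto simp: AE_all_countable)
 then show ?thesis
 proof eventually_elim
  fix a assume dp: "\<forall>q\<in>D. \<forall>k. a \<in> E q k --> density_point (E q k) a"
  have L0: "L \<ge> 0" by (rule lipschitz_on_nonneg[OF L])
  have M0: "M \<ge> 0" using M[of 0] norm_ge_zero order_trans by blast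
  show "(f has_derivative (%h. h \<bullet> g a)) (at a)"
   unfolding has_derivative_at_alt
  proof (intro conjI allI impI)
   show "bounded_linear (%h. h \<bullet> g a)" by (rule bounded_linear_inner_left)
   fix e :: real assume e: "e > 0"
   \<comment> \<open>three errors of size \<open>e / 3\<close>: moving the start of the segment (\<open>\<kappa>\<close>), the time spent outside \<open>F\<close> (\<open>\<eta>\<close>),
    and the variation of \<open>g\<close> on \<open>F\<close> (\<open>k\<close>)\<close>
   define \<kappa> where "\<kappa> = min 1 (e / (6 * (L + 1)))"
   have \<kappa>: "0 < \<kappa>" "\<kappa> <= 1" using e L0 by (auto simp: \<kappa>_def)
   have "2 * L * \<kappa> <= 2 * L * (e / (6 * (L + 1)))" using L0 by (intro mult_left_mono) (auto simp: \<kappa>_def)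
   also have "... <= e / 3" using L0 e by (simp add: field_simps)
   finally have k3: "2 * L * \<kappa> <= e / 3" .
   define \<eta> where "\<eta> = e / (12 * (M + 1)) * (\<kappa> / 2) ^ DIM('a)"
   have \<eta>: "\<eta> > 0" using e M0 \<kappa> by (simp add: \<eta>_def)
   have "\<eta> * (2 / \<kappa>) ^ DIM('a) = e / (12 * (M + 1)) * ((\<kappa> / 2) * (2 / \<kappa>)) ^ DIM('a)"
    unfolding \<eta>_def power_mult_distrib by simp
   then have \<eta>\<kappa>: "\<eta> * (2 / \<kappa>) ^ DIM('a) = e / (12 * (M + 1))" using \<kappa> by simp
   have e3: "2 * M * (2 * (e / (12 * (M + 1)))) <= e / 3" using M0 e by (simp add: field_simps)
   obtain k where k: "inverse (real (Suc k)) < e / 6" using reals_Archimedean[of "e / 6"] e by auto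
   obtain q where q: "q \<in> D" "q \<in> ball (g a) (inverse (real (Suc k)))"
    using D(2)[of "ball (g a) (inverse (real (Suc k)))"] by auto
   define F where "F = E q k"
   have Fm[measurable]: "F \<in> sets borel" unfolding F_def by (rule Em)
   have "a \<in> E q k" using q by (simp add: E_def)
   then have "density_point F a" using dp q by (auto simp: F_def)
   then obtain \<delta> where \<delta>: "\<delta> > 0" "!!r. 0 < r ==> r < \<delta> ==> measure lborel (ball a r - F) <= \<eta> * measure lborel (ball a r)"
    unfolding density_point_def using \<eta> by blast
   have gE: "norm (g y - g a) <= e / 3" if "y \<in> F" for y
   proof -
    have "dist (g y) (g a) <= dist (g y) q + dist (g a) q" by (rule dist_triangle2)
    moreover have "dist (g y) q < inverse (real (Suc k))" "dist (g a) q < inverse (real (Suc k))" using that q by (auto simp: F_def E_def)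
    ultimately show ?thesis using k by (simp add: dist_norm)
   qed
   have gM: "norm (g y - g a) <= 2 * M" for y using norm_triangle_ineq4[of "g y" "g a"] M[of y] M[of a] by simp
   show "\<exists>d>0. \<forall>y. norm (y - a) < d --> norm (f y - f a - (y - a) \<bullet> g a) <= e * norm (y - a)"
   proof (intro exI[of _ "\<delta> / 2"] conjI allI impI)
    show "\<delta> / 2 > 0" using \<delta> by simp
    fix y assume y: "norm (y - a) < \<delta> / 2"
    show "norm (f y - f a - (y - a) \<bullet> g a) <= e * norm (y - a)"
    proof (cases "y = a")
     case False
     define h where "h = y - a"
     have h: "h ~= 0" using False by (simp add: h_def)
     define m where "m x = (NN s. indicator {0..1::real} s * indicator (- F) (x + s *\<^sub>R h))" for x
     have "2 * norm h < \<delta>" using y by (simp add: h_def)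
     then have dens: "measure lborel (ball a (2 * norm h) - F) <= \<eta> * measure lborel (ball a (2 * norm h))"
      using h by (intro \<delta>(2)) auto
     obtain x where x: "x \<in> ball a (\<kappa> * norm h)"
      "f (x + h) - f x = (LBINT s. indicator {0..1} s *\<^sub>R (h \<bullet> g (x + s *\<^sub>R h)))"
      "m x < ennreal (2 * (\<eta> * (2 / \<kappa>) ^ DIM('a)))"
      using typical_segment[OF Fm \<kappa> \<eta> h dens line[of h]] unfolding m_def by blast
     have int1: "integrable lborel (%s. indicator {0..1::real} s *\<^sub>R h')" for h' :: real by simp
     have int2: "integrable lborel (%s. indicator {0..1::real} s *\<^sub>R (h \<bullet> g (x + s *\<^sub>R h)))"
     proof (rule Bochner_Integration.integrable_bound)
      show "integrable lborel (%s. indicator {0..1::real} s *\<^sub>R (norm h * M))" by (rule int1)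
      have "\<bar>h \<bullet> g z\<bar> <= norm h * M" for z
       using Cauchy_Schwarz_ineq2[of h "g z"] mult_left_mono[OF M[of z], of "norm h"] by simp
      then show "AE s in lborel. norm (indicator {0..1} s *\<^sub>R (h \<bullet> g (x + s *\<^sub>R h))) <= norm (indicator {0..1} s *\<^sub>R (norm h * M))"
       using M0 by (auto simp: indicator_def abs_mult)
     qed measurable
     have i2: "integrable lborel (%s. indicator {0..1::real} s * indicator (- F) (x + s *\<^sub>R h) :: real)"
     proof (rule Bochner_Integration.integrable_bound)
      show "integrable lborel (%s. indicator {0..1::real} s *\<^sub>R (1::real))" by (rule int1)
      show "AE s in lborel. norm (indicator {0..1::real} s * indicator (- F) (x + s *\<^sub>R h) :: real) <= norm (indicator {0..1::real} s *\<^sub>R (1::real))"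
       by (rule AE_I2) (auto simp: indicator_def)
     qed measurable
     have inc: "f (x + h) - f x - h \<bullet> g a = (LBINT s. indicator {0..1} s *\<^sub>R (h \<bullet> g (x + s *\<^sub>R h)) - indicator {0..1} s *\<^sub>R (h \<bullet> g a))"
      by (subst Bochner_Integration.integral_diff[OF int2 int1]) (simp add: x(2))
     have "\<bar>f (x + h) - f x - h \<bullet> g a\<bar> <= (LBINT s. indicator {0..1} s * (norm h * (e / 3)) + indicator {0..1} s * indicator (- F) (x + s *\<^sub>R h) * (norm h * (2 * M)))"
      unfolding inc
     proof (rule Bochner_Integration.integral_norm_bound_integral[where 'b=real, unfolded real_norm_def])
      show "integrable lborel (%s. indicator {0..1} s *\<^sub>R (h \<bullet> g (x + s *\<^sub>R h)) - indicator {0..1} s *\<^sub>R (h \<bullet> g a))"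
       by (intro Bochner_Integration.integrable_diff int1 int2)
      show "integrable lborel (%s. indicator {0..1} s * (norm h * (e / 3)) + indicator {0..1} s * indicator (- F) (x + s *\<^sub>R h) * (norm h * (2 * M)))"
      proof (rule Bochner_Integration.integrable_bound)
       show "integrable lborel (%s. indicator {0..1::real} s *\<^sub>R (norm h * (e / 3) + norm h * (2 * M)))" by (rule int1)
       show "AE s in lborel. norm (indicator {0..1} s * (norm h * (e / 3)) + indicator {0..1} s * indicator (- F) (x + s *\<^sub>R h) * (norm h * (2 * M)))
        <= norm (indicator {0..1} s *\<^sub>R (norm h * (e / 3) + norm h * (2 * M)))"
        using M0 e by (auto simp: indicator_def)
      qed measurable
      fix s :: real
      show "\<bar>indicator {0..1} s *\<^sub>R (h \<bullet> g (x + s *\<^sub>R h)) - indicator {0..1} s *\<^sub>R (h \<bullet> g a)\<bar>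
       <= indicator {0..1} s * (norm h * (e / 3)) + indicator {0..1} s * indicator (- F) (x + s *\<^sub>R h) * (norm h * (2 * M))"
      proof (cases "s \<in> {0..1}")
       case True
       have "\<bar>h \<bullet> (g (x + s *\<^sub>R h) - g a)\<bar> <= norm h * norm (g (x + s *\<^sub>R h) - g a)" by (rule Cauchy_Schwarz_ineq2)
       also have "... <= norm h * (e / 3) + indicator (- F) (x + s *\<^sub>R h) * (norm h * (2 * M))"
       proof (cases "x + s *\<^sub>R h \<in> F")
        case True then show ?thesis using mult_left_mono[OF gE[OF True], of "norm h"] by simp
       next
        case False
        have "0 <= norm h * (e / 3)" using e by simp
        then show ?thesis using False mult_left_mono[OF gM[of "x + s *\<^sub>R h"], of "norm h"] by simp
       qed
       finally show ?thesis using True by (simp add: inner_diff_right)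
      qed simp
     qed
     also have "... = norm h * (e / 3) + (LBINT s. indicator {0..1} s * indicator (- F) (x + s *\<^sub>R h)) * (norm h * (2 * M))"
     proof -
      have i1: "integrable lborel (%s. indicator {0..1::real} s * (norm h * (e / 3)))" using int1[of "norm h * (e / 3)"] by simp
      show ?thesis by (subst Bochner_Integration.integral_add[OF i1 integrable_mult_left[OF i2]]) simp
     qed
     also have "(LBINT s. indicator {0..1} s * indicator (- F) (x + s *\<^sub>R h)) = enn2real (m x)"
     proof -
      have "(LBINT s. indicator {0..1} s * indicator (- F) (x + s *\<^sub>R h))
       = enn2real (NN s. ennreal (indicator {0..1} s * indicator (- F) (x + s *\<^sub>R h)))"
       by (rule integral_eq_nn_integral) (rule borel_measurable_integrable[OF i2], simp)
      also have "(NN s. ennreal (indicator {0..1} s * indicator (- F) (x + s *\<^sub>R h))) = m x"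
       unfolding m_def by (rule nn_integral_cong) (auto simp: indicator_def)
      finally show ?thesis .
     qed
     also have "enn2real (m x) <= 2 * (e / (12 * (M + 1)))"
      using x(3) e M0 unfolding \<eta>\<kappa> by (intro enn2real_leI less_imp_le) auto
     finally have est: "\<bar>f (x + h) - f x - h \<bullet> g a\<bar> <= norm h * (e / 3) + 2 * (e / (12 * (M + 1))) * (norm h * (2 * M))"
      using M0 by (simp add: mult_right_mono)
     have "2 * (e / (12 * (M + 1))) * (norm h * (2 * M)) = norm h * (2 * M * (2 * (e / (12 * (M + 1)))))" by (simp add: mult_ac)
     also have "... <= norm h * (e / 3)" by (intro mult_left_mono e3) simp
     finally have est2: "\<bar>f (x + h) - f x - h \<bullet> g a\<bar> <= norm h * (e / 3) + norm h * (e / 3)" using est by linarith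
     have near: "\<bar>f (a + v) - f (x + v)\<bar> <= L * (\<kappa> * norm h)" for v
     proof -
      have "\<bar>f (a + v) - f (x + v)\<bar> <= L * dist a x" using lipschitz_onD[OF L, of "a + v" "x + v"] by (simp add: dist_real_def)
      also have "... <= L * (\<kappa> * norm h)" using x(1) L0 by (intro mult_left_mono) auto
      finally show ?thesis .
     qed
     have "L * (\<kappa> * norm h) + L * (\<kappa> * norm h) = (2 * L * \<kappa>) * norm h" by simp
     also have "... <= e / 3 * norm h" by (intro mult_right_mono k3) simp
     finally have "L * (\<kappa> * norm h) + L * (\<kappa> * norm h) <= norm h * (e / 3)" by (simp add: mult.commute)
     moreover have "norm h * (e / 3) + norm h * (e / 3) + norm h * (e / 3) = e * norm h" by simp
     ultimately have "\<bar>f (a + h) - f a - h \<bullet> g a\<bar> <= e * norm h"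
      using est2 near[of 0, unfolded add_0_right] near[of h] by linarith
     then show ?thesis by (simp add: h_def)
    qed simp
   qed
  qed
 qed
qed

lemma cdot_of_real: "cdot h (\<chi> j. cor (g $ j)) = cor (h \<bullet> g)"
 by (simp add: cdot_def inner_vec_def)

lemma norm_matrix_vector_mult_le: "norm (J *v h) <= norm J * norm h" for J :: "real^'n^'m"
proof -
 have "norm (J *v h) = L2_set (%i. \<bar>(J $ i) \<bullet> h\<bar>) UNIV"
  by (simp add: norm_vec_def matrix_vector_mul_component)
 also have "... <= L2_set (%i. norm (J $ i) * norm h) UNIV"
  by (intro L2_set_mono Cauchy_Schwarz_ineq2) auto
 also have "... = norm J * norm h" by (simp add: norm_vec_def[of J] L2_set_left_distrib)
 finally show ?thesis .
qed

theorem lipschitz_gradient: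
 fixes f :: "real^'n => real"
 assumes L: "L-lipschitz_on UNIV f"
 shows "\<exists>g. g \<in> borel_measurable borel & (\<forall>x. norm (g x) <= L * real CARD('n)) &
  (\<forall>h. AE x in lborel. f (x + h) - f x = (LBINT s. indicator {0..1} s *\<^sub>R (h \<bullet> g (x + s *\<^sub>R h)))) &
  (AE x in lebesgue. (f has_derivative (%h. h \<bullet> g x)) (at x))"
proof -
 have "\<forall>j. \<exists>g. g \<in> borel_measurable borel & (\<forall>x. \<bar>g x\<bar> <= L) &
  (\<forall>\<phi>. test_function \<phi> --> (LBINT x. f x * pderivative j \<phi> x) = - (LBINT x. g x * \<phi> x))"
  using lipschitz_weak_derivative[OF L] by blast
 from choice[OF this] obtain G where GG: "\<forall>j. G j \<in> borel_measurable borel & (\<forall>x. \<bar>G j x\<bar> <= L) &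
  (\<forall>\<phi>. test_function \<phi> --> (LBINT x. f x * pderivative j \<phi> x) = - (LBINT x. G j x * \<phi> x))" ..
 then have G: "borel_fun (G j)" "\<bar>G j x\<bar> <= L"
  "test_function \<phi> ==> (LBINT x. f x * pderivative j \<phi> x) = - (LBINT x. G j x * \<phi> x)" for j x \<phi>
  by simp_all
 define g where "g x = (\<chi> j. G j x)" for x
 have gm[measurable]: "borel_fun g"
 proof (rule borel_measurable_euclidean_space[THEN iffD2], intro ballI)
  fix i :: "real^'n" assume "i \<in> Basis"
  then obtain j where i: "i = axis j 1" by (auto simp: Basis_vec_def)
  show "borel_fun (%x. g x \<bullet> i)" using G(1)[of j] by (simp add: i inner_axis g_def)
 qed
 have gM: "norm (g x) <= L * real CARD('n)" for x
 proof -
  have "norm (g x) <= (\<Sum>j\<in>UNIV. \<bar>g x $ j\<bar>)" by (rule norm_le_l1_cart)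
  also have "... <= (\<Sum>j\<in>(UNIV::'n set). L)" by (intro sum_mono) (simp add: g_def G(2))
  finally show ?thesis by (simp add: mult.commute)
 qed
 have ofr: "locint (%x. cor (p x))" if "locint p" for p :: "real^'n => real"
  using that by (auto simp: locint_def scaleR_conv_of_real simp flip: of_real_mult)
 have L0: "L \<ge> 0" by (rule lipschitz_on_nonneg[OF L])
 have Gl: "locint (G j)" for j
 proof (rule locintI[OF G(1)])
  fix R
  have "(NN x. indicator (ball 0 R) x * ennreal (norm (G j x))) <= (NN x. ennreal L * indicator (ball (0::real^'n) R) x)"
   by (rule nn_integral_mono) (auto simp: indicator_def G(2) ennreal_leI)
  also have "... = ennreal L * emeasure lborel (ball (0::real^'n) R)" by (subst nn_integral_cmult) auto
  also have "... < \<infinity>" using emeasure_lborel_ball_finite[of "0::real^'n" R] by (simp add: ennreal_mult_less_top)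
  finally show "(NN x. indicator (ball 0 R) x * ennreal (norm (G j x))) < \<infinity>" .
 qed
 have w: "weakgrad (%x. cor (f x)) (%x. \<chi> j. cor (g x $ j))"
  unfolding weakgrad_def
 proof (intro conjI allI impI)
  show "locint (%x. cor (f x))" by (rule ofr[OF lipschitz_locint[OF L]])
  show "locint (%x. (\<chi> j. cor (g x $ j)) $ j)" for j using ofr[OF Gl[of j]] by (simp add: g_def)
  fix \<phi> j assume \<phi>: "test_function (\<phi> :: real^'n => real)"
  show "(LBINT x. cor (f x) * cor (pderivative j \<phi> x))
   = - (LBINT x. (\<chi> j. cor (g x $ j)) $ j * cor (\<phi> x))"
   using G(3)[OF \<phi>, of j] by (simp add: g_def flip: of_real_mult)
 qed
 have line: "AE x in lborel. f (x + h) - f x = (LBINT s. indicator {0..1} s *\<^sub>R (h \<bullet> g (x + s *\<^sub>R h)))" for h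
  using weakgrad_line[OF w zero_le_one, of h]
 proof eventually_elim
  case (elim x)
  have "cor (f (x + h) - f x) = (LBINT s. cor (indicator {0..1} s *\<^sub>R (h \<bullet> g (x + s *\<^sub>R h))))"
   using elim by (simp add: line_integral_def cdot_of_real scaleR_conv_of_real)
  also have "... = cor (LBINT s. indicator {0..1} s *\<^sub>R (h \<bullet> g (x + s *\<^sub>R h)))" by (rule integral_complex_of_real)
  finally show ?case by (simp only: of_real_eq_iff)
 qed
 show ?thesis using gm gM line Rademacher[OF L gm gM line] by blast
qed

text \<open>Almost everywhere the Jacobian is the matrix of the bounded weak gradients. Pair the line formula
 for an increment \<open>w\<close> of \<open>A\<close> with \<open>w\<close> itself: \<open>w \<bullet>
 w\<close> is at most \<open>norm w * M * norm h\<close>. Continuity removes the exceptional starting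
 points.\<close>

theorem lipschitz_grad_Linfty:
 fixes A :: "real^'n => real^'n"
 assumes L: "L-lipschitz_on UNIV A" and M: "grad_Linfty A <= ennreal M" "M \<ge> 0"
 shows "M-lipschitz_on UNIV A"
proof -
 have Li: "L-lipschitz_on UNIV (%x. A x $ i)" for i
 proof (rule lipschitz_onI[OF _ lipschitz_on_nonneg[OF L]])
  fix x y
  show "dist (A x $ i) (A y $ i) <= L * dist x y"
   using order_trans[OF dist_vec_nth_le lipschitz_onD[OF L, of x y]] by simp
 qed
 have "\<forall>i. \<exists>g. g \<in> borel_measurable borel & (\<forall>x. norm (g x) <= L * real CARD('n)) &
  (\<forall>h. AE x in lborel. A (x + h) $ i - A x $ i = (LBINT s. indicator {0..1} s *\<^sub>R (h \<bullet> g (x + s *\<^sub>R h)))) &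
  (AE x in lebesgue. ((%x. A x $ i) has_derivative (%h. h \<bullet> g x)) (at x))"
  using lipschitz_gradient[OF Li] by (intro allI)
 from choice[OF this] obtain g where gg: "\<forall>i. g i \<in> borel_measurable borel & (\<forall>x. norm (g i x) <= L * real CARD('n)) &
  (\<forall>h. AE x in lborel. A (x + h) $ i - A x $ i = (LBINT s. indicator {0..1} s *\<^sub>R (h \<bullet> g i (x + s *\<^sub>R h)))) &
  (AE x in lebesgue. ((%x. A x $ i) has_derivative (%h. h \<bullet> g i x)) (at x))" ..
 then have g: "borel_fun (g i)" "norm (g i x) <= L * real CARD('n)"
  "AE x in lborel. A (x + h) $ i - A x $ i = (LBINT s. indicator {0..1} s *\<^sub>R (h \<bullet> g i (x + s *\<^sub>R h)))"
  "AE x in lebesgue. ((%x. A x $ i) has_derivative (%h. h \<bullet> g i x)) (at x)" for i x h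
  by blast+
 define J where "J x = (\<chi> i. g i x)" for x
 have [measurable]: "borel_fun (%x. J x $ i)" for i using g(1)[of i] by (simp add: J_def)
 have Jm[measurable]: "borel_fun J"
 proof (rule borel_measurable_euclidean_space[THEN iffD2], intro ballI)
  fix b :: "real^'n^'n" assume "b \<in> Basis"
  then obtain i c where b: "b = axis i c" by (auto simp: Basis_vec_def)
  show "borel_fun (%x. J x \<bullet> b)" by (simp add: b inner_axis)
 qed
 have Jv: "(J x *v h) $ i = h \<bullet> g i x" for x h i
  by (simp add: matrix_vector_mul_component J_def inner_commute)
 have "AE x in lebesgue. \<forall>i. ((%x. A x $ i) has_derivative (%h. h \<bullet> g i x)) (at x)"
  using g(4) by (simp add: AE_all_countable)
 moreover have "AE x in lebesgue. ennreal (norm (jacobian A (at x))) <= grad_Linfty A"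
  unfolding grad_Linfty_def by (rule esssup_AE)
 ultimately have "AE x in lebesgue. norm (J x) <= M"
 proof eventually_elim
  case (elim x)
  have "(A has_derivative (%h. J x *v h)) (at x)"
  proof (rule has_derivative_componentwise_within[THEN iffD2], intro ballI)
   fix b :: "real^'n" assume "b \<in> Basis"
   then obtain i where b: "b = axis i 1" by (auto simp: Basis_vec_def)
   show "((%x. A x \<bullet> b) has_derivative (%h. (J x *v h) \<bullet> b)) (at x)"
    using elim(1) by (simp add: b inner_axis Jv)
  qed
  then have "frechet_derivative A (at x) = (%h. J x *v h)" by (rule frechet_derivative_at[symmetric])
  then have "jacobian A (at x) = J x" by (simp add: jacobian_def matrix_of_matrix_vector_mul)
  then have "ennreal (norm (J x)) <= ennreal M" using elim(2) M(1) by simp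
  then show ?case using M(2) by simp
 qed
 then have JM: "AE x in lborel. norm (J x) <= M"
  by (subst (asm) AE_completion_iff) measurable
 have est: "norm (A (x + h) - A x) <= M * norm h" for x h
 proof -
  have "AE x in lborel. x \<in> {x. norm (A (x + h) - A x) <= M * norm h}"
  proof -
   have "AE x in lborel. \<forall>i. A (x + h) $ i - A x $ i = (LBINT s. indicator {0..1} s *\<^sub>R (h \<bullet> g i (x + s *\<^sub>R h)))"
    using g(3)[of h] by (simp add: AE_all_countable)
   moreover have "AE x in lborel. AE s in lborel. norm (J (x + s *\<^sub>R h)) <= M" by (rule AE_translate_segment[OF JM])
   ultimately show ?thesis
   proof eventually_elim
    case (elim x)
    define w where "w = A (x + h) - A x"
    have int: "integrable lborel (%s. indicator {0..1} s *\<^sub>R (h \<bullet> g i (x + s *\<^sub>R h)))" for i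
    proof (rule Bochner_Integration.integrable_bound)
     show "integrable lborel (%s. indicator {0..1::real} s *\<^sub>R (norm h * (L * real CARD('n))))" by simp
     have "\<bar>h \<bullet> g i z\<bar> <= norm h * (L * real CARD('n))" for z
      using Cauchy_Schwarz_ineq2[of h "g i z"] mult_left_mono[OF g(2)[of i z], of "norm h"] by simp
     then show "AE s in lborel. norm (indicator {0..1} s *\<^sub>R (h \<bullet> g i (x + s *\<^sub>R h))) <= norm (indicator {0..1::real} s *\<^sub>R (norm h * (L * real CARD('n))))"
      using lipschitz_on_nonneg[OF L] by (auto simp: indicator_def abs_mult)
     show "(%s. indicator {0..1} s *\<^sub>R (h \<bullet> g i (x + s *\<^sub>R h))) \<in> borel_measurable lborel"
      using g(1)[of i] by measurable
    qed
    have "norm w * norm w = w \<bullet> w" by (simp add: dot_square_norm power2_eq_square)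
    also have "... = (\<Sum>i\<in>UNIV. w $ i * (LBINT s. indicator {0..1} s *\<^sub>R (h \<bullet> g i (x + s *\<^sub>R h))))"
     using elim(1) by (simp add: inner_vec_def w_def)
    also have "... = (LBINT s. (\<Sum>i\<in>UNIV. w $ i * (indicator {0..1} s *\<^sub>R (h \<bullet> g i (x + s *\<^sub>R h)))))"
     using int by (subst Bochner_Integration.integral_sum) auto
    also have "... <= (LBINT s. indicator {0..1::real} s *\<^sub>R (norm w * (M * norm h)))"
    proof (rule Bochner_Integration.integral_mono_AE)
     show "integrable lborel (%s. (\<Sum>i\<in>UNIV. w $ i * (indicator {0..1} s *\<^sub>R (h \<bullet> g i (x + s *\<^sub>R h)))))" using int by auto
     show "integrable lborel (%s. indicator {0..1::real} s *\<^sub>R (norm w * (M * norm h)))" by simp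
     show "AE s in lborel. (\<Sum>i\<in>UNIV. w $ i * (indicator {0..1} s *\<^sub>R (h \<bullet> g i (x + s *\<^sub>R h)))) <= indicator {0..1} s *\<^sub>R (norm w * (M * norm h))"
      using elim(2)
     proof eventually_elim
      fix s :: real assume b: "norm (J (x + s *\<^sub>R h)) <= M"
      have "w \<bullet> (J (x + s *\<^sub>R h) *v h) <= norm w * norm (J (x + s *\<^sub>R h) *v h)" by (rule norm_cauchy_schwarz)
      also have "... <= norm w * (M * norm h)"
       by (intro mult_left_mono order_trans[OF norm_matrix_vector_mult_le] mult_right_mono b) auto
      finally have "(\<Sum>i\<in>UNIV. w $ i * (h \<bullet> g i (x + s *\<^sub>R h))) <= norm w * (M * norm h)" by (simp add: inner_vec_def[of w] Jv)
      then show "(\<Sum>i\<in>UNIV. w $ i * (indicator {0..1} s *\<^sub>R (h \<bullet> g i (x + s *\<^sub>R h)))) <= indicator {0..1} s *\<^sub>R (norm w * (M * norm h))"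
       by (simp add: indicator_def)
     qed
    qed
    also have "... = norm w * (M * norm h)" by simp
    finally show ?case using M(2) by (cases "w = 0") (auto simp: w_def)
   qed
  qed
  then have "AE x in lebesgue. x \<in> {x. norm (A (x + h) - A x) <= M * norm h}" by (rule AE_completion)
  moreover have "closed {x. norm (A (x + h) - A x) <= M * norm h}"
  proof (rule closed_Collect_le)
   have "continuous_on UNIV A" by (rule lipschitz_on_continuous_on[OF L])
   then show "continuous_on UNIV (%x. norm (A (x + h) - A x))"
    by (intro continuous_on_norm continuous_on_diff) (auto intro!: continuous_on_compose2[of UNIV A] continuous_on_add continuous_on_id continuous_on_const)
   show "continuous_on UNIV (%_::real^'n. M * norm h)" by (rule continuous_on_const)
  qed
  ultimately have "x \<in> {x. norm (A (x + h) - A x) <= M * norm h}" by (intro mem_closed_if_AE_lebesgue)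
  then show ?thesis by simp
 qed
 show ?thesis
 proof (rule lipschitz_onI[OF _ M(2)])
  fix x y
  show "dist (A x) (A y) <= M * dist x y" using est[of y "x - y"] by (simp add: dist_norm)
 qed
qed

section \<open>From Lebesgue measurable to Borel measurable functions\<close>

lemma borel_version:
 fixes f :: "'a::euclidean_space => 'b::euclidean_space"
 assumes f: "f \<in> borel_measurable lebesgue"
 shows "\<exists>f'. f' \<in> borel_measurable borel & (AE x in lborel. f x = f' x)"
proof -
 have "\<exists>g. g \<in> borel_measurable borel & (AE x in lborel. f x \<bullet> b = g x)" for b
 proof -
  have "(%x. f x \<bullet> b) \<in> borel_measurable lebesgue" using f by simp
  from completion_ex_borel_measurable_real[OF this] show ?thesis by auto
 qed
 then have "\<forall>b. \<exists>g. g \<in> borel_measurable borel & (AE x in lborel. f x \<bullet> b = g x)" by blast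
 from choice[OF this] obtain g where g: "\<forall>b. g b \<in> borel_measurable borel & (AE x in lborel. f x \<bullet> b = g b x)" ..
 have "AE x in lborel. \<forall>b\<in>Basis. f x \<bullet> b = g b x" using g by (subst AE_finite_all) auto
 then have "AE x in lborel. f x = (\<Sum>b\<in>Basis. g b x *\<^sub>R b)"
  by eventually_elim (metis (no_types, lifting) euclidean_representation sum.cong)
 moreover have "(%x. \<Sum>b\<in>Basis. g b x *\<^sub>R b) \<in> borel_measurable borel"
  using g by (intro borel_measurable_sum borel_measurable_scaleR borel_measurable_const) auto
 ultimately show ?thesis by blast
qed

lemma borel_measurable_lebesgueI: "f \<in> borel_measurable borel ==> f \<in> borel_measurable lebesgue"
 by (rule measurable_completion) simp

lemma borel_measurable_vec_nth: "borel_fun (%z::'b::real_normed_vector^'n. z $ j)"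
 by (intro borel_measurable_continuous_onI linear_continuous_on bounded_linear_vec_nth)

lemma locally_integrable_iff_locint:
 fixes u u' :: "real^'n => 'b::{banach, second_countable_topology}"
 assumes u': "borel_fun u'" and u: "u \<in> borel_measurable lebesgue" and AE: "AE x in lborel. u x = u' x"
 shows "locally_integrable u \<longleftrightarrow> locint u'"
proof -
 note [measurable] = u'
 have eq: "set_integrable lebesgue K u \<longleftrightarrow> integrable lborel (%x. indicator K x *\<^sub>R u' x)" if K[measurable]: "K \<in> sets borel" for K
 proof -
  have "AE x in lborel. indicat_real K x *\<^sub>R u x = indicat_real K x *\<^sub>R u' x"
   using AE by eventually_elim simp
  then have AE': "AE x in lebesgue. indicat_real K x *\<^sub>R u x = indicat_real K x *\<^sub>R u' x" by (rule AE_completion)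
  have "set_integrable lebesgue K u \<longleftrightarrow> integrable lebesgue (%x. indicator K x *\<^sub>R u' x)"
   unfolding set_integrable_def
  proof (rule integrable_cong_AE[OF _ _ AE'])
   have Km: "indicat_real K \<in> borel_measurable lebesgue" by (rule borel_measurable_lebesgueI) measurable
   show "(%x. indicator K x *\<^sub>R u x) \<in> borel_measurable lebesgue" by (rule borel_measurable_scaleR[OF Km u])
   show "(%x. indicator K x *\<^sub>R u' x) \<in> borel_measurable lebesgue"
    by (rule borel_measurable_scaleR[OF Km borel_measurable_lebesgueI[OF u']])
  qed
  also have "... \<longleftrightarrow> integrable lborel (%x. indicator K x *\<^sub>R u' x)" by (rule integrable_completion) measurable
  finally show ?thesis .
 qed
 show ?thesis
 proof
  assume l: "locally_integrable u"
  show "locint u'"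
   unfolding locint_def
  proof (intro conjI u' allI)
   fix R :: real
   have "integrable lborel (%x. indicator (cball 0 R) x *\<^sub>R u' x)"
    using l eq[of "cball 0 R"] by (simp add: locally_integrable_def)
   then show "integrable lborel (%x. indicator (ball 0 R) x *\<^sub>R u' x)"
    by (rule Bochner_Integration.integrable_bound) (measurable, simp add: indicator_def)
  qed
 next
  assume l: "locint u'"
  show "locally_integrable u"
   unfolding locally_integrable_def
  proof (intro allI impI)
   fix K :: "(real^'n) set" assume K: "compact K"
   then obtain R where R: "K \<subseteq> ball 0 R" using compact_imp_bounded bounded_subset_ballD by blast
   have [measurable]: "K \<in> sets borel" using K by (simp add: borel_compact)
   have "integrable lborel (%x. indicator (ball 0 R) x *\<^sub>R u' x)" using l by (simp add: locint_def)
   then have "integrable lborel (%x. indicator K x *\<^sub>R u' x)"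
    by (rule Bochner_Integration.integrable_bound) (measurable, intro AE_I2, use R in \<open>force simp: indicator_def\<close>)
   then show "set_integrable lebesgue K u" by (simp add: eq)
  qed
 qed
qed

text \<open>Measurability of \<open>u\<close> itself, as the limit of its restrictions to balls.\<close>

lemma locally_integrable_measurable:
 fixes u :: "real^'n => 'b::{banach, second_countable_topology}"
 assumes u: "locally_integrable u" shows "u \<in> borel_measurable lebesgue"
proof (rule borel_measurable_LIMSEQ_metric)
 fix k :: nat
 have "set_integrable lebesgue (cball (0::real^'n) (real k)) u" using u by (simp add: locally_integrable_def)
 then show "(%x. indicator (cball 0 (real k)) x *\<^sub>R u x) \<in> borel_measurable lebesgue"
  unfolding set_integrable_def by (rule borel_measurable_integrable)
next
 fix x :: "real^'n"
 obtain k0 :: nat where k0: "norm x <= real k0" using real_arch_simple by blast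
 have "eventually (%k. indicator (cball 0 (real k)) x *\<^sub>R u x = u x) sequentially"
  using eventually_ge_at_top[of k0] by eventually_elim (use k0 in \<open>auto simp: indicator_def\<close>)
 then show "(%k. indicator (cball 0 (real k)) x *\<^sub>R u x) \<longlonglongrightarrow> u x" by (rule tendsto_eventually)
qed

lemma locint_nth: "locint g \<longleftrightarrow> (\<forall>j. locint (%x. g x $ j))" for g :: "real^'n => complex^'m"
proof (intro iffI allI)
 fix j assume g: "locint g"
 show "locint (%x. g x $ j)"
  unfolding locint_def
 proof (intro conjI allI)
  show "borel_fun (%x. g x $ j)"
   using locint_measurable[OF g] borel_measurable_vec_nth by (rule measurable_compose)
  show "integrable lborel (%x. indicator (ball 0 R) x *\<^sub>R g x $ j)" for R
   using integrable_bounded_linear[OF bounded_linear_vec_nth, of lborel "%x. indicator (ball 0 R) x *\<^sub>R g x" j] g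
   by (simp add: locint_def)
 qed
next
 assume "\<forall>j. locint (%x. g x $ j)"
 then have g: "locint (%x. g x $ j)" for j by blast
 have eq: "g x = (\<Sum>j\<in>UNIV. axis j (g x $ j))" for x by (simp add: vec_eq_iff axis_def)
 have ax: "bounded_linear (%z::complex. axis j z :: complex^'m)" for j
  by (simp add: linear_conv_bounded_linear[symmetric] linear_iff vec_eq_iff axis_def)
 have "locint (%x. \<Sum>j\<in>UNIV. axis j (g x $ j))"
 proof (rule locint_sum)
  fix j
  show "locint (%x. axis j (g x $ j))"
   unfolding locint_def
  proof (intro conjI allI)
   show "borel_fun (%x. axis j (g x $ j))"
    using locint_measurable[OF g[of j]]
    by (rule measurable_compose) (rule borel_measurable_continuous_onI[OF linear_continuous_on[OF ax]])
   have "axis j (indicator (ball 0 R) x *\<^sub>R g x $ j) = indicator (ball 0 R) x *\<^sub>R axis j (g x $ j)" for R x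
    by (simp add: indicator_def)
   then show "integrable lborel (%x. indicator (ball 0 R) x *\<^sub>R axis j (g x $ j))" for R
    using integrable_bounded_linear[OF ax, of lborel "%x. indicator (ball 0 R) x *\<^sub>R g x $ j" j] g[of j]
    by (simp add: locint_def)
  qed
 qed simp
 then show "locint g" by (simp only: eq[symmetric])
qed

text \<open>Neither side notices a change on a null set.\<close>

lemma has_weak_gradient_iff_weakgrad:
 assumes u': "borel_fun u'" and u: "u \<in> borel_measurable lebesgue" "AE x in lborel. u x = u' x"
  and g': "borel_fun g'" and g: "g \<in> borel_measurable lebesgue" "AE x in lborel. g x = g' x"
 shows "has_weak_gradient u g \<longleftrightarrow> weakgrad u' g'"
proof -
 have int: "(LINT x|lebesgue. v x * cor (p x)) = (LBINT x. v' x * cor (p x))"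
  if v: "v \<in> borel_measurable lebesgue" "borel_fun v'" "AE x in lborel. v x = v' x" and p: "borel_fun p"
  for v v' :: "real^'n => complex" and p
 proof -
  have p': "borel_fun (%x. cor (p x))" using p by simp
  note p2 = borel_measurable_lebesgueI[OF p'] and v2 = borel_measurable_lebesgueI[OF v(2)]
  have "(LINT x|lebesgue. v x * cor (p x)) = (LINT x|lebesgue. v' x * cor (p x))"
  proof (rule integral_cong_AE)
   have "AE x in lborel. v x * cor (p x) = v' x * cor (p x)"
    using v(3) by eventually_elim simp
   then show "AE x in lebesgue. v x * cor (p x) = v' x * cor (p x)" by (rule AE_completion)
  qed (rule borel_measurable_times[OF v(1) p2] borel_measurable_times[OF v2 p2])+
  also have "... = (LBINT x. v' x * cor (p x))"
   by (rule integral_completion) (simp add: borel_measurable_times[OF v(2) p'])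
  finally show ?thesis .
 qed
 have gj: "(%x. g x $ j) \<in> borel_measurable lebesgue" "borel_fun (%x. g' x $ j)" "AE x in lborel. g x $ j = g' x $ j" for j
 proof -
  note nth = borel_measurable_vec_nth[where j=j]
  show "(%x. g x $ j) \<in> borel_measurable lebesgue" using g(1) nth by (rule measurable_compose)
  show "borel_fun (%x. g' x $ j)" using g' nth by (rule measurable_compose)
  show "AE x in lborel. g x $ j = g' x $ j" using g(2) by eventually_elim simp
 qed
 have e1: "(LINT x|lebesgue. u x * cor (pderivative j \<phi> x)) = (LBINT x. u' x * cor (pderivative j \<phi> x))"
  and e2: "(LINT x|lebesgue. g x $ j * cor (\<phi> x)) = (LBINT x. g' x $ j * cor (\<phi> x))"
  if \<phi>: "test_function \<phi>" for \<phi> j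
  by (rule int[OF u(1) u' u(2) test_measurable[OF test_pderivative[OF \<phi>]]],
    rule int[OF gj test_measurable[OF \<phi>]])
 have "locally_integrable u \<longleftrightarrow> locint u'" "locally_integrable g \<longleftrightarrow> (\<forall>j. locint (%x. g' x $ j))"
  using locally_integrable_iff_locint[OF u' u] locally_integrable_iff_locint[OF g' g] by (simp_all add: locint_nth)
 then show ?thesis
  unfolding has_weak_gradient_def weakgrad_def using e1 e2 by auto
qed

lemma weakgrad_unique:
 fixes u :: "real^'n => complex"
 assumes "weakgrad u g1" "weakgrad u g2"
 shows "AE x in lborel. g1 x = g2 x"
proof -
 have "AE x in lborel. g1 x $ j - g2 x $ j = 0" for j
 proof (rule zero_AE_of_test_functions_complex)
  have l: "locint (%x. g1 x $ j)" "locint (%x. g2 x $ j)" using assms by (auto simp: weakgrad_def)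
  show "locint (%x. g1 x $ j - g2 x $ j)" by (rule locint_diff[OF l])
  fix \<phi> :: "real^'n => real" assume \<phi>: "test_function \<phi>"
  have "(LBINT x. u x * cor (pderivative j \<phi> x)) = - (LBINT x. g1 x $ j * cor (\<phi> x))"
   "(LBINT x. u x * cor (pderivative j \<phi> x)) = - (LBINT x. g2 x $ j * cor (\<phi> x))"
   using assms \<phi> by (simp_all add: weakgrad_def)
  then have "(LBINT x. g1 x $ j * cor (\<phi> x)) = (LBINT x. g2 x $ j * cor (\<phi> x))" by simp
  then show "(LBINT x. (g1 x $ j - g2 x $ j) * cor (\<phi> x)) = 0"
   using locint_mult_test[OF l(1) \<phi>] locint_mult_test[OF l(2) \<phi>] by (simp add: left_diff_distrib)
 qed
 then have "AE x in lborel. \<forall>j. g1 x $ j - g2 x $ j = 0" by (simp add: AE_all_countable)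
 then show ?thesis by eventually_elim (simp add: vec_eq_iff)
qed

lemma weakgrad_measurable: "weakgrad u g ==> g \<in> borel_measurable borel"
 using locint_nth[of g] locint_measurable[of g] by (auto simp: weakgrad_def)

text \<open>The chosen weak gradient agrees almost everywhere with the given one, by uniqueness.\<close>

lemma magnetic_energy_eq:
 assumes u: "u \<in> borel_measurable lebesgue" "AE x in lborel. u x = u' x" and w: "weakgrad u' g"
 shows "magnetic_energy A u = (energy (mag_grad A u' g))"
proof -
 have u': "borel_fun u'" using w by (auto simp: weakgrad_def locint_def)
 have gm: "borel_fun g" by (rule weakgrad_measurable[OF w])
 then have "has_weak_gradient u g"
  using has_weak_gradient_iff_weakgrad[OF u' u gm, of g] w borel_measurable_lebesgueI[OF gm] by auto
 then have W: "has_weak_gradient u (weak_gradient u)" unfolding weak_gradient_def by (rule someI[of "has_weak_gradient u"])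
 then have Wm: "weak_gradient u \<in> borel_measurable lebesgue"
  by (intro locally_integrable_measurable) (simp add: has_weak_gradient_def)
 obtain g2 where g2: "borel_fun g2" "AE x in lborel. weak_gradient u x = g2 x"
  using borel_version[OF Wm] by blast
 have "weakgrad u' g2" using has_weak_gradient_iff_weakgrad[OF u' u g2(1) Wm g2(2)] W by simp
 then have "AE x in lborel. g2 x = g x" using weakgrad_unique w by blast
 then have "AE x in lborel. ennreal ((norm (magnetic_gradient A u x))^2) = ennreal ((norm (mag_grad A u' g x))^2)"
  using g2(2) u(2) by eventually_elim (simp add: magnetic_gradient_def mag_grad_def)
 then show ?thesis
  unfolding magnetic_energy_def nn_integral_completion by (rule nn_integral_cong_AE)
qed

lemma L2_borel_version:
 assumes "u \<in> L2"
 shows "\<exists>u'. cL2 u' & (AE x in lborel. u x = u' x)"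
proof -
 have u: "u \<in> borel_measurable lebesgue" "(energy u) < \<infinity>"
  using assms by (auto simp: L2_def nn_integral_completion)
 obtain u' where u': "borel_fun u'" "AE x in lborel. u x = u' x" using borel_version[OF u(1)] by blast
 have "(energy u') = (NN x. ennreal ((norm (u x))^2))"
 proof (rule nn_integral_cong_AE)
  show "AE x in lborel. ennreal ((norm (u' x))^2) = ennreal ((norm (u x))^2)" using u'(2) by eventually_elim simp
 qed
 then show ?thesis using u' u(2) by (auto simp: cL2_def)
qed

lemma H1_magnetic_iff:
 assumes u: "u \<in> L2" "AE x in lborel. u x = u' x" and u': "cL2 u'"
 shows "u \<in> H1_magnetic A \<longleftrightarrow> (\<exists>g. weakgrad u' g & (energy (mag_grad A u' g)) < \<infinity>)"
proof -
 have um: "u \<in> borel_measurable lebesgue" using u by (simp add: L2_def)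
 have u'm: "borel_fun u'" using u' by (simp add: cL2_def)
 have "(\<exists>g. has_weak_gradient u g) \<longleftrightarrow> (\<exists>g. weakgrad u' g)"
 proof
  assume "\<exists>g. has_weak_gradient u g"
  then obtain g where W: "has_weak_gradient u g" by blast
  have gm: "g \<in> borel_measurable lebesgue" by (intro locally_integrable_measurable) (use W in \<open>simp add: has_weak_gradient_def\<close>)
  obtain g2 where g2: "borel_fun g2" "AE x in lborel. g x = g2 x" using borel_version[OF gm] by blast
  show "\<exists>g. weakgrad u' g" using has_weak_gradient_iff_weakgrad[OF u'm um u(2) g2(1) gm g2(2)] W by blast
 next
  assume "\<exists>g. weakgrad u' g"
  then obtain g where w: "weakgrad u' g" by blast
  have gm: "borel_fun g" by (rule weakgrad_measurable[OF w])
  show "\<exists>g. has_weak_gradient u g"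
   using has_weak_gradient_iff_weakgrad[OF u'm um u(2) gm, of g] w borel_measurable_lebesgueI[OF gm] by auto
 qed
 then have "u \<in> H1_magnetic A \<longleftrightarrow> (\<exists>g. weakgrad u' g) & magnetic_energy A u < \<infinity>"
  using u(1) by (simp add: H1_magnetic_def)
 also have "... \<longleftrightarrow> (\<exists>g. weakgrad u' g & magnetic_energy A u < \<infinity>)" by blast
 also have "... \<longleftrightarrow> (\<exists>g. weakgrad u' g & (energy (mag_grad A u' g)) < \<infinity>)"
  by (intro ex_cong1 conj_cong refl) (simp add: magnetic_energy_eq[OF um u(2)])
 finally show ?thesis .
qed

text \<open>An exceptional null set of radii is a null set of vectors, by polar coordinates.\<close>

lemma AE_lborel_norm_notin:
 assumes [measurable]: "R \<in> sets borel" and R: "emeasure lborel R = 0"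
 shows "AE x::'a::euclidean_space in lborel. x ~= 0 & norm x \<notin> R"
proof -
 have "(NN (x::'a). indicator R (norm x))
  = (\<integral>\<^sup>+r. (NS (s::'a). indicator R (norm (r *\<^sub>R s))) \<partial>radial_measure DIM('a))"
  by (rule nn_integral_polar) measurable
 also have "... = (radint DIM('a) (%r. indicator R \<bar>r\<bar> * emeasure cone_measure (UNIV::'a set)))"
 proof (rule nn_integral_cong)
  fix r :: real
  have "(NS (s::'a). indicator R (norm (r *\<^sub>R s))) = (NS (s::'a). indicator R \<bar>r\<bar>)"
   by (rule nn_integral_cong_AE) (use AE_cone_measure_norm[where 'a='a] in \<open>eventually_elim, simp\<close>)
  then show "(NS (s::'a). indicator R (norm (r *\<^sub>R s))) = indicator R \<bar>r\<bar> * emeasure cone_measure (UNIV::'a set)"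
   by simp
 qed
 also have "... = (NN r. ennreal (r ^ (DIM('a) - 1)) * indicator {0<..} r * (indicator R \<bar>r\<bar> * emeasure cone_measure (UNIV::'a set)))"
  by (rule nn_integral_radial_measure) measurable
 also have "... = (NN (r::real). 0)"
 proof (rule nn_integral_cong_AE)
  have "AE r in lborel. r \<notin> R" by (rule AE_not_in) (use R in \<open>simp add: null_sets_def\<close>)
  then show "AE r in lborel. ennreal (r ^ (DIM('a) - 1)) * indicator {0<..} r * (indicator R \<bar>r\<bar> * emeasure cone_measure (UNIV::'a set)) = 0"
   by eventually_elim (auto simp: indicator_def)
 qed
 also have "... = 0" by simp
 finally have *: "(NN (x::'a). indicator R (norm x)) = 0" .
 have "AE x::'a in lborel. indicator R (norm x) = (0::ennreal)"
  by (rule nn_integral_0_iff_AE[THEN iffD1, OF _ *]) measurable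
 moreover have "AE x::'a in lborel. x ~= 0" by (rule AE_lborel_singleton)
 ultimately show ?thesis by eventually_elim (simp add: indicator_eq_0_iff)
qed

text \<open>The average over the sphere that the functional sees at distance \<open>r\<close>.\<close>

definition sphere_energy :: "(real^'n => real^'n) => (real^'n => complex) => real => ennreal" where
 "sphere_energy A u r =
   (NS s. (energy (%x. mag_diff A u (r *\<^sub>R s) x / cor r)))"

lemma mag_quotient_measurable:
 fixes A :: "real^'n => real^'n"
 assumes [measurable]: "borel_fun A" "borel_fun u"
 shows "(%(r, s). \<integral>\<^sup>+x. ennreal ((norm (mag_diff A u (r *\<^sub>R s) x / cor r))^2) \<partial>lborel) \<in> borel_measurable (borel \<Otimes>\<^sub>M borel)"
proof -
 have [measurable]: "(%z::(real \<times> (real^'n)) \<times> (real^'n). mag_diff A u (fst (fst z) *\<^sub>R snd (fst z)) (snd z)) \<in> borel_measurable ((borel \<Otimes>\<^sub>M borel) \<Otimes>\<^sub>M lborel)"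
  unfolding mag_diff_def by measurable
 have "(%z::real \<times> (real^'n). \<integral>\<^sup>+x. ennreal ((norm (mag_diff A u (fst z *\<^sub>R snd z) x / cor (fst z)))^2) \<partial>lborel) \<in> borel_measurable (borel \<Otimes>\<^sub>M borel)"
  by (rule lborel.borel_measurable_nn_integral) (simp add: case_prod_beta)
 then show ?thesis by (simp add: case_prod_beta)
qed

lemma mag_quotient_measurable1:
 assumes "borel_fun A" "borel_fun u"
 shows "borel_fun (%s. \<integral>\<^sup>+x. ennreal ((norm (mag_diff A u (r *\<^sub>R s) x / cor r))^2) \<partial>lborel)"
proof -
 have "borel_fun (%s. (%(r, s). \<integral>\<^sup>+x. ennreal ((norm (mag_diff A u (r *\<^sub>R s) x / cor r))^2) \<partial>lborel) (r, s))"
  by (rule measurable_compose[OF _ mag_quotient_measurable[OF assms]]) measurable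
 then show ?thesis by simp
qed

lemma sphere_energy_measurable:
 fixes A :: "real^'n => real^'n"
 assumes "borel_fun A" "borel_fun u"
 shows "borel_fun (sphere_energy A u)"
proof -
 interpret C: finite_measure "cone_measure :: (real^'n) measure" by (rule finite_measure_cone)
 have sm: "measurable (borel \<Otimes>\<^sub>M cone_measure) borel = measurable (borel \<Otimes>\<^sub>M borel :: (real \<times> (real^'n)) measure) (borel :: ennreal measure)"
  by (intro measurable_cong_sets sets_pair_measure_cong) auto
 show ?thesis
  unfolding sphere_energy_def[abs_def]
  by (rule C.borel_measurable_nn_integral) (use mag_quotient_measurable[OF assms] in \<open>simp add: sm\<close>)
qed

text \<open>Substitute \<open>y = x + h\<close> and use polar coordinates for \<open>h\<close>. The Borel
 versions \<open>u'\<close> of \<open>u\<close> and \<open>p\<close> of \<open>\<rho>\<close> change the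
 integrand on a null set of pairs only.\<close>

theorem nonlocal_energy_eq:
 fixes A :: "real^'n => real^'n"
 assumes A[measurable]: "borel_fun A" and u'[measurable]: "borel_fun u'"
  and u: "AE x in lborel. u x = u' x"
  and p[measurable]: "borel_fun p" and \<rho>: "AE r in lborel. 0 < r --> ennreal (\<rho> r) = p r" "!!r. r \<ge> 0 ==> 0 <= \<rho> r"
 shows "nonlocal_energy A \<rho> u = (radint CARD('n) (%r. p r * sphere_energy A u' r))"
proof -
 interpret C: finite_measure "cone_measure :: (real^'n) measure" by (rule finite_measure_cone)
 obtain N where N: "{x \<in> space lborel. \<not> u x = u' x} \<subseteq> N" "emeasure lborel N = 0" "N \<in> sets lborel"
  by (rule AE_E[OF u])
 obtain R where R: "{r \<in> space lborel. \<not> (0 < r --> ennreal (\<rho> r) = p r)} \<subseteq> R" "emeasure lborel R = 0" "R \<in> sets lborel"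
  by (rule AE_E[OF \<rho>(1)])
 have Nm[measurable]: "N \<in> sets borel" and Rm[measurable]: "R \<in> sets borel" using N(3) R(3) by simp_all
 have Rp: "ennreal (\<rho> r) = p r" if "0 < r" "r \<notin> R" for r using R(1) that by auto
 define G where "G h x = ennreal ((norm (mag_diff A u' h x))^2 / (norm h)^2) * p (norm h)" for h x
 have Gm[measurable]: "(%z. G (f z) (g z)) \<in> borel_measurable M" if [measurable]: "f \<in> borel_measurable M" "g \<in> borel_measurable M" for f g and M :: "'b measure"
  unfolding G_def mag_diff_def by measurable
 have Gm2: "(%z. G (snd z - fst z) (fst z)) \<in> borel_measurable (lborel \<Otimes>\<^sub>M lborel)" by measurable
 have "AE z in lborel \<Otimes>\<^sub>M lborel. fst z \<notin> N & snd z \<notin> N & snd z - fst z ~= 0 & norm (snd z - fst z) \<notin> R"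
 proof (rule lborel_pair.AE_pair_measure)
  show "{z \<in> space (lborel \<Otimes>\<^sub>M lborel). fst z \<notin> N & snd z \<notin> N & snd z - fst z ~= 0 & norm (snd z - fst z) \<notin> R} \<in> sets (lborel \<Otimes>\<^sub>M lborel)"
   by measurable
  have nN: "AE x in lborel. x \<notin> N" by (rule AE_not_in) (use N in \<open>simp add: null_sets_def\<close>)
  show "AE x in lborel. AE y in lborel. fst (x, y) \<notin> N & snd (x, y) \<notin> N & snd (x, y) - fst (x, y) ~= 0 & norm (snd (x, y) - fst (x, y)) \<notin> R"
   using nN
  proof eventually_elim
   fix x assume x: "x \<notin> N"
   have "AE y in lborel. y + - x ~= 0 & norm (y + - x) \<notin> R"
    by (rule AE_lborel_shift[OF AE_lborel_norm_notin[OF Rm R(2)]])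
   with nN show "AE y in lborel. fst (x, y) \<notin> N & snd (x, y) \<notin> N & snd (x, y) - fst (x, y) ~= 0 & norm (snd (x, y) - fst (x, y)) \<notin> R"
    by eventually_elim (use x in simp)
  qed
 qed
 then have "AE z in lborel. (case z of (x, y) => ennreal ((norm (Psi A u x y - Psi A u x x))^2 / (norm (x - y))^2 * \<rho> (norm (x - y))))
  = G (snd z - fst z) (fst z)"
  unfolding lborel_prod
 proof eventually_elim
  fix z :: "(real^'n) \<times> (real^'n)"
  assume z: "fst z \<notin> N & snd z \<notin> N & snd z - fst z ~= 0 & norm (snd z - fst z) \<notin> R"
  obtain x y where xy: "z = (x, y)" by (cases z)
  have ux: "u x = u' x" "u y = u' y" using z N(1) xy by auto
  have "0 < norm (y - x)" "norm (y - x) \<notin> R" using z xy by simp_all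
  then have pr: "ennreal (\<rho> (norm (y - x))) = p (norm (y - x))" by (rule Rp)
  have mid: "x + (1/2) *\<^sub>R (y - x) = (1/2) *\<^sub>R (x + y)" by (simp add: scaleR_diff_right scaleR_add_right vec_eq_iff)
  have "Psi A u x y - Psi A u x x = mag_diff A u' (y - x) x"
   unfolding Psi_def mag_diff_def mid using ux by (simp add: inner_diff_left algebra_simps)
  then show "(case z of (x, y) => ennreal ((norm (Psi A u x y - Psi A u x x))^2 / (norm (x - y))^2 * \<rho> (norm (x - y)))) = G (snd z - fst z) (fst z)"
   using \<rho>(2)[of "norm (y - x)"] by (simp add: xy G_def ennreal_mult''[symmetric] pr[symmetric] norm_minus_commute[of x y])
 qed
 then have "nonlocal_energy A \<rho> u = (NN z. G (snd z - fst z) (fst z))"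
  unfolding nonlocal_energy_def nn_integral_completion by (rule nn_integral_cong_AE)
 also have "... = (\<integral>\<^sup>+z. G (snd z - fst z) (fst z) \<partial>(lborel \<Otimes>\<^sub>M lborel))" by (simp add: lborel_prod)
 also have "... = (NN x. (NN y. G (y - x) x))"
  using lborel.nn_integral_fst[OF Gm2] by simp
 also have "... = (NN x. (NN h. G h x))"
 proof (rule nn_integral_cong)
  fix x :: "real^'n"
  have "borel_fun (%y. G (y - x) x)" by measurable
  from nn_integral_lborel_shift[OF this, of x] show "(NN y. G (y - x) x) = (NN h. G h x)" by simp
 qed
 also have "... = (NN h. (NN x. G h x))"
  by (rule lborel_pair.Fubini') measurable
 also have "... = (\<integral>\<^sup>+r. (NS s. (NN x. G (r *\<^sub>R s) x)) \<partial>radial_measure DIM(real^'n))"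
 proof (rule nn_integral_polar)
  have "(%z::(real^'n) \<times> (real^'n). G (fst z) (snd z)) \<in> borel_measurable (borel \<Otimes>\<^sub>M lborel)" by measurable
  then show "borel_fun (%h. \<integral>\<^sup>+x. G h x \<partial>lborel)"
   by (intro lborel.borel_measurable_nn_integral) (simp add: case_prod_beta)
 qed
 also have "... = (radint CARD('n) (%r. p r * sphere_energy A u' r))"
  unfolding DIM_cart DIM_real mult_1_right
 proof (rule nn_integral_cong_AE)
  have "AE r in radial_measure CARD('n). r > 0"
   unfolding radial_measure_def by (subst AE_density) (auto simp: indicator_def)
  then show "AE r in radial_measure CARD('n). (NS s. (NN x. G (r *\<^sub>R s) x)) = p r * sphere_energy A u' r"
  proof eventually_elim
   fix r :: real assume r: "r > 0"
   have "(NS s. (NN x. G (r *\<^sub>R s) x))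
    = (NS s. p r * (energy (%x. mag_diff A u' (r *\<^sub>R s) x / cor r)))"
   proof (rule nn_integral_cong_AE)
    show "AE s in cone_measure. (NN x. G (r *\<^sub>R s) x)
     = p r * (energy (%x. mag_diff A u' (r *\<^sub>R s) x / cor r))"
     using AE_cone_measure_norm[where 'a="real^'n"]
    proof eventually_elim
     fix s :: "real^'n" assume s: "norm s = 1"
     have [measurable]: "borel_fun (mag_diff A u' (r *\<^sub>R s))" by (rule mag_diff_measurable1[OF A u'])
     have "(NN x. G (r *\<^sub>R s) x) = (NN x. p r * ennreal ((norm (mag_diff A u' (r *\<^sub>R s) x / cor r))^2))"
      using r s by (intro nn_integral_cong) (simp add: G_def norm_divide power_divide mult.commute)
     also have "... = p r * (energy (%x. mag_diff A u' (r *\<^sub>R s) x / cor r))"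
      by (rule nn_integral_cmult) measurable
     finally show "(NN x. G (r *\<^sub>R s) x)
      = p r * (energy (%x. mag_diff A u' (r *\<^sub>R s) x / cor r))" .
    qed
   qed
   also have "... = p r * sphere_energy A u' r"
    unfolding sphere_energy_def
    by (rule nn_integral_cmult) (simp add: mag_quotient_measurable1[OF A u'] measurable_cong_sets[OF sets_cone_measure refl])
   finally show "(NS s. (NN x. G (r *\<^sub>R s) x)) = p r * sphere_energy A u' r" .
  qed
 qed
 finally show ?thesis .
qed

text \<open>A sequence of mollifiers, seen as probability densities for \<open>radial_measure\<close> that concentrate at \<open>0\<close>.\<close>

lemma mollifier_densities:
 assumes "radial_mollifiers N \<rho>"
 shows "\<exists>p. (\<forall>n. p n \<in> borel_measurable borel & (AE r in lborel. 0 < r --> ennreal (\<rho> n r) = p n r) &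
   (radint N (p n)) = 1) &
  (\<forall>\<delta>>0. (%n. radint N (%r. p n r * indicator {\<delta><..} r)) \<longlonglongrightarrow> 0)"
proof -
 have m: "!!n. \<rho> n \<in> borel_measurable (lebesgue_on {0..})" "!!n r. r \<ge> 0 ==> 0 <= \<rho> n r"
  and one: "!!n. (\<integral>\<^sup>+ r\<in>{0<..}. ennreal (\<rho> n r * r ^ (N - 1)) \<partial>lebesgue) = 1"
  and zero: "!!\<delta>. \<delta> > 0 ==> (%n. \<integral>\<^sup>+ r\<in>{\<delta><..}. ennreal (\<rho> n r * r ^ (N - 1)) \<partial>lebesgue) \<longlonglongrightarrow> 0"
  using assms by (auto simp: radial_mollifiers_def)
 have "\<exists>q. q \<in> borel_measurable borel & (AE r in lborel. 0 < r --> ennreal (\<rho> n r) = q r)" for n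
 proof -
  have "(%r. if r \<in> {0..} then \<rho> n r else 0) \<in> borel_measurable lebesgue"
   using m(1)[of n] by (subst borel_measurable_if) auto
  from borel_version[OF this] obtain q where q: "borel_fun q" "AE r in lborel. (if r \<in> {0..} then \<rho> n r else 0) = q r" by blast
  have "AE r in lborel. 0 < r --> ennreal (\<rho> n r) = ennreal (q r)"
   using q(2) by eventually_elim (simp split: if_splits)
  then show ?thesis using q(1) by (intro exI[of _ "%r. ennreal (q r)"]) simp
 qed
 then have "\<forall>n. \<exists>q. q \<in> borel_measurable borel & (AE r in lborel. 0 < r --> ennreal (\<rho> n r) = q r)" by blast
 from choice[OF this] obtain p where p: "\<forall>n. p n \<in> borel_measurable borel & (AE r in lborel. 0 < r --> ennreal (\<rho> n r) = p n r)" ..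
 have eq: "(radint N (%r. p n r * indicator {\<delta><..} r)) = (\<integral>\<^sup>+ r\<in>{\<delta><..}. ennreal (\<rho> n r * r ^ (N - 1)) \<partial>lebesgue)"
  if \<delta>: "\<delta> \<ge> 0" for n \<delta>
 proof -
  have pm[measurable]: "borel_fun (p n)" and pr: "AE r in lborel. 0 < r --> ennreal (\<rho> n r) = p n r" using p by auto
  have "(radint N (%r. p n r * indicator {\<delta><..} r))
   = (NN r. ennreal (r ^ (N - 1)) * indicator {0<..} r * (p n r * indicator {\<delta><..} r))"
   by (rule nn_integral_radial_measure) measurable
  also have "... = (\<integral>\<^sup>+ r\<in>{\<delta><..}. ennreal (\<rho> n r * r ^ (N - 1)) \<partial>lborel)"
  proof (rule nn_integral_cong_AE)
   show "AE r in lborel. ennreal (r ^ (N - 1)) * indicator {0<..} r * (p n r * indicator {\<delta><..} r)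
    = ennreal (\<rho> n r * r ^ (N - 1)) * indicator {\<delta><..} r"
    using pr
   proof eventually_elim
    case (elim r)
    show ?case
    proof (cases "r > \<delta>")
     case True
     then have "0 < r" "ennreal (\<rho> n r) = p n r" using \<delta> elim by auto
     then show ?thesis using True m(2)[of r n] by (simp add: ennreal_mult'' mult.commute)
    qed simp
   qed
  qed
  also have "... = (\<integral>\<^sup>+ r\<in>{\<delta><..}. ennreal (\<rho> n r * r ^ (N - 1)) \<partial>lebesgue)" by (rule nn_integral_completion[symmetric])
  finally show ?thesis .
 qed
 have "(radint N (p n)) = 1" for n
 proof -
  have "(radint N (p n)) = (\<integral>\<^sup>+r. p n r * indicator {0<..} r \<partial>radial_measure N)"
  proof (rule nn_integral_cong_AE)
   have "AE r in radial_measure N. r > 0"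
    unfolding radial_measure_def by (subst AE_density) (auto simp: indicator_def)
   then show "AE r in radial_measure N. p n r = p n r * indicator {0<..} r" by eventually_elim simp
  qed
  then show ?thesis using eq[of 0 n] one[of n] by simp
 qed
 moreover have "(%n. radint N (%r. p n r * indicator {\<delta><..} r)) \<longlonglongrightarrow> 0" if "\<delta> > 0" for \<delta>
  using zero[OF that] eq[of \<delta>] that by simp
 ultimately show ?thesis using p by blast
qed

section \<open>Averages against mollifiers\<close>

lemma AE_radial_measure_pos: "AE r in radial_measure n. 0 < r"
 unfolding radial_measure_def by (subst AE_density) (auto simp: indicator_def)

lemma mollifier_mass_near_0:
 assumes p[measurable]: "!!n. p n \<in> borel_measurable borel" and one: "!!n. (radint N (p n)) = 1"
  and zero: "(%n. radint N (%r. p n r * indicator {\<delta><..} r)) \<longlonglongrightarrow> 0"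
 shows "(%n. radint N (%r. p n r * indicator {..\<delta>} r)) \<longlonglongrightarrow> 1"
proof -
 have eq: "(radint N (%r. p n r * indicator {..\<delta>} r)) = 1 - (radint N (%r. p n r * indicator {\<delta><..} r))" for n
 proof -
  have "1 = (radint N (%r. p n r * indicator {..\<delta>} r + p n r * indicator {\<delta><..} r))"
   unfolding one[of n, symmetric] by (rule nn_integral_cong) (auto simp: indicator_def)
  also have "... = (radint N (%r. p n r * indicator {..\<delta>} r)) + (radint N (%r. p n r * indicator {\<delta><..} r))"
   by (rule nn_integral_add) measurable
  finally have s: "1 = (radint N (%r. p n r * indicator {..\<delta>} r)) + (radint N (%r. p n r * indicator {\<delta><..} r))" .
  then have "(radint N (%r. p n r * indicator {\<delta><..} r)) ~= top"
   by (metis ennreal_add_eq_top ennreal_one_neq_top)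
  then show ?thesis unfolding s by (simp add: ennreal_add_diff_cancel_right)
 qed
 have "(%n. 1 - (radint N (%r. p n r * indicator {\<delta><..} r))) \<longlonglongrightarrow> 1 - 0"
  by (intro tendsto_diff_ennreal tendsto_const zero) simp_all
 then show ?thesis by (simp add: eq)
qed

text \<open>The hypothesis is sequential because it comes from weak limits; it makes \<open>k\<close> exceed
 any \<open>c < k0\<close> on an interval next to \<open>0\<close>, where almost all the mass lies.\<close>

lemma mollifier_liminf:
 assumes p[measurable]: "!!n. p n \<in> borel_measurable borel" and one: "!!n. (radint N (p n)) = 1"
  and zero: "!!\<delta>. \<delta> > 0 ==> (%n. radint N (%r. p n r * indicator {\<delta><..} r)) \<longlonglongrightarrow> 0"
  and low: "!!r::nat => real. (!!m. r m > 0) ==> (!!m. r m <= 1) ==> r \<longlonglongrightarrow> 0 ==> k0 <= liminf (%m. k (r m))"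
 shows "k0 <= liminf (%n. radint N (%r. p n r * k r))"
proof (rule dense_le)
 fix c assume c: "c < k0"
 then have c_fin: "c < top" by (rule less_le_trans) simp
 have "\<exists>\<delta>>0. \<forall>r. 0 < r & r <= \<delta> --> c <= k r"
 proof (rule ccontr)
  assume *: "\<not> ?thesis"
  have "\<exists>r. 0 < r & r <= inverse (real (Suc m)) & k r < c" for m
   using * by (metis inverse_positive_iff_positive not_le of_nat_0_less_iff zero_less_Suc)
  then have "\<forall>m. \<exists>r. 0 < r & r <= inverse (real (Suc m)) & k r < c" by blast
  from choice[OF this] obtain r where r: "\<forall>m. 0 < r m & r m <= inverse (real (Suc m)) & k (r m) < c" ..
  have "r m <= 1" for m
  proof -
   have "inverse (real (Suc m)) <= 1" by (simp add: inverse_le_1_iff)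
   then show ?thesis using r by (meson order_trans)
  qed
  moreover have "r \<longlonglongrightarrow> 0"
   by (rule tendsto_sandwich[OF _ _ tendsto_const LIMSEQ_inverse_real_of_nat]) (use r in \<open>auto intro!: always_eventually less_imp_le\<close>)
  ultimately have "k0 <= liminf (%m. k (r m))" using r by (intro low) auto
  also have "... <= liminf (%m. c)" by (intro Liminf_mono always_eventually) (use r in \<open>auto intro: less_imp_le\<close>)
  also have "... = c" by (simp add: Liminf_const)
  finally show False using c by simp
 qed
 then obtain \<delta> where \<delta>: "\<delta> > 0" "!!r. 0 < r ==> r <= \<delta> ==> c <= k r" by blast
 have "(%n. c * (radint N (%r. p n r * indicator {..\<delta>} r))) \<longlonglongrightarrow> c * 1"
  using c_fin by (intro ennreal_tendsto_cmult mollifier_mass_near_0[OF p one zero[OF \<delta>(1)]])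
 then have "c = liminf (%n. c * (radint N (%r. p n r * indicator {..\<delta>} r)))"
  by (simp add: lim_imp_Liminf)
 also have "... <= liminf (%n. radint N (%r. p n r * k r))"
 proof (intro Liminf_mono always_eventually allI)
  fix n
  have "c * (radint N (%r. p n r * indicator {..\<delta>} r)) = (radint N (%r. c * (p n r * indicator {..\<delta>} r)))"
   by (rule nn_integral_cmult[symmetric]) measurable
  also have "... <= (radint N (%r. p n r * k r))"
  proof (rule nn_integral_mono_AE)
   show "AE r in radial_measure N. c * (p n r * indicator {..\<delta>} r) <= p n r * k r"
    using AE_radial_measure_pos
   proof eventually_elim
    fix r :: real assume r: "0 < r"
    show "c * (p n r * indicator {..\<delta>} r) <= p n r * k r"
    proof (cases "r <= \<delta>")
     case True
     then show ?thesis using mult_left_mono[OF \<delta>(2)[OF r True], of "p n r"] by (simp add: mult.commute)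
    qed simp
   qed
  qed
  finally show "c * (radint N (%r. p n r * indicator {..\<delta>} r)) <= (radint N (%r. p n r * k r))" .
 qed
 finally show "c <= liminf (%n. radint N (%r. p n r * k r))" .
qed

lemma mollifier_limsup:
 assumes p[measurable]: "!!n. p n \<in> borel_measurable borel" and one: "!!n. (radint N (p n)) = 1"
  and zero: "!!\<delta>. \<delta> > 0 ==> (%n. radint N (%r. p n r * indicator {\<delta><..} r)) \<longlonglongrightarrow> 0"
  and up: "!!c. k0 < c ==> \<exists>\<delta>>0. \<forall>r. 0 < r & r <= \<delta> --> k r <= c"
  and C: "!!r. 0 < r ==> k r <= C" "C < top"
 shows "limsup (%n. radint N (%r. p n r * k r)) <= k0"
proof (rule dense_ge)
 fix c assume "k0 < c"
 then obtain \<delta> where \<delta>: "\<delta> > 0" "!!r. 0 < r ==> r <= \<delta> ==> k r <= c" using up by blast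
 have "(radint N (%r. p n r * k r)) <= c + C * (radint N (%r. p n r * indicator {\<delta><..} r))" for n
 proof -
  have "(radint N (%r. p n r * k r)) <= (radint N (%r. c * p n r + C * (p n r * indicator {\<delta><..} r)))"
  proof (rule nn_integral_mono_AE)
   show "AE r in radial_measure N. p n r * k r <= c * p n r + C * (p n r * indicator {\<delta><..} r)"
    using AE_radial_measure_pos
   proof eventually_elim
    fix r :: real assume r: "0 < r"
    show "p n r * k r <= c * p n r + C * (p n r * indicator {\<delta><..} r)"
    proof (cases "r <= \<delta>")
     case True
     then show ?thesis using mult_left_mono[OF \<delta>(2)[OF r True], of "p n r"] by (simp add: mult.commute)
    next
     case False
     have "p n r * k r <= C * p n r" using mult_left_mono[OF C(1)[OF r], of "p n r"] by (simp add: mult.commute)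
     then show ?thesis using False by (simp add: add_increasing)
    qed
   qed
  qed
  also have "... = c * (radint N (p n)) + C * (radint N (%r. p n r * indicator {\<delta><..} r))"
   by (subst nn_integral_add) (auto simp: nn_integral_cmult)
  finally show ?thesis by (simp add: one)
 qed
 then have "limsup (%n. radint N (%r. p n r * k r)) <= limsup (%n. c + C * (radint N (%r. p n r * indicator {\<delta><..} r)))"
  by (intro Limsup_mono always_eventually) auto
 also have "... = c"
 proof -
  have "(%n. c + C * (radint N (%r. p n r * indicator {\<delta><..} r))) \<longlonglongrightarrow> c + C * 0"
   by (intro tendsto_add tendsto_const ennreal_tendsto_cmult C(2) zero \<delta>(1))
  then show ?thesis by (simp add: lim_imp_Limsup)
 qed
 finally show "limsup (%n. radint N (%r. p n r * k r)) <= c" .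
qed

section \<open>Spherical averages of the magnetic difference quotient\<close>

lemma norm_cdot_square: "(norm (cdot s z))^2 = ((\<chi> j. Re (z $ j)) \<bullet> s)^2 + ((\<chi> j. Im (z $ j)) \<bullet> s)^2"
proof -
 have "Re (cdot s z) = (\<chi> j. Re (z $ j)) \<bullet> s" "Im (cdot s z) = (\<chi> j. Im (z $ j)) \<bullet> s"
  by (simp_all add: cdot_def inner_vec_def mult.commute)
 then show ?thesis by (simp add: cmod_power2)
qed

lemma norm_complex_vec_square: "(norm z)^2 = (norm (\<chi> j. Re (z $ j)))^2 + (norm (\<chi> j. Im (z $ j)))^2" for z :: "complex^'n"
 by (simp add: norm_vec_def L2_set_def sum_nonneg cmod_power2 sum.distrib)

lemma norm_cdot_le: "norm (cdot s z) <= norm s * norm z"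
proof (rule power2_le_imp_le)
 have "((\<chi> j. Re (z $ j)) \<bullet> s)^2 <= (norm (\<chi> j. Re (z $ j)))^2 * (norm s)^2" "((\<chi> j. Im (z $ j)) \<bullet> s)^2 <= (norm (\<chi> j. Im (z $ j)))^2 * (norm s)^2"
  using Cauchy_Schwarz_ineq[of "\<chi> j. Re (z $ j)" s] Cauchy_Schwarz_ineq[of "\<chi> j. Im (z $ j)" s] by (simp_all add: dot_square_norm)
 then show "(norm (cdot s z))^2 <= (norm s * norm z)^2"
  by (simp add: norm_cdot_square power_mult_distrib norm_complex_vec_square[of z] distrib_left mult.commute)
qed simp

lemma nn_integral_cdot_square:
 fixes z :: "complex^'n"
 shows "(NS s. ennreal ((norm (cdot s z))^2))
  = ennreal ((norm z)^2 / CARD('n)) * emeasure cone_measure (UNIV::(real^'n) set)"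
proof -
 have "(NS s. ennreal ((norm (cdot s z))^2))
  = (NS s. ennreal (((\<chi> j. Re (z $ j)) \<bullet> s)^2) + ennreal (((\<chi> j. Im (z $ j)) \<bullet> s)^2))"
  by (rule nn_integral_cong) (simp add: norm_cdot_square ennreal_plus)
 also have "... = (NS s. ennreal (((\<chi> j. Re (z $ j)) \<bullet> s)^2)) + (NS s. ennreal (((\<chi> j. Im (z $ j)) \<bullet> s)^2))"
  by (rule nn_integral_add) measurable
 also have "... = (ennreal ((norm (\<chi> j. Re (z $ j)))^2 / CARD('n)) + ennreal ((norm (\<chi> j. Im (z $ j)))^2 / CARD('n))) * emeasure cone_measure (UNIV::(real^'n) set)"
  by (simp add: nn_integral_inner_square_sphere_invariant[OF sphere_invariant_cone_measure] distrib_right)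
 also have "ennreal ((norm (\<chi> j. Re (z $ j)))^2 / CARD('n)) + ennreal ((norm (\<chi> j. Im (z $ j)))^2 / CARD('n)) = ennreal ((norm z)^2 / CARD('n))"
  by (simp add: norm_complex_vec_square[of z] add_divide_distrib flip: ennreal_plus)
 finally show ?thesis .
qed

lemma pair_sigma_finite_cone_lborel: "pair_sigma_finite (cone_measure :: (real^'n) measure) (lborel :: (real^'n) measure)"
proof -
 interpret C: finite_measure "cone_measure :: (real^'n) measure" by (rule finite_measure_cone)
 show ?thesis by unfold_locales
qed

lemma mag_grad_borel:
 assumes w: "weakgrad u g" and A: "borel_fun A"
 shows "borel_fun (mag_grad A u g)"
proof -
 have u: "locint u" and g: "locint g" using w by (auto simp: weakgrad_def locint_nth)
 note [measurable] = locint_measurable[OF u] A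
 have "borel_fun (%x. mag_grad A u g x \<bullet> b)" if b: "b \<in> Basis" for b
 proof -
  obtain j c where b: "b = axis j c" using b by (auto simp: Basis_vec_def)
  have [measurable]: "borel_fun (%x. g x $ j)" using w by (auto simp: weakgrad_def locint_def)
  have [measurable]: "borel_fun (%x. A x $ j)" using A borel_measurable_vec_nth by (rule measurable_compose)
  have "(%x. mag_grad A u g x \<bullet> b) = (%x. (g x $ j - \<i> * cor (A x $ j) * u x) \<bullet> c)"
   by (simp add: b inner_axis mag_grad_def)
  then show ?thesis by simp
 qed
 then show ?thesis by (subst borel_measurable_euclidean_space) blast
qed

lemma cdot_measurable:
 fixes G :: "'a::euclidean_space => complex^'n"
 assumes G: "borel_fun G"
 shows "(%(s, x). cdot s (G x)) \<in> borel_measurable (borel \<Otimes>\<^sub>M borel)"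
proof -
 have [measurable]: "(%z::(real^'n) \<times> 'a. G (snd z) $ j) \<in> borel_measurable (borel \<Otimes>\<^sub>M borel)" for j
  using measurable_compose[OF measurable_snd G] borel_measurable_vec_nth by (rule measurable_compose)
 have [measurable]: "(%z::(real^'n) \<times> 'a. fst z $ j) \<in> borel_measurable (borel \<Otimes>\<^sub>M borel)" for j
  by (rule measurable_compose[OF measurable_fst borel_measurable_vec_nth])
 show ?thesis unfolding cdot_def by measurable
qed

text \<open>The real and imaginary parts of a complex vector contribute separately, each by the second moment
 of the cone measure.\<close>

lemma spherical_average_cdot:
 fixes G :: "real^'n => complex^'n"
 assumes G: "borel_fun G"
 shows "(NS s. (energy (%x. cdot s (G x))))
  = ennreal (1 / CARD('n)) * emeasure cone_measure (UNIV::(real^'n) set) * (energy G)"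
proof -
 interpret P: pair_sigma_finite "cone_measure :: (real^'n) measure" "lborel :: (real^'n) measure"
  by (rule pair_sigma_finite_cone_lborel)
 note [measurable] = G
 have sm: "measurable (cone_measure \<Otimes>\<^sub>M lborel) borel = measurable (borel \<Otimes>\<^sub>M borel :: ((real^'n) \<times> (real^'n)) measure) (borel :: ennreal measure)"
  by (intro measurable_cong_sets sets_pair_measure_cong) auto
 have "(%z. ennreal ((norm (case z of (s, x) => cdot s (G x)))^2)) \<in> borel_measurable (borel \<Otimes>\<^sub>M borel)"
  using cdot_measurable[OF G] by measurable
 then have "(%(s, x). ennreal ((norm (cdot s (G x)))^2)) \<in> borel_measurable (cone_measure \<Otimes>\<^sub>M lborel)"
  by (simp add: sm case_prod_beta)
 then have "(NS s. (energy (%x. cdot s (G x))))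
  = (NN x. (NS s. ennreal ((norm (cdot s (G x)))^2)))"
  by (rule P.Fubini'[symmetric])
 also have "... = (NN x. (ennreal (1 / CARD('n)) * emeasure cone_measure (UNIV::(real^'n) set)) * ennreal ((norm (G x))^2))"
 proof (rule nn_integral_cong)
  fix x
  have "ennreal ((norm (G x))^2 / CARD('n)) = ennreal (1 / CARD('n)) * ennreal ((norm (G x))^2)"
   by (subst ennreal_mult[symmetric]) simp_all
  then show "(NS s. ennreal ((norm (cdot s (G x)))^2))
   = (ennreal (1 / CARD('n)) * emeasure cone_measure (UNIV::(real^'n) set)) * ennreal ((norm (G x))^2)"
   by (simp add: nn_integral_cdot_square mult_ac)
 qed
 also have "... = ennreal (1 / CARD('n)) * emeasure cone_measure (UNIV::(real^'n) set) * (energy G)"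
  by (rule nn_integral_cmult) measurable
 finally show ?thesis .
qed

lemma nn_integral_mag_quotient:
 assumes r: "r > 0" and u: "borel_fun u" and A: "borel_fun A"
 shows "(energy (%x. mag_diff A u h x / cor r))
  = ennreal (1 / r^2) * (energy (mag_diff A u h))"
proof -
 note [measurable] = mag_diff_measurable1[OF A u]
 have "(energy (%x. mag_diff A u h x / cor r))
  = (NN x. ennreal (1 / r^2) * ennreal ((norm (mag_diff A u h x))^2))"
  using r by (intro nn_integral_cong) (simp add: norm_divide power_divide flip: ennreal_mult)
 also have "... = ennreal (1 / r^2) * (energy (mag_diff A u h))"
  by (rule nn_integral_cmult) measurable
 finally show ?thesis .
qed

lemma sphere_energy_upper:
 fixes A :: "real^'n => real^'n"
 assumes w: "weakgrad u g" and L: "L-lipschitz_on UNIV A" and \<eta>: "\<eta> > 0" and r: "r > 0"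
 shows "sphere_energy A u r
  <= ennreal (1 + \<eta>) * (NS s. (energy (%x. cdot s (mag_grad A u g x))))
   + ennreal ((1 + 1 / \<eta>) * (r * L / 2)^2) * (energy u) * emeasure cone_measure (UNIV::(real^'n) set)"
proof -
 have A: "borel_fun A" by (rule lipschitz_measurable[OF L])
 have u: "borel_fun u" using w by (simp add: weakgrad_def locint_def)
 have L0: "L \<ge> 0" by (rule lipschitz_on_nonneg[OF L])
 define E where "E s = (energy (%x. cdot s (mag_grad A u g x)))" for s
 define U where "U = (energy u)"
 have Em[measurable]: "borel_fun E"
 proof -
  have "(%z. ennreal ((norm (case z of (s, x) => cdot s (mag_grad A u g x)))^2)) \<in> borel_measurable (borel \<Otimes>\<^sub>M lborel)"
   using cdot_measurable[OF mag_grad_borel[OF w A]] by (simp cong: measurable_cong_sets sets_pair_measure_cong) measurable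
  then show ?thesis unfolding E_def[abs_def]
   by (intro lborel.borel_measurable_nn_integral) (simp add: case_prod_beta)
 qed
 have "sphere_energy A u r <= (NS s. ennreal (1 + \<eta>) * E s + ennreal ((1 + 1 / \<eta>) * (r * L / 2)^2) * U)"
  unfolding sphere_energy_def
 proof (rule nn_integral_mono_AE)
  show "AE s in cone_measure. (energy (%x. mag_diff A u (r *\<^sub>R s) x / cor r))
   <= ennreal (1 + \<eta>) * E s + ennreal ((1 + 1 / \<eta>) * (r * L / 2)^2) * U"
   using AE_cone_measure_norm[where 'a="real^'n"]
  proof eventually_elim
   fix s :: "real^'n" assume s: "norm s = 1"
   have cm: "borel_fun (%x. cdot s (mag_grad A u g x))" by (rule mag_grad_measurable[OF w A])
   have "cdot (r *\<^sub>R s) z = cor r * cdot s z" for z :: "complex^'n"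
    by (simp add: cdot_def sum_distrib_left mult.assoc)
   then have "(energy (%x. cdot (r *\<^sub>R s) (mag_grad A u g x))) = (NN x. ennreal (r^2) * ennreal ((norm (cdot s (mag_grad A u g x)))^2))"
    by (intro nn_integral_cong) (simp add: norm_mult power_mult_distrib flip: ennreal_mult)
   also have "... = ennreal (r^2) * E s"
    unfolding E_def by (rule nn_integral_cmult) (use cm in measurable)
   finally have e: "(energy (%x. cdot (r *\<^sub>R s) (mag_grad A u g x))) = ennreal (r^2) * E s" .
   have c: "(1 + 1 / \<eta>) * ((norm (r *\<^sub>R s))^2 * L / 2)^2 = r^2 * ((1 + 1 / \<eta>) * (r * L / 2)^2)"
    using s by (simp add: power2_eq_square)
   have cE: "ennreal ((1 + 1 / \<eta>) * ((norm (r *\<^sub>R s))^2 * L / 2)^2) = ennreal (r^2) * ennreal ((1 + 1 / \<eta>) * (r * L / 2)^2)"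
    unfolding c by (rule ennreal_mult) (use \<eta> in simp_all)
   have i1: "ennreal (1 / r^2) * ennreal (r^2) = 1" using r by (simp flip: ennreal_mult)
   have "(energy (%x. mag_diff A u (r *\<^sub>R s) x / cor r))
    <= ennreal (1 / r^2) * (ennreal (1 + \<eta>) * (ennreal (r^2) * E s) + (ennreal (r^2) * ennreal ((1 + 1 / \<eta>) * (r * L / 2)^2)) * U)"
    unfolding nn_integral_mag_quotient[OF r u A]
    by (intro mult_left_mono order_trans[OF mag_diff_upper[OF w L \<eta>]]) (simp_all add: e cE[symmetric] U_def)
   also have "... = (ennreal (1 / r^2) * ennreal (r^2)) * (ennreal (1 + \<eta>) * E s + ennreal ((1 + 1 / \<eta>) * (r * L / 2)^2) * U)"
    by (simp only: distrib_left mult_ac)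
   finally show "(energy (%x. mag_diff A u (r *\<^sub>R s) x / cor r))
    <= ennreal (1 + \<eta>) * E s + ennreal ((1 + 1 / \<eta>) * (r * L / 2)^2) * U" by (simp only: i1 mult_1_left)
  qed
 qed
 also have "... = ennreal (1 + \<eta>) * (NS s. E s) + ennreal ((1 + 1 / \<eta>) * (r * L / 2)^2) * U * emeasure cone_measure (UNIV::(real^'n) set)"
  by (subst nn_integral_add) (simp_all add: nn_integral_cmult)
 finally show ?thesis by (simp add: E_def U_def)
qed

lemma sphere_energy_trivial_upper:
 fixes A :: "real^'n => real^'n"
 assumes u: "borel_fun u" and A: "borel_fun A" and r: "r > 0"
 shows "sphere_energy A u r <= ennreal (4 / r^2) * (energy u) * emeasure cone_measure (UNIV::(real^'n) set)"
proof -
 define U where "U = (energy u)"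
 have "sphere_energy A u r <= (NS (s::real^'n). ennreal (4 / r^2) * U)"
  unfolding sphere_energy_def
 proof (rule nn_integral_mono)
  fix s :: "real^'n"
  have "ennreal (1 / r^2) * (4 * U) = (ennreal (1 / r^2) * ennreal 4) * U" by (simp add: mult.assoc)
  also have "ennreal (1 / r^2) * ennreal 4 = ennreal (4 / r^2)" by (subst ennreal_mult[symmetric]) simp_all
  finally have e: "ennreal (1 / r^2) * (4 * U) = ennreal (4 / r^2) * U" .
  have "(energy (%x. mag_diff A u (r *\<^sub>R s) x / cor r)) <= ennreal (1 / r^2) * (4 * U)"
   unfolding nn_integral_mag_quotient[OF r u A] U_def
   by (rule mult_left_mono[OF mag_diff_trivial_upper[OF u A]]) simp
  then show "(energy (%x. mag_diff A u (r *\<^sub>R s) x / cor r)) <= ennreal (4 / r^2) * U"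
   unfolding e .
 qed
 then show ?thesis by (simp add: U_def)
qed

text \<open>Fatou's lemma over the directions.\<close>

lemma sphere_energy_lower:
 fixes A :: "real^'n => real^'n"
 assumes u: "cL2 u" and w: "weakgrad u g" and L: "L-lipschitz_on UNIV A"
  and E: "(energy (mag_grad A u g)) < \<infinity>" and r: "!!m. r m > 0" "!!m. r m <= 1" "r \<longlonglongrightarrow> 0"
 shows "(NS s. (energy (%x. cdot s (mag_grad A u g x)))) <= liminf (%m. sphere_energy A u (r m))"
proof -
 have A: "borel_fun A" by (rule lipschitz_measurable[OF L])
 have um: "borel_fun u" using u by (simp add: cL2_def)
 define f where "f m s = (energy (%x. mag_diff A u (r m *\<^sub>R s) x / cor (r m)))" for m s
 have F: "cL2 (%x. cdot s (mag_grad A u g x))" for s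
  unfolding cL2_def
 proof (intro conjI)
  show "borel_fun (%x. cdot s (mag_grad A u g x))" by (rule mag_grad_measurable[OF w A])
  note [measurable] = mag_grad_borel[OF w A]
  have "(energy (%x. cdot s (mag_grad A u g x))) <= (NN x. ennreal ((norm s)^2) * ennreal ((norm (mag_grad A u g x))^2))"
  proof (rule nn_integral_mono)
   fix x
   have "(norm (cdot s (mag_grad A u g x)))^2 <= (norm s * norm (mag_grad A u g x))^2" by (intro power_mono norm_cdot_le) simp
   then show "ennreal ((norm (cdot s (mag_grad A u g x)))^2) <= ennreal ((norm s)^2) * ennreal ((norm (mag_grad A u g x))^2)"
    by (simp add: power_mult_distrib ennreal_leI flip: ennreal_mult)
  qed
  also have "... = ennreal ((norm s)^2) * (energy (mag_grad A u g))" by (rule nn_integral_cmult) measurable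
  also have "... < \<infinity>" using E by (simp add: ennreal_mult_less_top)
  finally show "(energy (%x. cdot s (mag_grad A u g x))) < \<infinity>" .
 qed
 have "(NS s. (energy (%x. cdot s (mag_grad A u g x)))) <= (NS s. liminf (%m. f m s))"
  unfolding f_def by (intro nn_integral_mono mag_diff_lower[OF u w L F r])
 also have "... <= liminf (%m. \<integral>\<^sup>+s. f m s \<partial>cone_measure)"
  by (rule nn_integral_liminf) (simp add: f_def mag_quotient_measurable1[OF A um] measurable_cong_sets[OF sets_cone_measure refl])
 finally show ?thesis by (simp add: f_def sphere_energy_def)
qed

section \<open>Weak gradients from bounded nonlocal energy\<close>

lemma locint_potential:
 fixes A :: "real^'n => real^'n"
 assumes u: "locint u" and L: "L-lipschitz_on UNIV A"
 shows "locint (%x. \<i> * cor (A x $ j) * u x)"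
proof (rule locint_mult_bounded_on_balls[OF u])
 have A: "borel_fun A" by (rule lipschitz_measurable[OF L])
 have [measurable]: "borel_fun (%x. A x $ j)" using A borel_measurable_vec_nth by (rule measurable_compose)
 show "borel_fun (%x. \<i> * cor (A x $ j))" by measurable
 fix R :: real
 have "norm (\<i> * cor (A x $ j)) <= norm (A 0) + L * \<bar>R\<bar>" if "x \<in> ball 0 R" for x
 proof -
  have "norm (\<i> * cor (A x $ j)) <= norm (A x)" by (simp add: norm_mult component_le_norm_cart)
  also have "... <= norm (A 0) + L * norm x" by (rule lipschitz_norm_le[OF L])
  also have "... <= norm (A 0) + L * \<bar>R\<bar>" using that lipschitz_on_nonneg[OF L] by (intro add_left_mono mult_left_mono) auto
  finally show ?thesis .
 qed
 then show "\<exists>B. \<forall>x\<in>ball 0 R. norm (\<i> * cor (A x $ j)) <= B" by blast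
qed

lemma weak_mag_axis:
 assumes u: "locint u" and L: "L-lipschitz_on UNIV A" and \<phi>: "test_function \<phi>"
 shows "weak_mag A u (axis j 1) \<phi> = - ((LBINT x. u x * cor (pderivative j \<phi> x))
   + (LBINT x. \<i> * cor (A x $ j) * u x * cor (\<phi> x)))"
proof -
 have "(LBINT x. u x * cor (pderivative j \<phi> x) + \<i> * cor (A x $ j) * u x * cor (\<phi> x))
  = (LBINT x. u x * cor (pderivative j \<phi> x)) + (LBINT x. \<i> * cor (A x $ j) * u x * cor (\<phi> x))"
  by (intro Bochner_Integration.integral_add locint_mult_test[OF u test_pderivative[OF \<phi>]] locint_mult_test[OF locint_potential[OF u L] \<phi>])
 moreover have "weak_mag A u (axis j 1) \<phi> = - (LBINT x. u x * cor (pderivative j \<phi> x) + \<i> * cor (A x $ j) * u x * cor (\<phi> x))"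
  unfolding weak_mag_def by (intro arg_cong[where f=uminus] Bochner_Integration.integral_cong) (simp_all add: grad_def inner_axis' algebra_simps)
 ultimately show ?thesis by simp
qed

lemma weak_mag_cdot:
 assumes u: "locint u" and L: "L-lipschitz_on UNIV A" and \<phi>: "test_function \<phi>"
 shows "weak_mag A u s \<phi> = cdot s (\<chi> j. weak_mag A u (axis j 1) \<phi>)"
proof -
 define a where "a j x = u x * cor (pderivative j \<phi> x)" for j x
 define b where "b j x = \<i> * cor (A x $ j) * u x * cor (\<phi> x)" for j x
 have i: "integrable lborel (a j)" "integrable lborel (b j)" for j
  unfolding a_def[abs_def] b_def[abs_def]
  by (rule locint_mult_test[OF u test_pderivative[OF \<phi>]], rule locint_mult_test[OF locint_potential[OF u L] \<phi>])
 have "weak_mag A u s \<phi> = - (LBINT x. (\<Sum>j\<in>UNIV. cor (s $ j) * (a j x + b j x)))"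
  unfolding weak_mag_def
  by (intro arg_cong[where f=uminus] Bochner_Integration.integral_cong refl)
   (simp add: a_def b_def grad_def inner_vec_def sum_distrib_left sum_distrib_right sum.distrib algebra_simps)
 also have "... = - (\<Sum>j\<in>UNIV. cor (s $ j) * ((LBINT x. a j x) + (LBINT x. b j x)))"
  using i by (subst Bochner_Integration.integral_sum) auto
 also have "... = (\<Sum>j\<in>UNIV. cor (s $ j) * - ((LBINT x. a j x) + (LBINT x. b j x)))"
  by (simp only: sum_negf[symmetric] mult_minus_right)
 also have "... = cdot s (\<chi> j. weak_mag A u (axis j 1) \<phi>)"
  unfolding cdot_def by (simp add: weak_mag_axis[OF u L \<phi>] a_def b_def)
 finally show ?thesis .
qed

lemma weak_mag_lincomb:
 assumes u: "locint u" and L: "L-lipschitz_on UNIV A" and v: "test_function v" and z: "test_function z"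
 shows "weak_mag A u (axis j 1) (%x. a * v x + b * z x) = cor a * weak_mag A u (axis j 1) v + cor b * weak_mag A u (axis j 1) z"
proof -
 note t = test_lincomb[OF v z, of a b]
 have *: "(LBINT x. f x * cor (a * p x + b * q x))
  = cor a * (LBINT x. f x * cor (p x)) + cor b * (LBINT x. f x * cor (q x))"
  if f: "locint f" and p: "test_function p" and q: "test_function q" for f :: "real^'a => complex" and p q
 proof -
  have "(LBINT x. f x * cor (a * p x + b * q x))
   = (LBINT x. cor a * (f x * cor (p x)) + cor b * (f x * cor (q x)))"
   by (rule Bochner_Integration.integral_cong) (simp_all add: algebra_simps)
  also have "... = cor a * (LBINT x. f x * cor (p x)) + cor b * (LBINT x. f x * cor (q x))"
   using locint_mult_test[OF f p] locint_mult_test[OF f q] by simp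
  finally show ?thesis .
 qed
 show ?thesis
  unfolding weak_mag_axis[OF u L t] weak_mag_axis[OF u L v] weak_mag_axis[OF u L z] pderivative_lincomb[OF v z]
   *[OF u test_pderivative[OF v] test_pderivative[OF z]] *[OF locint_potential[OF u L] v z]
  by (simp add: algebra_simps)
qed

lemma cL2_test_Cauchy_Schwarz:
 assumes f: "cL2 f" and \<phi>: "test_function \<phi>"
 shows "ennreal ((norm (LBINT x. f x * cor (\<phi> x)))^2) <= ennreal (LBINT x. (\<phi> x)^2) * (energy f)"
proof -
 have [measurable]: "borel_fun f" using f by (simp add: cL2_def)
 note [measurable] = test_measurable[OF \<phi>]
 have s1: "sq_integrable lborel (%x. norm (f x))"
  by (rule sq_integrableI_nn) (use f in \<open>simp_all add: cL2_def\<close>)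
 have s2: "sq_integrable lborel (%x. \<bar>\<phi> x\<bar>)"
  using test_sq_integrable[OF \<phi>] by (simp add: sq_integrable_def)
 have "norm (LBINT x. f x * cor (\<phi> x)) <= (LBINT x. norm (f x) * \<bar>\<phi> x\<bar>)"
  using integral_norm_bound[of lborel "%x. f x * cor (\<phi> x)"] by (simp add: norm_mult)
 then have "(norm (LBINT x. f x * cor (\<phi> x)))^2 <= (LBINT x. norm (f x) * \<bar>\<phi> x\<bar>)^2"
  by (rule power_mono) simp
 also have "... <= (LBINT x. (norm (f x))^2) * (LBINT x. \<bar>\<phi> x\<bar>^2)" by (rule sq_integrable_Cauchy_Schwarz[OF s1 s2])
 finally have "(norm (LBINT x. f x * cor (\<phi> x)))^2 <= (LBINT x. (\<phi> x)^2) * (LBINT x. (norm (f x))^2)"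
  by (simp add: mult.commute)
 then show ?thesis unfolding cL2_nn_integral[OF f] by (subst ennreal_mult[symmetric]) (auto intro!: ennreal_leI)
qed

text \<open>For fixed \<open>s\<close> bound the pairing of the quotient with \<open>\<phi>\<close> by the
 Cauchy-Schwarz inequality, then apply Fatou's lemma over the directions.\<close>

lemma weak_mag_sphere_energy:
 fixes A :: "real^'n => real^'n"
 assumes u: "cL2 u" and L: "L-lipschitz_on UNIV A" and \<phi>: "test_function \<phi>"
  and r: "!!m. r m > 0" "!!m. r m <= 1" "r \<longlonglongrightarrow> 0"
 shows "(NS s. ennreal ((norm (weak_mag A u s \<phi>))^2))
  <= liminf (%m. ennreal (LBINT x. (\<phi> x)^2) * sphere_energy A u (r m))"
proof -
 have A: "borel_fun A" by (rule lipschitz_measurable[OF L])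
 have um: "borel_fun u" using u by (simp add: cL2_def)
 define B where "B = ennreal (LBINT x. (\<phi> x)^2)"
 define f where "f m s = (energy (%x. mag_diff A u (r m *\<^sub>R s) x / cor (r m)))" for m s
 have fm[measurable]: "f m \<in> borel_measurable cone_measure" for m
  by (simp add: f_def[abs_def] mag_quotient_measurable1[OF A um] measurable_cong_sets[OF sets_cone_measure refl])
 have "ennreal ((norm (weak_mag A u s \<phi>))^2) <= liminf (%m. B * f m s)" for s
 proof -
  define c where "c m = (LBINT x. mag_diff A u (r m *\<^sub>R s) x * cor (\<phi> x)) / cor (r m)" for m
  have "(%m. ennreal ((norm (c m))^2)) \<longlonglongrightarrow> ennreal ((norm (weak_mag A u s \<phi>))^2)"
   unfolding c_def by (intro tendsto_ennrealI tendsto_power tendsto_norm mag_diff_test_tendsto[OF cL2_locint[OF u] L \<phi> r])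
  then have "ennreal ((norm (weak_mag A u s \<phi>))^2) = liminf (%m. ennreal ((norm (c m))^2))"
   by (rule lim_imp_Liminf[OF sequentially_bot, symmetric])
  also have "... <= liminf (%m. B * f m s)"
  proof (intro Liminf_mono always_eventually allI)
   fix m
   have "c m = (LBINT x. mag_diff A u (r m *\<^sub>R s) x / cor (r m) * cor (\<phi> x))"
    by (simp add: c_def integral_divide_zero[symmetric] del: integral_divide_zero)
   then show "ennreal ((norm (c m))^2) <= B * f m s"
    unfolding B_def f_def using cL2_test_Cauchy_Schwarz[OF cL2_divide[OF cL2_mag_diff[OF u A]] \<phi>] by simp
  qed
  finally show ?thesis .
 qed
 then have "(NS s. ennreal ((norm (weak_mag A u s \<phi>))^2)) <= (NS s. liminf (%m. B * f m s))"
  by (intro nn_integral_mono)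
 also have "... <= liminf (%m. \<integral>\<^sup>+s. B * f m s \<partial>cone_measure)"
  by (rule nn_integral_liminf) measurable
 also have "(%m. \<integral>\<^sup>+s. B * f m s \<partial>cone_measure) = (%m. B * sphere_energy A u (r m))"
  by (rule ext) (simp add: nn_integral_cmult, simp add: f_def sphere_energy_def)
 finally show ?thesis by (simp add: B_def)
qed

text \<open>\<open>weak_mag\<close> is linear in the direction, so its spherical second moment controls all
 its components \<open>T j\<close>. They are therefore bounded functionals of the test function, represented by
 square integrable \<open>G j\<close>; adding \<open>i A u\<close> gives the weak gradient.\<close>

theorem weakgrad_of_bounded_energy:
 fixes A :: "real^'n => real^'n"
 assumes u: "cL2 u" and L: "L-lipschitz_on UNIV A"
  and p[measurable]: "!!n. p n \<in> borel_measurable borel" and one: "!!n. (radint N (p n)) = 1"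
  and zero: "!!\<delta>. \<delta> > 0 ==> (%n. radint N (%r. p n r * indicator {\<delta><..} r)) \<longlonglongrightarrow> 0"
  and C: "!!n. (radint N (%r. p n r * sphere_energy A u r)) <= ennreal C" "C \<ge> 0"
 shows "\<exists>g. weakgrad u g & (energy (mag_grad A u g)) < \<infinity>"
proof -
 have ul: "locint u" by (rule cL2_locint[OF u])
 have A: "borel_fun A" by (rule lipschitz_measurable[OF L])
 have um: "borel_fun u" using u by (simp add: cL2_def)
 note [measurable] = sphere_energy_measurable[OF A um]
 define \<sigma> where "\<sigma> = enn2real (emeasure cone_measure (UNIV :: (real^'n) set))"
 have \<sigma>: "emeasure cone_measure (UNIV :: (real^'n) set) = ennreal \<sigma>" "\<sigma> > 0"
  using emeasure_cone_measure_UNIV_finite[where 'a="real^'n"] emeasure_cone_measure_UNIV_pos[where 'a="real^'n"]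
  by (simp_all add: \<sigma>_def enn2real_positive_iff)
 define T where "T j \<phi> = weak_mag A u (axis j 1) \<phi>" for j \<phi>
 define K where "K = C * CARD('n) / \<sigma>"
 have K0: "K \<ge> 0" using C(2) \<sigma>(2) by (simp add: K_def)
 have bound: "(norm (T j \<phi>))^2 <= K * (LBINT x. (\<phi> x)^2)" if \<phi>: "test_function \<phi>" for j \<phi>
 proof -
  define B where "B = (LBINT x. (\<phi> x)^2)"
  have B0: "B \<ge> 0" by (simp add: B_def)
  define w where "w = (\<chi> j. T j \<phi>)"
  have "(NS s. ennreal ((norm (cdot s w))^2)) <= liminf (%n. radint N (%r. p n r * (ennreal B * sphere_energy A u r)))"
  proof (rule mollifier_liminf[OF p one zero])
   fix r :: "nat => real" assume r: "!!m. r m > 0" "!!m. r m <= 1" "r \<longlonglongrightarrow> 0"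
   show "(NS s. ennreal ((norm (cdot s w))^2)) <= liminf (%m. ennreal B * sphere_energy A u (r m))"
    using weak_mag_sphere_energy[OF u L \<phi> r] by (simp add: B_def w_def T_def weak_mag_cdot[OF ul L \<phi>, symmetric])
  qed
  also have "... <= liminf (%n. ennreal (B * C))"
  proof (intro Liminf_mono always_eventually allI)
   fix n
   have "(radint N (%r. p n r * (ennreal B * sphere_energy A u r))) = (radint N (%r. ennreal B * (p n r * sphere_energy A u r)))"
    by (simp add: mult_ac)
   also have "... = ennreal B * (radint N (%r. p n r * sphere_energy A u r))" by (rule nn_integral_cmult) measurable
   also have "... <= ennreal B * ennreal C" by (intro mult_left_mono C(1)) simp
   finally show "(radint N (%r. p n r * (ennreal B * sphere_energy A u r))) <= ennreal (B * C)"
    using B0 C(2) by (simp add: ennreal_mult)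
  qed
  also have "... = ennreal (B * C)" by (simp add: Liminf_const)
  finally have le: "ennreal ((norm w)^2 / CARD('n)) * ennreal \<sigma> <= ennreal (B * C)"
   by (simp only: nn_integral_cdot_square \<sigma>(1))
  have "ennreal ((norm w)^2 / CARD('n) * \<sigma>) = ennreal ((norm w)^2 / CARD('n)) * ennreal \<sigma>"
   by (rule ennreal_mult) (use \<sigma>(2) in simp_all)
  with le have "ennreal ((norm w)^2 / CARD('n) * \<sigma>) <= ennreal (B * C)" by (simp only:)
  then have "(norm w)^2 / CARD('n) * \<sigma> <= B * C" using B0 C(2) by (simp add: ennreal_le_iff)
  then have "(norm w)^2 <= K * B" using \<sigma>(2) by (simp add: K_def field_simps)
  moreover have "(norm (T j \<phi>))^2 <= (norm w)^2"
   using Finite_Cartesian_Product.norm_nth_le[of w j] by (intro power_mono) (simp_all add: w_def)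
  ultimately have "(norm (T j \<phi>))^2 <= K * B" by (rule order_trans[rotated])
  then show ?thesis by (simp only: B_def)
 qed
 define V where "V = {\<phi> :: real^'n => real. test_function \<phi>}"
 have riesz: "\<exists>g. sq_integrable lborel g & (\<forall>v\<in>V. c (T j v) = (LBINT x. g x * v x)) & (\<forall>e>0. \<exists>v\<in>V. (LBINT x. (v x - g x)^2) < e)"
  if c: "c = Re \<or> c = Im" for c j
 proof (rule Riesz_representation[of V lborel "%v. c (T j v)" K])
  show "V ~= {}" using test_zero by (auto simp: V_def)
  show "sq_integrable lborel v" if "v \<in> V" for v using that test_sq_integrable by (simp add: V_def)
  show "(%x. a * v x + b * w x) \<in> V" if "v \<in> V" "w \<in> V" for v w a b
   using that test_lincomb by (auto simp: V_def)
  show "c (T j (%x. a * v x + b * w x)) = a * c (T j v) + b * c (T j w)" if "v \<in> V" "w \<in> V" for v w a b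
   using that c by (auto simp: V_def T_def weak_mag_lincomb[OF ul L])
  show "(c (T j v))^2 <= K * (LBINT x. (v x)^2)" if "v \<in> V" for v
  proof -
   have "(c (T j v))^2 <= (norm (T j v))^2" using c by (auto simp: cmod_power2)
   also have "... <= K * (LBINT x. (v x)^2)" by (rule bound) (use that in \<open>simp add: V_def\<close>)
   finally show ?thesis .
  qed
 qed (rule K0)
 have "\<exists>G. cL2 G & (\<forall>\<phi>. test_function \<phi> --> T j \<phi> = (LBINT x. G x * cor (\<phi> x)))" for j
 proof -
  obtain a where a: "sq_integrable lborel a" "!!v. v \<in> V ==> Re (T j v) = (LBINT x. a x * v x)" using riesz[of Re j] by blast
  obtain b where b: "sq_integrable lborel b" "!!v. v \<in> V ==> Im (T j v) = (LBINT x. b x * v x)" using riesz[of Im j] by blast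
  define G where "G x = cor (a x) + \<i> * cor (b x)" for x
  have [measurable]: "borel_fun a" "borel_fun b" using a(1) b(1) by (simp_all add: sq_integrable_def)
  have Gm[measurable]: "borel_fun G" unfolding G_def[abs_def] by measurable
  have "(energy G) = (NN x. ennreal ((a x)^2) + ennreal ((b x)^2))"
   by (rule nn_integral_cong) (simp add: G_def cmod_power2 ennreal_plus)
  also have "... = (NN x. ennreal ((a x)^2)) + (NN x. ennreal ((b x)^2))" by (rule nn_integral_add) measurable
  also have "... < \<infinity>" by (simp add: sq_integrable_nn_integral[OF a(1)] sq_integrable_nn_integral[OF b(1)])
  finally have cG: "cL2 G" by (simp add: cL2_def Gm)
  have "T j \<phi> = (LBINT x. G x * cor (\<phi> x))" if \<phi>: "test_function \<phi>" for \<phi>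
  proof -
   have i: "integrable lborel (%x. G x * cor (\<phi> x))" by (rule locint_mult_test[OF cL2_locint[OF cG] \<phi>])
   have "\<phi> \<in> V" using \<phi> by (simp add: V_def)
   then show ?thesis
    using a(2)[of \<phi>] b(2)[of \<phi>] integral_Re[OF i] integral_Im[OF i] by (intro complex_eqI) (simp_all add: G_def)
  qed
  then show ?thesis using cG by blast
 qed
 then have "\<forall>j. \<exists>G. cL2 G & (\<forall>\<phi>. test_function \<phi> --> T j \<phi> = (LBINT x. G x * cor (\<phi> x)))" by blast
 from choice[OF this] obtain G where GG: "\<forall>j. cL2 (G j) & (\<forall>\<phi>. test_function \<phi> --> T j \<phi> = (LBINT x. G j x * cor (\<phi> x)))" ..
 then have G: "cL2 (G j)" "test_function \<phi> ==> T j \<phi> = (LBINT x. G j x * cor (\<phi> x))" for j \<phi> by simp_all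
 define g where "g x = (\<chi> j. G j x + \<i> * cor (A x $ j) * u x)" for x
 have w: "weakgrad u g"
  unfolding weakgrad_def
 proof (intro conjI allI impI ul)
  show "locint (%x. g x $ j)" for j
   unfolding g_def vec_lambda_beta by (intro locint_add cL2_locint[OF G(1)] locint_potential[OF ul L])
  fix \<phi> j assume \<phi>: "test_function (\<phi> :: real^'n => real)"
  have "(LBINT x. g x $ j * cor (\<phi> x))
   = (LBINT x. G j x * cor (\<phi> x)) + (LBINT x. \<i> * cor (A x $ j) * u x * cor (\<phi> x))"
   unfolding g_def vec_lambda_beta distrib_right
   by (intro Bochner_Integration.integral_add locint_mult_test[OF cL2_locint[OF G(1)] \<phi>] locint_mult_test[OF locint_potential[OF ul L] \<phi>])
  then show "(LBINT x. u x * cor (pderivative j \<phi> x)) = - (LBINT x. g x $ j * cor (\<phi> x))"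
   using G(2)[OF \<phi>, of j, symmetric] by (simp add: T_def weak_mag_axis[OF ul L \<phi>])
 qed
 have [measurable]: "borel_fun (G j)" for j using G(1)[of j] by (simp add: cL2_def)
 have "mag_grad A u g x = (\<chi> j. G j x)" for x by (simp add: mag_grad_def g_def)
 then have "(energy (mag_grad A u g)) = (NN x. (\<Sum>j\<in>UNIV. ennreal ((norm (G j x))^2)))"
  by (intro nn_integral_cong) (simp add: norm_vec_def L2_set_def sum_nonneg sum_ennreal)
 also have "... = (\<Sum>j\<in>UNIV. \<integral>\<^sup>+x. ennreal ((norm (G j x))^2) \<partial>lborel)" by (rule nn_integral_sum) measurable
 also have "... < \<infinity>" using G(1) by (simp add: cL2_def less_top)
 finally show ?thesis using w by blast
qed

section \<open>The nonlocal characterisation\<close>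

text \<open>For \<open>r \<le> 1\<close> take \<open>\<eta> = 1\<close> in the sharp bound; for \<open>r \<ge>
 1\<close> the triangle inequality is enough.\<close>

lemma sphere_energy_uniform_bound:
 fixes A :: "real^'n => real^'n"
 defines "S \<equiv> emeasure cone_measure (UNIV::(real^'n) set)"
 assumes w: "weakgrad u g" and L: "L-lipschitz_on UNIV A" and r: "r > 0"
 shows "sphere_energy A u r <= 2 * S * (energy (mag_grad A u g))
  + 2 * S * (2 + (ennreal L)^2) * (energy u)"
proof -
 have A: "borel_fun A" by (rule lipschitz_measurable[OF L])
 have um: "borel_fun u" using w by (simp add: weakgrad_def locint_def)
 have L0: "L \<ge> 0" by (rule lipschitz_on_nonneg[OF L])
 define E where "E = (energy (mag_grad A u g))"
 define U where "U = (energy u)"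
 have L2: "2 * (2 + (ennreal L)^2) = ennreal (2 * (2 + L^2))"
  using L0 by (simp add: ennreal_mult ennreal_plus ennreal_power)
 show ?thesis
 proof (cases "r <= 1")
  case True
  have "ennreal (1 / CARD('n)) * S * E <= 1 * S * E"
   by (intro mult_right_mono) (simp_all add: ennreal_le_1)
  then have e1: "ennreal (1 + 1) * (ennreal (1 / CARD('n)) * S * E) <= 2 * S * E"
   using mult_left_mono[of "ennreal (1 / CARD('n)) * S * E" "S * E" "2::ennreal"] by (simp add: mult.assoc)
  have "(1 + 1 / 1) * (r * L / 2)^2 <= 2 * (2 + L^2)"
  proof -
   have "r * L <= 1 * L" using True L0 by (intro mult_right_mono)
   then have "(r * L / 2)^2 <= L^2" using r L0 by (intro power_mono) auto
   then show ?thesis by simp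
  qed
  then have e2: "ennreal ((1 + 1 / 1) * (r * L / 2)^2) * U * S <= ennreal (2 * (2 + L^2)) * U * S"
   by (intro mult_right_mono ennreal_leI) simp_all
  have "sphere_energy A u r <= ennreal (1 + 1) * (ennreal (1 / CARD('n)) * S * E) + ennreal ((1 + 1 / 1) * (r * L / 2)^2) * U * S"
   using sphere_energy_upper[OF w L zero_less_one r]
   unfolding spherical_average_cdot[OF mag_grad_borel[OF w A]] E_def U_def S_def .
  also have "... <= 2 * S * E + ennreal (2 * (2 + L^2)) * U * S" by (intro add_mono e1 e2)
  finally show ?thesis unfolding L2[symmetric] by (simp add: E_def U_def mult_ac)
 next
  case False
  have "4 / r^2 <= 2 * (2 + L^2)"
  proof -
   have "1 <= r^2" using False by simp
   then have "4 / r^2 <= 4" by (simp add: divide_le_eq)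
   also have "4 <= 2 * (2 + L^2)" by simp
   finally show ?thesis .
  qed
  then have "ennreal (4 / r^2) * U * S <= ennreal (2 * (2 + L^2)) * U * S"
   by (intro mult_right_mono ennreal_leI) simp_all
  then have "sphere_energy A u r <= ennreal (2 * (2 + L^2)) * U * S"
   using sphere_energy_trivial_upper[OF um A r] unfolding U_def S_def by (rule order_trans[rotated])
  also have "... = 2 * S * (2 + (ennreal L)^2) * U" unfolding L2[symmetric] by (simp only: mult_ac)
  also have "... <= 2 * S * E + 2 * S * (2 + (ennreal L)^2) * U" by simp
  finally show ?thesis by (simp add: E_def U_def)
 qed
qed

text \<open>Given \<open>d > k0\<close>, first choose \<open>\<eta>\<close>, then \<open>\<delta>\<close>, so
 that each of the two error terms is at most half of the gap.\<close>

theorem sphere_energy_limit: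
 fixes A :: "real^'n => real^'n"
 defines "S \<equiv> emeasure cone_measure (UNIV::(real^'n) set)"
 assumes u: "cL2 u" and w: "weakgrad u g" and L: "L-lipschitz_on UNIV A"
  and E: "(energy (mag_grad A u g)) < \<infinity>"
  and p: "!!n. p n \<in> borel_measurable borel" and one: "!!n. (radint N (p n)) = 1"
  and zero: "!!\<delta>. \<delta> > 0 ==> (%n. radint N (%r. p n r * indicator {\<delta><..} r)) \<longlonglongrightarrow> 0"
 shows "(%n. radint N (%r. p n r * sphere_energy A u r))
  \<longlonglongrightarrow> ennreal (1 / CARD('n)) * S * (energy (mag_grad A u g))"
proof -
 have A: "borel_fun A" by (rule lipschitz_measurable[OF L])
 define k0 where "k0 = (\<integral>\<^sup>+s. (energy (%x. cdot s (mag_grad A u g x))) \<partial>(cone_measure :: (real^'n) measure))"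
 define U where "U = (energy u)"
 have k0: "k0 = ennreal (1 / CARD('n)) * S * (energy (mag_grad A u g))"
  unfolding k0_def S_def by (rule spherical_average_cdot[OF mag_grad_borel[OF w A]])
 have S: "S < top" using emeasure_cone_measure_UNIV_finite[where 'a="real^'n"] by (simp add: S_def)
 have U: "U < top" using u by (simp add: U_def cL2_def)
 have k0_fin: "k0 < top" unfolding k0 using S E by (simp add: ennreal_mult_less_top)
 have liminf: "k0 <= liminf (%n. radint N (%r. p n r * sphere_energy A u r))"
  by (rule mollifier_liminf[OF p one zero]) (auto simp: k0_def intro!: sphere_energy_lower[OF u w L E])
 have limsup: "limsup (%n. radint N (%r. p n r * sphere_energy A u r)) <= k0"
 proof (rule mollifier_limsup[OF p one zero])
  show "sphere_energy A u r <= 2 * S * (energy (mag_grad A u g)) + 2 * S * (2 + (ennreal L)^2) * U" if "0 < r" for r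
   unfolding S_def U_def by (rule sphere_energy_uniform_bound[OF w L that])
  have "(2 + (ennreal L)^2) < top" by (simp add: power2_eq_square ennreal_mult_less_top)
  then show "2 * S * (energy (mag_grad A u g)) + 2 * S * (2 + (ennreal L)^2) * U < top"
   using S U E by (simp add: ennreal_mult_less_top)
  fix c assume c: "k0 < c"
  define k a where "k = enn2real k0" and "a = enn2real (U * S)"
  have k: "k0 = ennreal k" "k \<ge> 0" and a: "U * S = ennreal a" "a \<ge> 0"
   using k0_fin U S by (simp_all add: k_def a_def ennreal_mult_less_top)
  obtain d where d: "k < d" "ennreal d <= c"
  proof (cases c)
   case (real d) then show ?thesis using c k that[of d] by (auto simp: ennreal_less_iff)
  next
   case top then show ?thesis using that[of "k + 1"] by simp
  qed
  define \<eta> where "\<eta> = (d - k) / (2 * (k + 1))"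
  have \<eta>: "\<eta> > 0" using d k by (simp add: \<eta>_def)
  define b where "b = (1 + 1 / \<eta>) * (L / 2)^2 * a"
  have b: "b \<ge> 0" using \<eta> a by (simp add: b_def)
  define \<delta> where "\<delta> = min 1 ((d - k) / (2 * (b + 1)))"
  have \<delta>: "\<delta> > 0" using d b by (simp add: \<delta>_def)
  show "\<exists>\<delta>>0. \<forall>r. 0 < r & r <= \<delta> --> sphere_energy A u r <= c"
  proof (intro exI[of _ \<delta>] conjI allI impI \<delta>)
   fix r assume r: "0 < r & r <= \<delta>"
   have "r * r <= \<delta> * 1" using r by (intro mult_mono) (auto simp: \<delta>_def)
   also have "... <= (d - k) / (2 * (b + 1))" by (simp add: \<delta>_def)
   finally have "b * (r * r) <= b * ((d - k) / (2 * (b + 1)))" using b by (intro mult_left_mono)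
   also have "... <= (d - k) / 2" using b d by (simp add: divide_simps)
   finally have br: "b * r^2 <= (d - k) / 2" by (simp add: power2_eq_square)
   have \<eta>k: "\<eta> * k <= (d - k) / 2" using k d by (simp add: \<eta>_def divide_simps)
   have "sphere_energy A u r <= ennreal (1 + \<eta>) * ennreal k + ennreal ((1 + 1 / \<eta>) * (r * L / 2)^2) * ennreal a"
    using sphere_energy_upper[OF w L \<eta>, of r] r unfolding k0_def[symmetric] U_def[symmetric] S_def[symmetric] k(1) mult.assoc a(1) by simp
   also have "... = ennreal ((1 + \<eta>) * k + (1 + 1 / \<eta>) * (r * L / 2)^2 * a)"
    using \<eta> k(2) a(2) by (intro ennreal_lincomb[symmetric]) auto
   also have "(1 + \<eta>) * k + (1 + 1 / \<eta>) * (r * L / 2)^2 * a = k + \<eta> * k + b * r^2"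
    by (simp add: b_def power_mult_distrib power_divide algebra_simps)
   also have "ennreal (k + \<eta> * k + b * r^2) <= ennreal d"
   proof (rule ennreal_leI)
    have "\<eta> * k + b * r^2 <= (d - k) / 2 + (d - k) / 2" by (intro add_mono br \<eta>k)
    then show "k + \<eta> * k + b * r^2 <= d" by simp
   qed
   finally show "sphere_energy A u r <= c" using d(2) by (rule order_trans)
  qed
 qed
 have "(%n. radint N (%r. p n r * sphere_energy A u r)) \<longlonglongrightarrow> k0"
 proof (rule Liminf_eq_Limsup[OF sequentially_bot])
  have le: "liminf (%n. radint N (%r. p n r * sphere_energy A u r))
    <= limsup (%n. radint N (%r. p n r * sphere_energy A u r))"
   by (rule Liminf_le_Limsup[OF sequentially_bot])
  show "liminf (%n. radint N (%r. p n r * sphere_energy A u r)) = k0"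
   by (rule antisym[OF order_trans[OF le limsup] liminf])
  show "limsup (%n. radint N (%r. p n r * sphere_energy A u r)) = k0"
   by (rule antisym[OF limsup order_trans[OF liminf le]])
 qed
 then show ?thesis by (simp only: k0)
qed

lemma mollifier_average_le:
 assumes p[measurable]: "borel_fun p" and one: "(radint N p) = 1" and k: "!!r. 0 < r ==> k r <= B"
 shows "(radint N (%r. p r * k r)) <= B"
proof -
 have "(radint N (%r. p r * k r)) <= (radint N (%r. p r * B))"
 proof (rule nn_integral_mono_AE)
  show "AE r in radial_measure N. p r * k r <= p r * B"
   using AE_radial_measure_pos by eventually_elim (rule mult_left_mono[OF k], simp_all)
 qed
 also have "... = (radint N p) * B" by (rule nn_integral_multc) measurable
 finally show ?thesis by (simp add: one)
qed

theorem theorem1p1: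
  fixes A :: "real^'n \<Rightarrow> real^'n"
    and \<rho> :: "nat \<Rightarrow> real \<Rightarrow> real"
    and u :: "real^'n \<Rightarrow> complex"
  assumes "\<exists>L. L-lipschitz_on UNIV A"
    and "radial_mollifiers CARD('n) \<rho>"
  shows "(u \<in> H1_magnetic A \<longleftrightarrow> u \<in> L2 \<and> (SUP n. nonlocal_energy A (\<rho> n) u) < \<infinity>) \<and>
    (u \<in> H1_magnetic A \<longrightarrow>
      (\<forall>\<omega>. norm \<omega> = 1 \<longrightarrow>
        (\<lambda>n. nonlocal_energy A (\<rho> n) u) \<longlonglongrightarrow> 2 * Q_const (\<omega> :: real^'n) * magnetic_energy A u) \<and>
      (\<forall>n. nonlocal_energy A (\<rho> n) u
         \<le> 2 * sphere_area TYPE('n) * magnetic_energy A u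
           + 2 * sphere_area TYPE('n) * (2 + (grad_Linfty A)\<^sup>2)
               * (\<integral>\<^sup>+ x. ennreal ((norm (u x))\<^sup>2) \<partial>lebesgue)))"
proof -
 obtain L where L: "L-lipschitz_on UNIV A" using assms(1) by blast
 have A: "borel_fun A" by (rule lipschitz_measurable[OF L])
 define S where "S = emeasure cone_measure (UNIV::(real^'n) set)"
 have S: "S < top" "0 < S"
  using emeasure_cone_measure_UNIV_finite[where 'a="real^'n"] emeasure_cone_measure_UNIV_pos[where 'a="real^'n"] by (simp_all add: S_def)
 obtain p where p_props: "\<forall>n. p n \<in> borel_measurable borel & (AE r in lborel. 0 < r --> ennreal (\<rho> n r) = p n r) &
   (radint CARD('n) (p n)) = 1"
  and p0: "\<forall>\<delta>>0. (%n. radint CARD('n) (%r. p n r * indicator {\<delta><..} r)) \<longlonglongrightarrow> 0"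
  using mollifier_densities[OF assms(2)] by blast
 have p: "borel_fun (p n)" "AE r in lborel. 0 < r --> ennreal (\<rho> n r) = p n r" "(radint CARD('n) (p n)) = 1" for n
  using p_props by auto
 have zero: "(%n. radint CARD('n) (%r. p n r * indicator {\<delta><..} r)) \<longlonglongrightarrow> 0" if "\<delta> > 0" for \<delta>
  using p0 that by blast
 have \<rho>: "0 <= \<rho> n r" if "r \<ge> 0" for n r using assms(2) that by (simp add: radial_mollifiers_def)
 show ?thesis
 proof (cases "u \<in> L2")
  case False
  then show ?thesis by (simp add: H1_magnetic_def)
 next
  case True
  have um: "u \<in> borel_measurable lebesgue" using True by (simp add: L2_def)
  obtain u' where u': "cL2 u'" and AE: "AE x in lborel. u x = u' x" using L2_borel_version[OF True] by blast
  have u'm: "borel_fun u'" using u' by (simp add: cL2_def)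
  have H1: "u \<in> H1_magnetic A \<longleftrightarrow> (\<exists>g. weakgrad u' g & (energy (mag_grad A u' g)) < \<infinity>)"
   by (rule H1_magnetic_iff[OF True AE u'])
  have NE: "nonlocal_energy A (\<rho> n) u = (radint CARD('n) (%r. p n r * sphere_energy A u' r))" for n
   by (rule nonlocal_energy_eq[OF A u'm AE p(1,2) \<rho>])
  define U where "U = (\<integral>\<^sup>+ x. ennreal ((norm (u x))^2) \<partial>lebesgue)"
  have U: "U < top" using True by (simp add: U_def L2_def)
  have U': "(energy u') = U"
   unfolding U_def nn_integral_completion
  proof (rule nn_integral_cong_AE)
   show "AE x in lborel. ennreal ((norm (u' x))^2) = ennreal ((norm (u x))^2)" using AE by eventually_elim simp
  qed
  have bound: "nonlocal_energy A (\<rho> n) u <= 2 * S * magnetic_energy A u + 2 * S * (2 + (ennreal M)^2) * U"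
   if "weakgrad u' g" "M-lipschitz_on UNIV A" for g M n
   unfolding NE magnetic_energy_eq[OF um AE that(1)] U'[symmetric] S_def
   by (intro mollifier_average_le p sphere_energy_uniform_bound that)
  have char: "u \<in> H1_magnetic A \<longleftrightarrow> (SUP n. nonlocal_energy A (\<rho> n) u) < \<infinity>"
  proof
   assume H: "u \<in> H1_magnetic A"
   then obtain g where g: "weakgrad u' g" using H1 by blast
   have E: "magnetic_energy A u < top" using H by (simp add: H1_magnetic_def)
   have "(SUP n. nonlocal_energy A (\<rho> n) u) <= 2 * S * magnetic_energy A u + 2 * S * (2 + (ennreal L)^2) * U"
    by (intro SUP_least bound[OF g L])
   also have "... < \<infinity>"
   proof -
    have "2 + (ennreal L)^2 < top" by (simp add: power2_eq_square ennreal_mult_less_top)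
    then show ?thesis using S E U by (simp add: ennreal_mult_less_top)
   qed
   finally show "(SUP n. nonlocal_energy A (\<rho> n) u) < \<infinity>" .
  next
   assume fin: "(SUP n. nonlocal_energy A (\<rho> n) u) < \<infinity>"
   define C where "C = enn2real (SUP n. nonlocal_energy A (\<rho> n) u)"
   have C: "ennreal C = (SUP n. nonlocal_energy A (\<rho> n) u)" using fin by (simp add: C_def)
   have Cb: "(radint CARD('n) (%r. p n r * sphere_energy A u' r)) <= ennreal C" for n
    unfolding NE[symmetric] C by (rule SUP_upper) simp
   have "\<exists>g. weakgrad u' g & (energy (mag_grad A u' g)) < \<infinity>"
    by (rule weakgrad_of_bounded_energy[OF u' L p(1) p(3) zero Cb]) (simp_all add: C_def)
   then show "u \<in> H1_magnetic A" using H1 by blast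
  qed
  have "(%n. nonlocal_energy A (\<rho> n) u) \<longlonglongrightarrow> 2 * Q_const \<omega> * magnetic_energy A u"
   if H: "u \<in> H1_magnetic A" and \<omega>: "norm \<omega> = 1" for \<omega> :: "real^'n"
  proof -
   obtain g where g: "weakgrad u' g" "(energy (mag_grad A u' g)) < \<infinity>" using H H1 by blast
   show ?thesis
    unfolding NE two_Q_const_eq[OF \<omega>] magnetic_energy_eq[OF um AE g(1)]
    by (rule sphere_energy_limit[OF u' g(1) L g(2) p(1) p(3) zero])
  qed
  moreover have "nonlocal_energy A (\<rho> n) u <= 2 * sphere_area TYPE('n) * magnetic_energy A u
      + 2 * sphere_area TYPE('n) * (2 + (grad_Linfty A)^2) * U"
   if H: "u \<in> H1_magnetic A" for n
  proof -
   obtain g where g: "weakgrad u' g" using H H1 by blast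
   show ?thesis
   proof (cases "grad_Linfty A = top")
    case False
    define M where "M = enn2real (grad_Linfty A)"
    have M: "ennreal M = grad_Linfty A" using False by (simp add: M_def less_top)
    have "M-lipschitz_on UNIV A" by (rule lipschitz_grad_Linfty[OF L]) (simp_all add: M, simp add: M_def)
    from bound[OF g this] show ?thesis by (simp only: M sphere_area_eq S_def)
   next
    \<comment> \<open>then the bound is infinite, except for \<open>U = 0\<close>, where any Lipschitz constant will do\<close>
    case top: True
    show ?thesis
    proof (cases "U = 0")
     case True
     with bound[OF g L, of n] show ?thesis by (simp add: sphere_area_eq S_def)
    next
     case False
     have "(2::ennreal) + top^2 = top" by (simp add: power2_eq_square ennreal_top_mult)
     then have "2 * S * (2 + (grad_Linfty A)^2) * U = top"
      using S False by (simp add: top ennreal_mult_top ennreal_top_mult)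
     then show ?thesis by (simp add: sphere_area_eq S_def)
    qed
   qed
  qed
  ultimately show ?thesis using char True by (auto simp: U_def)
 qed
qed

end
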